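(* Let $q\ge 1$ be a fixed integer, let $\min\{p,n\}\to\infty$, and suppose that the null hypothesis holds, i.e. the observations are $\mathbf{x}_t=\mathbf{z}_t$, $t=1,\ldots,n$, where $\mathbf z_t=(z_{1,t},\ldots,z_{p,t})^\top$ is a $p$-dimensional mean-zero white noise with $\boldsymbol\Sigma=\mathrm{Cov}(\mathbf{z}_t)$. Assume: (1) $\{\mathbf{z}_t\}_{t\in\mathbb Z}$ is a sequence of i.i.d. random vectors such that $\mathbb E\{(\mathbf z_t^\top\mathbf z_s)^4\}=O(p^2)$ for $t\ne s$, and $\max_{1\le i\le p}\mathbb E(z_{i,t}^4)\le C_1$ for some universal constant $C_1>0$; (2) the largest eigenvalue of $\boldsymbol\Sigma$ is uniformly bounded away from infinity, and $\lim_{p\to\infty}p^{-1}\mathrm{tr}(\boldsymbol\Sigma^\ell)>0$ for $\ell=1,2$; (3) $\max_{1\le i\le p}\mathbb E(z_{i,t}^{16})\le C_2$ for some universal constant $C_2>0$, $\mathbb E[\{|\mathbf z_t|_2^2-\mathrm{tr}(\boldsymbol\Sigma)\}^8]=O\{(\mathbb E[\{|\mathbf z_t|_2^2-\mathrm{tr}(\boldsymbol\Sigma)\}^2])^4\}$, and $|\mathbb E(\mathbf z_t|\mathbf z_t|_2^2)|_2^2=O(\mathbb E[\{|\mathbf z_t|_2^2-\mathrm{tr}(\boldsymbol\Sigma)\}^2])$. Define $$\sigma_{n1}^2=2p^{-2}\,\mathrm{tr}^2(\boldsymbol\Sigma^2),\qquad \mu_2=-p^{-1}n^{-1}\,\mathbb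 E[\{|\mathbf z_t|_2^2-\mathrm{tr}(\boldsymbol\Sigma)\}^2],$$ $$\sigma_{n2}^2=p^{-2}n^{-3}\,\mathbb E[\{|\mathbf z_t|_2^2-\mathrm{tr}(\boldsymbol\Sigma)\}^4]+(n-2-3n^{-1})\mu_2^2 .$$ Then, as $n\to\infty$, $$\left(\frac{G_{n,1,1}}{\sigma_{n1}},\ldots,\frac{G_{n,q,1}}{\sigma_{n1}},\frac{G_{n,1,2}-\mu_2}{\sigma_{n2}},\ldots,\frac{G_{n,q,2}-\mu_2}{\sigma_{n2}}\right)\xrightarrow{\mathrm d}\mathcal N(\mathbf 0,\mathbf I_{2q}),$$ where $G_{n,\tau,1}$ and $G_{n,\tau,2}$, $\tau=1,\ldots,q$, are the statistics of $\mathbf x_1,\ldots,\mathbf x_n$ defined in the context.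
   Context: For $\mathbf x_1,\ldots,\mathbf x_n\in\mathbb R^p$ use the circular convention $\mathbf x_{t+\tau}=\mathbf x_{t+\tau-n}$ if $t+\tau>n$. For $\tau\in\{1,\ldots,q\}$, $$G_{n,\tau,1}=\frac1{np}\sum_{t\ne s}\mathbf x_t^\top\mathbf x_s\,\mathbf x_{t+\tau}^\top\mathbf x_{s+\tau},\qquad G_{n,\tau,2}=\frac1{np}\sum_{t=1}^n|\mathbf x_t|_2^2|\mathbf x_{t+\tau}|_2^2-\frac1p\Big(\frac1n\sum_{t=1}^n|\mathbf x_t|_2^2\Big)^2,$$ where the first sum runs over $t,s\in\{1,\ldots,n\}$ with $t\neq s$ and $|\cdot|_2$ is the Euclidean norm. $\mathrm{tr}^2(\cdot)$ denotes the square of the trace. The law of $\mathbf z_t$ (and hence $\boldsymbol\Sigma$) may depend on $p$; constants in $O(\cdot)$ do not depend on $p$ or $n$.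
   Formalization: The formal statement additionally assumes σ_{n2} ≠ 0 once min{p,n} is large; conditions (1)–(3) allow |z_t|_2^2 to be almost surely constant (e.g. independent ±1 coordinates), where σ_{n2} = 0 and the ratios are undefined. *)

theory Defs
  imports "HOL-Probability.Probability" "Jordan_Normal_Form.Spectral_Radius"
begin

text \<open>
  The dimension \<open>p\<close> varies, so a vector in \<open>\<real>\<^sup>p\<close> is a function \<open>u :: nat \<Rightarrow> real\<close> of which only the
  coordinates \<open>i < p\<close> matter; its Euclidean norm is \<open>L2_set u {..<p}\<close>.
\<close>

definition dotp :: "nat \<Rightarrow> (nat \<Rightarrow> real) \<Rightarrow> (nat \<Rightarrow> real) \<Rightarrow> real" where
  "dotp p u v = (\<Sum>i<p. u i * v i)"

definition mat_trace :: "real mat \<Rightarrow> real" where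
  "mat_trace A = (\<Sum>i<dim_row A. A $$ (i, i))"

definition cross_cov :: "'a measure \<Rightarrow> nat \<Rightarrow> ('a \<Rightarrow> nat \<Rightarrow> real) \<Rightarrow> ('a \<Rightarrow> nat \<Rightarrow> real) \<Rightarrow> real mat" where
  "cross_cov M p X Y = mat p p (\<lambda>(i, j).
     \<integral>\<omega>. (X \<omega> i - (\<integral>\<omega>'. X \<omega>' i \<partial>M)) * (Y \<omega> j - (\<integral>\<omega>'. Y \<omega>' j \<partial>M)) \<partial>M)"

text \<open>
  Random vectors with values in \<open>\<real>\<^sup>p\<close> are compared through their restrictions to \<open>{..<p}\<close>, as elements
  of the finite product Borel space. Measurability is part of \<open>indep_vars\<close>.
\<close>

definition iid_vectors :: "'a measure \<Rightarrow> nat \<Rightarrow> (int \<Rightarrow> 'a \<Rightarrow> nat \<Rightarrow> real) \<Rightarrow> bool" where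
  "iid_vectors M p z \<longleftrightarrow>
     prob_space.indep_vars M (\<lambda>_. \<Pi>\<^sub>M i\<in>{..<p}. borel) (\<lambda>t \<omega>. restrict (z t \<omega>) {..<p}) UNIV \<and>
     (\<forall>s t. distr M (\<Pi>\<^sub>M i\<in>{..<p}. borel) (\<lambda>\<omega>. restrict (z s \<omega>) {..<p}) =
            distr M (\<Pi>\<^sub>M i\<in>{..<p}. borel) (\<lambda>\<omega>. restrict (z t \<omega>) {..<p}))"

definition mean_zero_white_noise ::
  "'a measure \<Rightarrow> nat \<Rightarrow> (int \<Rightarrow> 'a \<Rightarrow> nat \<Rightarrow> real) \<Rightarrow> real mat \<Rightarrow> bool" where
  "mean_zero_white_noise M p z S \<longleftrightarrow>
     (\<forall>t. \<forall>i<p. (\<lambda>\<omega>. z t \<omega> i) \<in> borel_measurable M \<and> integrable M (\<lambda>\<omega>. (z t \<omega> i)\<^sup>2) \<and>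
                (\<integral>\<omega>. z t \<omega> i \<partial>M) = 0) \<and>
     (\<forall>t. cross_cov M p (z t) (z t) = S) \<and>
     (\<forall>s t. s \<noteq> t \<longrightarrow> cross_cov M p (z s) (z t) = 0\<^sub>m p p)"

text \<open>
  With \<open>S\<close> the covariance matrix of \<open>X\<close>, the quantity \<open>E[(|X|\<^sup>2 - tr S)\<^sup>k]\<close>.
\<close>

definition norm_moment :: "'a measure \<Rightarrow> nat \<Rightarrow> real mat \<Rightarrow> ('a \<Rightarrow> nat \<Rightarrow> real) \<Rightarrow> nat \<Rightarrow> real" where
  "norm_moment M p S X k = (\<integral>\<omega>. ((L2_set (X \<omega>) {..<p})\<^sup>2 - mat_trace S) ^ k \<partial>M)"

text \<open>
  Circular time convention: the observation at time \<open>t + \<tau> > n\<close> is the one at time \<open>t + \<tau> - n\<close>. This is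
  a genuine time in \<open>{1..n}\<close> as long as \<open>\<tau> \<le> n\<close>.
\<close>

definition circ :: "nat \<Rightarrow> nat \<Rightarrow> nat" where
  "circ n t = (if t > n then t - n else t)"

definition G1 :: "nat \<Rightarrow> nat \<Rightarrow> nat \<Rightarrow> (nat \<Rightarrow> nat \<Rightarrow> real) \<Rightarrow> real" where
  "G1 p n \<tau> x = 1 / (real n * real p) *
     (\<Sum>(t, s) | t \<in> {1..n} \<and> s \<in> {1..n} \<and> t \<noteq> s.
        dotp p (x t) (x s) * dotp p (x (circ n (t + \<tau>))) (x (circ n (s + \<tau>))))"

definition G2 :: "nat \<Rightarrow> nat \<Rightarrow> nat \<Rightarrow> (nat \<Rightarrow> nat \<Rightarrow> real) \<Rightarrow> real" where
  "G2 p n \<tau> x =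
     1 / (real n * real p) *
       (\<Sum>t = 1..n. (L2_set (x t) {..<p})\<^sup>2 * (L2_set (x (circ n (t + \<tau>))) {..<p})\<^sup>2)
     - 1 / real p * (1 / real n * (\<Sum>t = 1..n. (L2_set (x t) {..<p})\<^sup>2))\<^sup>2"

definition sigma_n1 :: "nat \<Rightarrow> real mat \<Rightarrow> real" where
  "sigma_n1 p S = sqrt (2 / (real p)\<^sup>2 * (mat_trace (S ^\<^sub>m 2))\<^sup>2)"

definition mu2 :: "'a measure \<Rightarrow> nat \<Rightarrow> nat \<Rightarrow> real mat \<Rightarrow> ('a \<Rightarrow> nat \<Rightarrow> real) \<Rightarrow> real" where
  "mu2 M p n S X = - (1 / (real p * real n)) * norm_moment M p S X 2"

definition sigma_n2 :: "'a measure \<Rightarrow> nat \<Rightarrow> nat \<Rightarrow> real mat \<Rightarrow> ('a \<Rightarrow> nat \<Rightarrow> real) \<Rightarrow> real" where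
  "sigma_n2 M p n S X =
     sqrt (1 / ((real p)\<^sup>2 * real n ^ 3) * norm_moment M p S X 4
           + (real n - 2 - 3 / real n) * (mu2 M p n S X)\<^sup>2)"

text \<open>
  Weak convergence of laws on a topological space, along an arbitrary filter. The library's
  \<open>weak_conv_m\<close> covers only sequences of measures on the real line.
\<close>

definition weak_conv_on ::
  "'b topology \<Rightarrow> ('i \<Rightarrow> 'b measure) \<Rightarrow> 'b measure \<Rightarrow> 'i filter \<Rightarrow> bool" where
  "weak_conv_on T \<mu> \<nu> F \<longleftrightarrow>
     (\<forall>f. continuous_map T euclideanreal f \<and> bounded (f ` topspace T) \<longrightarrow>
        ((\<lambda>i. \<integral>y. f y \<partial>\<mu> i) \<longlongrightarrow> (\<integral>y. f y \<partial>\<nu>)) F)"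

definition conv_in_distr ::
  "nat set \<Rightarrow> ('i \<Rightarrow> 'a measure) \<Rightarrow> ('i \<Rightarrow> 'a \<Rightarrow> nat \<Rightarrow> real) \<Rightarrow> (nat \<Rightarrow> real) measure \<Rightarrow> 'i filter \<Rightarrow> bool" where
  "conv_in_distr K M X \<nu> F \<longleftrightarrow>
     weak_conv_on (product_topology (\<lambda>_. euclideanreal) K)
       (\<lambda>i. distr (M i) (\<Pi>\<^sub>M k\<in>K. borel) (\<lambda>\<omega>. restrict (X i \<omega>) K)) \<nu> F"

text \<open>For finite \<open>K\<close>, this is \<open>N(0, I)\<close> on \<open>\<real>\<^sup>K\<close>: the coordinates are independent standard normals.\<close>

definition std_normal_vec :: "nat set \<Rightarrow> (nat \<Rightarrow> real) measure" where
  "std_normal_vec K = (\<Pi>\<^sub>M k\<in>K. std_normal_distribution)"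

text \<open>The regime \<open>min {p, n} \<rightarrow> \<infinity>\<close>; no relation between the rates of \<open>p\<close> and \<open>n\<close> is imposed.\<close>

definition min_at_top :: "(nat \<times> nat) filter" where
  "min_at_top = filtercomap (\<lambda>(p, n). min p n) at_top"

end

theory Submission
  imports Defs
begin

text \<open>
  Cut \<open>{1..n}\<close> into blocks of a fixed length \<open>L > q\<close> and discard all lagged products that leave a
  block. In \<open>L\<^sup>1\<close>, this changes every statistic by \<open>O(sqrt (q / L)) + o(1)\<close>, uniformly in \<open>p\<close>. A linear
  combination of the remaining sums is, for i.i.d. blocks \<open>Z\<^sub>b\<close>, a sum
  \<open>\<Sum>\<^sub>b h(Z\<^sub>b) + \<Sum>\<^sub>b\<^sub><\<^sub>b\<^sub>' H(Z\<^sub>b, Z\<^sub>b\<^sub>')\<close> with \<open>h\<close> centered and \<open>H\<close> degenerate. This is a martingale, and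
  its characteristic function differs from a Gaussian one by an explicit error in the fourth moments of
  \<open>h\<close> and \<open>H\<close> and in the Hilbert--Schmidt norm of the square of the kernel \<open>H\<close>; the square of this norm is of
  order \<open>tr\<^sup>2(\<Sigma>\<^sup>4) / tr\<^sup>4(\<Sigma>\<^sup>2) = O(1 / p\<^sup>2)\<close>. Let first \<open>min {p, n}\<close> and then \<open>L\<close> tend to infinity.
\<close>

section \<open>Convergence of characteristic functions on finite products\<close>

text \<open>The summands at times t and s share observations when s is close to t or when the circle
  closes, so the sums are no U-statistics of the sample itself. Blocks restore exact independence,
  and once the pairs inside one block are dropped, a kernel in two independent blocks remains,
  centered in each of them. Since p and n are unrelated, all bounds must be free of p. Normalising
  first achieves this: division by \<open>tr(Sigma^2)\<close> and by the standard deviation of the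
  squared norm turns the moment assumptions into constants bounding \<open>dot4\<close>,
  \<open>y4\<close> and \<open>tr(Sigma^4) / tr(Sigma^2)\<close>; the error then depends only on n
  and on \<open>tr(Sigma^2)\<close>, which grows like p. The first q statistics form the quadratic
  part \<open>H\<close>, the last q the linear part \<open>h\<close>. Lags are orthogonal within
  each group, and the groups interact only through the integral of \<open>h\<close> against
  \<open>H\<close>. Circularity makes the centring of the second group exact: a shift preserves sums
  over all times, so no linear remainder appears. The given and the asymptotic standard deviation
  differ by a factor \<open>\<kappa>\<close>, which tends to 1 because the standardised fourth
  moment of the squared norm stays bounded.\<close>

inductive trig_poly :: "'k set \<Rightarrow> (('k \<Rightarrow> real) \<Rightarrow> complex) \<Rightarrow> bool" for K where
  exp: "trig_poly K (\<lambda>x. cis (\<Sum>k\<in>K. a k * x k))"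
| scale: "trig_poly K f \<Longrightarrow> trig_poly K (\<lambda>x. c * f x)"
| add: "trig_poly K f \<Longrightarrow> trig_poly K g \<Longrightarrow> trig_poly K (\<lambda>x. f x + g x)"

text \<open>Frequencies add when exponentials are multiplied, so their span is an algebra, as
  Stone--Weierstrass requires. Products are derived instead of built in because convergence of
  integrals passes through sums and scalings but not through products.\<close>

lemma trig_poly_mult:
  assumes "trig_poly K f" "trig_poly K g"
  shows "trig_poly K (\<lambda>x. f x * g x)"
  using assms(1)
proof induction
  case (exp a)
  show ?case using assms(2)
  proof induction
    case (exp b)
    show ?case
      using trig_poly.exp[of K "\<lambda>k. a k + b k"]
      by (simp add: cis_mult sum.distrib algebra_simps)
  next
    case (scale f c)
    then show ?case using trig_poly.scale[of K _ c] by (simp add: mult.left_commute)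
  next
    case (add f g)
    then show ?case using trig_poly.add by (fastforce simp add: distrib_left)
  qed
next
  case (scale f c)
  then show ?case using trig_poly.scale[of K _ c] by (simp add: mult.assoc)
next
  case (add f h)
  then show ?case using trig_poly.add by (fastforce simp add: distrib_right)
qed

lemma trig_poly_const: "trig_poly K (\<lambda>_. c)"
  using trig_poly.scale[OF trig_poly.exp[of K "\<lambda>_. 0"], of c] by simp

lemma trig_poly_sin:
  assumes "finite K" "k \<in> K"
  shows "trig_poly K (\<lambda>x. complex_of_real (sin (\<theta> * x k)))"
proof -
  have e: "trig_poly K (\<lambda>x. cis (c * x k))" for c
  proof -
    have "(\<Sum>j\<in>K. (if j = k then c else 0) * x j) = c * x k" for x :: "'a \<Rightarrow> real"
    proof -
      have "(\<Sum>j\<in>K. (if j = k then c else 0) * x j) = (\<Sum>j\<in>K. if j = k then c * x j else 0)"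
        by (rule sum.cong) auto
      also have "\<dots> = c * x k" using assms by simp
      finally show ?thesis .
    qed
    then show ?thesis using trig_poly.exp[of K "\<lambda>j. if j = k then c else 0"] by simp
  qed
  have "trig_poly K (\<lambda>x. (1 / (2 * \<i>)) * cis (\<theta> * x k) + (- 1 / (2 * \<i>)) * cis (- \<theta> * x k))"
    by (intro trig_poly.add trig_poly.scale e)
  moreover have "(1 / (2 * \<i>)) * cis (\<theta> * y) + (- 1 / (2 * \<i>)) * cis (- \<theta> * y) = complex_of_real (sin (\<theta> * y))" for y
    by (simp add: complex_eq_iff)
  ultimately show ?thesis by simp
qed

lemma trig_poly_measurable:
  assumes "trig_poly K f" "finite K"
  shows "f \<in> borel_measurable (PiM K (\<lambda>_. borel))"
  using assms(1)
proof induction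
  case (exp a)
  have "(\<lambda>x. \<Sum>k\<in>K. a k * x k) \<in> borel_measurable (PiM K (\<lambda>_. borel))"
    by (intro borel_measurable_sum borel_measurable_times) auto
  moreover have "cis \<in> borel_measurable borel"
    by (rule borel_measurable_continuous_onI) (intro continuous_intros)
  ultimately show ?case by (rule measurable_compose)
next
  case (scale f c)
  then show ?case by simp
next
  case (add f g)
  then show ?case by simp
qed

lemma trig_poly_bounded: "trig_poly K f \<Longrightarrow> \<exists>C. \<forall>x. cmod (f x) \<le> C"
proof (induction rule: trig_poly.induct)
  case (exp a)
  then show ?case by (intro exI[of _ 1]) simp
next
  case (scale f c)
  then obtain C where "\<forall>x. cmod (f x) \<le> C" by auto
  then show ?case by (intro exI[of _ "cmod c * C"]) (auto simp: norm_mult mult_left_mono)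
next
  case (add f g)
  then obtain C D where "\<forall>x. cmod (f x) \<le> C" "\<forall>x. cmod (g x) \<le> D" by auto
  then show ?case by (intro exI[of _ "C + D"]) (meson add_mono norm_triangle_ineq order_trans)
qed

text \<open>
  On the box \<open>|x\<^sub>k| \<le> R\<close> each coordinate is recovered from \<open>sin (\<theta> x\<^sub>k)\<close> with \<open>\<theta> = 1/R\<close>, so that the
  Stone--Weierstrass theorem on a cube yields trigonometric polynomials that stay bounded off the box.
\<close>

lemma trig_poly_approx:
  fixes f :: "('k::countable \<Rightarrow> real) \<Rightarrow> real"
  assumes K: "finite K" and f: "continuous_map (product_topology (\<lambda>_. euclideanreal) K) euclideanreal f"
    and B: "\<And>x. x \<in> extensional K \<Longrightarrow> \<bar>f x\<bar> \<le> B" and R: "R > 0" and e: "\<epsilon> > 0"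
  shows "\<exists>g. trig_poly K (\<lambda>x. complex_of_real (g x)) \<and> (\<forall>x. \<bar>g x\<bar> \<le> B + \<epsilon>) \<and>
    (\<forall>x\<in>extensional K. (\<forall>k\<in>K. \<bar>x k\<bar> \<le> R) \<longrightarrow> \<bar>f x - g x\<bar> \<le> \<epsilon>)"
proof -
  \<comment> \<open>Coordinates outside \<open>K\<close> are pinned to \<open>undefined\<close>, the
    value of extensional functions there. The cube then lies in the full function space, where
    compactness is the one of the type.\<close>
  define S :: "('k \<Rightarrow> real) set" where "S = PiE UNIV (\<lambda>k. if k \<in> K then {-1..1} else {undefined})"
  define s :: "('k \<Rightarrow> real) \<Rightarrow> ('k \<Rightarrow> real)" where "s x k = (if k \<in> K then sin (x k / R) else undefined)" for x k
  define G where "G y = (\<lambda>k\<in>K. R * arcsin (y k))" for y :: "'k \<Rightarrow> real"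
  have "compactin (product_topology (\<lambda>_. euclideanreal) UNIV) S"
    unfolding S_def compactin_PiE by auto
  then have cS: "compact S"
    by (simp add: euclidean_product_topology)
  have coord: "continuous_on S (\<lambda>y. y k)" for k
    by (rule continuous_on_subset[OF continuous_on_product_coordinates subset_UNIV])
  have sS: "s x \<in> S" for x by (auto simp: s_def S_def)
  have "continuous_map (top_of_set S) (product_topology (\<lambda>_. euclideanreal) K) G"
    unfolding continuous_map_componentwise
  proof safe
    fix k assume k: "k \<in> K"
    have "continuous_on S (\<lambda>y. R * arcsin (y k))"
      using k by (intro continuous_on_mult continuous_on_const continuous_on_arcsin coord)
        (auto simp: S_def PiE_iff split: if_splits)
    then show "continuous_map (top_of_set S) euclideanreal (\<lambda>x. G x k)"
      using k by (simp add: G_def)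
  qed (auto simp: G_def)
  from continuous_map_compose[OF this f] have cF: "continuous_on S (f \<circ> G)"
    by simp
  define P where "P g \<longleftrightarrow> continuous_on S g \<and> trig_poly K (\<lambda>x. complex_of_real (g (s x)))" for g
  have "\<exists>g. P g \<and> (\<forall>x\<in>S. \<bar>(f \<circ> G) x - g x\<bar> < \<epsilon>)"
  proof (rule Stone_Weierstrass_HOL[OF cS _ _ _ _ _ cF e])
    show "P (\<lambda>x. c)" for c by (simp add: P_def trig_poly_const)
    show "P g \<Longrightarrow> continuous_on S g" for g by (simp add: P_def)
    show "P g \<and> P h \<Longrightarrow> P (\<lambda>x. g x + h x)" for g h
      using trig_poly.add[of K "\<lambda>x. complex_of_real (g (s x))"] by (auto simp: P_def intro: continuous_on_add)
    show "P g \<and> P h \<Longrightarrow> P (\<lambda>x. g x * h x)" for g h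
      using trig_poly_mult[of K "\<lambda>x. complex_of_real (g (s x))"] by (auto simp: P_def intro: continuous_on_mult)
    show "\<exists>g. P g \<and> g x \<noteq> g y" if xy: "x \<in> S \<and> y \<in> S \<and> x \<noteq> y" for x y
    proof -
      obtain k where k: "x k \<noteq> y k" using xy by auto
      have "x k \<in> (if k \<in> K then {-1..1} else {undefined})" "y k \<in> (if k \<in> K then {-1..1} else {undefined})"
        using xy PiE_mem[OF _ UNIV_I, of _ "\<lambda>k. if k \<in> K then {-1..1} else {undefined}" k] unfolding S_def by blast+
      with k have kK: "k \<in> K" by (auto split: if_splits)
      have "(\<lambda>x. complex_of_real (s x k)) = (\<lambda>x. complex_of_real (sin (1 / R * x k)))"
        using kK by (simp add: s_def)
      then have "P (\<lambda>x. x k)"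
        unfolding P_def using trig_poly_sin[OF K kK, of "1 / R"] coord[of k] by simp
      with k show ?thesis by (intro exI[of _ "\<lambda>x. x k"]) simp
    qed
  qed
  then obtain g where g: "P g" "\<And>x. x \<in> S \<Longrightarrow> \<bar>f (G x) - g x\<bar> < \<epsilon>" by auto
  have ge: "\<bar>f (G (s x)) - g (s x)\<bar> < \<epsilon>" for x using g(2)[OF sS] .
  have "\<bar>g (s x)\<bar> \<le> B + \<epsilon>" for x
    using B[of "G (s x)"] ge[of x] by (auto simp: G_def)
  moreover have "\<bar>f x - g (s x)\<bar> \<le> \<epsilon>" if x: "x \<in> extensional K" "\<forall>k\<in>K. \<bar>x k\<bar> \<le> R" for x
  proof -
    have "G (s x) = x"
    proof
      fix k
      show "G (s x) k = x k"
      proof (cases "k \<in> K")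
        case True
        have "\<bar>x k\<bar> \<le> R" using x(2) True by blast
        then have "\<bar>x k / R\<bar> \<le> 1" using R by (simp add: abs_divide)
        then have "- (pi/2) \<le> x k / R" "x k / R \<le> pi/2" using pi_ge_two by linarith+
        then have "arcsin (sin (x k / R)) = x k / R" by (rule arcsin_sin)
        then show ?thesis using True R by (simp add: G_def s_def)
      next
        case False
        then show ?thesis using x(1) by (simp add: G_def extensional_def)
      qed
    qed
    then show ?thesis using ge[of x] by simp
  qed
  ultimately show ?thesis using g(1) by (intro exI[of _ "g \<circ> s"]) (auto simp: P_def)
qed

section \<open>From trigonometric polynomials to all bounded continuous functions\<close>

lemma trig_poly_tendsto:
  fixes \<mu> :: "'i \<Rightarrow> ('k \<Rightarrow> real) measure"
  assumes "trig_poly K f" and K: "finite K"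
    and \<mu>: "eventually (\<lambda>i. prob_space (\<mu> i) \<and> sets (\<mu> i) = sets (PiM K (\<lambda>_. borel))) F"
    and \<nu>: "prob_space \<nu>" "sets \<nu> = sets (PiM K (\<lambda>_. borel))"
    and char: "\<And>a. ((\<lambda>i. \<integral>x. cis (\<Sum>k\<in>K. a k * x k) \<partial>\<mu> i) \<longlongrightarrow> (\<integral>x. cis (\<Sum>k\<in>K. a k * x k) \<partial>\<nu>)) F"
  shows "((\<lambda>i. \<integral>x. f x \<partial>\<mu> i) \<longlongrightarrow> (\<integral>x. f x \<partial>\<nu>)) F"
proof -
  have int: "integrable M f" if f: "trig_poly K f" and M: "prob_space M" "sets M = sets (PiM K (\<lambda>_. borel))" for M f
  proof -
    interpret prob_space M by fact
    obtain C where "\<forall>x. cmod (f x) \<le> C" using trig_poly_bounded[OF f] by auto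
    then show ?thesis
      using trig_poly_measurable[OF f K] M(2)
      by (intro integrable_const_bound[of _ C]) (auto cong: measurable_cong_sets)
  qed
  show ?thesis using assms(1)
  proof induction
    case (exp a)
    then show ?case by (rule char)
  next
    case (scale f c)
    then show ?case by (simp add: tendsto_mult_left)
  next
    case (add f g)
    have ev: "eventually (\<lambda>i. (\<integral>x. f x \<partial>\<mu> i) + (\<integral>x. g x \<partial>\<mu> i) = (\<integral>x. f x + g x \<partial>\<mu> i)) F"
      using \<mu> by eventually_elim (simp add: int[OF add(1)] int[OF add(2)])
    have "(\<integral>x. f x + g x \<partial>\<nu>) = (\<integral>x. f x \<partial>\<nu>) + (\<integral>x. g x \<partial>\<nu>)"
      using \<nu> by (simp add: int[OF add(1)] int[OF add(2)])
    then show ?case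
      using Lim_transform_eventually[OF tendsto_add[OF add.IH] ev] by simp
  qed
qed

text \<open>Trigonometric polynomials are measurable by construction. Approximating \<open>f\<close>
  up to \<open>1 / Suc n\<close> on the box of radius \<open>Suc n\<close> exhibits \<open>f\<close>
  as their pointwise limit, so no comparison of the topology with the product sigma-algebra is
  needed.\<close>

lemma borel_measurable_continuous_map_PiM:
  fixes f :: "('k::countable \<Rightarrow> real) \<Rightarrow> real"
  assumes K: "finite K" and f: "continuous_map (product_topology (\<lambda>_. euclideanreal) K) euclideanreal f"
    and B: "\<And>x. x \<in> extensional K \<Longrightarrow> \<bar>f x\<bar> \<le> B"
  shows "f \<in> borel_measurable (PiM K (\<lambda>_. borel))"
proof -
  have "\<forall>n. \<exists>g. trig_poly K (\<lambda>x. complex_of_real (g x)) \<and> 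
    (\<forall>x\<in>extensional K. (\<forall>k\<in>K. \<bar>x k\<bar> \<le> real (Suc n)) \<longrightarrow> \<bar>f x - g x\<bar> \<le> 1 / real (Suc n))"
    using trig_poly_approx[OF K f B] by (metis of_nat_0_less_iff zero_less_Suc zero_less_divide_1_iff)
  then obtain g where g: "\<And>n. trig_poly K (\<lambda>x. complex_of_real (g n x))"
    "\<And>n x. x \<in> extensional K \<Longrightarrow> (\<forall>k\<in>K. \<bar>x k\<bar> \<le> real (Suc n)) \<Longrightarrow> \<bar>f x - g n x\<bar> \<le> 1 / real (Suc n)"
    by metis
  have gm: "g n \<in> borel_measurable (PiM K (\<lambda>_. borel))" for n
    using measurable_compose[OF trig_poly_measurable[OF g(1) K] borel_measurable_Re] by simp
  show ?thesis
  proof (rule borel_measurable_LIMSEQ_real[OF _ gm])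
    fix x assume "x \<in> space (PiM K (\<lambda>_. borel :: real measure))"
    then have x: "x \<in> extensional K" by (auto simp: space_PiM PiE_def)
    define r where "r = (\<Sum>k\<in>K. \<bar>x k\<bar>)"
    have r: "\<bar>x k\<bar> \<le> r" if "k \<in> K" for k
      unfolding r_def using that K by (intro member_le_sum) auto
    obtain m where m: "r \<le> real m" using real_arch_simple by auto
    have "\<forall>\<^sub>F n in sequentially. \<bar>g n x - f x\<bar> \<le> 1 / real (Suc n)"
      using eventually_ge_at_top[of m]
    proof eventually_elim
      case (elim n)
      then have "\<forall>k\<in>K. \<bar>x k\<bar> \<le> real (Suc n)" using r m by fastforce
      then show ?case using g(2)[OF x] by (simp add: abs_minus_commute)
    qed
    then have "(\<lambda>n. g n x - f x) \<longlonglongrightarrow> 0"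
      using tendsto_0_le[OF LIMSEQ_inverse_real_of_nat, of "\<lambda>n. g n x - f x" 1] 
      by (simp add: divide_inverse)
    then show "(\<lambda>n. g n x) \<longlonglongrightarrow> f x" by (rule LIM_zero_cancel)
  qed
qed

text \<open>Levy's continuity theorem, with tightness supplied by a common bound \<open>D\<close> on
  the first absolute moments: \<open>f\<close> is traded for a trigonometric polynomial on a large
  box, and Markov's inequality controls the mass outside.\<close>

theorem weak_conv_on_char:
  fixes \<mu> :: "'i \<Rightarrow> ('k::countable \<Rightarrow> real) measure"
  assumes K: "finite K"
    and \<mu>: "eventually (\<lambda>i. prob_space (\<mu> i) \<and> sets (\<mu> i) = sets (PiM K (\<lambda>_. borel)) \<and>
        (\<forall>k\<in>K. integrable (\<mu> i) (\<lambda>x. x k) \<and> (\<integral>x. \<bar>x k\<bar> \<partial>\<mu> i) \<le> D)) F"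
    and \<nu>: "prob_space \<nu>" "sets \<nu> = sets (PiM K (\<lambda>_. borel))"
        "\<And>k. k \<in> K \<Longrightarrow> integrable \<nu> (\<lambda>x. x k)"  "\<And>k. k \<in> K \<Longrightarrow> (\<integral>x. \<bar>x k\<bar> \<partial>\<nu>) \<le> D"
    and char: "\<And>a. ((\<lambda>i. \<integral>x. cis (\<Sum>k\<in>K. a k * x k) \<partial>\<mu> i) \<longlongrightarrow> (\<integral>x. cis (\<Sum>k\<in>K. a k * x k) \<partial>\<nu>)) F"
  shows "weak_conv_on (product_topology (\<lambda>_. euclideanreal) K) \<mu> \<nu> F"
  unfolding weak_conv_on_def
proof (intro allI impI, elim conjE)
  fix f :: "('k \<Rightarrow> real) \<Rightarrow> real"
  assume f: "continuous_map (product_topology (\<lambda>_. euclideanreal) K) euclideanreal f"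
    and bd: "bounded (f ` topspace (product_topology (\<lambda>_. euclideanreal) K))"
  obtain B0 where B0: "\<And>x. x \<in> extensional K \<Longrightarrow> \<bar>f x\<bar> \<le> B0"
    using bd unfolding bounded_iff by (auto simp: PiE_def)
  define B where "B = max B0 0"
  have B: "\<And>x. x \<in> extensional K \<Longrightarrow> \<bar>f x\<bar> \<le> B" and B_ge: "B \<ge> 0"
    using B0 by (auto simp: B_def le_max_iff_disj)
  have fm: "f \<in> borel_measurable (PiM K (\<lambda>_. borel))"
    by (rule borel_measurable_continuous_map_PiM[OF K f B])
  \<comment> \<open>For empty \<open>K\<close> nothing prevents \<open>D\<close> from being
    negative.\<close>
  define D' where "D' = max D 0"
  have key: "\<bar>(\<integral>x. f x \<partial>M) - (\<integral>x. g x \<partial>M)\<bar> \<le> e + (2 * B + e) * (card K * D') / R"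
    if M: "prob_space M" "sets M = sets (PiM K (\<lambda>_. borel))"
      "\<forall>k\<in>K. integrable M (\<lambda>x. x k) \<and> (\<integral>x. \<bar>x k\<bar> \<partial>M) \<le> D"
      and g: "trig_poly K (\<lambda>x. complex_of_real (g x))" "\<forall>x. \<bar>g x\<bar> \<le> B + e"
      "\<forall>x\<in>extensional K. (\<forall>k\<in>K. \<bar>x k\<bar> \<le> R) \<longrightarrow> \<bar>f x - g x\<bar> \<le> e" and R: "R > 0" and e: "e > 0"
    for M g R and e :: real
  proof -
    interpret prob_space M by fact
    have sp: "space M = extensional K"
      using sets_eq_imp_space_eq[OF M(2)] by (auto simp: space_PiM PiE_def)
    have f_int: "integrable M f"
      using fm M(2) B by (intro integrable_const_bound[of _ B]) (auto simp: sp cong: measurable_cong_sets)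
    have gm: "g \<in> borel_measurable M"
      using measurable_compose[OF trig_poly_measurable[OF g(1) K] borel_measurable_Re] M(2) by (auto cong: measurable_cong_sets)
    have g_int: "integrable M g"
      using gm g(2) by (intro integrable_const_bound[of _ "B + e"]) auto
    \<comment> \<open>Markov's inequality in pointwise form: outside the box the difference is at
      most \<open>2 * B + e\<close>, and there the sum of the \<open>\<bar>x k\<bar>\<close> divided
      by \<open>R\<close> is at least 1.\<close>
    have pt: "\<bar>f x - g x\<bar> \<le> e + (2 * B + e) * (\<Sum>k\<in>K. \<bar>x k\<bar>) / R" if x: "x \<in> space M" for x
    proof (cases "\<forall>k\<in>K. \<bar>x k\<bar> \<le> R")
      case True
      have "0 \<le> (2 * B + e) * (\<Sum>k\<in>K. \<bar>x k\<bar>) / R" using B_ge e R by (intro divide_nonneg_pos mult_nonneg_nonneg sum_nonneg) auto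
      then show ?thesis using True g(3) x sp by fastforce
    next
      case False
      then obtain k where k: "k \<in> K" "\<bar>x k\<bar> > R" by auto
      have "R \<le> (\<Sum>k\<in>K. \<bar>x k\<bar>)" using k K member_le_sum[of k K "\<lambda>k. \<bar>x k\<bar>"] by auto
      then have "1 \<le> (\<Sum>k\<in>K. \<bar>x k\<bar>) / R" using R by simp
      then have "(2 * B + e) * 1 \<le> (2 * B + e) * ((\<Sum>k\<in>K. \<bar>x k\<bar>) / R)" using B_ge e by (intro mult_left_mono) auto
      moreover have "\<bar>f x\<bar> \<le> B" "\<bar>g x\<bar> \<le> B + e" using B x sp g(2) by auto
      ultimately show ?thesis using e by simp
    qed
    have abs_int: "integrable M (\<lambda>x. \<bar>x k\<bar>)" if "k \<in> K" for k using M(3) that by auto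
    have "\<bar>(\<integral>x. f x \<partial>M) - (\<integral>x. g x \<partial>M)\<bar> = \<bar>\<integral>x. f x - g x \<partial>M\<bar>"
      using f_int g_int by simp
    also have "\<dots> \<le> (\<integral>x. \<bar>f x - g x\<bar> \<partial>M)" by (rule integral_abs_bound)
    also have "\<dots> \<le> (\<integral>x. e + (2 * B + e) * (\<Sum>k\<in>K. \<bar>x k\<bar>) / R \<partial>M)"
      using f_int g_int abs_int pt by (intro integral_mono) auto
    also have "\<dots> = e + (2 * B + e) * (\<Sum>k\<in>K. \<integral>x. \<bar>x k\<bar> \<partial>M) / R"
      using abs_int by (simp add: prob_space)
    also have "\<dots> \<le> e + (2 * B + e) * (card K * D') / R"
    proof -
      have "(\<Sum>k\<in>K. \<integral>x. \<bar>x k\<bar> \<partial>M) \<le> (\<Sum>k\<in>K. D')" using M(3) by (intro sum_mono) (auto simp: D'_def le_max_iff_disj)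
      then show ?thesis using B_ge e R by (intro add_left_mono divide_right_mono mult_left_mono) auto
    qed
    finally show ?thesis .
  qed
  show "((\<lambda>i. \<integral>y. f y \<partial>\<mu> i) \<longlongrightarrow> (\<integral>y. f y \<partial>\<nu>)) F"
    unfolding tendsto_iff
  proof (intro allI impI)
    fix r :: real assume r: "r > 0"
    \<comment> \<open>Each of the two passages from \<open>f\<close> to \<open>g\<close> will cost
      at most \<open>e\<close> + r/8, hence r/4, and the convergence for \<open>g\<close> costs r/8;
      the total 5r/8 stays below \<open>r\<close>.\<close>
    define e where "e = min 1 (r / 8)"
    have e: "e > 0" "e \<le> 1" "e \<le> r / 8" using r by (auto simp: e_def)
    define R where "R = 8 * (2 * B + 1) * (card K * D' + 1) / r"
    have R: "R > 0" using r B_ge by (auto simp: R_def D'_def intro!: divide_pos_pos mult_pos_pos add_nonneg_pos)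
    have Rb: "(2 * B + e) * (card K * D') / R \<le> r / 8"
    proof -
      have "(2 * B + e) * (card K * D') \<le> (2 * B + 1) * (card K * D' + 1)"
        using B_ge e by (intro mult_mono) (auto simp: D'_def)
      also have "\<dots> = r / 8 * R" using r by (simp add: R_def)
      finally show ?thesis using R by (simp add: pos_divide_le_eq)
    qed
    obtain g where g: "trig_poly K (\<lambda>x. complex_of_real (g x))" "\<forall>x. \<bar>g x\<bar> \<le> B + e"
      "\<forall>x\<in>extensional K. (\<forall>k\<in>K. \<bar>x k\<bar> \<le> R) \<longrightarrow> \<bar>f x - g x\<bar> \<le> e"
      using trig_poly_approx[OF K f B R e(1)] by auto
    have "((\<lambda>i. \<integral>x. complex_of_real (g x) \<partial>\<mu> i) \<longlongrightarrow> (\<integral>x. complex_of_real (g x) \<partial>\<nu>)) F"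
      by (rule trig_poly_tendsto[OF g(1) K _ \<nu>(1,2) char]) (use \<mu> in eventually_elim, auto)
    then have "((\<lambda>i. \<integral>x. g x \<partial>\<mu> i) \<longlongrightarrow> (\<integral>x. g x \<partial>\<nu>)) F"
      by (simp add: tendsto_of_real_iff)
    then have "eventually (\<lambda>i. \<bar>(\<integral>x. g x \<partial>\<mu> i) - (\<integral>x. g x \<partial>\<nu>)\<bar> < r / 8) F"
      using r unfolding tendsto_iff dist_real_def by (metis divide_pos_pos zero_less_numeral)
    then show "eventually (\<lambda>i. dist (\<integral>y. f y \<partial>\<mu> i) (\<integral>y. f y \<partial>\<nu>) < r) F"
      using \<mu>
    proof eventually_elim
      case (elim i)
      have "\<bar>(\<integral>x. f x \<partial>\<mu> i) - (\<integral>x. g x \<partial>\<mu> i)\<bar> \<le> e + (2 * B + e) * (card K * D') / R"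
        using elim by (intro key g R e) auto
      moreover have "\<bar>(\<integral>x. f x \<partial>\<nu>) - (\<integral>x. g x \<partial>\<nu>)\<bar> \<le> e + (2 * B + e) * (card K * D') / R"
        using \<nu> by (intro key g R e) auto
      ultimately show ?case using elim(1) Rb e r unfolding dist_real_def by linarith
    qed
  qed
qed

text \<open>These are the conditions that \<open>weak_conv_on_char\<close> places on the limit law,
  together with its characteristic function.\<close>

lemma std_normal_vec_props:
  assumes K: "finite K"
  shows "prob_space (std_normal_vec K)" "sets (std_normal_vec K) = sets (PiM K (\<lambda>_. borel))"
    "\<And>k. k \<in> K \<Longrightarrow> integrable (std_normal_vec K) (\<lambda>x. x k)"
    "\<And>k. k \<in> K \<Longrightarrow> (\<integral>x. \<bar>x k\<bar> \<partial>std_normal_vec K) \<le> 1"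
    "\<And>a. (\<integral>x. cis (\<Sum>k\<in>K. a k * x k) \<partial>std_normal_vec K) = complex_of_real (exp (- (\<Sum>k\<in>K. (a k)\<^sup>2) / 2))"
proof -
  interpret N: prob_space std_normal_distribution by (rule prob_space_normal_density) simp
  interpret product_prob_space "\<lambda>_. std_normal_distribution" K by unfold_locales
  show "prob_space (std_normal_vec K)" unfolding std_normal_vec_def by unfold_locales
  show "sets (std_normal_vec K) = sets (PiM K (\<lambda>_. borel))"
    unfolding std_normal_vec_def by (rule sets_PiM_cong) auto
  have I: "integrable std_normal_distribution (\<lambda>x. x)"
    using integrable_std_normal_distribution_moment[of 1] by simp
  have I2: "integrable std_normal_distribution (\<lambda>x. x^2)"
    using integrable_std_normal_distribution_moment[of 2] by simp
  have E2: "(\<integral>x. x^2 \<partial>std_normal_distribution) = 1"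
    using std_normal_distribution_even_moments[of 1] by simp
  fix k assume k: "k \<in> K"
  have d: "distr (std_normal_vec K) std_normal_distribution (\<lambda>x. x k) = std_normal_distribution"
    unfolding std_normal_vec_def using k by (rule PiM_component)
  have mk: "(\<lambda>x. x k) \<in> measurable (std_normal_vec K) std_normal_distribution"
    unfolding std_normal_vec_def using k by (rule measurable_component_singleton)
  show "integrable (std_normal_vec K) (\<lambda>x. x k)"
    using integrable_distr[OF mk, of "\<lambda>x. x"] I d by simp
  have "(\<integral>x. \<bar>x k\<bar> \<partial>std_normal_vec K) = (\<integral>x. \<bar>x\<bar> \<partial>std_normal_distribution)"
    using integral_distr[OF mk, of abs] d by simp
  also have "\<dots> \<le> (\<integral>x. (1 + x^2)/2 \<partial>std_normal_distribution)"
  proof (rule integral_mono)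
    fix x :: real
    show "\<bar>x\<bar> \<le> (1 + x^2)/2" using zero_le_power2[of "\<bar>x\<bar> - 1"] by (simp add: power2_diff)
  qed (use I I2 in auto)
  also have "\<dots> = 1" using I2 E2 N.prob_space by simp
  finally show "(\<integral>x. \<bar>x k\<bar> \<partial>std_normal_vec K) \<le> 1" .
next
  interpret N: prob_space std_normal_distribution by (rule prob_space_normal_density) simp
  interpret product_prob_space "\<lambda>_. std_normal_distribution" K by unfold_locales
  fix a
  have "cis (\<Sum>k\<in>K. a k * x k) = (\<Prod>k\<in>K. iexp (a k * x k))" for x :: "nat \<Rightarrow> real"
    using K by (simp add: cis_conv_exp sum_distrib_left exp_sum)
  then have "(\<integral>x. cis (\<Sum>k\<in>K. a k * x k) \<partial>std_normal_vec K) = (\<Prod>k\<in>K. \<integral>x. iexp (a k * x) \<partial>std_normal_distribution)"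
    unfolding std_normal_vec_def using K
    by (simp, intro product_integral_prod) (auto intro!: N.integrable_const_bound[of _ 1])
  also have "\<dots> = (\<Prod>k\<in>K. complex_of_real (exp (- (a k)\<^sup>2 / 2)))"
    using char_std_normal_distribution unfolding char_def fun_eq_iff by simp
  also have "\<dots> = complex_of_real (exp (- (\<Sum>k\<in>K. (a k)\<^sup>2) / 2))"
    using K by (simp add: exp_sum[symmetric] sum_negf sum_divide_distrib flip: of_real_prod)
  finally show "(\<integral>x. cis (\<Sum>k\<in>K. a k * x k) \<partial>std_normal_vec K) = complex_of_real (exp (- (\<Sum>k\<in>K. (a k)\<^sup>2) / 2))" .
qed

section \<open>The largest eigenvalue of a covariance matrix\<close>

definition apply_mat :: "nat \<Rightarrow> (nat \<Rightarrow> nat \<Rightarrow> real) \<Rightarrow> (nat \<Rightarrow> real) \<Rightarrow> nat \<Rightarrow> real" where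
  "apply_mat p a x i = (\<Sum>j<p. a i j * x j)"

lemma dotp_add_left: "dotp p (\<lambda>i. x i + c * y i) z = dotp p x z + c * dotp p y z"
  by (simp add: dotp_def algebra_simps sum.distrib sum_distrib_left)

lemma dotp_commute: "dotp p x y = dotp p y x"
  by (simp add: dotp_def mult.commute)

lemma dotp_add_right: "dotp p z (\<lambda>i. x i + c * y i) = dotp p z x + c * dotp p z y"
  by (simp add: dotp_def algebra_simps sum.distrib sum_distrib_left)

lemma dotp_self_nonneg: "dotp p x x \<ge> 0"
  by (auto simp: dotp_def intro!: sum_nonneg)

lemma apply_mat_add: "apply_mat p a (\<lambda>i. x i + c * y i) = (\<lambda>i. apply_mat p a x i + c * apply_mat p a y i)"
  by (simp add: apply_mat_def algebra_simps sum.distrib sum_distrib_left fun_eq_iff)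

lemma apply_mat_symmetric:
  assumes "\<And>i j. i < p \<Longrightarrow> j < p \<Longrightarrow> a i j = a j i"
  shows "dotp p x (apply_mat p a y) = dotp p y (apply_mat p a x)"
proof -
  have "dotp p x (apply_mat p a y) = (\<Sum>i<p. \<Sum>j<p. x i * (a i j * y j))"
    by (simp add: dotp_def apply_mat_def sum_distrib_left)
  also have "\<dots> = (\<Sum>j<p. \<Sum>i<p. x i * (a i j * y j))" by (rule sum.swap)
  also have "\<dots> = (\<Sum>j<p. \<Sum>i<p. y j * (a j i * x i))"
    using assms by (intro sum.cong refl) (simp add: mult_ac)
  also have "\<dots> = dotp p y (apply_mat p a x)"
    by (simp add: dotp_def apply_mat_def sum_distrib_left)
  finally show ?thesis .
qed

text \<open>First-order condition at a maximum: for small \<open>t\<close> of the sign of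
  \<open>b\<close> the linear term would win. The witness is \<open>b / d\<close> with
  \<open>d\<close> larger than \<open>c\<close>.\<close>

lemma quadratic_nonneg_linear_zero:
  fixes b c :: real
  assumes "\<And>t. t * b \<le> t\<^sup>2 * c"
  shows "b = 0"
proof (rule ccontr)
  assume b: "b \<noteq> 0"
  define d where "d = \<bar>c\<bar> + 1"
  have d: "d > 0" "c < d" by (auto simp: d_def)
  have "(b / d) * b \<le> (b / d)\<^sup>2 * c" by (rule assms)
  also have "\<dots> = (b\<^sup>2 / d) * (c / d)" using d by (simp add: power2_eq_square)
  also have "\<dots> < (b\<^sup>2 / d) * 1" using d b by (intro mult_strict_left_mono) auto
  finally show False by (simp add: power2_eq_square)
qed

lemma continuous_on_coordinate: "continuous_on A (\<lambda>x :: nat \<Rightarrow> real. x i)"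
  by (rule continuous_on_subset[OF continuous_on_product_coordinates subset_UNIV])

text \<open>The quadratic form attains its maximum on the unit sphere, and a maximiser is an
  eigenvector. This gives the one eigenvalue that dominates the form without diagonalising the
  matrix.\<close>

lemma rayleigh_eigenvector:
  assumes p: "p \<ge> 1" and sym: "\<And>i j. i < p \<Longrightarrow> j < p \<Longrightarrow> a i j = a j i"
  shows "\<exists>m x0. (\<exists>i<p. x0 i \<noteq> 0) \<and> (\<forall>i<p. apply_mat p a x0 i = m * x0 i) \<and> (\<forall>x. dotp p x (apply_mat p a x) \<le> m * dotp p x x)"
proof -
  \<comment> \<open>Unit vectors have coordinates in [-1, 1]; fixing the coordinates from
    \<open>p\<close> on to 0 makes the sphere a closed subset of a compact cube in the function
    space.\<close>
  define C :: "(nat \<Rightarrow> real) set" where "C = PiE UNIV (\<lambda>i. if i < p then {-1..1} else {0})"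
  define K where "K = C \<inter> {x. dotp p x x = 1}"
  let ?Q = "\<lambda>x. dotp p x (apply_mat p a x)"
  have "compactin (product_topology (\<lambda>_. euclideanreal) UNIV) C"
    unfolding C_def compactin_PiE by auto
  then have cC: "compact C" by (simp add: euclidean_product_topology)
  have "continuous_on UNIV (\<lambda>x. dotp p x x)"
    unfolding dotp_def by (intro continuous_on_sum continuous_on_mult continuous_on_coordinate)
  then have "closed {x. dotp p x x = 1}"
    using continuous_closed_preimage_constant[of UNIV "\<lambda>x. dotp p x x" 1] by simp
  then have cK: "compact K" unfolding K_def by (rule compact_Int_closed[OF cC])
  have cQ: "continuous_on K ?Q"
    unfolding dotp_def apply_mat_def by (intro continuous_on_sum continuous_on_mult continuous_on_coordinate continuous_on_const)
  define e0 :: "nat \<Rightarrow> real" where "e0 i = (if i = 0 then 1 else 0)" for i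
  have "dotp p e0 e0 = (\<Sum>i<p. if i = 0 then 1 else 0)" unfolding dotp_def by (intro sum.cong refl) (simp add: e0_def)
  also have "\<dots> = 1" using p by simp
  finally have "e0 \<in> K" using p by (auto simp: K_def C_def e0_def)
  then have Kne: "K \<noteq> {}" by blast
  obtain x0 where x0: "x0 \<in> K" "\<And>y. y \<in> K \<Longrightarrow> ?Q y \<le> ?Q x0"
    using continuous_attains_sup[OF cK Kne cQ] by blast
  define m where "m = ?Q x0"
  have n0: "dotp p x0 x0 = 1" using x0 by (simp add: K_def)
  have bound: "?Q x \<le> m * dotp p x x" for x
  proof (cases "dotp p x x = 0")
    case True
    then have "\<And>i. i < p \<Longrightarrow> x i = 0" by (auto simp: dotp_def sum_nonneg_eq_0_iff)
    then show ?thesis by (simp add: dotp_def)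
  next
    case False
    define r where "r = sqrt (dotp p x x)"
    have r: "r > 0" "r\<^sup>2 = dotp p x x" using False dotp_self_nonneg[of p x] by (auto simp: r_def)
    define y where "y i = (if i < p then x i / r else 0)" for i
    have yy: "dotp p y y = 1"
    proof -
      have "dotp p y y = dotp p x x / r\<^sup>2" by (simp add: dotp_def y_def sum_divide_distrib power2_eq_square)
      then show ?thesis using r False by simp
    qed
    have "\<bar>y i\<bar> \<le> 1" if "i < p" for i
    proof -
      have "(y i)\<^sup>2 \<le> dotp p y y"
        unfolding dotp_def power2_eq_square using that by (intro member_le_sum) auto
      then show ?thesis using yy by (simp add: abs_square_le_1)
    qed
    then have "y i \<in> (if i < p then {-1..1} else {0})" for i
    proof (cases "i < p")
      case True
      with \<open>\<And>i. i < p \<Longrightarrow> \<bar>y i\<bar> \<le> 1\<close>[OF True] show ?thesis by (simp add: abs_le_iff)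
    qed (simp add: y_def)
    then have "y \<in> K" using yy by (simp add: K_def C_def PiE_iff)
    then have "?Q y \<le> m" using x0(2) by (simp add: m_def)
    moreover have "?Q y = ?Q x / r\<^sup>2"
      by (simp add: dotp_def apply_mat_def y_def sum_divide_distrib sum_distrib_left power2_eq_square)
    moreover have "dotp p x x > 0" using False dotp_self_nonneg[of p x] by simp
    ultimately show ?thesis using r(2) by (simp add: pos_divide_le_eq)
  qed
  \<comment> \<open>The residual of the eigenvalue equation is itself the test direction: moving
    from \<open>x0\<close> along \<open>r\<close> raises the form minus \<open>m\<close> times the
    squared norm by twice the squared norm of \<open>r\<close> to first order, which maximality
    permits only for \<open>r\<close> = 0.\<close>
  define r where "r i = apply_mat p a x0 i + (- m) * x0 i" for i
  have lin: "dotp p r (apply_mat p a x0) - m * dotp p r x0 = dotp p r r"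
    using dotp_add_right[of p r "apply_mat p a x0" "- m" x0] by (simp add: r_def[abs_def])
  have sw: "dotp p x0 (apply_mat p a r) = dotp p r (apply_mat p a x0)" by (rule apply_mat_symmetric[OF sym])
  have "t * (2 * dotp p r r) \<le> t\<^sup>2 * (m * dotp p r r - ?Q r)" for t
  proof -
    have "?Q (\<lambda>i. x0 i + t * r i) = ?Q x0 + 2 * t * dotp p r (apply_mat p a x0) + t\<^sup>2 * ?Q r"
      unfolding apply_mat_add dotp_add_left dotp_add_right sw
      by (simp add: algebra_simps power2_eq_square)
    moreover have "dotp p (\<lambda>i. x0 i + t * r i) (\<lambda>i. x0 i + t * r i) = 1 + 2 * t * dotp p r x0 + t\<^sup>2 * dotp p r r"
      unfolding dotp_add_left dotp_add_right
      by (simp add: n0 dotp_commute[of p x0 r] algebra_simps power2_eq_square)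
    ultimately have "?Q x0 + 2 * t * dotp p r (apply_mat p a x0) + t\<^sup>2 * ?Q r \<le> m * (1 + 2 * t * dotp p r x0 + t\<^sup>2 * dotp p r r)"
      using bound[of "\<lambda>i. x0 i + t * r i"] by simp
    then have "2 * t * (dotp p r (apply_mat p a x0) - m * dotp p r x0) \<le> t\<^sup>2 * (m * dotp p r r - ?Q r)"
      by (simp add: m_def algebra_simps)
    then show ?thesis by (simp add: lin algebra_simps)
  qed
  then have "2 * dotp p r r = 0" by (rule quadratic_nonneg_linear_zero)
  then have r0: "\<And>i. i < p \<Longrightarrow> r i = 0" by (auto simp: dotp_def sum_nonneg_eq_0_iff)
  have "\<exists>i<p. x0 i \<noteq> 0"
  proof (rule ccontr)
    assume "\<not> ?thesis"
    then have "dotp p x0 x0 = 0" by (auto simp: dotp_def intro!: sum.neutral)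
    with n0 show False by simp
  qed
  moreover have "\<forall>i<p. apply_mat p a x0 i = m * x0 i" using r0 by (simp add: r_def)
  ultimately show ?thesis using bound by blast
qed

text \<open>The maximum of the Rayleigh quotient is an element of the spectrum and hence at most its
  maximum.\<close>

lemma eigenvalue_bound_quadratic:
  fixes S :: "real mat"
  assumes S: "S \<in> carrier_mat p p" and p: "p \<ge> 1" and sym: "\<And>i j. i < p \<Longrightarrow> j < p \<Longrightarrow> S $$ (i, j) = S $$ (j, i)"
    and C: "Max (spectrum S) \<le> C"
  shows "dotp p x (apply_mat p (\<lambda>i j. S $$ (i, j)) x) \<le> C * dotp p x x"
proof -
  obtain m x0 where x0: "\<exists>i<p. x0 i \<noteq> 0" "\<forall>i<p. apply_mat p (\<lambda>i j. S $$ (i, j)) x0 i = m * x0 i"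
    and b: "\<And>x. dotp p x (apply_mat p (\<lambda>i j. S $$ (i, j)) x) \<le> m * dotp p x x"
    using rayleigh_eigenvector[OF p, of "\<lambda>i j. S $$ (i, j)"] sym by blast
  have "eigenvector S (vec p x0) m"
    unfolding eigenvector_def
  proof (intro conjI)
    show "vec p x0 \<noteq> 0\<^sub>v (dim_row S)" using x0(1) S by (auto simp: vec_eq_iff)
    show "S *\<^sub>v vec p x0 = m \<cdot>\<^sub>v vec p x0"
    proof (rule eq_vecI)
      fix i assume "i < dim_vec (m \<cdot>\<^sub>v vec p x0)"
      then have i: "i < p" by simp
      have "(S *\<^sub>v vec p x0) $ i = apply_mat p (\<lambda>i j. S $$ (i, j)) x0 i"
        using S i by (auto simp: apply_mat_def scalar_prod_def lessThan_atLeast0 intro!: sum.cong)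
      then show "(S *\<^sub>v vec p x0) $ i = (m \<cdot>\<^sub>v vec p x0) $ i" using x0(2) i by simp
    qed (use S in simp)
  qed (use S in simp)
  then have "m \<in> spectrum S" by (auto simp: spectrum_def eigenvalue_def)
  then have "m \<le> C" using card_finite_spectrum(1)[OF S] C by (meson Max_ge order_trans)
  then have "m * dotp p x x \<le> C * dotp p x x" using dotp_self_nonneg by (intro mult_right_mono) auto
  with b[of x] show ?thesis by linarith
qed

text \<open>Positivity of the form at x - y/C, where y is the image of x, is expanded; the bound by
  \<open>C\<close> on the form at x and at y leaves exactly the claim. Again no square root or
  diagonalisation of the matrix is involved.\<close>

lemma eigenvalue_bound_norm:
  fixes S :: "real mat"
  assumes S: "S \<in> carrier_mat p p" and p: "p \<ge> 1" and sym: "\<And>i j. i < p \<Longrightarrow> j < p \<Longrightarrow> S $$ (i, j) = S $$ (j, i)"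
    and psd: "\<And>x. dotp p x (apply_mat p (\<lambda>i j. S $$ (i, j)) x) \<ge> 0"
    and C: "Max (spectrum S) \<le> C" and C0: "C > 0"
  defines "T \<equiv> apply_mat p (\<lambda>i j. S $$ (i, j))"
  shows "dotp p (T x) (T x) \<le> C\<^sup>2 * dotp p x x"
proof -
  define y where "y = T x"
  have Q: "dotp p u (T u) \<le> C * dotp p u u" for u
    unfolding T_def by (rule eigenvalue_bound_quadratic[OF S p sym C])
  have sy: "dotp p x (T y) = dotp p y y" "dotp p y (T x) = dotp p y y"
    unfolding T_def y_def using apply_mat_symmetric[of p "\<lambda>i j. S $$ (i, j)"] sym by auto
  have "0 \<le> dotp p (\<lambda>i. x i + (- 1 / C) * y i) (T (\<lambda>i. x i + (- 1 / C) * y i))"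
    unfolding T_def by (rule psd)
  also have "\<dots> = dotp p x (T x) - 2 / C * dotp p y y + (1 / C)\<^sup>2 * dotp p y (T y)"
  proof -
    have "dotp p (\<lambda>i. x i + c * y i) (T (\<lambda>i. x i + c * y i)) = dotp p x (T x) + 2 * c * dotp p y y + c\<^sup>2 * dotp p y (T y)" for c
      unfolding T_def apply_mat_add dotp_add_left dotp_add_right unfolding T_def[symmetric] sy
      by (simp add: algebra_simps power2_eq_square)
    from this[of "- 1 / C"] show ?thesis by simp
  qed
  also have "\<dots> \<le> C * dotp p x x - 2 / C * dotp p y y + (1 / C)\<^sup>2 * (C * dotp p y y)"
    by (intro add_mono diff_mono mult_left_mono order.refl Q) auto
  also have "\<dots> = C * dotp p x x - 1 / C * dotp p y y" using C0 by (simp add: power2_eq_square field_simps)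
  finally have "dotp p y y / C \<le> C * dotp p x x" by simp
  then show ?thesis using C0 by (simp add: y_def[symmetric] pos_divide_le_eq power2_eq_square mult_ac)
qed

text \<open>Each column of the square is the matrix applied to one of its own columns, so the norm
  bound applies columnwise. For a covariance matrix this says tr(S^4) is at most C^2 tr(S^2); the
  bound on the largest eigenvalue enters the limit theorem here.\<close>

lemma eigenvalue_bound_square:
  fixes S :: "real mat"
  assumes S: "S \<in> carrier_mat p p" and p: "p \<ge> 1" and sym: "\<And>i j. i < p \<Longrightarrow> j < p \<Longrightarrow> S $$ (i, j) = S $$ (j, i)"
    and psd: "\<And>x. dotp p x (apply_mat p (\<lambda>i j. S $$ (i, j)) x) \<ge> 0"
    and C: "Max (spectrum S) \<le> C" and C0: "C > 0"
  shows "(\<Sum>i<p. \<Sum>j<p. (\<Sum>k<p. S $$ (i, k) * S $$ (k, j))\<^sup>2) \<le> C\<^sup>2 * (\<Sum>i<p. \<Sum>j<p. (S $$ (i, j))\<^sup>2)"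
proof -
  have "(\<Sum>i<p. \<Sum>j<p. (\<Sum>k<p. S $$ (i, k) * S $$ (k, j))\<^sup>2) = (\<Sum>j<p. \<Sum>i<p. (\<Sum>k<p. S $$ (i, k) * S $$ (k, j))\<^sup>2)"
    by (rule sum.swap)
  also have "\<dots> \<le> (\<Sum>j<p. C\<^sup>2 * (\<Sum>i<p. (S $$ (i, j))\<^sup>2))"
    using eigenvalue_bound_norm[OF S p sym psd C C0, of "\<lambda>k. S $$ (k, j)" for j]
    by (intro sum_mono) (simp add: dotp_def apply_mat_def power2_eq_square)
  also have "\<dots> = C\<^sup>2 * (\<Sum>i<p. \<Sum>j<p. (S $$ (i, j))\<^sup>2)"
  proof -
    have "(\<Sum>i<p. \<Sum>j<p. (S $$ (i, j))\<^sup>2) = (\<Sum>j<p. \<Sum>i<p. (S $$ (i, j))\<^sup>2)" by (rule sum.swap)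
    then show ?thesis by (simp add: sum_distrib_left)
  qed
  finally show ?thesis .
qed

section \<open>Degenerate U-statistics\<close>

lemma power4_add_le: "(a + b) ^ 4 \<le> 8 * (a ^ 4 + (b::real) ^ 4)"
proof -
  have s: "(a + b)\<^sup>2 \<le> 2 * (a\<^sup>2 + b\<^sup>2)" for a b :: real
    using zero_le_power2[of "a - b"] by (simp add: power2_eq_square algebra_simps)
  have "(a + b) ^ 4 = ((a + b)\<^sup>2)\<^sup>2" by simp
  also have "\<dots> \<le> (2 * (a\<^sup>2 + b\<^sup>2))\<^sup>2" using s by (intro power_mono) auto
  also have "\<dots> = 4 * (a\<^sup>2 + b\<^sup>2)\<^sup>2" by (subst power_mult_distrib) simp
  also have "\<dots> \<le> 4 * (2 * ((a\<^sup>2)\<^sup>2 + (b\<^sup>2)\<^sup>2))" using s[of "a\<^sup>2" "b\<^sup>2"] by linarith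
  finally show ?thesis by simp
qed

lemma integrable_power4_add:
  fixes X Y :: "'a \<Rightarrow> real"
  assumes "X \<in> borel_measurable M" "Y \<in> borel_measurable M" "integrable M (\<lambda>x. X x ^ 4)" "integrable M (\<lambda>x. Y x ^ 4)"
  shows "integrable M (\<lambda>x. (X x + Y x) ^ 4)"
proof (rule Bochner_Integration.integrable_bound)
  show "integrable M (\<lambda>x. 8 * (X x ^ 4 + Y x ^ 4))" using assms by simp
  have "norm ((a + b) ^ 4) \<le> norm (8 * (a ^ 4 + b ^ 4))" for a b :: real
    using power4_add_le[of a b] by simp
  then show "AE x in M. norm ((X x + Y x) ^ 4) \<le> norm (8 * (X x ^ 4 + Y x ^ 4))" by blast
qed (use assms in auto)

lemma integrable_power4_sum:
  fixes X :: "'i \<Rightarrow> 'a \<Rightarrow> real"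
  assumes "finite I" "\<And>i. i \<in> I \<Longrightarrow> X i \<in> borel_measurable M" "\<And>i. i \<in> I \<Longrightarrow> integrable M (\<lambda>x. X i x ^ 4)"
  shows "integrable M (\<lambda>x. (\<Sum>i\<in>I. X i x) ^ 4)"
  using assms
proof (induction rule: finite_induct)
  case empty
  then show ?case by (simp add: power_0_left)
next
  case (insert j I)
  then have "integrable M (\<lambda>x. (X j x + (\<Sum>i\<in>I. X i x)) ^ 4)"
    by (intro integrable_power4_add) auto
  then show ?case using insert by simp
qed

lemma integrable_mult_L2:
  fixes X Y :: "'a \<Rightarrow> real"
  assumes "X \<in> borel_measurable M" "Y \<in> borel_measurable M" "integrable M (\<lambda>x. (X x)\<^sup>2)" "integrable M (\<lambda>x. (Y x)\<^sup>2)"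
  shows "integrable M (\<lambda>x. X x * Y x)"
proof (rule Bochner_Integration.integrable_bound)
  show "integrable M (\<lambda>x. (X x)\<^sup>2 + (Y x)\<^sup>2)" using assms by simp
  have "\<bar>a * b\<bar> \<le> a\<^sup>2 + b\<^sup>2" for a b :: real
    using sum_squares_bound[of a b] sum_squares_bound[of a "-b"] by (auto simp: abs_if)
  then show "AE x in M. norm (X x * Y x) \<le> norm ((X x)\<^sup>2 + (Y x)\<^sup>2)" by auto
qed (use assms in auto)

lemma integrable_power2_sum:
  fixes X :: "'i \<Rightarrow> 'a \<Rightarrow> real"
  assumes "finite I" "\<And>i. i \<in> I \<Longrightarrow> X i \<in> borel_measurable M" "\<And>i. i \<in> I \<Longrightarrow> integrable M (\<lambda>x. (X i x)\<^sup>2)"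
  shows "integrable M (\<lambda>x. (\<Sum>i\<in>I. X i x)\<^sup>2)"
  unfolding power2_eq_square sum_product
  by (intro Bochner_Integration.integrable_sum integrable_mult_L2 assms)

lemma (in finite_measure) integrable_L2_L1:
  fixes X :: "'a \<Rightarrow> real"
  assumes "X \<in> borel_measurable M" "integrable M (\<lambda>x. (X x)\<^sup>2)"
  shows "integrable M X"
  using integrable_mult_L2[of X M "\<lambda>_. 1"] assms by simp

lemma (in finite_measure) integrable_L4_L2:
  fixes X :: "'a \<Rightarrow> real"
  assumes "X \<in> borel_measurable M" "integrable M (\<lambda>x. X x ^ 4)"
  shows "integrable M (\<lambda>x. (X x)\<^sup>2)"
  using integrable_L2_L1[of "\<lambda>x. (X x)\<^sup>2"] assms by simp

lemma (in finite_measure) integrable_L4_L3: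
  fixes X :: "'a \<Rightarrow> real"
  assumes "X \<in> borel_measurable M" "integrable M (\<lambda>x. X x ^ 4)"
  shows "integrable M (\<lambda>x. X x ^ 3)"
proof -
  have "integrable M (\<lambda>x. (X x)\<^sup>2 * X x)"
    using assms integrable_L4_L2[OF assms] by (intro integrable_mult_L2) auto
  then show ?thesis by (simp add: power2_eq_square power3_eq_cube mult.assoc)
qed

lemma (in prob_space) expectation_power2_le:
  fixes X :: "'a \<Rightarrow> real"
  assumes "X \<in> borel_measurable M" "integrable M (\<lambda>x. (X x)\<^sup>2)"
  shows "(expectation X)\<^sup>2 \<le> expectation (\<lambda>x. (X x)\<^sup>2)"
  using variance_eq[OF integrable_L2_L1[OF assms] assms(2)] variance_positive[of X] by simp

lemma (in prob_space) expectation_const_add_power2: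
  fixes X :: "'a \<Rightarrow> real"
  assumes "X \<in> borel_measurable M" "integrable M (\<lambda>x. (X x)\<^sup>2)" "expectation X = 0"
  shows "expectation (\<lambda>x. (a + X x)\<^sup>2) = a\<^sup>2 + expectation (\<lambda>x. (X x)\<^sup>2)"
  using assms integrable_L2_L1[OF assms(1,2)] by (simp add: power2_sum prob_space)

lemma (in prob_space) expectation_abs_le_sqrt:
  fixes X :: "'a \<Rightarrow> real"
  assumes "X \<in> borel_measurable M" "integrable M (\<lambda>x. (X x)\<^sup>2)"
  shows "expectation (\<lambda>x. \<bar>X x\<bar>) \<le> sqrt (expectation (\<lambda>x. (X x)\<^sup>2))"
  using expectation_power2_le[of "\<lambda>x. \<bar>X x\<bar>"] assms by (intro real_le_rsqrt) auto

text \<open>Cauchy--Schwarz from the discriminant of the nonnegative quadratic function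
  \<open>q\<close>. It is one-sided; bounds on absolute values come from a second application to the
  negated function.\<close>

lemma (in prob_space) expectation_mult_le_sqrt:
  fixes X Y :: "'a \<Rightarrow> real"
  assumes m: "X \<in> borel_measurable M" "Y \<in> borel_measurable M"
    and i: "integrable M (\<lambda>x. (X x)\<^sup>2)" "integrable M (\<lambda>x. (Y x)\<^sup>2)"
  shows "expectation (\<lambda>x. X x * Y x) \<le> sqrt (expectation (\<lambda>x. (X x)\<^sup>2)) * sqrt (expectation (\<lambda>x. (Y x)\<^sup>2))"
proof -
  define a b c where "a = expectation (\<lambda>x. (X x)\<^sup>2)" "b = expectation (\<lambda>x. X x * Y x)" "c = expectation (\<lambda>x. (Y x)\<^sup>2)"
  have a0: "a \<ge> 0" and c0: "c \<ge> 0" by (simp_all add: a_b_c_def)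
  have xy: "integrable M (\<lambda>x. X x * Y x)" by (rule integrable_mult_L2[OF m i])
  have q: "0 \<le> a * t\<^sup>2 + 2 * b * t + c" for t
  proof -
    have "0 \<le> expectation (\<lambda>x. (t * X x + Y x)\<^sup>2)" by simp
    also have "expectation (\<lambda>x. (t * X x + Y x)\<^sup>2) = expectation (\<lambda>x. t\<^sup>2 * (X x)\<^sup>2 + 2 * t * (X x * Y x) + (Y x)\<^sup>2)"
      by (intro Bochner_Integration.integral_cong) (auto simp: power2_eq_square algebra_simps)
    also have "\<dots> = t\<^sup>2 * a + 2 * t * b + c" using i xy by (simp add: a_b_c_def)
    finally show ?thesis by (simp add: algebra_simps)
  qed
  have "b\<^sup>2 \<le> a * c"
  proof (cases "a = 0")
    case True
    have "b = 0"
    proof (rule ccontr)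
      assume "b \<noteq> 0"
      \<comment> \<open>At this argument \<open>2 * b * t + c\<close> equals -1.\<close>
      then show False using q[of "- (c + 1) / (2 * b)"] True c0 by (simp add: field_simps)
    qed
    then show ?thesis using True by simp
  next
    case False
    have "0 \<le> a * (a * (- b / a)\<^sup>2 + 2 * b * (- b / a) + c)" by (intro mult_nonneg_nonneg q a0)
    also have "\<dots> = a * c - b\<^sup>2" using False by (simp add: field_simps power2_eq_square)
    finally show ?thesis by simp
  qed
  then have "b \<le> sqrt (a * c)" by (rule real_le_rsqrt)
  then show ?thesis by (simp add: a_b_c_def real_sqrt_mult)
qed

text \<open>The Taylor remainder is cubic. The inequality
  \<open>2 * \<bar>t\<bar> ^ 3 \<le> \<eta> * t^2 + t ^ 4 / \<eta>\<close> trades it for second and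
  fourth moments, the only ones that can be summed over the martingale; \<open>\<eta>\<close> stays
  free until both parts can be balanced.\<close>

lemma (in prob_space) char_second_order:
  fixes X :: "'a \<Rightarrow> real"
  assumes m: "X \<in> borel_measurable M" and i: "integrable M (\<lambda>x. X x ^ 4)" and z: "expectation X = 0" and e: "\<eta> > 0"
  shows "cmod ((\<integral>x. cis (X x) \<partial>M) - complex_of_real (1 - expectation (\<lambda>x. (X x)\<^sup>2) / 2))
    \<le> (\<eta> * expectation (\<lambda>x. (X x)\<^sup>2) + expectation (\<lambda>x. X x ^ 4) / \<eta>) / 12"
proof -
  have i2: "integrable M (\<lambda>x. (X x)\<^sup>2)" by (rule integrable_L4_L2[OF m i])
  have i1: "integrable M X" by (rule integrable_L2_L1[OF m i2])
  have cm: "(\<lambda>x. cis (X x)) \<in> borel_measurable M"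
    by (rule measurable_compose[OF m]) (intro borel_measurable_continuous_onI continuous_intros)
  have ci: "integrable M (\<lambda>x. cis (X x))" using cm by (intro integrable_const_bound[of _ 1]) auto
  let ?q = "\<lambda>x. complex_of_real (1 - (X x)\<^sup>2 / 2) + \<i> * complex_of_real (X x)"
  have qi: "integrable M ?q" using i1 i2 by (intro Bochner_Integration.integrable_add integrable_mult_right integrable_of_real) auto
  have qE: "(\<integral>x. ?q x \<partial>M) = complex_of_real (1 - expectation (\<lambda>x. (X x)\<^sup>2) / 2)"
  proof -
    have "(\<integral>x. ?q x \<partial>M) = (\<integral>x. complex_of_real (1 - (X x)\<^sup>2 / 2) \<partial>M) + (\<integral>x. \<i> * complex_of_real (X x) \<partial>M)"
      using i1 i2 by (intro Bochner_Integration.integral_add integrable_mult_right integrable_of_real) auto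
    also have "(\<integral>x. \<i> * complex_of_real (X x) \<partial>M) = 0" using z by simp
    also have "(\<integral>x. complex_of_real (1 - (X x)\<^sup>2 / 2) \<partial>M) = complex_of_real (1 - expectation (\<lambda>x. (X x)\<^sup>2) / 2)"
      using i2 by (simp only: integral_complex_of_real) (simp add: prob_space)
    finally show ?thesis by simp
  qed
  have pt: "cmod (cis t - (complex_of_real (1 - t\<^sup>2 / 2) + \<i> * complex_of_real t)) \<le> (\<eta> * t\<^sup>2 + t ^ 4 / \<eta>) / 12" for t
  proof -
    have "cis t - (complex_of_real (1 - t\<^sup>2 / 2) + \<i> * complex_of_real t) = iexp t - (\<Sum>k\<le>2. (\<i> * t) ^ k / fact k)"
      by (simp add: cis_conv_exp numeral_2_eq_2 field_simps power2_eq_square)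
    then have "cmod (cis t - (complex_of_real (1 - t\<^sup>2 / 2) + \<i> * complex_of_real t)) \<le> \<bar>t\<bar> ^ 3 / 6"
      using iexp_approx1[of t 2] by (simp add: numeral_3_eq_3 fact_numeral)
    also have "\<dots> \<le> (\<eta> * t\<^sup>2 + t ^ 4 / \<eta>) / 12"
    proof -
      have "0 \<le> t\<^sup>2 * (\<eta> - \<bar>t\<bar>)\<^sup>2 / \<eta>" using e by simp
      also have "\<dots> = \<eta> * t\<^sup>2 - 2 * \<bar>t\<bar> ^ 3 + t ^ 4 / \<eta>"
        using e by (simp add: field_simps power2_diff power3_eq_cube power2_eq_square power4_eq_xxxx abs_mult_self_eq)
      finally show ?thesis by simp
    qed
    finally show ?thesis .
  qed
  have "(\<integral>x. cis (X x) \<partial>M) - complex_of_real (1 - expectation (\<lambda>x. (X x)\<^sup>2) / 2) = (\<integral>x. cis (X x) - ?q x \<partial>M)"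
    using ci qi qE by simp
  also have "cmod \<dots> \<le> (\<integral>x. cmod (cis (X x) - ?q x) \<partial>M)" by (rule integral_norm_bound)
  also have "\<dots> \<le> (\<integral>x. (\<eta> * (X x)\<^sup>2 + X x ^ 4 / \<eta>) / 12 \<partial>M)"
    using ci qi i i2 pt by (intro integral_mono integrable_norm) auto
  also have "\<dots> = (\<eta> * expectation (\<lambda>x. (X x)\<^sup>2) + expectation (\<lambda>x. X x ^ 4) / \<eta>) / 12"
    using i i2 by simp
  finally show ?thesis .
qed

lemma exp_neg_second_order:
  fixes t :: real
  assumes "t \<ge> 0"
  shows "\<bar>1 - t / 2 - exp (- t / 2)\<bar> \<le> t\<^sup>2 / 8"
proof -
  define s where "s = t / 2"
  have s: "s \<ge> 0" using assms by (simp add: s_def)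
  have up: "exp (- s) \<ge> 1 - s" using exp_ge_add_one_self[of "-s"] by simp
  have "(\<lambda>s::real. 1 - s + s\<^sup>2 / 2 - exp (- s)) 0 \<le> (\<lambda>s::real. 1 - s + s\<^sup>2 / 2 - exp (- s)) s"
  proof (rule DERIV_nonneg_imp_nondecreasing[OF s])
    fix x :: real assume "0 \<le> x" "x \<le> s"
    have "((\<lambda>s::real. 1 - s + s\<^sup>2 / 2 - exp (- s)) has_real_derivative (- 1 + x + exp (- x))) (at x)"
      by (auto intro!: derivative_eq_intros)
    moreover have "0 \<le> - 1 + x + exp (- x)" using exp_ge_add_one_self[of "-x"] by simp
    ultimately show "\<exists>y. ((\<lambda>s::real. 1 - s + s\<^sup>2 / 2 - exp (- s)) has_real_derivative y) (at x) \<and> 0 \<le> y" by blast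
  qed
  then have "exp (- s) \<le> 1 - s + s\<^sup>2 / 2" by simp
  with up have "\<bar>1 - s - exp (- s)\<bar> \<le> s\<^sup>2 / 2" by linarith
  then show ?thesis by (simp add: s_def power2_eq_square)
qed

section \<open>Powers of a probability space and sums of independent copies\<close>

abbreviation (in prob_space) Pow_M :: "nat \<Rightarrow> (nat \<Rightarrow> 'a) measure" where
  "Pow_M k \<equiv> PiM {..<k} (\<lambda>_. M)"

lemma (in prob_space) prob_space_Pow: "prob_space (Pow_M k)"
  by (intro prob_space_PiM prob_space_axioms)

text \<open>Integrating the last coordinate out plays the role of conditional expectation given the
  first \<open>k\<close> coordinates in the inductions that follow.\<close>

lemma (in prob_space) integral_Pow_Suc:
  fixes f :: "_ \<Rightarrow> _::{banach, second_countable_topology}"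
  assumes "integrable (Pow_M (Suc k)) f"
  shows "integral\<^sup>L (Pow_M (Suc k)) f = (\<integral>x. (\<integral>y. f (x(k := y)) \<partial>M) \<partial>Pow_M k)"
proof -
  interpret product_prob_space "\<lambda>_::nat. M" UNIV by unfold_locales
  show ?thesis
    using product_integral_insert[of "{..<k}" k f] assms by (simp add: lessThan_Suc)
qed

lemma (in prob_space) Pow_component:
  fixes f :: "'a \<Rightarrow> real"
  assumes l: "l < k" and f: "f \<in> borel_measurable M"
  shows "integrable (Pow_M k) (\<lambda>x. f (x l)) \<longleftrightarrow> integrable M f" (is ?a)
    and "(\<integral>x. f (x l) \<partial>Pow_M k) = (\<integral>x. f x \<partial>M)" (is ?b)
proof -
  have d: "distr (Pow_M k) M (\<lambda>x. x l) = M"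
    by (rule distr_PiM_component) (use l prob_space_axioms in auto)
  have m: "(\<lambda>x. x l) \<in> measurable (Pow_M k) M" using l by (intro measurable_component_singleton) simp
  show ?a using integrable_distr_eq[OF m f] d by simp
  show ?b using integral_distr[OF m f] d by simp
qed

lemma (in prob_space) space_Pow: "x \<in> space (Pow_M k) \<Longrightarrow> l < k \<Longrightarrow> x l \<in> space M"
  by (auto simp: space_PiM PiE_iff)

lemma (in prob_space) Pow_sum_power2:
  fixes u :: "'a \<Rightarrow> real"
  assumes u: "u \<in> borel_measurable M" "integrable M (\<lambda>x. (u x)\<^sup>2)" "expectation u = 0"
  shows "(\<integral>x. (\<Sum>l<k. u (x l))\<^sup>2 \<partial>Pow_M k) = k * expectation (\<lambda>x. (u x)\<^sup>2)"
proof (induction k)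
  case 0
  then show ?case by simp
next
  case (Suc k)
  interpret Pk: prob_space "Pow_M k" by (rule prob_space_Pow)
  have u1: "integrable M u" by (rule integrable_L2_L1[OF u(1,2)])
  have m: "(\<lambda>x. u (x l)) \<in> borel_measurable (Pow_M n)" if "l < n" for l n
    using that by (intro measurable_compose[OF _ u(1)] measurable_component_singleton) simp
  have i2: "integrable (Pow_M n) (\<lambda>x. (\<Sum>l<n. u (x l))\<^sup>2)" for n
    using u(2) u(1) by (intro integrable_power2_sum m) (auto simp: Pow_component(1)[of _ _ "\<lambda>x. (u x)\<^sup>2"])
  have "(\<integral>x. (\<Sum>l<Suc k. u (x l))\<^sup>2 \<partial>Pow_M (Suc k)) = (\<integral>x. (\<integral>y. ((\<Sum>l<k. u (x l)) + u y)\<^sup>2 \<partial>M) \<partial>Pow_M k)"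
    by (subst integral_Pow_Suc[OF i2]) (simp cong: sum.cong_simp)
  also have "\<dots> = (\<integral>x. (\<Sum>l<k. u (x l))\<^sup>2 + expectation (\<lambda>x. (u x)\<^sup>2) \<partial>Pow_M k)"
    using u u1 by (simp add: power2_sum prob_space)
  also have "\<dots> = (Suc k) * expectation (\<lambda>x. (u x)\<^sup>2)"
    using i2[of k] Suc by (subst Bochner_Integration.integral_add) (simp_all add: Pk.prob_space algebra_simps)
  finally show ?case .
qed

lemma (in prob_space) Pow_sum_mean:
  fixes u :: "'a \<Rightarrow> real"
  assumes u: "u \<in> borel_measurable M" "integrable M u" "expectation u = 0"
  shows "(\<integral>x. (\<Sum>l<k. u (x l)) \<partial>Pow_M k) = 0"
  using u by (subst Bochner_Integration.integral_sum) (auto simp: Pow_component)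

text \<open>In the fourth power of partial sum plus new term, the third moment of \<open>u\<close>
  meets the mean of the partial sum, which is 0, and the middle term gives six times k times the
  squared second moment, at most the fourth moment. The constant 3 closes the induction because
  \<open>3 * k^2 + 6 * k + 1\<close> is below \<open>3 * (k + 1)^2\<close>.\<close>

lemma (in prob_space) Pow_sum_power4:
  fixes u :: "'a \<Rightarrow> real"
  assumes u: "u \<in> borel_measurable M" "integrable M (\<lambda>x. u x ^ 4)" "expectation u = 0"
  shows "(\<integral>x. (\<Sum>l<k. u (x l)) ^ 4 \<partial>Pow_M k) \<le> 3 * (real k)\<^sup>2 * expectation (\<lambda>x. u x ^ 4)"
proof (induction k)
  case 0
  then show ?case by simp
next
  case (Suc k)
  interpret Pk: prob_space "Pow_M k" by (rule prob_space_Pow)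
  have u2: "integrable M (\<lambda>x. (u x)\<^sup>2)" by (rule integrable_L4_L2[OF u(1,2)])
  have u3: "integrable M (\<lambda>x. u x ^ 3)" by (rule integrable_L4_L3[OF u(1,2)])
  have u1: "integrable M u" by (rule integrable_L2_L1[OF u(1) u2])
  have m: "(\<lambda>x. u (x l)) \<in> borel_measurable (Pow_M n)" if "l < n" for l n
    using that by (intro measurable_compose[OF _ u(1)] measurable_component_singleton) simp
  have i4: "integrable (Pow_M n) (\<lambda>x. (\<Sum>l<n. u (x l)) ^ 4)" for n
    using u(2) u(1) by (intro integrable_power4_sum m) (auto simp: Pow_component(1)[of _ _ "\<lambda>x. u x ^ 4"])
  let ?s = "\<lambda>x. \<Sum>l<k. u (x l)"
  have sm: "?s \<in> borel_measurable (Pow_M k)" using m by simp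
  have s2: "integrable (Pow_M k) (\<lambda>x. (?s x)\<^sup>2)" by (rule Pk.integrable_L4_L2[OF sm i4])
  have s1: "integrable (Pow_M k) ?s" by (rule Pk.integrable_L2_L1[OF sm s2])
  let ?m2 = "expectation (\<lambda>x. (u x)\<^sup>2)" and ?m3 = "expectation (\<lambda>x. u x ^ 3)" and ?m4 = "expectation (\<lambda>x. u x ^ 4)"
  have ex: "(a + b) ^ 4 = a ^ 4 + 4 * a ^ 3 * b + 6 * a\<^sup>2 * b\<^sup>2 + 4 * a * b ^ 3 + b ^ 4" for a b :: real
    by (simp add: power4_eq_xxxx power3_eq_cube power2_eq_square algebra_simps)
  have "(\<integral>x. (\<Sum>l<Suc k. u (x l)) ^ 4 \<partial>Pow_M (Suc k)) = (\<integral>x. (\<integral>y. (?s x + u y) ^ 4 \<partial>M) \<partial>Pow_M k)"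
    by (subst integral_Pow_Suc[OF i4]) (simp cong: sum.cong_simp)
  also have "\<dots> = (\<integral>x. (?s x) ^ 4 + 6 * ?m2 * (?s x)\<^sup>2 + 4 * ?m3 * ?s x + ?m4 \<partial>Pow_M k)"
    unfolding ex using u u1 u2 u3 by (simp add: prob_space algebra_simps)
  also have "\<dots> = (\<integral>x. (?s x) ^ 4 \<partial>Pow_M k) + 6 * ?m2 * (real k * ?m2) + ?m4"
    using i4[of k] s2 s1 Pow_sum_mean[OF u(1) u1 u(3)] Pow_sum_power2[OF u(1) u2 u(3)]
    by (simp add: Pk.prob_space)
  also have "\<dots> \<le> 3 * (real k)\<^sup>2 * ?m4 + 6 * real k * ?m4 + ?m4"
  proof -
    have "?m2\<^sup>2 \<le> ?m4" using expectation_power2_le[of "\<lambda>x. (u x)\<^sup>2"] u by simp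
    then have "6 * real k * ?m2\<^sup>2 \<le> 6 * real k * ?m4" by (intro mult_left_mono) auto
    then show ?thesis using Suc by (simp add: power2_eq_square mult_ac)
  qed
  also have "\<dots> \<le> 3 * (real (Suc k))\<^sup>2 * ?m4"
  proof -
    have "0 \<le> ?m4" by simp
    moreover have "3 * (real (Suc k))\<^sup>2 * ?m4 = 3 * (real k)\<^sup>2 * ?m4 + 6 * real k * ?m4 + 3 * ?m4"
      by (simp add: power2_eq_square algebra_simps)
    ultimately show ?thesis by linarith
  qed
  finally show ?case .
qed

section \<open>Degenerate kernels and the squares of their operators\<close>

lemma (in prob_space) pair_fst:
  fixes f :: "'b \<Rightarrow> real"
  assumes N: "prob_space N" and f: "f \<in> borel_measurable N"
  shows "integrable (N \<Otimes>\<^sub>M M) (\<lambda>p. f (fst p)) \<longleftrightarrow> integrable N f"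
proof -
  have d: "distr (N \<Otimes>\<^sub>M M) N fst = N" by (rule distr_pair_fst)
  show ?thesis using integrable_distr_eq[OF measurable_fst f, of M] d by simp
qed

lemma (in prob_space) pair_snd:
  fixes f :: "'a \<Rightarrow> real"
  assumes N: "prob_space N" and f: "f \<in> borel_measurable M"
  shows "integrable (N \<Otimes>\<^sub>M M) (\<lambda>p. f (snd p)) \<longleftrightarrow> integrable M f"
proof -
  note M = prob_space_axioms
  interpret N: prob_space N by fact
  interpret pair_prob_space N M ..
  have "integrable (N \<Otimes>\<^sub>M M) (\<lambda>p. f (snd p)) \<longleftrightarrow> integrable (M \<Otimes>\<^sub>M N) (\<lambda>p. f (fst p))"
    using integrable_product_swap_iff[of "\<lambda>p. f (snd p)"] by (simp add: case_prod_unfold)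
  then show ?thesis using N.pair_fst[OF M f] by simp
qed

text \<open>Data of a second-order Hoeffding decomposition: linear part \<open>h\<close>, symmetric
  degenerate part \<open>H\<close>. The conditions on the sections of \<open>H\<close> hold at every
  point, not merely almost everywhere, because the inner integrals are evaluated along a fixed
  realisation of the past.\<close>

locale ustat_kernel = prob_space M for M :: "'a measure" +
  fixes H :: "'a \<Rightarrow> 'a \<Rightarrow> real" and h :: "'a \<Rightarrow> real"
  assumes H_meas: "(\<lambda>p. H (fst p) (snd p)) \<in> borel_measurable (M \<Otimes>\<^sub>M M)"
    and H_sym: "\<And>x y. H x y = H y x"
    and H_mean: "\<And>x. x \<in> space M \<Longrightarrow> (\<integral>y. H x y \<partial>M) = 0"
    and H_int: "\<And>x. x \<in> space M \<Longrightarrow> integrable M (\<lambda>y. H x y ^ 4)"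
    and H_int_pair: "integrable (M \<Otimes>\<^sub>M M) (\<lambda>p. H (fst p) (snd p) ^ 4)"
    and h_meas: "h \<in> borel_measurable M"
    and h_int: "integrable M (\<lambda>x. h x ^ 4)"
    and h_mean: "(\<integral>x. h x \<partial>M) = 0"

text \<open>For the integral operator with kernel \<open>H\<close>: \<open>G\<close> is the kernel
  of its square, \<open>A\<close> the diagonal of \<open>G\<close>, \<open>g\<close> the image of
  \<open>h\<close>, and \<open>Gsq\<close> the squared Hilbert--Schmidt norm of the square. The
  conditional variances of the martingale are made of \<open>A\<close>, \<open>G\<close> and
  \<open>g\<close>.\<close>

definition (in ustat_kernel) "A x = (\<integral>y. (H x y)\<^sup>2 \<partial>M)"
definition (in ustat_kernel) "G x y = (\<integral>z. H x z * H y z \<partial>M)"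
definition (in ustat_kernel) "g x = (\<integral>z. h z * H x z \<partial>M)"
definition (in ustat_kernel) "H2 = (\<integral>x. (\<integral>y. (H x y)\<^sup>2 \<partial>M) \<partial>M)"
definition (in ustat_kernel) "H4 = (\<integral>x. (\<integral>y. H x y ^ 4 \<partial>M) \<partial>M)"
definition (in ustat_kernel) "Gsq = (\<integral>x. (\<integral>y. (G x y)\<^sup>2 \<partial>M) \<partial>M)"
definition (in ustat_kernel) "h2 = (\<integral>x. (h x)\<^sup>2 \<partial>M)"
definition (in ustat_kernel) "h4 = (\<integral>x. h x ^ 4 \<partial>M)"

lemma (in ustat_kernel) H_comp [measurable (raw)]:
  assumes "a \<in> measurable N M" "b \<in> measurable N M"
  shows "(\<lambda>w. H (a w) (b w)) \<in> borel_measurable N"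
  using measurable_compose[OF measurable_Pair[OF assms] H_meas] by simp

lemma (in ustat_kernel) H_comp1:
  assumes "x \<in> space M"
  shows "(\<lambda>y. H x y) \<in> borel_measurable M"
  by (rule H_comp) (use assms in auto)

lemma (in ustat_kernel) H_int2: "x \<in> space M \<Longrightarrow> integrable M (\<lambda>y. (H x y)\<^sup>2)"
  by (rule integrable_L4_L2[OF H_comp1 H_int])

lemma (in ustat_kernel) H_int1: "x \<in> space M \<Longrightarrow> integrable M (\<lambda>y. H x y)"
  by (rule integrable_L2_L1[OF H_comp1 H_int2])

lemma (in ustat_kernel) h_int2: "integrable M (\<lambda>x. (h x)\<^sup>2)"
  by (rule integrable_L4_L2[OF h_meas h_int])

lemma (in ustat_kernel) h_int1: "integrable M h"
  by (rule integrable_L2_L1[OF h_meas h_int2])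

lemma (in ustat_kernel) A_comp [measurable (raw)]:
  assumes "a \<in> measurable N M"
  shows "(\<lambda>w. A (a w)) \<in> borel_measurable N"
  unfolding A_def
proof (rule borel_measurable_lebesgue_integral)
  have "(\<lambda>p. H (a (fst p)) (snd p)) \<in> borel_measurable (N \<Otimes>\<^sub>M M)"
    by (intro H_comp measurable_compose[OF measurable_fst assms] measurable_snd)
  then show "(\<lambda>(w, y). (H (a w) y)\<^sup>2) \<in> borel_measurable (N \<Otimes>\<^sub>M M)"
    by (simp add: case_prod_unfold)
qed

lemma (in ustat_kernel) A_meas: "A \<in> borel_measurable M"
  using A_comp[of "\<lambda>x. x" M] by simp

lemma (in ustat_kernel) G_comp [measurable (raw)]:
  assumes "a \<in> measurable N M" "b \<in> measurable N M"
  shows "(\<lambda>w. G (a w) (b w)) \<in> borel_measurable N"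
  unfolding G_def
proof (rule borel_measurable_lebesgue_integral)
  have "(\<lambda>p. H (a (fst p)) (snd p) * H (b (fst p)) (snd p)) \<in> borel_measurable (N \<Otimes>\<^sub>M M)"
    by (intro borel_measurable_times H_comp measurable_compose[OF measurable_fst assms(1)]
        measurable_compose[OF measurable_fst assms(2)] measurable_snd)
  then show "(\<lambda>(w, y). H (a w) y * H (b w) y) \<in> borel_measurable (N \<Otimes>\<^sub>M M)"
    by (simp add: case_prod_unfold)
qed

lemma (in ustat_kernel) G_comp1: "y \<in> space M \<Longrightarrow> (\<lambda>x. G x y) \<in> borel_measurable M"
  by (rule G_comp) auto

lemma (in ustat_kernel) g_meas: "g \<in> borel_measurable M"
proof -
  have "(\<lambda>p. h (snd p) * H (fst p) (snd p)) \<in> borel_measurable (M \<Otimes>\<^sub>M M)"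
    by (intro borel_measurable_times H_meas measurable_compose[OF measurable_snd h_meas])
  then show ?thesis
    unfolding g_def by (intro borel_measurable_lebesgue_integral) (simp add: case_prod_unfold)
qed

lemma (in ustat_kernel) A_nonneg: "A x \<ge> 0"
  by (simp add: A_def)

lemma (in ustat_kernel) A_power2_le: "x \<in> space M \<Longrightarrow> (A x)\<^sup>2 \<le> (\<integral>y. H x y ^ 4 \<partial>M)"
  using expectation_power2_le[of "\<lambda>y. (H x y)\<^sup>2"] H_comp1[of x] H_int[of x] by (simp add: A_def)

lemma (in ustat_kernel) H4_int: "integrable M (\<lambda>x. \<integral>y. H x y ^ 4 \<partial>M)"
proof -
  interpret pair_prob_space M M ..
  show ?thesis using integrable_fst'[OF H_int_pair] by simp
qed

lemma (in ustat_kernel) A_int2: "integrable M (\<lambda>x. (A x)\<^sup>2)"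
  by (rule Bochner_Integration.integrable_bound[OF H4_int])
    (use A_meas A_power2_le in \<open>auto intro!: AE_I2\<close>)

lemma (in ustat_kernel) A_int1: "integrable M A"
  by (rule integrable_L2_L1[OF A_meas A_int2])

lemma (in ustat_kernel) A2_le: "(\<integral>x. (A x)\<^sup>2 \<partial>M) \<le> H4"
  unfolding H4_def by (intro integral_mono A_int2 H4_int A_power2_le)

lemma (in ustat_kernel) A_mean: "(\<integral>x. A x \<partial>M) = H2"
  by (simp add: A_def H2_def)

lemma (in ustat_kernel) HH_int:
  "x \<in> space M \<Longrightarrow> y \<in> space M \<Longrightarrow> integrable M (\<lambda>z. H x z * H y z)"
  by (intro integrable_mult_L2 H_comp1 H_int2)

lemma (in ustat_kernel) hH_int: "x \<in> space M \<Longrightarrow> integrable M (\<lambda>z. h z * H x z)"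
  by (intro integrable_mult_L2 H_comp1 H_int2 h_meas h_int2)

lemma (in ustat_kernel) G_diag: "G x x = A x"
  by (simp add: G_def A_def power2_eq_square)

lemma (in ustat_kernel) G_sym: "G x y = G y x"
  by (simp add: G_def mult.commute)

text \<open>Cauchy--Schwarz bounds the left side by \<open>A x * A y\<close>. Passing to the
  arithmetic mean separates the variables, so integrability of the square of \<open>G\<close> on any
  product reduces to that of the square of \<open>A\<close>.\<close>

lemma (in ustat_kernel) G_power2_le:
  assumes "x \<in> space M" "y \<in> space M"
  shows "(G x y)\<^sup>2 \<le> ((A x)\<^sup>2 + (A y)\<^sup>2) / 2"
proof -
  have "(G x y)\<^sup>2 \<le> (sqrt (A x) * sqrt (A y))\<^sup>2"
  proof -
    have "G x y \<le> sqrt (A x) * sqrt (A y)"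
      using expectation_mult_le_sqrt[OF H_comp1[OF assms(1)] H_comp1[OF assms(2)] H_int2[OF assms(1)] H_int2[OF assms(2)]]
      by (simp add: G_def A_def)
    moreover have "- G x y \<le> sqrt (A x) * sqrt (A y)"
      using expectation_mult_le_sqrt[OF borel_measurable_uminus[OF H_comp1[OF assms(1)]] H_comp1[OF assms(2)]] H_int2[OF assms(1)] H_int2[OF assms(2)]
      by (simp add: G_def A_def)
    ultimately show ?thesis by (intro abs_le_square_iff[THEN iffD1]) (auto simp: abs_le_iff A_nonneg)
  qed
  also have "\<dots> = A x * A y" by (simp add: power_mult_distrib A_nonneg)
  also have "\<dots> \<le> ((A x)\<^sup>2 + (A y)\<^sup>2) / 2" using sum_squares_bound[of "A x" "A y"] by simp
  finally show ?thesis .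
qed

lemma (in ustat_kernel) G_int2: "y \<in> space M \<Longrightarrow> integrable M (\<lambda>x. (G x y)\<^sup>2)"
proof (rule Bochner_Integration.integrable_bound)
  show "integrable M (\<lambda>x. ((A x)\<^sup>2 + (A y)\<^sup>2) / 2)" using A_int2 by simp
  assume y: "y \<in> space M"
  then show "(\<lambda>x. (G x y)\<^sup>2) \<in> borel_measurable M" using G_comp1 by simp
  show "AE x in M. norm ((G x y)\<^sup>2) \<le> norm (((A x)\<^sup>2 + (A y)\<^sup>2) / 2)"
    using G_power2_le y by (intro AE_I2) simp
qed

lemma (in ustat_kernel) G_int2_pair:
  assumes N: "prob_space N" and a: "a \<in> measurable N M" "integrable N (\<lambda>x. (A (a x))\<^sup>2)"
  shows "integrable (N \<Otimes>\<^sub>M M) (\<lambda>p. (G (a (fst p)) (snd p))\<^sup>2)"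
proof (rule Bochner_Integration.integrable_bound)
  show "integrable (N \<Otimes>\<^sub>M M) (\<lambda>p. ((A (a (fst p)))\<^sup>2 + (A (snd p))\<^sup>2) / 2)"
    using pair_fst[OF N, of "\<lambda>x. (A (a x))\<^sup>2"] pair_snd[OF N, of "\<lambda>x. (A x)\<^sup>2"] a A_int2 A_meas A_comp[OF a(1)] by simp
  have "(\<lambda>p. G (a (fst p)) (snd p)) \<in> borel_measurable (N \<Otimes>\<^sub>M M)"
    by (intro G_comp measurable_compose[OF measurable_fst a(1)] measurable_snd)
  then show "(\<lambda>p. (G (a (fst p)) (snd p))\<^sup>2) \<in> borel_measurable (N \<Otimes>\<^sub>M M)" by simp
  show "AE p in N \<Otimes>\<^sub>M M. norm ((G (a (fst p)) (snd p))\<^sup>2) \<le> norm (((A (a (fst p)))\<^sup>2 + (A (snd p))\<^sup>2) / 2)"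
  proof (intro AE_I2)
    fix p assume "p \<in> space (N \<Otimes>\<^sub>M M)"
    then have "a (fst p) \<in> space M" "snd p \<in> space M"
      using a(1)[THEN measurable_space] by (auto simp: space_pair_measure)
    from G_power2_le[OF this] show "norm ((G (a (fst p)) (snd p))\<^sup>2) \<le> norm (((A (a (fst p)))\<^sup>2 + (A (snd p))\<^sup>2) / 2)"
      by simp
  qed
qed

lemma (in ustat_kernel) H_int4_pair:
  assumes N: "prob_space N" and a: "a \<in> measurable N M" "integrable N (\<lambda>x. \<integral>y. H (a x) y ^ 4 \<partial>M)"
  shows "integrable (N \<Otimes>\<^sub>M M) (\<lambda>p. H (a (fst p)) (snd p) ^ 4)"
proof -
  interpret N: prob_space N by fact
  interpret pair_prob_space N M ..
  have m: "(\<lambda>p. H (a (fst p)) (snd p)) \<in> borel_measurable (N \<Otimes>\<^sub>M M)"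
    by (intro H_comp measurable_compose[OF measurable_fst a(1)] measurable_snd)
  show ?thesis
  proof (rule Fubini_integrable)
    show "(\<lambda>p. H (a (fst p)) (snd p) ^ 4) \<in> borel_measurable (N \<Otimes>\<^sub>M M)" using m by simp
    show "integrable N (\<lambda>x. \<integral>y. norm (H (a (fst (x, y))) (snd (x, y)) ^ 4) \<partial>M)" using a(2) by simp
    show "AE x in N. integrable M (\<lambda>y. H (a (fst (x, y))) (snd (x, y)) ^ 4)"
      using a(1)[THEN measurable_space] H_int by (intro AE_I2) auto
  qed
qed

lemma (in ustat_kernel) H_int2_pair: "integrable (M \<Otimes>\<^sub>M M) (\<lambda>p. (H (fst p) (snd p))\<^sup>2)"
proof -
  interpret pair_prob_space M M ..
  show ?thesis by (rule integrable_L4_L2[OF H_meas H_int_pair])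
qed

text \<open>Self-adjointness of the integral operator.\<close>

lemma (in ustat_kernel) Fubini_H:
  assumes a: "a \<in> borel_measurable M" "integrable M (\<lambda>x. (a x)\<^sup>2)" and b: "b \<in> borel_measurable M" "integrable M (\<lambda>x. (b x)\<^sup>2)"
  shows "(\<integral>x. a x * (\<integral>y. b y * H x y \<partial>M) \<partial>M) = (\<integral>y. b y * (\<integral>x. a x * H y x \<partial>M) \<partial>M)"
proof -
  interpret pair_prob_space M M ..
  have m: "(\<lambda>p. a (fst p) * b (snd p)) \<in> borel_measurable (M \<Otimes>\<^sub>M M)"
    by (intro borel_measurable_times measurable_compose[OF measurable_fst a(1)] measurable_compose[OF measurable_snd b(1)])
  have ab: "integrable (M \<Otimes>\<^sub>M M) (\<lambda>p. (a (fst p) * b (snd p))\<^sup>2)"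
  proof (rule Fubini_integrable)
    show "integrable M (\<lambda>x. \<integral>y. norm ((a (fst (x, y)) * b (snd (x, y)))\<^sup>2) \<partial>M)"
      using a(2) by (simp add: power_mult_distrib)
    show "AE x in M. integrable M (\<lambda>y. (a (fst (x, y)) * b (snd (x, y)))\<^sup>2)"
      using b(2) by (simp add: power_mult_distrib)
  qed (use m in simp)
  have "integrable (M \<Otimes>\<^sub>M M) (\<lambda>p. (a (fst p) * b (snd p)) * H (fst p) (snd p))"
    by (rule integrable_mult_L2[OF m H_meas ab H_int2_pair])
  then have i: "integrable (M \<Otimes>\<^sub>M M) (case_prod (\<lambda>x y. a x * b y * H x y))"
    by (simp add: case_prod_unfold)
  have "(\<integral>x. a x * (\<integral>y. b y * H x y \<partial>M) \<partial>M) = (\<integral>x. (\<integral>y. a x * b y * H x y \<partial>M) \<partial>M)"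
    by (simp add: mult.assoc flip: integral_mult_right_zero)
  also have "\<dots> = (\<integral>y. (\<integral>x. a x * b y * H x y \<partial>M) \<partial>M)" by (rule Fubini_integral[OF i, symmetric])
  also have "\<dots> = (\<integral>y. b y * (\<integral>x. a x * H y x \<partial>M) \<partial>M)"
    by (simp add: mult.assoc mult.left_commute H_sym flip: integral_mult_right_zero)
  finally show ?thesis .
qed

text \<open>Applying the operator twice is the operator with kernel \<open>G\<close>;
  self-adjointness is used with a section of \<open>H\<close> as test function.\<close>

lemma (in ustat_kernel) H_H_integral:
  assumes b: "b \<in> borel_measurable M" "integrable M (\<lambda>x. (b x)\<^sup>2)" and u: "u \<in> space M"
  shows "(\<integral>y. H u y * (\<integral>v. b v * H y v \<partial>M) \<partial>M) = (\<integral>v. b v * G u v \<partial>M)"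
  using Fubini_H[OF H_comp1[OF u] H_int2[OF u] b] by (simp add: G_def H_sym mult.commute)

text \<open>Degeneracy says that the operator annihilates constants, and so does its square.\<close>

lemma (in ustat_kernel) G_mean:
  assumes u: "u \<in> space M"
  shows "(\<integral>v. G v u \<partial>M) = 0"
proof -
  have "(\<integral>v. 1 * G u v \<partial>M) = (\<integral>y. H u y * (\<integral>v. 1 * H y v \<partial>M) \<partial>M)"
    by (rule H_H_integral[OF _ _ u, symmetric]) auto
  also have "\<dots> = 0" using H_mean by (auto intro!: integral_eq_zero_AE AE_I2)
  finally show ?thesis by (simp add: G_sym)
qed

lemma (in ustat_kernel) g_power2_le: "x \<in> space M \<Longrightarrow> (g x)\<^sup>2 \<le> h2 * A x"
proof -
  assume x: "x \<in> space M"
  have "g x \<le> sqrt h2 * sqrt (A x)"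
    using expectation_mult_le_sqrt[OF h_meas H_comp1[OF x] h_int2 H_int2[OF x]] by (simp add: g_def h2_def A_def)
  moreover have "- g x \<le> sqrt h2 * sqrt (A x)"
    using expectation_mult_le_sqrt[OF borel_measurable_uminus[OF h_meas] H_comp1[OF x]] h_int2 H_int2[OF x]
    by (simp add: g_def h2_def A_def)
  ultimately have "(g x)\<^sup>2 \<le> (sqrt h2 * sqrt (A x))\<^sup>2"
    by (intro abs_le_square_iff[THEN iffD1]) (auto simp: abs_le_iff A_nonneg h2_def)
  then show ?thesis by (simp add: power_mult_distrib A_nonneg h2_def)
qed

lemma (in ustat_kernel) g_int2: "integrable M (\<lambda>x. (g x)\<^sup>2)"
proof (rule Bochner_Integration.integrable_bound)
  show "integrable M (\<lambda>x. h2 * A x)" using A_int1 by simp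
  show "AE x in M. norm ((g x)\<^sup>2) \<le> norm (h2 * A x)" using g_power2_le A_nonneg by (intro AE_I2) (simp add: h2_def)
qed (use g_meas in simp)

lemma (in ustat_kernel) g_mean: "(\<integral>x. g x \<partial>M) = 0"
proof -
  have "(\<integral>x. 1 * (\<integral>y. h y * H x y \<partial>M) \<partial>M) = (\<integral>y. h y * (\<integral>x. 1 * H y x \<partial>M) \<partial>M)"
    by (rule Fubini_H) (use h_meas h_int2 in auto)
  also have "\<dots> = 0" using H_mean by (auto intro!: integral_eq_zero_AE AE_I2)
  finally show ?thesis by (simp add: g_def)
qed

lemma (in ustat_kernel) Gsq_eq: "Gsq = (\<integral>p. (G (fst p) (snd p))\<^sup>2 \<partial>(M \<Otimes>\<^sub>M M))"
proof -
  note M = prob_space_axioms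
  interpret pair_prob_space M M ..
  show ?thesis unfolding Gsq_def
    using integral_fst'[OF G_int2_pair[OF M measurable_ident_sets[OF refl]]] A_int2 by simp
qed

lemma (in ustat_kernel) Gsq_nonneg: "Gsq \<ge> 0" by (simp add: Gsq_eq)

text \<open>With \<open>K\<close> the integral operator of kernel \<open>H\<close>, this is \<open>\<parallel>K h\<parallel>\<^sup>2 = \<langle>h, K\<^sup>2 h\<rangle> \<le> \<parallel>h\<parallel>\<^sup>2 \<parallel>K\<^sup>2\<parallel>\<^sub>H\<^sub>S\<close>.\<close>

lemma (in ustat_kernel) g2_le: "(\<integral>x. (g x)\<^sup>2 \<partial>M) \<le> h2 * sqrt Gsq"
proof -
  note M = prob_space_axioms
  interpret pair_prob_space M M ..
  have hh_m: "(\<lambda>p. h (fst p) * h (snd p)) \<in> borel_measurable (M \<Otimes>\<^sub>M M)"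
    by (intro borel_measurable_times measurable_compose[OF measurable_fst h_meas] measurable_compose[OF measurable_snd h_meas])
  have G_m: "(\<lambda>p. G (fst p) (snd p)) \<in> borel_measurable (M \<Otimes>\<^sub>M M)"
    by (intro G_comp measurable_fst measurable_snd)
  have G_i: "integrable (M \<Otimes>\<^sub>M M) (\<lambda>p. (G (fst p) (snd p))\<^sup>2)"
    using G_int2_pair[OF M measurable_ident_sets[OF refl]] A_int2 by simp
  have hh_i: "integrable (M \<Otimes>\<^sub>M M) (\<lambda>p. (h (fst p) * h (snd p))\<^sup>2)"
  proof (rule Fubini_integrable)
    show "integrable M (\<lambda>x. \<integral>y. norm ((h (fst (x, y)) * h (snd (x, y)))\<^sup>2) \<partial>M)"
      using h_int2 by (simp add: power_mult_distrib)
    show "AE x in M. integrable M (\<lambda>y. (h (fst (x, y)) * h (snd (x, y)))\<^sup>2)"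
      using h_int2 by (simp add: power_mult_distrib)
  qed (use hh_m in simp)
  have "(\<integral>x. (g x)\<^sup>2 \<partial>M) = (\<integral>x. g x * (\<integral>y. h y * H x y \<partial>M) \<partial>M)"
    by (simp add: g_def power2_eq_square)
  also have "\<dots> = (\<integral>y. h y * (\<integral>x. g x * H y x \<partial>M) \<partial>M)"
    by (rule Fubini_H[OF g_meas g_int2 h_meas h_int2])
  also have "\<dots> = (\<integral>y. h y * (\<integral>v. h v * G y v \<partial>M) \<partial>M)"
    using H_H_integral[OF h_meas h_int2]
    by (intro Bochner_Integration.integral_cong) (simp_all add: g_def mult.commute)
  also have "\<dots> = (\<integral>y. (\<integral>v. h y * h v * G y v \<partial>M) \<partial>M)"
    by (simp add: mult.assoc flip: integral_mult_right_zero)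
  also have "\<dots> = (\<integral>p. (h (fst p) * h (snd p)) * G (fst p) (snd p) \<partial>(M \<Otimes>\<^sub>M M))"
    using integral_fst'[OF integrable_mult_L2[OF hh_m G_m hh_i G_i]] by simp
  also have "\<dots> \<le> sqrt (\<integral>p. (h (fst p) * h (snd p))\<^sup>2 \<partial>(M \<Otimes>\<^sub>M M)) * sqrt (\<integral>p. (G (fst p) (snd p))\<^sup>2 \<partial>(M \<Otimes>\<^sub>M M))"
    by (rule expectation_mult_le_sqrt[OF hh_m G_m hh_i G_i])
  also have "(\<integral>p. (h (fst p) * h (snd p))\<^sup>2 \<partial>(M \<Otimes>\<^sub>M M)) = h2\<^sup>2"
  proof -
    have "(\<integral>p. (h (fst p) * h (snd p))\<^sup>2 \<partial>(M \<Otimes>\<^sub>M M)) = (\<integral>x. (\<integral>y. (h x)\<^sup>2 * (h y)\<^sup>2 \<partial>M) \<partial>M)"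
      using integral_fst'[OF hh_i, symmetric] by (simp add: power_mult_distrib)
    also have "\<dots> = h2 * h2" by (simp add: h2_def)
    finally show ?thesis by (simp add: power2_eq_square)
  qed
  finally show ?thesis by (simp add: Gsq_eq h2_def)
qed

section \<open>Conditional variance and fourth moment of the martingale increments\<close>

lemma abs_diff_perturb:
  fixes v s e r :: real
  assumes "\<bar>1 - s / 2 - e\<bar> \<le> r"
  shows "\<bar>1 - v / 2 - e\<bar> \<le> \<bar>v - s\<bar> / 2 + r"
  using assms by argo

lemma error_sum_mono:
  fixes u w w' a b c d t :: real
  assumes "w \<le> w'" "d \<le> 2 * a + b + 2 * c"
  shows "(u + w) / 12 + d / 2 + t \<le> (u + w') / 12 + (a + b / 2 + c) + t"
  using assms by argo

lemma sum_symmetric_square: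
  fixes f :: "nat \<Rightarrow> nat \<Rightarrow> real"
  assumes "\<And>l m. f l m = f m l"
  shows "(\<Sum>l<k. \<Sum>m<k. f l m) = (\<Sum>l<k. f l l) + 2 * (\<Sum>l<k. \<Sum>m<l. f m l)"
proof (induction k)
  case (Suc k)
  have "(\<Sum>m<k. f k m) = (\<Sum>m<k. f m k)" by (intro sum.cong refl assms)
  then show ?case using Suc by (simp add: sum.distrib)
qed simp

lemma (in ustat_kernel) Pow_comp_measurable: "l < n \<Longrightarrow> (\<lambda>x. x l) \<in> measurable (Pow_M n) M"
  by (intro measurable_component_singleton) simp

lemma (in ustat_kernel) increment_power4_int:
  assumes x: "x \<in> space (Pow_M k)"
  shows "(\<lambda>y. h y + (\<Sum>l<k. H (x l) y)) \<in> borel_measurable M"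
    "integrable M (\<lambda>y. (h y + (\<Sum>l<k. H (x l) y)) ^ 4)"
proof -
  have m: "(\<lambda>y. \<Sum>l<k. H (x l) y) \<in> borel_measurable M"
    using space_Pow[OF x] by (intro borel_measurable_sum H_comp1) simp
  show "(\<lambda>y. h y + (\<Sum>l<k. H (x l) y)) \<in> borel_measurable M" using m h_meas by simp
  show "integrable M (\<lambda>y. (h y + (\<Sum>l<k. H (x l) y)) ^ 4)"
    using space_Pow[OF x]
    by (intro integrable_power4_add h_meas m h_int integrable_power4_sum H_comp1 H_int) auto
qed

lemma (in ustat_kernel) increment_mean:
  assumes x: "x \<in> space (Pow_M k)"
  shows "(\<integral>y. h y + (\<Sum>l<k. H (x l) y) \<partial>M) = 0"
proof -
  have "(\<integral>y. h y + (\<Sum>l<k. H (x l) y) \<partial>M) = (\<integral>y. h y \<partial>M) + (\<Sum>l<k. \<integral>y. H (x l) y \<partial>M)"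
    using space_Pow[OF x] H_int1 h_int1
    by (subst Bochner_Integration.integral_add) (auto intro!: Bochner_Integration.integral_sum Bochner_Integration.integrable_sum)
  then show ?thesis using space_Pow[OF x] H_mean h_mean by simp
qed

text \<open>Squaring the increment and integrating in the new variable turns products of
  \<open>h\<close> and \<open>H\<close> into \<open>g\<close> and products of two sections of
  \<open>H\<close> into \<open>G\<close>, whose diagonal is \<open>A\<close>. Only \<open>h2\<close>
  is deterministic; the rest is studied as a function of the past.\<close>

lemma (in ustat_kernel) increment_variance:
  assumes x: "x \<in> space (Pow_M k)"
  shows "(\<integral>y. (h y + (\<Sum>l<k. H (x l) y))\<^sup>2 \<partial>M) =
    h2 + 2 * (\<Sum>l<k. g (x l)) + (\<Sum>l<k. A (x l)) + 2 * (\<Sum>l<k. \<Sum>m<l. G (x m) (x l))"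
proof -
  have sp: "x l \<in> space M" if "l < k" for l using space_Pow[OF x that] .
  have 1: "integrable M (\<lambda>y. 2 * (\<Sum>l<k. h y * H (x l) y))"
    using sp by (intro integrable_mult_right Bochner_Integration.integrable_sum hH_int) auto
  have 2: "integrable M (\<lambda>y. \<Sum>l<k. \<Sum>m<k. H (x l) y * H (x m) y)"
    using sp by (intro Bochner_Integration.integrable_sum HH_int) auto
  have "(\<integral>y. (h y + (\<Sum>l<k. H (x l) y))\<^sup>2 \<partial>M) =
    (\<integral>y. (h y)\<^sup>2 + 2 * (\<Sum>l<k. h y * H (x l) y) + (\<Sum>l<k. \<Sum>m<k. H (x l) y * H (x m) y) \<partial>M)"
  proof (intro Bochner_Integration.integral_cong refl)
    fix y
    have "(h y + (\<Sum>l<k. H (x l) y))\<^sup>2 = (h y)\<^sup>2 + 2 * (h y * (\<Sum>l<k. H (x l) y)) + (\<Sum>l<k. H (x l) y) * (\<Sum>m<k. H (x m) y)"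
      by (simp add: power2_eq_square algebra_simps)
    then show "(h y + (\<Sum>l<k. H (x l) y))\<^sup>2 = (h y)\<^sup>2 + 2 * (\<Sum>l<k. h y * H (x l) y) + (\<Sum>l<k. \<Sum>m<k. H (x l) y * H (x m) y)"
      unfolding sum_product sum_distrib_left[of "h y"] .
  qed
  also have "\<dots> = h2 + 2 * (\<Sum>l<k. \<integral>y. h y * H (x l) y \<partial>M) + (\<Sum>l<k. \<Sum>m<k. \<integral>y. H (x l) y * H (x m) y \<partial>M)"
  proof -
    have "(\<integral>y. (h y)\<^sup>2 + 2 * (\<Sum>l<k. h y * H (x l) y) + (\<Sum>l<k. \<Sum>m<k. H (x l) y * H (x m) y) \<partial>M)
      = (\<integral>y. (h y)\<^sup>2 \<partial>M) + (\<integral>y. 2 * (\<Sum>l<k. h y * H (x l) y) \<partial>M) + (\<integral>y. (\<Sum>l<k. \<Sum>m<k. H (x l) y * H (x m) y) \<partial>M)"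
      using h_int2 1 2 by simp
    also have "(\<integral>y. 2 * (\<Sum>l<k. h y * H (x l) y) \<partial>M) = 2 * (\<Sum>l<k. \<integral>y. h y * H (x l) y \<partial>M)"
      using sp hH_int by (subst integral_mult_right_zero) (simp add: Bochner_Integration.integral_sum)
    also have "(\<integral>y. (\<Sum>l<k. \<Sum>m<k. H (x l) y * H (x m) y) \<partial>M) = (\<Sum>l<k. \<Sum>m<k. \<integral>y. H (x l) y * H (x m) y \<partial>M)"
    proof -
      have "(\<integral>y. (\<Sum>l<k. \<Sum>m<k. H (x l) y * H (x m) y) \<partial>M) = (\<Sum>l<k. \<integral>y. (\<Sum>m<k. H (x l) y * H (x m) y) \<partial>M)"
        by (intro Bochner_Integration.integral_sum Bochner_Integration.integrable_sum HH_int sp) auto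
      also have "\<dots> = (\<Sum>l<k. \<Sum>m<k. \<integral>y. H (x l) y * H (x m) y \<partial>M)"
        by (intro sum.cong refl Bochner_Integration.integral_sum HH_int sp) auto
      finally show ?thesis .
    qed
    finally show ?thesis by (simp add: h2_def)
  qed
  also have "\<dots> = h2 + 2 * (\<Sum>l<k. g (x l)) + (\<Sum>l<k. \<Sum>m<k. G (x l) (x m))"
    by (simp add: g_def G_def)
  also have "(\<Sum>l<k. \<Sum>m<k. G (x l) (x m)) = (\<Sum>l<k. A (x l)) + 2 * (\<Sum>l<k. \<Sum>m<l. G (x m) (x l))"
    by (subst sum_symmetric_square) (auto simp: G_diag G_sym)
  finally show ?thesis by simp
qed

lemma (in ustat_kernel) G_sum_int2:
  "integrable (Pow_M n) (\<lambda>x. (G (x m) (x l))\<^sup>2)" if "m < n" "l < n" for m l n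
proof (rule Bochner_Integration.integrable_bound)
  show "integrable (Pow_M n) (\<lambda>x. ((A (x m))\<^sup>2 + (A (x l))\<^sup>2) / 2)"
    using that A_int2 A_meas Pow_component(1)[of _ n "\<lambda>x. (A x)\<^sup>2"] by simp
  show "(\<lambda>x. (G (x m) (x l))\<^sup>2) \<in> borel_measurable (Pow_M n)"
    using G_comp[OF Pow_comp_measurable Pow_comp_measurable] that by simp
  show "AE x in Pow_M n. norm ((G (x m) (x l))\<^sup>2) \<le> norm (((A (x m))\<^sup>2 + (A (x l))\<^sup>2) / 2)"
    using G_power2_le space_Pow that by (intro AE_I2) simp
qed

lemma (in ustat_kernel) G_sum_int1:
  assumes "m < n" "l < n"
  shows "integrable (Pow_M n) (\<lambda>x. G (x m) (x l))"
proof -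
  interpret Pn: prob_space "Pow_M n" by (rule prob_space_Pow)
  show ?thesis
    by (rule Pn.integrable_L2_L1[OF G_comp[OF Pow_comp_measurable Pow_comp_measurable] G_sum_int2]) (use assms in auto)
qed

text \<open>The order of integration is reversed: for fixed \<open>y\<close> the summands are
  independent and centered in the sample coordinates, so only their squares contribute.\<close>

lemma (in ustat_kernel) G_sum_param_power2:
  "(\<integral>x. (\<integral>y. (\<Sum>m<k. G (x m) y)\<^sup>2 \<partial>M) \<partial>Pow_M k) = k * Gsq"
proof -
  interpret Pk: prob_space "Pow_M k" by (rule prob_space_Pow)
  interpret Q: pair_prob_space "Pow_M k" M ..
  have "integrable (Pow_M k \<Otimes>\<^sub>M M) (\<lambda>p. (\<Sum>m<k. G (fst p m) (snd p))\<^sup>2)"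
  proof (rule integrable_power2_sum)
    fix m assume m: "m \<in> {..<k}"
    then show "(\<lambda>p. G (fst p m) (snd p)) \<in> borel_measurable (Pow_M k \<Otimes>\<^sub>M M)"
      by (intro G_comp measurable_compose[OF measurable_fst Pow_comp_measurable] measurable_snd) simp
    show "integrable (Pow_M k \<Otimes>\<^sub>M M) (\<lambda>p. (G (fst p m) (snd p))\<^sup>2)"
      using m A_int2 A_meas Pow_component(1)[of _ k "\<lambda>x. (A x)\<^sup>2"]
      by (intro G_int2_pair[OF prob_space_Pow, of "\<lambda>x. x m"] Pow_comp_measurable) simp_all
  qed simp
  then have i: "integrable (Pow_M k \<Otimes>\<^sub>M M) (case_prod (\<lambda>x y. (\<Sum>m<k. G (x m) y)\<^sup>2))"
    by (simp add: case_prod_unfold)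
  have "(\<integral>x. (\<integral>y. (\<Sum>m<k. G (x m) y)\<^sup>2 \<partial>M) \<partial>Pow_M k) = (\<integral>y. (\<integral>x. (\<Sum>m<k. G (x m) y)\<^sup>2 \<partial>Pow_M k) \<partial>M)"
    by (rule Q.Fubini_integral[OF i, symmetric])
  also have "\<dots> = (\<integral>y. k * (\<integral>x. (G x y)\<^sup>2 \<partial>M) \<partial>M)"
    by (intro Bochner_Integration.integral_cong refl Pow_sum_power2 G_comp1 G_int2 G_mean)
  also have "\<dots> = k * Gsq" by (simp add: Gsq_def G_sym)
  finally show ?thesis .
qed

text \<open>The coordinate with index k adds a term that is centered given the earlier ones, hence
  orthogonal to the earlier double sum, with second moment \<open>k * Gsq\<close>. These
  contributions add up to at most half of \<open>k^2 * Gsq\<close>.\<close>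

lemma (in ustat_kernel) G_double_sum_power2:
  "(\<integral>x. (\<Sum>l<k. \<Sum>m<l. G (x m) (x l))\<^sup>2 \<partial>Pow_M k) \<le> (real k)\<^sup>2 / 2 * Gsq"
proof (induction k)
  case 0
  then show ?case by simp
next
  case (Suc k)
  interpret Pk: prob_space "Pow_M k" by (rule prob_space_Pow)
  let ?T = "\<lambda>k x. \<Sum>l<k. \<Sum>m<l. G (x m) (x l)"
  have gm: "(\<lambda>x. G (x m) (x l)) \<in> borel_measurable (Pow_M n)" if "m < n" "l < n" for m l n
    using that by (intro G_comp Pow_comp_measurable)
  have si: "integrable (Pow_M n) (\<lambda>x. (\<Sum>m<l. G (x m) (x l))\<^sup>2)" if "l < n" for l n
    using that by (intro integrable_power2_sum gm G_sum_int2) auto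
  have Ti: "integrable (Pow_M n) (\<lambda>x. (?T n x)\<^sup>2)" for n
    by (intro integrable_power2_sum borel_measurable_sum gm si) auto
  have sG: "(\<lambda>y. \<Sum>m<k. G (x m) y) \<in> borel_measurable M" "integrable M (\<lambda>y. (\<Sum>m<k. G (x m) y)\<^sup>2)"
    "(\<integral>y. (\<Sum>m<k. G (x m) y) \<partial>M) = 0" if x: "x \<in> space (Pow_M k)" for x
  proof -
    have c: "(\<lambda>y. G (x m) y) \<in> borel_measurable M" "integrable M (\<lambda>y. (G (x m) y)\<^sup>2)" "(\<integral>y. G (x m) y \<partial>M) = 0"
      if "m < k" for m
      using G_comp1[of "x m"] G_int2[of "x m"] G_mean[of "x m"] space_Pow[OF x that] by (simp_all add: G_sym[of "x m"])
    show "(\<lambda>y. \<Sum>m<k. G (x m) y) \<in> borel_measurable M" using c by simp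
    show "integrable M (\<lambda>y. (\<Sum>m<k. G (x m) y)\<^sup>2)" using c by (intro integrable_power2_sum) auto
    show "(\<integral>y. (\<Sum>m<k. G (x m) y) \<partial>M) = 0"
      using c integrable_L2_L1[OF c(1,2)] by (subst Bochner_Integration.integral_sum) auto
  qed
  have "integrable (Pow_M (Suc k)) (\<lambda>x. (?T (Suc k) x)\<^sup>2)" by (rule Ti)
  from integral_Pow_Suc[OF this]
  have "(\<integral>x. (?T (Suc k) x)\<^sup>2 \<partial>Pow_M (Suc k)) = (\<integral>x. (\<integral>y. (?T k x + (\<Sum>m<k. G (x m) y))\<^sup>2 \<partial>M) \<partial>Pow_M k)"
    by (simp cong: sum.cong_simp)
  also have "\<dots> = (\<integral>x. (?T k x)\<^sup>2 + (\<integral>y. (\<Sum>m<k. G (x m) y)\<^sup>2 \<partial>M) \<partial>Pow_M k)"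
  proof (intro Bochner_Integration.integral_cong refl)
    fix x assume x: "x \<in> space (Pow_M k)"
    note s = sG[OF x]
    show "(\<integral>y. (?T k x + (\<Sum>m<k. G (x m) y))\<^sup>2 \<partial>M) = (?T k x)\<^sup>2 + (\<integral>y. (\<Sum>m<k. G (x m) y)\<^sup>2 \<partial>M)"
      by (rule expectation_const_add_power2[OF s])
  qed
  also have "\<dots> = (\<integral>x. (?T k x)\<^sup>2 \<partial>Pow_M k) + k * Gsq"
  proof -
    \<comment> \<open>Cauchy--Schwarz and \<open>G_power2_le\<close> give a dominating function in
      which past and new variable are separated.\<close>
    have "integrable (Pow_M k) (\<lambda>x. \<integral>y. (\<Sum>m<k. G (x m) y)\<^sup>2 \<partial>M)"
    proof (rule Bochner_Integration.integrable_bound)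
      show "integrable (Pow_M k) (\<lambda>x. k * (\<Sum>m<k. ((A (x m))\<^sup>2 + (\<integral>y. (A y)\<^sup>2 \<partial>M)) / 2))"
        using A_int2 A_meas Pow_component(1)[of _ k "\<lambda>x. (A x)\<^sup>2"]
        by (intro integrable_mult_right Bochner_Integration.integrable_sum) simp
      have "(\<lambda>p. (\<Sum>m<k. G (fst p m) (snd p))\<^sup>2) \<in> borel_measurable (Pow_M k \<Otimes>\<^sub>M M)"
        by (intro borel_measurable_power borel_measurable_sum G_comp measurable_compose[OF measurable_fst Pow_comp_measurable] measurable_snd) simp
      then show "(\<lambda>x. \<integral>y. (\<Sum>m<k. G (x m) y)\<^sup>2 \<partial>M) \<in> borel_measurable (Pow_M k)"
        by (intro borel_measurable_lebesgue_integral) (simp add: case_prod_unfold)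
      show "AE x in Pow_M k. norm (\<integral>y. (\<Sum>m<k. G (x m) y)\<^sup>2 \<partial>M) \<le> norm (k * (\<Sum>m<k. ((A (x m))\<^sup>2 + (\<integral>y. (A y)\<^sup>2 \<partial>M)) / 2))"
      proof (intro AE_I2)
        fix x assume x: "x \<in> space (Pow_M k)"
        have "(\<integral>y. (\<Sum>m<k. G (x m) y)\<^sup>2 \<partial>M) \<le> (\<integral>y. k * (\<Sum>m<k. ((A (x m))\<^sup>2 + (A y)\<^sup>2) / 2) \<partial>M)"
        proof (rule integral_mono[OF sG(2)[OF x]])
          show "integrable M (\<lambda>y. real k * (\<Sum>m<k. ((A (x m))\<^sup>2 + (A y)\<^sup>2) / 2))" using A_int2 by simp
          fix y assume y: "y \<in> space M"
          have "(\<Sum>m<k. G (x m) y)\<^sup>2 \<le> (\<Sum>m<k. (G (x m) y)\<^sup>2) * card {..<k}"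
            using Cauchy_Schwarz_ineq_sum[of "\<lambda>m. G (x m) y" "\<lambda>_. 1" "{..<k}"] by simp
          also have "\<dots> \<le> (\<Sum>m<k. ((A (x m))\<^sup>2 + (A y)\<^sup>2) / 2) * card {..<k}"
            using space_Pow[OF x] y by (intro mult_right_mono sum_mono G_power2_le) auto
          finally show "(\<Sum>m<k. G (x m) y)\<^sup>2 \<le> real k * (\<Sum>m<k. ((A (x m))\<^sup>2 + (A y)\<^sup>2) / 2)" by (simp add: mult.commute)
        qed
        also have "\<dots> = k * (\<Sum>m<k. ((A (x m))\<^sup>2 + (\<integral>y. (A y)\<^sup>2 \<partial>M)) / 2)"
          using A_int2 by (simp add: prob_space)
        finally show "norm (\<integral>y. (\<Sum>m<k. G (x m) y)\<^sup>2 \<partial>M) \<le> norm (k * (\<Sum>m<k. ((A (x m))\<^sup>2 + (\<integral>y. (A y)\<^sup>2 \<partial>M)) / 2))"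
          by simp
      qed
    qed
    then show ?thesis using Ti[of k] G_sum_param_power2[of k] by simp
  qed
  also have "\<dots> \<le> (real k)\<^sup>2 / 2 * Gsq + k * Gsq" using Suc by simp
  also have "\<dots> \<le> (real (Suc k))\<^sup>2 / 2 * Gsq"
  proof -
    have "(real (Suc k))\<^sup>2 / 2 * Gsq = (real k)\<^sup>2 / 2 * Gsq + k * Gsq + Gsq / 2"
      by (simp add: power2_eq_square algebra_simps)
    then show ?thesis using Gsq_nonneg by simp
  qed
  finally show ?case .
qed

lemma (in ustat_kernel) G_mean_Pow:
  assumes ml: "m < l" "l < k"
  shows "(\<integral>x. G (x m) (x l) \<partial>Pow_M k) = 0"
proof -
  interpret Pk: prob_space "Pow_M k" by (rule prob_space_Pow)
  have ins: "insert m ({..<k} - {m}) = {..<k}" using ml by auto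
  have i: "integrable (Pow_M k) (\<lambda>x. G (x m) (x l))"
    using ml by (intro G_sum_int1) auto
  interpret P: product_prob_space "\<lambda>_::nat. M" UNIV by unfold_locales
  have "(\<integral>x. G (x m) (x l) \<partial>PiM {..<k} (\<lambda>_. M)) = (\<integral>x. (\<integral>y. G ((x(m := y)) m) ((x(m := y)) l) \<partial>M) \<partial>PiM ({..<k} - {m}) (\<lambda>_. M))"
    by (rule P.product_integral_insert[of "{..<k} - {m}" m "\<lambda>x. G (x m) (x l)", unfolded ins, OF _ _ i]) auto
  also have "\<dots> = (\<integral>x. 0 \<partial>PiM ({..<k} - {m}) (\<lambda>_. M))"
  proof (intro Bochner_Integration.integral_cong refl)
    fix x assume "x \<in> space (PiM ({..<k} - {m}) (\<lambda>_. M))"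
    then have "x l \<in> space M" using ml by (auto simp: space_PiM PiE_iff)
    then show "(\<integral>y. G ((x(m := y)) m) ((x(m := y)) l) \<partial>M) = 0" using ml by (simp add: G_mean)
  qed
  finally show ?thesis by simp
qed

text \<open>After centring, three terms remain: sums of \<open>g\<close>, of \<open>A - H2\<close>,
  and the double sum of \<open>G\<close>. Each has mean 0 and is estimated in L2. The
  \<open>g\<close> term is the interaction of linear and quadratic part; both it and the double sum
  are small because \<open>Gsq\<close> is, whereas the \<open>A\<close> term is small by
  averaging.\<close>

lemma (in ustat_kernel) conditional_variance_deviation:
  shows "integrable (Pow_M k) (\<lambda>x. \<integral>y. (h y + (\<Sum>l<k. H (x l) y))\<^sup>2 \<partial>M)" (is "integrable _ ?V")
    "(\<integral>x. (\<integral>y. (h y + (\<Sum>l<k. H (x l) y))\<^sup>2 \<partial>M) \<partial>Pow_M k) = h2 + k * H2"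
    "(\<integral>x. \<bar>(\<integral>y. (h y + (\<Sum>l<k. H (x l) y))\<^sup>2 \<partial>M) - (h2 + k * H2)\<bar> \<partial>Pow_M k)
      \<le> 2 * sqrt (k * (h2 * sqrt Gsq)) + sqrt (k * H4) + 2 * (k * sqrt Gsq)"
proof -
  interpret Pk: prob_space "Pow_M k" by (rule prob_space_Pow)
  let ?T = "\<lambda>x. \<Sum>l<k. \<Sum>m<l. G (x m) (x l)"
  let ?a = "\<lambda>x. \<Sum>l<k. A (x l) - H2"
  let ?g = "\<lambda>x. \<Sum>l<k. g (x l)"
  have gm: "(\<lambda>x. G (x m) (x l)) \<in> borel_measurable (Pow_M k)" if "m < k" "l < k" for m l
    using that by (intro G_comp Pow_comp_measurable)
  have T: "?T \<in> borel_measurable (Pow_M k)" "integrable (Pow_M k) (\<lambda>x. (?T x)\<^sup>2)"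
    by (intro borel_measurable_sum integrable_power2_sum gm G_sum_int2; simp)+
  have g: "?g \<in> borel_measurable (Pow_M k)" "integrable (Pow_M k) (\<lambda>x. (?g x)\<^sup>2)"
    using g_int2 g_meas Pow_component(1)[of _ k "\<lambda>x. (g x)\<^sup>2"]
    by (intro borel_measurable_sum integrable_power2_sum measurable_compose[OF Pow_comp_measurable g_meas]; simp)+
  have aA: "(\<lambda>x. A x - H2) \<in> borel_measurable M" "integrable M (\<lambda>x. (A x - H2)\<^sup>2)" "(\<integral>x. A x - H2 \<partial>M) = 0"
    using A_meas A_int1 A_int2 A_mean by (simp_all add: power2_diff prob_space)
  have a: "?a \<in> borel_measurable (Pow_M k)" "integrable (Pow_M k) (\<lambda>x. (?a x)\<^sup>2)"
    using aA Pow_component(1)[of _ k "\<lambda>x. (A x - H2)\<^sup>2"]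
    by (intro borel_measurable_sum integrable_power2_sum measurable_compose[OF Pow_comp_measurable aA(1)]; simp)+
  have V: "?V x = h2 + k * H2 + (2 * ?g x + ?a x + 2 * ?T x)" if "x \<in> space (Pow_M k)" for x
    using increment_variance[OF that] by (simp add: sum_subtractf)
  have i: "integrable (Pow_M k) ?g" "integrable (Pow_M k) ?a" "integrable (Pow_M k) ?T"
    using Pk.integrable_L2_L1[OF g] Pk.integrable_L2_L1[OF a] Pk.integrable_L2_L1[OF T] .
  have "integrable (Pow_M k) (\<lambda>x. h2 + k * H2 + (2 * ?g x + ?a x + 2 * ?T x))"
    by (intro Bochner_Integration.integrable_add integrable_mult_right i Pk.integrable_const)
  then show Vi: "integrable (Pow_M k) ?V"
    by (subst Bochner_Integration.integrable_cong[where g = "\<lambda>x. h2 + k * H2 + (2 * ?g x + ?a x + 2 * ?T x)"]) (auto intro: V)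
  have E: "(\<integral>x. ?V x \<partial>Pow_M k) = h2 + k * H2 + (2 * (\<integral>x. ?g x \<partial>Pow_M k) + (\<integral>x. ?a x \<partial>Pow_M k) + 2 * (\<integral>x. ?T x \<partial>Pow_M k))"
  proof -
    have "(\<integral>x. ?V x \<partial>Pow_M k) = (\<integral>x. h2 + k * H2 + (2 * ?g x + ?a x + 2 * ?T x) \<partial>Pow_M k)"
      by (intro Bochner_Integration.integral_cong refl V)
    also have "\<dots> = h2 + k * H2 + (2 * (\<integral>x. ?g x \<partial>Pow_M k) + (\<integral>x. ?a x \<partial>Pow_M k) + 2 * (\<integral>x. ?T x \<partial>Pow_M k))"
      using i by (simp only: Bochner_Integration.integral_add integral_mult_right_zero
        Bochner_Integration.integrable_add integrable_mult_right Pk.integrable_const) (simp add: Pk.prob_space)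
    finally show ?thesis .
  qed
  have g0: "(\<integral>x. ?g x \<partial>Pow_M k) = 0"
    by (rule Pow_sum_mean[OF g_meas integrable_L2_L1[OF g_meas g_int2] g_mean])
  have a0: "(\<integral>x. ?a x \<partial>Pow_M k) = 0"
    by (rule Pow_sum_mean[OF aA(1) integrable_L2_L1[OF aA(1,2)] aA(3)])
  have T0: "(\<integral>x. ?T x \<partial>Pow_M k) = 0"
  proof -
    have "(\<Sum>l<k. \<Sum>m<l. \<integral>x. G (x m) (x l) \<partial>Pow_M k) = 0"
      by (intro sum.neutral ballI G_mean_Pow) auto
    moreover have "(\<integral>x. ?T x \<partial>Pow_M k) = (\<Sum>l<k. \<integral>x. (\<Sum>m<l. G (x m) (x l)) \<partial>Pow_M k)"
      by (intro Bochner_Integration.integral_sum Bochner_Integration.integrable_sum G_sum_int1) auto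
    moreover have "\<dots> = (\<Sum>l<k. \<Sum>m<l. \<integral>x. G (x m) (x l) \<partial>Pow_M k)"
      by (intro sum.cong refl Bochner_Integration.integral_sum G_sum_int1) auto
    ultimately show ?thesis by simp
  qed
  show EV: "(\<integral>x. ?V x \<partial>Pow_M k) = h2 + k * H2" using E g0 a0 T0 by simp
  have "(\<integral>x. \<bar>?V x - (h2 + k * H2)\<bar> \<partial>Pow_M k) \<le> (\<integral>x. 2 * \<bar>?g x\<bar> + \<bar>?a x\<bar> + 2 * \<bar>?T x\<bar> \<partial>Pow_M k)"
  proof (rule integral_mono)
    show "integrable (Pow_M k) (\<lambda>x. \<bar>?V x - (h2 + k * H2)\<bar>)" using Vi by simp
    show "integrable (Pow_M k) (\<lambda>x. 2 * \<bar>?g x\<bar> + \<bar>?a x\<bar> + 2 * \<bar>?T x\<bar>)" 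
      by (intro Bochner_Integration.integrable_add integrable_mult_right integrable_abs i)
    fix x assume "x \<in> space (Pow_M k)"
    then show "\<bar>?V x - (h2 + k * H2)\<bar> \<le> 2 * \<bar>?g x\<bar> + \<bar>?a x\<bar> + 2 * \<bar>?T x\<bar>"
      by (subst V) (assumption, linarith)
  qed
  also have "\<dots> = 2 * (\<integral>x. \<bar>?g x\<bar> \<partial>Pow_M k) + (\<integral>x. \<bar>?a x\<bar> \<partial>Pow_M k) + 2 * (\<integral>x. \<bar>?T x\<bar> \<partial>Pow_M k)"
    using i[THEN integrable_abs] by (simp only: Bochner_Integration.integral_add integral_mult_right_zero
        Bochner_Integration.integrable_add integrable_mult_right)
  also have "\<dots> \<le> 2 * sqrt (k * (h2 * sqrt Gsq)) + sqrt (k * H4) + 2 * (k * sqrt Gsq)"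
  proof (intro add_mono mult_left_mono)
    have "(\<integral>x. \<bar>?g x\<bar> \<partial>Pow_M k) \<le> sqrt (\<integral>x. (?g x)\<^sup>2 \<partial>Pow_M k)" by (rule Pk.expectation_abs_le_sqrt[OF g])
    also have "\<dots> \<le> sqrt (k * (h2 * sqrt Gsq))"
      unfolding Pow_sum_power2[OF g_meas g_int2 g_mean] using g2_le by (intro real_sqrt_le_mono mult_left_mono) auto
    finally show "(\<integral>x. \<bar>?g x\<bar> \<partial>Pow_M k) \<le> sqrt (k * (h2 * sqrt Gsq))" .
    have "(\<integral>x. \<bar>?a x\<bar> \<partial>Pow_M k) \<le> sqrt (\<integral>x. (?a x)\<^sup>2 \<partial>Pow_M k)" by (rule Pk.expectation_abs_le_sqrt[OF a])
    also have "\<dots> = sqrt (k * (\<integral>x. (A x - H2)\<^sup>2 \<partial>M))" by (simp add: Pow_sum_power2[OF aA])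
    also have "\<dots> \<le> sqrt (k * H4)"
    proof -
      have "(\<integral>x. (A x - H2)\<^sup>2 \<partial>M) = (\<integral>x. (A x)\<^sup>2 \<partial>M) - H2\<^sup>2"
        using variance_eq[OF A_int1 A_int2] by (simp add: A_mean)
      then have "(\<integral>x. (A x - H2)\<^sup>2 \<partial>M) \<le> H4" using A2_le zero_le_power2[of H2] by linarith
      then show ?thesis by (intro real_sqrt_le_mono mult_left_mono) auto
    qed
    finally show "(\<integral>x. \<bar>?a x\<bar> \<partial>Pow_M k) \<le> sqrt (k * H4)" .
    have "(\<integral>x. \<bar>?T x\<bar> \<partial>Pow_M k) \<le> sqrt (\<integral>x. (?T x)\<^sup>2 \<partial>Pow_M k)" by (rule Pk.expectation_abs_le_sqrt[OF T])
    also have "\<dots> \<le> sqrt ((real k)\<^sup>2 * Gsq)"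
      using G_double_sum_power2[of k] mult_nonneg_nonneg[OF zero_le_power2[of "real k"] Gsq_nonneg] by (intro real_sqrt_le_mono) linarith
    finally show "(\<integral>x. \<bar>?T x\<bar> \<partial>Pow_M k) \<le> k * sqrt Gsq" by (simp add: real_sqrt_mult)
  qed auto
  finally show "(\<integral>x. \<bar>?V x - (h2 + k * H2)\<bar> \<partial>Pow_M k) \<le> 2 * sqrt (k * (h2 * sqrt Gsq)) + sqrt (k * H4) + 2 * (k * sqrt Gsq)" .
qed

text \<open>With the new variable fixed, the sections of \<open>H\<close> are independent centered
  summands, so \<open>Pow_sum_power4\<close> applies inside and Fubini finishes. The factor 8 pays
  for separating \<open>h\<close> from the sum.\<close>

lemma (in ustat_kernel) increment_fourth_moment:
  shows "integrable (Pow_M k) (\<lambda>x. \<integral>y. (h y + (\<Sum>l<k. H (x l) y)) ^ 4 \<partial>M)" (is ?i)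
    "(\<integral>x. (\<integral>y. (h y + (\<Sum>l<k. H (x l) y)) ^ 4 \<partial>M) \<partial>Pow_M k) \<le> 8 * (h4 + 3 * (real k)\<^sup>2 * H4)" (is ?b)
proof -
  interpret Pk: prob_space "Pow_M k" by (rule prob_space_Pow)
  interpret Q: pair_prob_space "Pow_M k" M ..
  have Hc: "(\<lambda>p. H (fst p l) (snd p)) \<in> borel_measurable (Pow_M k \<Otimes>\<^sub>M M)" if "l < k" for l
    using that by (intro H_comp measurable_compose[OF measurable_fst Pow_comp_measurable] measurable_snd)
  have m4: "(\<lambda>x. \<integral>y. H x y ^ 4 \<partial>M) \<in> borel_measurable M" using H4_int by simp
  have Hs: "integrable (Pow_M k \<Otimes>\<^sub>M M) (\<lambda>p. (\<Sum>l<k. H (fst p l) (snd p)) ^ 4)"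
    using H4_int m4 Pow_component(1)[of _ k "\<lambda>x. \<integral>y. H x y ^ 4 \<partial>M"]
    by (intro integrable_power4_sum Hc H_int4_pair[OF prob_space_Pow Pow_comp_measurable]) auto
  have hs: "integrable (Pow_M k \<Otimes>\<^sub>M M) (\<lambda>p. h (snd p) ^ 4)"
    using pair_snd[OF prob_space_Pow, of "\<lambda>y. h y ^ 4"] h_int h_meas by simp
  have full: "integrable (Pow_M k \<Otimes>\<^sub>M M) (\<lambda>p. (h (snd p) + (\<Sum>l<k. H (fst p l) (snd p))) ^ 4)"
    by (intro integrable_power4_add Hs hs borel_measurable_sum Hc measurable_compose[OF measurable_snd h_meas]) simp
  show ?i using Q.integrable_fst'[OF full] by simp
  have "(\<integral>x. (\<integral>y. (h y + (\<Sum>l<k. H (x l) y)) ^ 4 \<partial>M) \<partial>Pow_M k)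
    = (\<integral>p. (h (snd p) + (\<Sum>l<k. H (fst p l) (snd p))) ^ 4 \<partial>(Pow_M k \<Otimes>\<^sub>M M))"
    using Q.integral_fst'[OF full] by simp
  also have "\<dots> \<le> (\<integral>p. 8 * (h (snd p) ^ 4 + (\<Sum>l<k. H (fst p l) (snd p)) ^ 4) \<partial>(Pow_M k \<Otimes>\<^sub>M M))"
    by (intro integral_mono full integrable_mult_right Bochner_Integration.integrable_add Hs hs power4_add_le)
  also have "\<dots> = 8 * ((\<integral>p. h (snd p) ^ 4 \<partial>(Pow_M k \<Otimes>\<^sub>M M)) + (\<integral>p. (\<Sum>l<k. H (fst p l) (snd p)) ^ 4 \<partial>(Pow_M k \<Otimes>\<^sub>M M)))"
    using Hs hs by simp
  also have "(\<integral>p. h (snd p) ^ 4 \<partial>(Pow_M k \<Otimes>\<^sub>M M)) = h4"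
    using Q.integral_fst'[OF hs] by (simp add: h4_def Pk.prob_space)
  also have "(\<integral>p. (\<Sum>l<k. H (fst p l) (snd p)) ^ 4 \<partial>(Pow_M k \<Otimes>\<^sub>M M)) \<le> 3 * (real k)\<^sup>2 * H4"
  proof -
    have i: "integrable (Pow_M k \<Otimes>\<^sub>M M) (case_prod (\<lambda>x y. (\<Sum>l<k. H (x l) y) ^ 4))"
      using Hs by (simp add: case_prod_unfold)
    have "(\<integral>p. (\<Sum>l<k. H (fst p l) (snd p)) ^ 4 \<partial>(Pow_M k \<Otimes>\<^sub>M M)) = (\<integral>y. (\<integral>x. (\<Sum>l<k. H (x l) y) ^ 4 \<partial>Pow_M k) \<partial>M)"
      using Q.integral_snd[OF i] by (simp add: case_prod_unfold)
    also have "\<dots> \<le> (\<integral>y. 3 * (real k)\<^sup>2 * (\<integral>x. H x y ^ 4 \<partial>M) \<partial>M)"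
    proof (rule integral_mono)
      show "integrable M (\<lambda>y. \<integral>x. (\<Sum>l<k. H (x l) y) ^ 4 \<partial>Pow_M k)"
        using Q.integrable_snd[OF i] .
      show "integrable M (\<lambda>y. 3 * (real k)\<^sup>2 * (\<integral>x. H x y ^ 4 \<partial>M))"
        using H4_int by (simp add: H_sym)
      fix y assume y: "y \<in> space M"
      show "(\<integral>x. (\<Sum>l<k. H (x l) y) ^ 4 \<partial>Pow_M k) \<le> 3 * (real k)\<^sup>2 * (\<integral>x. H x y ^ 4 \<partial>M)"
        using Pow_sum_power4[OF H_comp1[OF y] H_int[OF y] H_mean[OF y], of k] by (simp add: H_sym[of _ y])
    qed
    also have "\<dots> = 3 * (real k)\<^sup>2 * H4" by (simp add: H4_def H_sym)
    finally show ?thesis .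
  qed
  finally show ?b by simp
qed

text \<open>Given the past, the characteristic function of increment k is close to
  \<open>exp (- s / 2)\<close> with the deterministic \<open>s\<close> = \<open>h2 + k * H2\<close>.
  The past enters as a factor of modulus 1 and the constants \<open>exp (- s / 2)\<close> are at
  most 1, so the replacement errors merely add up. In each error the first group is the Taylor
  remainder, the second the deviation of the conditional variance from its mean, the last the
  expansion of the exponential.\<close>

theorem (in ustat_kernel) char_bound:
  assumes \<eta>: "\<eta> > 0"
  shows "cmod ((\<integral>x. cis (\<Sum>k<N. h (x k) + (\<Sum>l<k. H (x l) (x k))) \<partial>Pow_M N) - complex_of_real (exp (- (\<Sum>k<N. h2 + real k * H2) / 2)))
    \<le> (\<Sum>k<N. (\<eta> * (h2 + real k * H2) + 8 * (h4 + 3 * (real k)\<^sup>2 * H4) / \<eta>) / 12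
        + (sqrt (real k * (h2 * sqrt Gsq)) + sqrt (real k * H4) / 2 + real k * sqrt Gsq) + (h2 + real k * H2)\<^sup>2 / 8)"
proof (induction N)
  case 0
  interpret P0: prob_space "Pow_M 0" by (rule prob_space_Pow)
  show ?case using P0.prob_space by simp
next
  case (Suc k)
  interpret Pk: prob_space "Pow_M k" by (rule prob_space_Pow)
  let ?S = "\<lambda>k x. \<Sum>k<k. h (x k) + (\<Sum>l<k. H (x l) (x k))"
  let ?D = "\<lambda>x y. h y + (\<Sum>l<k. H (x l) y)"
  let ?V = "\<lambda>x. \<integral>y. (?D x y)\<^sup>2 \<partial>M" and ?W = "\<lambda>x. \<integral>y. ?D x y ^ 4 \<partial>M"
  define s where "s = h2 + k * H2"
  have s0: "s \<ge> 0" by (simp add: s_def h2_def H2_def)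
  define \<phi> where "\<phi> n = (\<integral>x. cis (?S n x) \<partial>Pow_M n)" for n
  have Sm: "?S n \<in> borel_measurable (Pow_M n)" for n
    by (intro borel_measurable_sum borel_measurable_add measurable_compose[OF Pow_comp_measurable h_meas] H_comp Pow_comp_measurable) auto
  have cm: "(\<lambda>x. cis (f x)) \<in> borel_measurable N" if "f \<in> borel_measurable N" for f and N :: "'c measure"
    by (rule measurable_compose[OF that]) (intro borel_measurable_continuous_onI continuous_intros)
  have ci: "integrable (Pow_M n) (\<lambda>x. cis (?S n x))" for n
  proof -
    interpret Pn: prob_space "Pow_M n" by (rule prob_space_Pow)
    show ?thesis using cm[OF Sm] by (intro Pn.integrable_const_bound[of _ 1]) auto
  qed
  let ?\<psi> = "\<lambda>x. \<integral>y. cis (?D x y) \<partial>M"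
  have Dm: "(\<lambda>p. ?D (fst p) (snd p)) \<in> borel_measurable (Pow_M k \<Otimes>\<^sub>M M)"
    by (intro borel_measurable_add borel_measurable_sum measurable_compose[OF measurable_snd h_meas] H_comp
      measurable_compose[OF measurable_fst Pow_comp_measurable] measurable_snd) simp
  have \<psi>m: "?\<psi> \<in> borel_measurable (Pow_M k)"
    using cm[OF Dm] by (intro borel_measurable_lebesgue_integral) (simp add: case_prod_unfold)
  have \<psi>1: "cmod (?\<psi> x) \<le> 1" if "x \<in> space (Pow_M k)" for x
  proof -
    have "cmod (?\<psi> x) \<le> (\<integral>y. cmod (cis (?D x y)) \<partial>M)" by (rule integral_norm_bound)
    then show ?thesis by (simp add: prob_space)
  qed
  have step: "\<phi> (Suc k) = (\<integral>x. cis (?S k x) * ?\<psi> x \<partial>Pow_M k)"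
  proof -
    have "\<phi> (Suc k) = (\<integral>x. (\<integral>y. cis (?S k x + ?D x y) \<partial>M) \<partial>Pow_M k)"
      unfolding \<phi>_def using integral_Pow_Suc[OF ci[of "Suc k"]] by (simp cong: sum.cong_simp)
    then show ?thesis by (simp flip: cis_mult)
  qed
  have pi: "integrable (Pow_M k) (\<lambda>x. cis (?S k x) * ?\<psi> x)"
    using cm[OF Sm] \<psi>m \<psi>1 by (intro Pk.integrable_const_bound[of _ 1]) (auto simp: norm_mult)
  let ?e = "complex_of_real (exp (- s / 2))"
  have "cmod (\<phi> (Suc k) - ?e * \<phi> k) = cmod (\<integral>x. cis (?S k x) * ?\<psi> x - ?e * cis (?S k x) \<partial>Pow_M k)"
    unfolding step unfolding \<phi>_def using pi ci[of k] by simp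
  also have "\<dots> = cmod (\<integral>x. cis (?S k x) * (?\<psi> x - ?e) \<partial>Pow_M k)"
    by (simp add: right_diff_distrib mult.commute)
  also have "\<dots> \<le> (\<integral>x. cmod (cis (?S k x) * (?\<psi> x - ?e)) \<partial>Pow_M k)" by (rule integral_norm_bound)
  also have "\<dots> = (\<integral>x. cmod (?\<psi> x - ?e) \<partial>Pow_M k)" by (simp add: norm_mult)
  also have "\<dots> \<le> (\<integral>x. (\<eta> * ?V x + ?W x / \<eta>) / 12 + \<bar>?V x - s\<bar> / 2 + s\<^sup>2 / 8 \<partial>Pow_M k)"
  proof (rule integral_mono)
    show "integrable (Pow_M k) (\<lambda>x. cmod (?\<psi> x - ?e))"
    proof (rule Pk.integrable_const_bound[of _ "1 + cmod ?e"])
      show "AE x in Pow_M k. norm (cmod (?\<psi> x - ?e)) \<le> 1 + cmod ?e"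
      proof (intro AE_I2)
        fix x assume "x \<in> space (Pow_M k)"
        from \<psi>1[OF this] show "norm (cmod (?\<psi> x - ?e)) \<le> 1 + cmod ?e" using norm_triangle_ineq4[of "?\<psi> x" ?e] by simp
      qed
    qed (use \<psi>m in simp)
    show "integrable (Pow_M k) (\<lambda>x. (\<eta> * ?V x + ?W x / \<eta>) / 12 + \<bar>?V x - s\<bar> / 2 + s\<^sup>2 / 8)"
      using conditional_variance_deviation(1)[of k] increment_fourth_moment(1)[of k] by simp
    fix x assume x: "x \<in> space (Pow_M k)"
    have 1: "cmod (?\<psi> x - complex_of_real (1 - ?V x / 2)) \<le> (\<eta> * ?V x + ?W x / \<eta>) / 12"
      by (rule char_second_order[OF increment_power4_int[OF x] increment_mean[OF x] \<eta>])
    have "cmod (?\<psi> x - ?e) \<le> cmod (?\<psi> x - complex_of_real (1 - ?V x / 2)) + cmod (complex_of_real (1 - ?V x / 2 - exp (- s / 2)))"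
      using norm_triangle_ineq[of "?\<psi> x - complex_of_real (1 - ?V x / 2)" "complex_of_real (1 - ?V x / 2 - exp (- s / 2))"] by simp
    also have "cmod (complex_of_real (1 - ?V x / 2 - exp (- s / 2))) \<le> \<bar>?V x - s\<bar> / 2 + s\<^sup>2 / 8"
    proof -
      show ?thesis unfolding norm_of_real by (rule abs_diff_perturb[OF exp_neg_second_order[OF s0]])
    qed
    finally show "cmod (?\<psi> x - ?e) \<le> (\<eta> * ?V x + ?W x / \<eta>) / 12 + \<bar>?V x - s\<bar> / 2 + s\<^sup>2 / 8" using 1 by linarith
  qed
  also have "\<dots> = (\<eta> * (\<integral>x. ?V x \<partial>Pow_M k) + (\<integral>x. ?W x \<partial>Pow_M k) / \<eta>) / 12 + (\<integral>x. \<bar>?V x - s\<bar> \<partial>Pow_M k) / 2 + s\<^sup>2 / 8"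
    using conditional_variance_deviation(1)[of k] increment_fourth_moment(1)[of k] by (simp add: Pk.prob_space)
  also have "\<dots> \<le> (\<eta> * s + 8 * (h4 + 3 * (real k)\<^sup>2 * H4) / \<eta>) / 12
        + (sqrt (k * (h2 * sqrt Gsq)) + sqrt (k * H4) / 2 + k * sqrt Gsq) + s\<^sup>2 / 8"
  proof -
    have "(\<integral>x. ?W x \<partial>Pow_M k) / \<eta> \<le> 8 * (h4 + 3 * (real k)\<^sup>2 * H4) / \<eta>"
      using increment_fourth_moment(2)[of k] \<eta> by (intro divide_right_mono) auto
    from error_sum_mono[OF this conditional_variance_deviation(3)[of k]] show ?thesis
      unfolding conditional_variance_deviation(2) s_def .
  qed
  finally have st: "cmod (\<phi> (Suc k) - ?e * \<phi> k) \<le> (\<eta> * s + 8 * (h4 + 3 * (real k)\<^sup>2 * H4) / \<eta>) / 12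
        + (sqrt (k * (h2 * sqrt Gsq)) + sqrt (k * H4) / 2 + k * sqrt Gsq) + s\<^sup>2 / 8" (is "_ \<le> ?err") .
  let ?E = "\<lambda>n. complex_of_real (exp (- (\<Sum>k<n. h2 + real k * H2) / 2))"
  have "?E (Suc k) = ?e * ?E k" by (simp add: s_def flip: of_real_mult exp_add) (simp add: field_simps)
  then have "\<phi> (Suc k) - ?E (Suc k) = (\<phi> (Suc k) - ?e * \<phi> k) + ?e * (\<phi> k - ?E k)"
    by (simp add: algebra_simps)
  then have "cmod (\<phi> (Suc k) - ?E (Suc k)) \<le> cmod (\<phi> (Suc k) - ?e * \<phi> k) + cmod ?e * cmod (\<phi> k - ?E k)"
    using norm_triangle_ineq[of "\<phi> (Suc k) - ?e * \<phi> k" "?e * (\<phi> k - ?E k)"] by (simp only: norm_mult)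
  also have "cmod ?e * cmod (\<phi> k - ?E k) \<le> 1 * cmod (\<phi> k - ?E k)"
    using s0 by (intro mult_right_mono) auto
  finally have "cmod (\<phi> (Suc k) - ?E (Suc k)) \<le> ?err + cmod (\<phi> k - ?E k)" using st by linarith
  with Suc show ?case by (simp add: \<phi>_def s_def)
qed

text \<open>The scaling is \<open>h\<close> of order \<open>n^(-1/2)\<close> and \<open>H\<close> of
  order 1/n, so each of at most \<open>n\<close> steps has variance O(1/n). With
  \<open>\<eta>\<close> = \<open>1 / sqrt n\<close> both parts of the Taylor remainder are
  O(\<open>n^(-3/2)\<close>) per step; their constants 2 and 32, divided by 12, give 17/6.\<close>

lemma (in ustat_kernel) char_bound_normalized:
  assumes n: "n \<ge> 1" and N: "N \<le> n" and K: "K \<ge> 0" and \<epsilon>: "\<epsilon> \<ge> 0"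
    and b: "h2 \<le> K / n" "H2 \<le> K / (real n)\<^sup>2" "h4 \<le> K / (real n)\<^sup>2" "H4 \<le> K / real n ^ 4" "Gsq \<le> \<epsilon> / real n ^ 4"
  shows "cmod ((\<integral>x. cis (\<Sum>k<N. h (x k) + (\<Sum>l<k. H (x l) (x k))) \<partial>Pow_M N) - complex_of_real (exp (- (\<Sum>k<N. h2 + real k * H2) / 2)))
    \<le> 17 / 6 * K / sqrt n + sqrt K / (2 * sqrt n) + K\<^sup>2 / (2 * n) + sqrt (K * sqrt \<epsilon>) + sqrt \<epsilon>"
proof -
  define r where "r = sqrt (real n)"
  have n0: "real n > 0" using n by simp
  have r: "r > 0" "r * r = n" "r\<^sup>2 = n" "r ^ 4 = (real n)\<^sup>2" using n0 by (simp_all add: r_def power4_eq_xxxx power2_eq_square)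
  have nn: "h2 \<ge> 0" "H2 \<ge> 0" "H4 \<ge> 0" "h4 \<ge> 0" "Gsq \<ge> 0"
    by (simp_all add: h2_def H2_def h4_def H4_def Gsq_nonneg)
  have sG: "sqrt Gsq \<le> sqrt \<epsilon> / (real n)\<^sup>2"
  proof -
    have "sqrt Gsq \<le> sqrt (\<epsilon> / ((real n)\<^sup>2)\<^sup>2)" using b(5) by simp
    then show ?thesis by (simp only: real_sqrt_divide real_sqrt_abs) simp
  qed
  have sH: "sqrt H4 \<le> sqrt K / (real n)\<^sup>2"
  proof -
    have "sqrt H4 \<le> sqrt (K / ((real n)\<^sup>2)\<^sup>2)" using b(4) by simp
    then show ?thesis by (simp only: real_sqrt_divide real_sqrt_abs) simp
  qed
  have term_le: "((1 / r) * (h2 + real k * H2) + 8 * (h4 + 3 * (real k)\<^sup>2 * H4) / (1 / r)) / 12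
        + (sqrt (real k * (h2 * sqrt Gsq)) + sqrt (real k * H4) / 2 + real k * sqrt Gsq) + (h2 + real k * H2)\<^sup>2 / 8
      \<le> (17 / 6 * K / r + sqrt K / (2 * r) + K\<^sup>2 / (2 * n) + sqrt (K * sqrt \<epsilon>) + sqrt \<epsilon>) / n" if "k < N" for k
  proof -
    have k: "real k \<le> real n" using that N by simp
    have 1: "h2 + real k * H2 \<le> 2 * K / n"
    proof -
      have "real k * H2 \<le> real n * (K / (real n)\<^sup>2)" using k b(2) nn by (intro mult_mono) auto
      then show ?thesis using b(1) n0 by (simp add: power2_eq_square field_simps)
    qed
    have 2: "h4 + 3 * (real k)\<^sup>2 * H4 \<le> 4 * K / (real n)\<^sup>2"
    proof -
      have "(real k)\<^sup>2 * H4 \<le> (real n)\<^sup>2 * (K / real n ^ 4)" using k b(4) nn by (intro mult_mono power_mono) auto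
      also have "\<dots> = K / (real n)\<^sup>2" using n0 by (simp add: power2_eq_square power4_eq_xxxx)
      finally have "(real k)\<^sup>2 * H4 \<le> K / (real n)\<^sup>2" .
      moreover have "4 * K / (real n)\<^sup>2 = 4 * (K / (real n)\<^sup>2)" "3 * (real k)\<^sup>2 * H4 = 3 * ((real k)\<^sup>2 * H4)" by simp_all
      ultimately show ?thesis using b(3) by argo
    qed
    have a: "((1 / r) * (h2 + real k * H2) + 8 * (h4 + 3 * (real k)\<^sup>2 * H4) / (1 / r)) / 12 \<le> 17 / 6 * K / r / n"
    proof -
      define t where "t = K / r / n"
      have "(1 / r) * (h2 + real k * H2) \<le> (1 / r) * (2 * K / n)" using 1 r by (intro mult_left_mono) auto
      also have "\<dots> = 2 * t" by (simp add: t_def)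
      finally have A: "(1 / r) * (h2 + real k * H2) \<le> 2 * t" .
      have "8 * (h4 + 3 * (real k)\<^sup>2 * H4) * r \<le> 8 * (4 * K / (real n)\<^sup>2) * r"
        using r by (intro mult_right_mono mult_left_mono 2) auto
      also have "\<dots> = 32 * t"
        using r n0 by (simp add: power2_eq_square field_simps t_def)
      finally have "8 * (h4 + 3 * (real k)\<^sup>2 * H4) / (1 / r) \<le> 32 * t" by simp
      moreover have "17 / 6 * K / r / n = 17 / 6 * t" by (simp add: t_def)
      ultimately show ?thesis using A by argo
    qed
    have bb: "sqrt (real k * (h2 * sqrt Gsq)) \<le> sqrt (K * sqrt \<epsilon>) / n"
    proof -
      have "real k * (h2 * sqrt Gsq) \<le> n * (K / n * (sqrt \<epsilon> / (real n)\<^sup>2))"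
        using k b(1) sG nn K by (intro mult_mono) auto
      also have "\<dots> = K * sqrt \<epsilon> / (real n)\<^sup>2" using n0 by simp
      finally have "sqrt (real k * (h2 * sqrt Gsq)) \<le> sqrt (K * sqrt \<epsilon> / (real n)\<^sup>2)" by simp
      then show ?thesis by (simp add: real_sqrt_divide)
    qed
    have cc: "sqrt (real k * H4) / 2 \<le> sqrt K / (2 * r) / n"
    proof -
      have "sqrt (real k * H4) = sqrt (real k) * sqrt H4" by (rule real_sqrt_mult)
      also have "\<dots> \<le> r * (sqrt K / (real n)\<^sup>2)"
        using k sH nn r by (intro mult_mono) (auto simp: r_def)
      also have "\<dots> = sqrt K / r / n" using r n0 by (simp add: power2_eq_square field_simps)
      finally show ?thesis by simp
    qed
    have dd: "real k * sqrt Gsq \<le> sqrt \<epsilon> / n"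
    proof -
      have "real k * sqrt Gsq \<le> n * (sqrt \<epsilon> / (real n)\<^sup>2)" using k sG nn by (intro mult_mono) auto
      then show ?thesis using n0 by (simp add: power2_eq_square)
    qed
    have ee: "(h2 + real k * H2)\<^sup>2 / 8 \<le> K\<^sup>2 / (2 * n) / n"
    proof -
      have "(h2 + real k * H2)\<^sup>2 \<le> (2 * K / n)\<^sup>2" using 1 nn by (intro power_mono) auto
      then show ?thesis by (simp add: power2_eq_square)
    qed
    show ?thesis using a bb cc dd ee unfolding add_divide_distrib by linarith
  qed
  have "cmod ((\<integral>x. cis (\<Sum>k<N. h (x k) + (\<Sum>l<k. H (x l) (x k))) \<partial>Pow_M N) - complex_of_real (exp (- (\<Sum>k<N. h2 + real k * H2) / 2)))
    \<le> (\<Sum>k<N. ((1 / r) * (h2 + real k * H2) + 8 * (h4 + 3 * (real k)\<^sup>2 * H4) / (1 / r)) / 12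
        + (sqrt (real k * (h2 * sqrt Gsq)) + sqrt (real k * H4) / 2 + real k * sqrt Gsq) + (h2 + real k * H2)\<^sup>2 / 8)"
    using r by (intro char_bound) auto
  also have "\<dots> \<le> (\<Sum>k<N. (17 / 6 * K / r + sqrt K / (2 * r) + K\<^sup>2 / (2 * n) + sqrt (K * sqrt \<epsilon>) + sqrt \<epsilon>) / n)"
    by (intro sum_mono term_le) auto
  also have "\<dots> = (17 / 6 * K / r + sqrt K / (2 * r) + K\<^sup>2 / (2 * n) + sqrt (K * sqrt \<epsilon>) + sqrt \<epsilon>) * (N / n)"
    by simp
  also have "\<dots> \<le> (17 / 6 * K / r + sqrt K / (2 * r) + K\<^sup>2 / (2 * n) + sqrt (K * sqrt \<epsilon>) + sqrt \<epsilon>) * 1"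
    using N n0 K \<epsilon> r by (intro mult_left_mono add_nonneg_nonneg) auto
  finally show ?thesis by (simp add: r_def)
qed

section \<open>Kernels of finite rank\<close>

locale finite_rank_kernel = prob_space M for M :: "'a measure" +
  fixes D :: "'d set" and c :: "'d \<Rightarrow> real" and \<Phi> :: "'d \<Rightarrow> 'a \<Rightarrow> real" and h :: "'a \<Rightarrow> real"
  assumes D: "finite D"
    and \<Phi>_meas: "\<And>d. d \<in> D \<Longrightarrow> \<Phi> d \<in> borel_measurable M"
    and \<Phi>_int: "\<And>d. d \<in> D \<Longrightarrow> integrable M (\<lambda>x. \<Phi> d x ^ 4)"
    and \<Phi>_mean: "\<And>d. d \<in> D \<Longrightarrow> (\<integral>x. \<Phi> d x \<partial>M) = 0"
    and h_meas: "h \<in> borel_measurable M"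
    and h_int: "integrable M (\<lambda>x. h x ^ 4)"
    and h_mean: "(\<integral>x. h x \<partial>M) = 0"

definition (in finite_rank_kernel) "H x y = (\<Sum>d\<in>D. c d * \<Phi> d x * \<Phi> d y)"
text \<open>The Gram matrix of the factors. Every functional of the kernel that has to be computed
  exactly is a trace in this matrix and the diagonal matrix of the weights \<open>c\<close>.\<close>

definition (in finite_rank_kernel) "\<Gamma> d e = (\<integral>x. \<Phi> d x * \<Phi> e x \<partial>M)"

lemma (in finite_rank_kernel) \<Phi>_int2: "d \<in> D \<Longrightarrow> integrable M (\<lambda>x. (\<Phi> d x)\<^sup>2)"
  by (rule integrable_L4_L2[OF \<Phi>_meas \<Phi>_int])

lemma (in finite_rank_kernel) \<Phi>_int1: "d \<in> D \<Longrightarrow> integrable M (\<Phi> d)"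
  by (rule integrable_L2_L1[OF \<Phi>_meas \<Phi>_int2])

lemma (in finite_rank_kernel) \<Phi>\<Phi>_int: "d \<in> D \<Longrightarrow> e \<in> D \<Longrightarrow> integrable M (\<lambda>x. \<Phi> d x * \<Phi> e x)"
  by (intro integrable_mult_L2 \<Phi>_meas \<Phi>_int2)

lemma (in finite_rank_kernel) ustat: "ustat_kernel M H h"
proof
  have M: "prob_space M" by (rule prob_space_axioms)
  have m: "(\<lambda>p. \<Phi> d (fst p)) \<in> borel_measurable (M \<Otimes>\<^sub>M M)" "(\<lambda>p. \<Phi> d (snd p)) \<in> borel_measurable (M \<Otimes>\<^sub>M M)" if "d \<in> D" for d
    by (rule measurable_compose[OF measurable_fst \<Phi>_meas[OF that]], rule measurable_compose[OF measurable_snd \<Phi>_meas[OF that]])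
  show "(\<lambda>p. H (fst p) (snd p)) \<in> borel_measurable (M \<Otimes>\<^sub>M M)"
    unfolding H_def by (intro borel_measurable_sum borel_measurable_times borel_measurable_const m)
  show "H x y = H y x" for x y by (simp add: H_def mult_ac)
  show "(\<integral>y. H x y \<partial>M) = 0" for x
    unfolding H_def using \<Phi>_int1 \<Phi>_mean by (subst Bochner_Integration.integral_sum) auto
  show "integrable M (\<lambda>y. H x y ^ 4)" for x
    unfolding H_def using \<Phi>_meas \<Phi>_int by (intro integrable_power4_sum D) (auto simp: power_mult_distrib)
  show "integrable (M \<Otimes>\<^sub>M M) (\<lambda>p. H (fst p) (snd p) ^ 4)"
    unfolding H_def
  proof (rule integrable_power4_sum[OF D])
    fix d assume d: "d \<in> D"
    show "(\<lambda>p. c d * \<Phi> d (fst p) * \<Phi> d (snd p)) \<in> borel_measurable (M \<Otimes>\<^sub>M M)"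
      using d by (intro borel_measurable_times borel_measurable_const m)
    interpret P: pair_prob_space M M ..
    have "integrable (M \<Otimes>\<^sub>M M) (\<lambda>p. \<Phi> d (fst p) ^ 4 * \<Phi> d (snd p) ^ 4)"
    proof (rule P.Fubini_integrable)
      show "(\<lambda>p. \<Phi> d (fst p) ^ 4 * \<Phi> d (snd p) ^ 4) \<in> borel_measurable (M \<Otimes>\<^sub>M M)"
        using d by (intro borel_measurable_times borel_measurable_power m)
      show "integrable M (\<lambda>x. \<integral>y. norm (\<Phi> d (fst (x, y)) ^ 4 * \<Phi> d (snd (x, y)) ^ 4) \<partial>M)"
        using d \<Phi>_int by simp
      show "AE x in M. integrable M (\<lambda>y. \<Phi> d (fst (x, y)) ^ 4 * \<Phi> d (snd (x, y)) ^ 4)"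
        using d \<Phi>_int by simp
    qed
    then show "integrable (M \<Otimes>\<^sub>M M) (\<lambda>p. (c d * \<Phi> d (fst p) * \<Phi> d (snd p)) ^ 4)"
      by (simp add: power_mult_distrib mult.assoc)
  qed
qed (use h_meas h_int h_mean in auto)

lemma (in finite_rank_kernel) double_sum_integral:
  "(\<integral>x. (\<Sum>d\<in>D. \<Sum>e\<in>D. k d e * (\<Phi> d x * \<Phi> e x)) \<partial>M) = (\<Sum>d\<in>D. \<Sum>e\<in>D. k d e * \<Gamma> d e)"
proof -
  have "(\<integral>x. (\<Sum>d\<in>D. \<Sum>e\<in>D. k d e * (\<Phi> d x * \<Phi> e x)) \<partial>M) = (\<Sum>d\<in>D. \<integral>x. (\<Sum>e\<in>D. k d e * (\<Phi> d x * \<Phi> e x)) \<partial>M)"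
    by (intro Bochner_Integration.integral_sum Bochner_Integration.integrable_sum integrable_mult_right \<Phi>\<Phi>_int)
  also have "\<dots> = (\<Sum>d\<in>D. \<Sum>e\<in>D. \<integral>x. k d e * (\<Phi> d x * \<Phi> e x) \<partial>M)"
    by (intro sum.cong refl Bochner_Integration.integral_sum integrable_mult_right \<Phi>\<Phi>_int)
  finally show ?thesis by (simp add: \<Gamma>_def)
qed

lemma (in finite_rank_kernel) G_eq:
  "ustat_kernel.G M H x y = (\<Sum>d\<in>D. \<Sum>e\<in>D. (c d * c e * (\<Phi> d x * \<Phi> e y)) * \<Gamma> d e)"
proof -
  have "ustat_kernel.G M H x y = (\<integral>z. (\<Sum>d\<in>D. \<Sum>e\<in>D. (c d * c e * (\<Phi> d x * \<Phi> e y)) * (\<Phi> d z * \<Phi> e z)) \<partial>M)"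
    unfolding ustat_kernel.G_def[OF ustat] by (simp add: H_def sum_product mult_ac)
  then show ?thesis by (simp only: double_sum_integral)
qed

text \<open>With C the diagonal matrix of weights, the right side is the trace of the square of C
  times \<open>\<Gamma>\<close>.\<close>

lemma (in finite_rank_kernel) H2_eq: "ustat_kernel.H2 M H = (\<Sum>d\<in>D. \<Sum>e\<in>D. c d * c e * (\<Gamma> d e)\<^sup>2)"
proof -
  have "(\<integral>y. (H x y)\<^sup>2 \<partial>M) = ustat_kernel.G M H x x" for x
    unfolding ustat_kernel.G_def[OF ustat] by (simp add: power2_eq_square)
  then have "ustat_kernel.H2 M H = (\<integral>x. (\<Sum>d\<in>D. \<Sum>e\<in>D. (c d * c e * \<Gamma> d e) * (\<Phi> d x * \<Phi> e x)) \<partial>M)"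
    unfolding ustat_kernel.H2_def[OF ustat] G_eq by (simp add: mult_ac)
  then show ?thesis unfolding double_sum_integral power2_eq_square by (simp add: mult_ac)
qed

lemma (in finite_rank_kernel) sum_\<Phi>_power2:
  "(\<integral>y. (\<Sum>e\<in>D. b e * \<Phi> e y)\<^sup>2 \<partial>M) = (\<Sum>d\<in>D. \<Sum>e\<in>D. b d * b e * \<Gamma> d e)"
proof -
  have "(\<integral>y. (\<Sum>e\<in>D. b e * \<Phi> e y)\<^sup>2 \<partial>M) = (\<integral>y. (\<Sum>d\<in>D. \<Sum>e\<in>D. (b d * b e) * (\<Phi> d y * \<Phi> e y)) \<partial>M)"
    by (simp add: power2_eq_square sum_product mult_ac)
  then show ?thesis by (simp only: double_sum_integral)
qed

text \<open>The right side is the trace of the fourth power of C times \<open>\<Gamma>\<close>, with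
  C the diagonal matrix of weights, written as a weighted sum of squared entries of
  \<open>\<Gamma>\<close> C \<open>\<Gamma>\<close>.\<close>

lemma (in finite_rank_kernel) Gsq_eq:
  "ustat_kernel.Gsq M H = (\<Sum>d\<in>D. \<Sum>e\<in>D. c d * c e * (\<Sum>f\<in>D. c f * \<Gamma> d f * \<Gamma> f e)\<^sup>2)"
proof -
  \<comment> \<open>\<open>B e\<close> is the image of the factor \<open>\<Phi> e\<close> under the
    integral operator, which makes \<open>G\<close> a sum of products of \<open>B\<close> and
    \<open>\<Phi>\<close>.\<close>
  define B where "B e x = (\<Sum>d\<in>D. c d * \<Gamma> d e * \<Phi> d x)" for e x
  have Bm: "B e \<in> borel_measurable M" "integrable M (\<lambda>x. (B e x)\<^sup>2)" for e
    unfolding B_def using \<Phi>_meas \<Phi>_int2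
    by (intro borel_measurable_sum integrable_power2_sum D; auto simp: power_mult_distrib)+
  have Bi: "integrable M (\<lambda>x. B d x * B e x)" for d e
    by (intro integrable_mult_L2 Bm)
  have BB: "(\<integral>x. B d x * B e x \<partial>M) = (\<Sum>f\<in>D. \<Sum>f'\<in>D. c f * \<Gamma> f d * (c f' * \<Gamma> f' e) * \<Gamma> f f')" for d e
  proof -
    have "(\<integral>x. B d x * B e x \<partial>M) = (\<integral>x. (\<Sum>f\<in>D. \<Sum>f'\<in>D. (c f * \<Gamma> f d * (c f' * \<Gamma> f' e)) * (\<Phi> f x * \<Phi> f' x)) \<partial>M)"
      by (simp add: B_def sum_product mult_ac)
    then show ?thesis by (simp only: double_sum_integral)
  qed
  have \<Gamma>_sym: "\<Gamma> d e = \<Gamma> e d" for d e by (simp add: \<Gamma>_def mult.commute)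
  have "ustat_kernel.G M H x y = (\<Sum>e\<in>D. (c e * B e x) * \<Phi> e y)" for x y
    unfolding G_eq B_def by (subst sum.swap) (simp add: sum_distrib_left sum_distrib_right mult_ac)
  then have "(\<integral>y. (ustat_kernel.G M H x y)\<^sup>2 \<partial>M) = (\<Sum>d\<in>D. \<Sum>e\<in>D. (c d * B d x) * (c e * B e x) * \<Gamma> d e)" for x
    by (simp only: sum_\<Phi>_power2)
  moreover have "(c d * B d x) * (c e * B e x) * \<Gamma> d e = (c d * c e * \<Gamma> d e) * (B d x * B e x)" for d e x by simp
  ultimately have "ustat_kernel.Gsq M H = (\<integral>x. (\<Sum>d\<in>D. \<Sum>e\<in>D. (c d * c e * \<Gamma> d e) * (B d x * B e x)) \<partial>M)"
    unfolding ustat_kernel.Gsq_def[OF ustat] by simp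
  also have "\<dots> = (\<Sum>d\<in>D. \<Sum>e\<in>D. (c d * c e * \<Gamma> d e) * (\<integral>x. B d x * B e x \<partial>M))"
    using Bi by (simp add: Bochner_Integration.integral_sum Bochner_Integration.integrable_sum)
  also have "\<dots> = (\<Sum>d\<in>D. \<Sum>e\<in>D. \<Sum>f\<in>D. \<Sum>f'\<in>D. (c d * c e * \<Gamma> d e) * (c f * \<Gamma> f d * (c f' * \<Gamma> f' e) * \<Gamma> f f'))"
    by (simp add: BB sum_distrib_left)
  \<comment> \<open>With \<open>d\<close> and \<open>f'\<close> outermost, the sums over
    \<open>e\<close> and \<open>f\<close> become two copies of the same matrix entry.\<close>
  also have "\<dots> = (\<Sum>d\<in>D. \<Sum>f'\<in>D. \<Sum>e\<in>D. \<Sum>f\<in>D. (c d * c e * \<Gamma> d e) * (c f * \<Gamma> f d * (c f' * \<Gamma> f' e) * \<Gamma> f f'))"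
  proof (rule sum.cong[OF refl])
    fix d
    have "(\<Sum>e\<in>D. \<Sum>f\<in>D. \<Sum>f'\<in>D. (c d * c e * \<Gamma> d e) * (c f * \<Gamma> f d * (c f' * \<Gamma> f' e) * \<Gamma> f f'))
      = (\<Sum>e\<in>D. \<Sum>f'\<in>D. \<Sum>f\<in>D. (c d * c e * \<Gamma> d e) * (c f * \<Gamma> f d * (c f' * \<Gamma> f' e) * \<Gamma> f f'))"
      by (intro sum.cong refl sum.swap)
    also have "\<dots> = (\<Sum>f'\<in>D. \<Sum>e\<in>D. \<Sum>f\<in>D. (c d * c e * \<Gamma> d e) * (c f * \<Gamma> f d * (c f' * \<Gamma> f' e) * \<Gamma> f f'))"
      by (rule sum.swap)
    finally show "(\<Sum>e\<in>D. \<Sum>f\<in>D. \<Sum>f'\<in>D. (c d * c e * \<Gamma> d e) * (c f * \<Gamma> f d * (c f' * \<Gamma> f' e) * \<Gamma> f f')) = \<dots>" .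
  qed
  also have "\<dots> = (\<Sum>d\<in>D. \<Sum>e\<in>D. c d * c e * (\<Sum>f\<in>D. c f * \<Gamma> d f * \<Gamma> f e)\<^sup>2)"
    unfolding power2_eq_square sum_product
    by (intro sum.cong refl) (simp add: sum_distrib_left \<Gamma>_sym[of _ d for d] mult_ac \<Gamma>_sym)
  finally show ?thesis .
qed

section \<open>Blocks of white noise\<close>

lemma prod_two:
  fixes a :: "'i \<Rightarrow> 'b::comm_monoid_mult"
  assumes "finite I" "i \<in> I" "j \<in> I" "i \<noteq> j" "\<And>l. l \<in> I \<Longrightarrow> l \<noteq> i \<Longrightarrow> l \<noteq> j \<Longrightarrow> a l = 1"
  shows "prod a I = a i * a j"
proof -
  have "prod a I = prod a {i, j}" by (rule prod.mono_neutral_right) (use assms in auto)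
  then show ?thesis using assms(4) by simp
qed

lemma sum_power4_le:
  fixes x :: "'i \<Rightarrow> real"
  shows "(\<Sum>i\<in>I. x i) ^ 4 \<le> real (card I) ^ 3 * (\<Sum>i\<in>I. x i ^ 4)"
proof -
  have cs: "(\<Sum>i\<in>I. y i)\<^sup>2 \<le> real (card I) * (\<Sum>i\<in>I. (y i)\<^sup>2)" for y :: "'i \<Rightarrow> real"
    using Cauchy_Schwarz_ineq_sum[of y "\<lambda>_. 1" I] by (simp add: mult.commute)
  have "(\<Sum>i\<in>I. x i) ^ 4 = ((\<Sum>i\<in>I. x i)\<^sup>2)\<^sup>2" by simp
  also have "\<dots> \<le> (real (card I) * (\<Sum>i\<in>I. (x i)\<^sup>2))\<^sup>2" by (intro power_mono cs) simp
  also have "\<dots> = (real (card I))\<^sup>2 * (\<Sum>i\<in>I. (x i)\<^sup>2)\<^sup>2" by (rule power_mult_distrib)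
  also have "\<dots> \<le> (real (card I))\<^sup>2 * (real (card I) * (\<Sum>i\<in>I. ((x i)\<^sup>2)\<^sup>2))" by (intro mult_left_mono cs) simp
  also have "\<dots> = real (card I) ^ 3 * (\<Sum>i\<in>I. x i ^ 4)" by (simp add: power2_eq_square[of "real (card I)"] power3_eq_cube)
  finally show ?thesis .
qed

lemma (in prob_space) Pow_prod_two:
  fixes f g :: "'a \<Rightarrow> real"
  assumes ij: "i < k" "j < k" "i \<noteq> j" and f: "integrable M f" and g: "integrable M g"
  shows "integrable (Pow_M k) (\<lambda>x. f (x i) * g (x j))" (is ?a)
    and "(\<integral>x. f (x i) * g (x j) \<partial>Pow_M k) = expectation f * expectation g" (is ?b)
proof -
  define F where "F l = (if l = i then f else if l = j then g else (\<lambda>_. 1))" for l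
  have F: "integrable M (F l)" for l using f g by (simp add: F_def)
  have eq: "f (x i) * g (x j) = (\<Prod>l<k. F l (x l))" for x
    using ij by (subst prod_two[of "{..<k}" i j]) (auto simp: F_def)
  interpret P: product_prob_space "\<lambda>_::nat. M" UNIV by unfold_locales
  show ?a unfolding eq by (rule P.product_integrable_prod) (use F in auto)
  have "(\<integral>x. f (x i) * g (x j) \<partial>PiM {..<k} (\<lambda>_. M)) = (\<Prod>l<k. integral\<^sup>L M (F l))"
    unfolding eq by (rule P.product_integral_prod) (use F in auto)
  also have "\<dots> = expectation f * expectation g"
    using ij by (subst prod_two[of "{..<k}" i j]) (auto simp: F_def prob_space)
  finally show ?b .
qed

text \<open>If the two ordered pairs differ, one of \<open>i\<close>, \<open>i'\<close> is missing
  from the other pair and its centered factor makes the integral vanish. The orderings exclude the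
  transposed match, in which the value would be another one.\<close>

lemma (in prob_space) Pow_pair_product:
  fixes f1 f2 f3 f4 :: "'a \<Rightarrow> real"
  assumes ij: "i < i'" "i' < k" "j < j'" "j' < k"
    and m: "f1 \<in> borel_measurable M" "f2 \<in> borel_measurable M" "f3 \<in> borel_measurable M" "f4 \<in> borel_measurable M"
    and int: "integrable M (\<lambda>x. (f1 x)\<^sup>2)" "integrable M (\<lambda>x. (f2 x)\<^sup>2)" "integrable M (\<lambda>x. (f3 x)\<^sup>2)" "integrable M (\<lambda>x. (f4 x)\<^sup>2)"
    and z: "expectation f1 = 0" "expectation f2 = 0"
  shows "(\<integral>x. (f1 (x i) * f2 (x i')) * (f3 (x j) * f4 (x j')) \<partial>Pow_M k) =
    (if i = j \<and> i' = j' then expectation (\<lambda>x. f1 x * f3 x) * expectation (\<lambda>x. f2 x * f4 x) else 0)"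
proof -
  define A where "A l = (if l = i then f1 else if l = i' then f2 else (\<lambda>_. 1))" for l
  define B where "B l = (if l = j then f3 else if l = j' then f4 else (\<lambda>_. 1))" for l
  have AB: "integrable M (\<lambda>x. A l x * B l x)" for l
    by (rule integrable_mult_L2) (use m int in \<open>auto simp: A_def B_def\<close>)
  have eqA: "f1 (x i) * f2 (x i') = (\<Prod>l<k. A l (x l))" for x
    using ij by (subst prod_two[of "{..<k}" i i']) (auto simp: A_def)
  have eqB: "f3 (x j) * f4 (x j') = (\<Prod>l<k. B l (x l))" for x
    using ij by (subst prod_two[of "{..<k}" j j']) (auto simp: B_def)
  interpret P: product_prob_space "\<lambda>_::nat. M" UNIV by unfold_locales
  have I: "(\<integral>x. (f1 (x i) * f2 (x i')) * (f3 (x j) * f4 (x j')) \<partial>PiM {..<k} (\<lambda>_. M)) = (\<Prod>l<k. \<integral>x. A l x * B l x \<partial>M)"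
    unfolding eqA eqB prod.distrib[symmetric] by (rule P.product_integral_prod) (use AB in auto)
  show ?thesis
  proof (cases "i = j \<and> i' = j'")
    case True
    have "(\<Prod>l<k. \<integral>x. A l x * B l x \<partial>M) = expectation (\<lambda>x. f1 x * f3 x) * expectation (\<lambda>x. f2 x * f4 x)"
      using ij True by (subst prod_two[of "{..<k}" i i']) (auto simp: A_def B_def prob_space)
    then show ?thesis using I True by simp
  next
    case False
    have "\<exists>l<k. (\<integral>x. A l x * B l x \<partial>M) = 0"
    proof (cases "i \<noteq> j \<and> i \<noteq> j'")
      case True
      then have "(\<integral>x. A i x * B i x \<partial>M) = 0" using z by (simp add: A_def B_def)
      then show ?thesis using ij by (intro exI[of _ i]) simp
    next
      case F: False
      then have "i' \<noteq> j \<and> i' \<noteq> j'" using False ij by auto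
      then have "(\<integral>x. A i' x * B i' x \<partial>M) = 0" using z ij by (simp add: A_def B_def)
      then show ?thesis using ij by (intro exI[of _ i']) simp
    qed
    then have "(\<Prod>l<k. \<integral>x. A l x * B l x \<partial>M) = 0" by (auto intro!: prod_zero)
    then show ?thesis using I by (simp only: if_not_P[OF False])
  qed
qed

text \<open>\<open>V\<close> is the law of one observation and \<open>y\<close> will be its
  standardised squared norm. Until the statistics are identified, only the first, second and fourth
  moments of \<open>y\<close> matter, so its relation to the coordinates is left open here.\<close>

locale noise = prob_space V for V :: "(nat \<Rightarrow> real) measure" +
  fixes p :: nat and S :: "nat \<Rightarrow> nat \<Rightarrow> real" and y :: "(nat \<Rightarrow> real) \<Rightarrow> real"
  assumes coord_meas: "\<And>i. i < p \<Longrightarrow> (\<lambda>u. u i) \<in> borel_measurable V"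
    and coord_int: "\<And>i. i < p \<Longrightarrow> integrable V (\<lambda>u. u i ^ 4)"
    and coord_mean: "\<And>i. i < p \<Longrightarrow> (\<integral>u. u i \<partial>V) = 0"
    and coord_cov: "\<And>i j. i < p \<Longrightarrow> j < p \<Longrightarrow> (\<integral>u. u i * u j \<partial>V) = S i j"
    and y_meas: "y \<in> borel_measurable V"
    and y_int: "integrable V (\<lambda>u. y u ^ 4)"
    and y_mean: "(\<integral>u. y u \<partial>V) = 0"
    and y_var: "(\<integral>u. (y u)\<^sup>2 \<partial>V) = 1"

definition (in noise) "y4 = (\<integral>u. y u ^ 4 \<partial>V)"
definition (in noise) "dot4 = (\<integral>u. (\<integral>v. dotp p u v ^ 4 \<partial>V) \<partial>V)"

section \<open>The kernel of a block and its exact moments\<close>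

definition block_h :: "((nat \<Rightarrow> real) \<Rightarrow> real) \<Rightarrow> nat \<Rightarrow> nat \<Rightarrow> (nat \<Rightarrow> real) \<Rightarrow> (nat \<Rightarrow> nat \<Rightarrow> real) \<Rightarrow> real" where
  "block_h y q L d Z = (\<Sum>\<tau>=1..q. \<Sum>i<L - \<tau>. d \<tau> * (y (Z i) * y (Z (i + \<tau>))))"

definition block_H :: "nat \<Rightarrow> nat \<Rightarrow> nat \<Rightarrow> (nat \<Rightarrow> real) \<Rightarrow> (nat \<Rightarrow> nat \<Rightarrow> real) \<Rightarrow> (nat \<Rightarrow> nat \<Rightarrow> real) \<Rightarrow> real" where
  "block_H p q L c Z W = (\<Sum>\<tau>=1..q. \<Sum>i<L - \<tau>. \<Sum>j<L - \<tau>. c \<tau> * (dotp p (Z i) (W j) * dotp p (Z (i + \<tau>)) (W (j + \<tau>))))"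

text \<open>The entry \<open>(a, b)\<close> of the unnormalised autocovariance matrix of a block at
  lag \<open>\<tau>\<close>, without the products that would leave the block.\<close>

definition block_\<Phi> :: "nat \<Rightarrow> nat \<times> nat \<times> nat \<Rightarrow> (nat \<Rightarrow> nat \<Rightarrow> real) \<Rightarrow> real" where
  "block_\<Phi> L = (\<lambda>(\<tau>, a, b) Z. \<Sum>i<L - \<tau>. Z i a * Z (i + \<tau>) b)"

definition block_D :: "nat \<Rightarrow> nat \<Rightarrow> (nat \<times> nat \<times> nat) set" where
  "block_D p q = {1..q} \<times> {..<p} \<times> {..<p}"

lemma sum_swap3:
  "(\<Sum>j\<in>J. \<Sum>a\<in>A. \<Sum>b\<in>B. f j a b) = (\<Sum>a\<in>A. \<Sum>b\<in>B. \<Sum>j\<in>J. f j a b)"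
proof -
  have "(\<Sum>j\<in>J. \<Sum>a\<in>A. \<Sum>b\<in>B. f j a b) = (\<Sum>a\<in>A. \<Sum>j\<in>J. \<Sum>b\<in>B. f j a b)" by (rule sum.swap)
  also have "\<dots> = (\<Sum>a\<in>A. \<Sum>b\<in>B. \<Sum>j\<in>J. f j a b)" by (intro sum.cong refl sum.swap)
  finally show ?thesis .
qed

lemma sum_block_D: "(\<Sum>d\<in>block_D p q. f d) = (\<Sum>\<tau>=1..q. \<Sum>a<p. \<Sum>b<p. f (\<tau>, a, b))"
  unfolding block_D_def by (simp add: sum.cartesian_product)

text \<open>A product of two inner products is the Frobenius inner product of two rank-one matrices.
  Summed over positions, the kernel becomes a weighted Frobenius inner product of the autocovariance
  matrices of the two blocks, hence of finite rank.\<close>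

lemma block_H_factor:
  "block_H p q L c Z W = (\<Sum>d\<in>block_D p q. c (fst d) * block_\<Phi> L d Z * block_\<Phi> L d W)"
proof -
  have "(\<Sum>i<m. \<Sum>j<m. c * (dotp p (Z i) (W j) * dotp p (Z (i + t)) (W (j + t))))
     = (\<Sum>a<p. \<Sum>b<p. c * (\<Sum>i<m. Z i a * Z (i + t) b) * (\<Sum>j<m. W j a * W (j + t) b))" for m t :: nat and c :: real
  proof -
    have "(\<Sum>i<m. \<Sum>j<m. c * (dotp p (Z i) (W j) * dotp p (Z (i + t)) (W (j + t))))
      = (\<Sum>i<m. \<Sum>j<m. \<Sum>a<p. \<Sum>b<p. c * ((Z i a * Z (i + t) b) * (W j a * W (j + t) b)))"
      unfolding dotp_def sum_product by (intro sum.cong refl) (simp add: sum_distrib_left mult_ac)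
    also have "\<dots> = (\<Sum>i<m. \<Sum>a<p. \<Sum>b<p. \<Sum>j<m. c * ((Z i a * Z (i + t) b) * (W j a * W (j + t) b)))"
      by (intro sum.cong refl sum_swap3)
    also have "\<dots> = (\<Sum>a<p. \<Sum>b<p. \<Sum>i<m. \<Sum>j<m. c * ((Z i a * Z (i + t) b) * (W j a * W (j + t) b)))"
      by (rule sum_swap3)
    also have "\<dots> = (\<Sum>a<p. \<Sum>b<p. c * (\<Sum>i<m. Z i a * Z (i + t) b) * (\<Sum>j<m. W j a * W (j + t) b))"
    proof (intro sum.cong refl)
      fix a b
      have "(\<Sum>i<m. \<Sum>j<m. c * ((Z i a * Z (i + t) b) * (W j a * W (j + t) b)))
        = c * (\<Sum>i<m. \<Sum>j<m. (Z i a * Z (i + t) b) * (W j a * W (j + t) b))" by (simp only: sum_distrib_left)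
      also have "\<dots> = c * ((\<Sum>i<m. Z i a * Z (i + t) b) * (\<Sum>j<m. W j a * W (j + t) b))" by (simp only: sum_product)
      finally show "(\<Sum>i<m. \<Sum>j<m. c * ((Z i a * Z (i + t) b) * (W j a * W (j + t) b)))
        = c * (\<Sum>i<m. Z i a * Z (i + t) b) * (\<Sum>j<m. W j a * W (j + t) b)" by (simp only: mult.assoc)
    qed
    finally show ?thesis .
  qed
  then show ?thesis unfolding block_H_def sum_block_D by (simp add: block_\<Phi>_def)
qed

lemma (in noise) coord_int2: "i < p \<Longrightarrow> integrable V (\<lambda>u. (u i)\<^sup>2)"
  by (rule integrable_L4_L2[OF coord_meas coord_int])

lemma (in noise) y_int2: "integrable V (\<lambda>u. (y u)\<^sup>2)"
  by (rule integrable_L4_L2[OF y_meas y_int])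

lemma (in noise) Pow_component_measurable: "l < n \<Longrightarrow> (\<lambda>Z. Z l) \<in> measurable (Pow_M n) V"
  by (intro measurable_component_singleton) simp

lemma (in noise) block_coord_measurable:
  "i < L \<Longrightarrow> a < p \<Longrightarrow> (\<lambda>Z. Z i a) \<in> borel_measurable (Pow_M L)"
  by (rule measurable_compose[OF Pow_component_measurable coord_meas])

lemma (in noise) block_y_measurable: "i < L \<Longrightarrow> (\<lambda>Z. y (Z i)) \<in> borel_measurable (Pow_M L)"
  by (rule measurable_compose[OF Pow_component_measurable y_meas])

lemma (in noise) pair_power4_int:
  assumes "i < L" "j < L" "i \<noteq> j" "integrable V (\<lambda>u. f u ^ 4)" "integrable V (\<lambda>u. g u ^ 4)"
  shows "integrable (Pow_M L) (\<lambda>Z. (f (Z i) * g (Z j) :: real) ^ 4)"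
  using Pow_prod_two(1)[of i L j "\<lambda>u. f u ^ 4" "\<lambda>u. g u ^ 4"] assms by (simp add: power_mult_distrib)

lemma (in noise) coord_pair_product:
  assumes "i < i'" "i' < L" "j < j'" "j' < L" "a < p" "b < p" "a' < p" "b' < p"
  shows "(\<integral>Z. (Z i a * Z i' b) * (Z j a' * Z j' b') \<partial>Pow_M L) = (if i = j \<and> i' = j' then S a a' * S b b' else 0)"
  using Pow_pair_product[of i i' L j j' "\<lambda>u. u a" "\<lambda>u. u b" "\<lambda>u. u a'" "\<lambda>u. u b'"] assms
  by (simp add: coord_meas coord_int2 coord_mean coord_cov)

lemma (in noise) y_pair_product:
  assumes "i < i'" "i' < L" "j < j'" "j' < L"
  shows "(\<integral>Z. (y (Z i) * y (Z i')) * (y (Z j) * y (Z j')) \<partial>Pow_M L) = (if i = j \<and> i' = j' then 1 else 0)"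
  using Pow_pair_product[of i i' L j j' y y y y] assms
  by (simp add: y_meas y_int2 y_mean y_var flip: power2_eq_square)

lemma (in noise) block_\<Phi>_measurable:
  "d \<in> block_D p q \<Longrightarrow> block_\<Phi> L d \<in> borel_measurable (Pow_M L)"
  unfolding block_\<Phi>_def block_D_def
  by (auto intro!: borel_measurable_sum borel_measurable_times block_coord_measurable)

lemma (in noise) block_\<Phi>_int:
  assumes d: "d \<in> block_D p q"
  shows "integrable (Pow_M L) (\<lambda>Z. block_\<Phi> L d Z ^ 4)"
proof -
  obtain \<tau> a b where [simp]: "d = (\<tau>, a, b)" and *: "\<tau> \<ge> 1" "a < p" "b < p" using d by (auto simp: block_D_def)
  have "integrable (Pow_M L) (\<lambda>Z. (\<Sum>i<L - \<tau>. Z i a * Z (i + \<tau>) b) ^ 4)"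
    using * coord_int
    by (intro integrable_power4_sum borel_measurable_times block_coord_measurable pair_power4_int[of _ L _ "\<lambda>u. u a" "\<lambda>u. u b"]) auto
  then show ?thesis by (simp add: block_\<Phi>_def)
qed

lemma (in noise) coord_int1: "i < p \<Longrightarrow> integrable V (\<lambda>u. u i)"
  by (rule integrable_L2_L1[OF coord_meas coord_int2])

lemma (in noise) y_int1: "integrable V y"
  by (rule integrable_L2_L1[OF y_meas y_int2])

lemma (in noise) block_\<Phi>_mean:
  assumes d: "d \<in> block_D p q"
  shows "(\<integral>Z. block_\<Phi> L d Z \<partial>Pow_M L) = 0"
proof -
  obtain \<tau> a b where [simp]: "d = (\<tau>, a, b)" and *: "\<tau> \<ge> 1" "a < p" "b < p" using d by (auto simp: block_D_def)
  have "(\<integral>Z. (\<Sum>i<L - \<tau>. Z i a * Z (i + \<tau>) b) \<partial>Pow_M L) = (\<Sum>i<L - \<tau>. \<integral>Z. Z i a * Z (i + \<tau>) b \<partial>Pow_M L)"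
    using * by (intro Bochner_Integration.integral_sum Pow_prod_two(1)[of _ L _ "\<lambda>u. u a" "\<lambda>u. u b"] coord_int1) auto
  also have "\<dots> = 0"
    using * by (intro sum.neutral ballI) (subst Pow_prod_two(2)[of _ L _ "\<lambda>u. u a" "\<lambda>u. u b"], auto simp: coord_int1 coord_mean)
  finally show ?thesis by (simp add: block_\<Phi>_def)
qed

lemma (in noise) block_h_measurable: "block_h y q L d \<in> borel_measurable (Pow_M L)"
  unfolding block_h_def
  by (intro borel_measurable_sum borel_measurable_times borel_measurable_const block_y_measurable) auto

lemma (in noise) block_h_term_int:
  assumes "\<tau> \<ge> 1" "i < L - \<tau>"
  shows "integrable (Pow_M L) (\<lambda>Z. (d * (y (Z i) * y (Z (i + \<tau>)))) ^ 4)"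
    "(\<integral>Z. (d * (y (Z i) * y (Z (i + \<tau>)))) ^ 4 \<partial>Pow_M L) = d ^ 4 * y4\<^sup>2"
  using assms Pow_prod_two[of i L "i + \<tau>" "\<lambda>u. y u ^ 4" "\<lambda>u. y u ^ 4"] y_int
  by (simp_all add: power_mult_distrib y4_def power2_eq_square)

lemma (in noise) block_h_int: "integrable (Pow_M L) (\<lambda>Z. block_h y q L d Z ^ 4)"
  unfolding block_h_def
  by (intro integrable_power4_sum block_h_term_int borel_measurable_sum borel_measurable_times borel_measurable_const block_y_measurable) auto

lemma (in noise) block_h_mean: "(\<integral>Z. block_h y q L d Z \<partial>Pow_M L) = 0"
proof -
  have i: "integrable (Pow_M L) (\<lambda>Z. y (Z i) * y (Z (i + \<tau>)))" and z: "(\<integral>Z. y (Z i) * y (Z (i + \<tau>)) \<partial>Pow_M L) = 0"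
    if "\<tau> \<ge> 1" "i < L - \<tau>" for \<tau> i
    using that Pow_prod_two[of i L "i + \<tau>" y y] y_int1 y_mean by auto
  have "(\<integral>Z. block_h y q L d Z \<partial>Pow_M L) = (\<Sum>\<tau>=1..q. \<integral>Z. (\<Sum>i<L - \<tau>. d \<tau> * (y (Z i) * y (Z (i + \<tau>)))) \<partial>Pow_M L)"
    unfolding block_h_def by (intro Bochner_Integration.integral_sum Bochner_Integration.integrable_sum integrable_mult_right i) auto
  also have "\<dots> = (\<Sum>\<tau>=1..q. \<Sum>i<L - \<tau>. \<integral>Z. d \<tau> * (y (Z i) * y (Z (i + \<tau>))) \<partial>Pow_M L)"
    by (intro sum.cong refl Bochner_Integration.integral_sum integrable_mult_right i) auto
  also have "\<dots> = 0" by (intro sum.neutral ballI) (auto simp: z)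
  finally show ?thesis .
qed

lemma (in noise) block_kernel:
  "finite_rank_kernel (Pow_M L) (block_D p q) (block_\<Phi> L) (block_h y q L d)"
proof -
  interpret P: prob_space "Pow_M L" by (rule prob_space_Pow)
  show ?thesis
    by unfold_locales (auto simp: block_D_def intro: block_\<Phi>_measurable block_\<Phi>_int block_\<Phi>_mean block_h_measurable block_h_int block_h_mean)
qed

lemma (in noise) block_kernel_H:
  "finite_rank_kernel.H (block_D p q) (\<lambda>d. c (fst d)) (block_\<Phi> L) = block_H p q L c"
  unfolding finite_rank_kernel.H_def[OF block_kernel] block_H_factor fun_eq_iff by simp

lemma (in noise) block_ustat: "ustat_kernel (Pow_M L) (block_H p q L c) (block_h y q L d)"
  using finite_rank_kernel.ustat[OF block_kernel, where c = "\<lambda>d. c (fst d)"] unfolding block_kernel_H .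

text \<open>Two products can correlate only if they sit at the same pair of positions, which forces
  equal lags. The Gram matrix is therefore block diagonal in the lag, with \<open>L - \<tau>\<close>
  times the Kronecker square of \<open>S\<close> in each block; the asymptotic independence of the
  lags originates here.\<close>

lemma (in noise) block_\<Gamma>:
  assumes "(\<tau>, a, b) \<in> block_D p q" "(\<tau>', a', b') \<in> block_D p q"
  shows "finite_rank_kernel.\<Gamma> (Pow_M L) (block_\<Phi> L) (\<tau>, a, b) (\<tau>', a', b') =
    (if \<tau> = \<tau>' then real (L - \<tau>) * (S a a' * S b b') else 0)"
proof -
  have *: "\<tau> \<ge> 1" "\<tau>' \<ge> 1" "a < p" "b < p" "a' < p" "b' < p" using assms by (auto simp: block_D_def)
  interpret P: prob_space "Pow_M L" by (rule prob_space_Pow)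
  have i: "integrable (Pow_M L) (\<lambda>Z. (Z i a * Z (i + \<tau>) b) * (Z j a' * Z (j + \<tau>') b'))" if "i < L - \<tau>" "j < L - \<tau>'" for i j
    using * that
    by (intro integrable_mult_L2 P.integrable_L4_L2 borel_measurable_times block_coord_measurable
      pair_power4_int[of _ L _ "\<lambda>u. u a" "\<lambda>u. u b"] pair_power4_int[of _ L _ "\<lambda>u. u a'" "\<lambda>u. u b'"] coord_int) auto
  have "finite_rank_kernel.\<Gamma> (Pow_M L) (block_\<Phi> L) (\<tau>, a, b) (\<tau>', a', b')
    = (\<integral>Z. (\<Sum>i<L - \<tau>. \<Sum>j<L - \<tau>'. (Z i a * Z (i + \<tau>) b) * (Z j a' * Z (j + \<tau>') b')) \<partial>Pow_M L)"
    unfolding finite_rank_kernel.\<Gamma>_def[OF block_kernel] by (simp add: block_\<Phi>_def sum_product)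
  also have "\<dots> = (\<Sum>i<L - \<tau>. \<integral>Z. (\<Sum>j<L - \<tau>'. (Z i a * Z (i + \<tau>) b) * (Z j a' * Z (j + \<tau>') b')) \<partial>Pow_M L)"
    by (intro Bochner_Integration.integral_sum Bochner_Integration.integrable_sum i) auto
  also have "\<dots> = (\<Sum>i<L - \<tau>. \<Sum>j<L - \<tau>'. \<integral>Z. (Z i a * Z (i + \<tau>) b) * (Z j a' * Z (j + \<tau>') b') \<partial>Pow_M L)"
    by (intro sum.cong refl Bochner_Integration.integral_sum i) auto
  also have "\<dots> = (\<Sum>i<L - \<tau>. \<Sum>j<L - \<tau>'. if i = j \<and> i + \<tau> = j + \<tau>' then S a a' * S b b' else 0)"
    using * by (intro sum.cong refl coord_pair_product) auto
  also have "\<dots> = (if \<tau> = \<tau>' then real (L - \<tau>) * (S a a' * S b b') else 0)"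
  proof (cases "\<tau> = \<tau>'")
    case True
    then have "(\<Sum>i<L - \<tau>. \<Sum>j<L - \<tau>'. if i = j \<and> i + \<tau> = j + \<tau>' then S a a' * S b b' else 0) =
      (\<Sum>i<L - \<tau>. \<Sum>j<L - \<tau>. if j = i then S a a' * S b b' else 0)" by (intro sum.cong refl) auto
    also have "\<dots> = (\<Sum>i<L - \<tau>. S a a' * S b b')" by (intro sum.cong refl) simp
    finally show ?thesis using True by simp
  qed (auto intro!: sum.neutral)
  finally show ?thesis .
qed

lemma sum_scaled_product:
  fixes k :: real
  shows "(\<Sum>a\<in>I. \<Sum>b\<in>I. k * (f a * f b)) = k * (\<Sum>a\<in>I. f a)\<^sup>2"
  unfolding power2_eq_square sum_product by (simp only: sum_distrib_left)

text \<open>Traces are multiplicative on Kronecker products, so each lag contributes the square of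
  tr(S^2).\<close>

lemma (in noise) block_H2:
  "ustat_kernel.H2 (Pow_M L) (block_H p q L c) = (\<Sum>\<tau>=1..q. (c \<tau> * real (L - \<tau>))\<^sup>2 * (\<Sum>a<p. \<Sum>b<p. (S a b)\<^sup>2)\<^sup>2)"
proof -
  let ?\<rho> = "\<Sum>a<p. \<Sum>b<p. (S a b)\<^sup>2"
  have "ustat_kernel.H2 (Pow_M L) (block_H p q L c) = (\<Sum>d\<in>block_D p q. \<Sum>e\<in>block_D p q.
      c (fst d) * c (fst e) * (finite_rank_kernel.\<Gamma> (Pow_M L) (block_\<Phi> L) d e)\<^sup>2)"
    using finite_rank_kernel.H2_eq[OF block_kernel, where c = "\<lambda>d. c (fst d)"] unfolding block_kernel_H .
  also have "\<dots> = (\<Sum>d\<in>block_D p q. \<Sum>e\<in>block_D p q. c (fst d) * c (fst e) *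
      (if fst d = fst e then real (L - fst d) * (S (fst (snd d)) (fst (snd e)) * S (snd (snd d)) (snd (snd e))) else 0)\<^sup>2)"
    by (intro sum.cong refl arg_cong2[of _ _ _ _ times] arg_cong[of _ _ "\<lambda>x. x\<^sup>2"]) (auto simp: block_\<Gamma>)
  also have "\<dots> = (\<Sum>\<tau>=1..q. \<Sum>a<p. \<Sum>b<p. \<Sum>\<tau>'=1..q. if \<tau>' = \<tau> then (c \<tau> * real (L - \<tau>))\<^sup>2 * (\<Sum>a'<p. \<Sum>b'<p. (S a a')\<^sup>2 * (S b b')\<^sup>2) else 0)"
    unfolding sum_block_D
    by (intro sum.cong refl) (auto simp: sum_distrib_left power_mult_distrib power2_eq_square mult_ac)
  also have "\<dots> = (\<Sum>\<tau>=1..q. \<Sum>a<p. \<Sum>b<p. (c \<tau> * real (L - \<tau>))\<^sup>2 * ((\<Sum>a'<p. (S a a')\<^sup>2) * (\<Sum>b'<p. (S b b')\<^sup>2)))"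
    by (intro sum.cong refl) (simp add: sum_product)
  also have "\<dots> = (\<Sum>\<tau>=1..q. (c \<tau> * real (L - \<tau>))\<^sup>2 * ?\<rho>\<^sup>2)"
    by (simp only: sum_scaled_product)
  finally show ?thesis .
qed

text \<open>The same computation one power higher: each lag contributes the square of tr(S^4), which
  for symmetric \<open>S\<close> is the sum of the squared entries of its square.\<close>

lemma (in noise) block_Gsq:
  "ustat_kernel.Gsq (Pow_M L) (block_H p q L c) =
    (\<Sum>\<tau>=1..q. (c \<tau> * real (L - \<tau>)) ^ 4 * (\<Sum>a<p. \<Sum>b<p. (\<Sum>k<p. S a k * S k b)\<^sup>2)\<^sup>2)"
proof -
  let ?T = "\<lambda>a b. \<Sum>k<p. S a k * S k b"
  let ?\<rho> = "\<Sum>a<p. \<Sum>b<p. (?T a b)\<^sup>2"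
  let ?g = "finite_rank_kernel.\<Gamma> (Pow_M L) (block_\<Phi> L)"
  have inner: "(\<Sum>f\<in>block_D p q. c (fst f) * ?g d f * ?g f e) =
      (if fst d = fst e then c (fst d) * (real (L - fst d))\<^sup>2 * (?T (fst (snd d)) (fst (snd e)) * ?T (snd (snd d)) (snd (snd e))) else 0)"
    if de: "d \<in> block_D p q" "e \<in> block_D p q" for d e
  proof -
    obtain \<tau> a b \<tau>' a' b' where [simp]: "d = (\<tau>, a, b)" "e = (\<tau>', a', b')" by (metis surj_pair)
    have \<tau>: "\<tau> \<in> {1..q}" using de by (simp add: block_D_def)
    have "(\<Sum>f\<in>block_D p q. c (fst f) * ?g d f * ?g f e) =
      (\<Sum>f\<in>block_D p q. c (fst f) * (if \<tau> = fst f then real (L - \<tau>) * (S a (fst (snd f)) * S b (snd (snd f))) else 0)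
        * (if fst f = \<tau>' then real (L - fst f) * (S (fst (snd f)) a' * S (snd (snd f)) b') else 0))"
      using de by (intro sum.cong refl arg_cong2[of _ _ _ _ times]) (auto simp: block_\<Gamma>)
    also have "\<dots> = (\<Sum>t=1..q. if t = \<tau> then (if \<tau> = \<tau>' then c \<tau> * (real (L - \<tau>))\<^sup>2 * (\<Sum>k<p. \<Sum>l<p. (S a k * S k a') * (S b l * S l b')) else 0) else 0)"
      unfolding sum_block_D
      by (intro sum.cong refl) (auto simp: sum_distrib_left power2_eq_square mult_ac)
    also have "\<dots> = (if \<tau> = \<tau>' then c \<tau> * (real (L - \<tau>))\<^sup>2 * (?T a a' * ?T b b') else 0)"
      using \<tau> by (simp add: sum_product)
    finally show ?thesis by simp
  qed
  have "ustat_kernel.Gsq (Pow_M L) (block_H p q L c) = (\<Sum>d\<in>block_D p q. \<Sum>e\<in>block_D p q.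
      c (fst d) * c (fst e) * (\<Sum>f\<in>block_D p q. c (fst f) * ?g d f * ?g f e)\<^sup>2)"
    using finite_rank_kernel.Gsq_eq[OF block_kernel, where c = "\<lambda>d. c (fst d)"] unfolding block_kernel_H .
  also have "\<dots> = (\<Sum>d\<in>block_D p q. \<Sum>e\<in>block_D p q. c (fst d) * c (fst e) *
      (if fst d = fst e then c (fst d) * (real (L - fst d))\<^sup>2 * (?T (fst (snd d)) (fst (snd e)) * ?T (snd (snd d)) (snd (snd e))) else 0)\<^sup>2)"
    by (intro sum.cong refl) (simp only: inner)
  also have "\<dots> = (\<Sum>\<tau>=1..q. \<Sum>a<p. \<Sum>b<p. \<Sum>\<tau>'=1..q. if \<tau>' = \<tau> then (c \<tau> * real (L - \<tau>)) ^ 4 * (\<Sum>a'<p. \<Sum>b'<p. (?T a a')\<^sup>2 * (?T b b')\<^sup>2) else 0)"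
  proof -
    have "c \<tau> * c \<tau>' * (if \<tau> = \<tau>' then c \<tau> * (real (L - \<tau>))\<^sup>2 * (x * z) else 0)\<^sup>2
      = (if \<tau>' = \<tau> then (c \<tau> * real (L - \<tau>)) ^ 4 * (x\<^sup>2 * z\<^sup>2) else 0)" for \<tau> \<tau>' and x z :: real
      by (simp add: power2_eq_square power4_eq_xxxx)
    then show ?thesis
      by (simp only: sum_block_D fst_conv snd_conv) (intro sum.cong refl, simp add: sum_distrib_left)
  qed
  also have "\<dots> = (\<Sum>\<tau>=1..q. \<Sum>a<p. \<Sum>b<p. (c \<tau> * real (L - \<tau>)) ^ 4 * ((\<Sum>a'<p. (?T a a')\<^sup>2) * (\<Sum>b'<p. (?T b b')\<^sup>2)))"
    by (intro sum.cong refl) (simp add: sum_product)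
  also have "\<dots> = (\<Sum>\<tau>=1..q. (c \<tau> * real (L - \<tau>)) ^ 4 * ?\<rho>\<^sup>2)"
    by (simp only: sum_scaled_product)
  finally show ?thesis .
qed

lemma (in noise) block_h2: "ustat_kernel.h2 (Pow_M L) (block_h y q L d) = (\<Sum>\<tau>=1..q. (d \<tau>)\<^sup>2 * real (L - \<tau>))"
proof -
  interpret P: prob_space "Pow_M L" by (rule prob_space_Pow)
  define I where "I = (SIGMA \<tau>:{1..q}. {..<L - \<tau>})"
  define Y where "Y x Z = y (Z (snd x)) * y (Z (snd x + fst x))" for x :: "nat \<times> nat" and Z :: "nat \<Rightarrow> nat \<Rightarrow> real"
  have h: "block_h y q L d Z = (\<Sum>x\<in>I. d (fst x) * Y x Z)" for Z
    unfolding block_h_def I_def by (subst sum.Sigma) (auto simp: Y_def case_prod_unfold)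
  have Yi: "integrable (Pow_M L) (\<lambda>Z. Y x Z * Y x' Z)" if "x \<in> I" "x' \<in> I" for x x'
    using that unfolding Y_def I_def
    by (intro integrable_mult_L2 P.integrable_L4_L2 borel_measurable_times block_y_measurable pair_power4_int y_int) auto
  have YE: "(\<integral>Z. Y x Z * Y x' Z \<partial>Pow_M L) = (if x' = x then 1 else 0)" if "x \<in> I" "x' \<in> I" for x x'
    using that unfolding Y_def I_def by (subst y_pair_product) (auto simp: prod_eq_iff)
  have "ustat_kernel.h2 (Pow_M L) (block_h y q L d) = (\<integral>Z. (\<Sum>x\<in>I. \<Sum>x'\<in>I. (d (fst x) * d (fst x')) * (Y x Z * Y x' Z)) \<partial>Pow_M L)"
    unfolding ustat_kernel.h2_def[OF block_ustat] h by (simp add: power2_eq_square sum_product mult_ac)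
  also have "\<dots> = (\<Sum>x\<in>I. \<integral>Z. (\<Sum>x'\<in>I. (d (fst x) * d (fst x')) * (Y x Z * Y x' Z)) \<partial>Pow_M L)"
    by (intro Bochner_Integration.integral_sum Bochner_Integration.integrable_sum integrable_mult_right Yi)
  also have "\<dots> = (\<Sum>x\<in>I. \<Sum>x'\<in>I. \<integral>Z. (d (fst x) * d (fst x')) * (Y x Z * Y x' Z) \<partial>Pow_M L)"
    by (intro sum.cong refl Bochner_Integration.integral_sum integrable_mult_right Yi)
  also have "\<dots> = (\<Sum>x\<in>I. \<Sum>x'\<in>I. if x' = x then (d (fst x))\<^sup>2 else 0)"
    by (intro sum.cong refl) (auto simp: YE power2_eq_square)
  also have "\<dots> = (\<Sum>x\<in>I. (d (fst x))\<^sup>2)"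
    by (intro sum.cong refl) (simp add: I_def)
  also have "\<dots> = (\<Sum>\<tau>=1..q. \<Sum>i<L - \<tau>. (d \<tau>)\<^sup>2)"
    unfolding I_def by (subst sum.Sigma) (auto simp: case_prod_unfold)
  finally show ?thesis by (simp add: mult.commute)
qed

text \<open>\<open>q\<close> and \<open>L\<close> stay fixed in the limit, so a crude power-mean
  bound over at most \<open>q * L\<close> products suffices. Each product has two independent
  factors, whence the square of \<open>y4\<close>.\<close>

lemma (in noise) block_h4:
  assumes d: "\<And>\<tau>. \<tau> \<in> {1..q} \<Longrightarrow> \<bar>d \<tau>\<bar> \<le> \<delta>"
  shows "ustat_kernel.h4 (Pow_M L) (block_h y q L d) \<le> (real q * real L) ^ 4 * \<delta> ^ 4 * y4\<^sup>2"
proof -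
  define I where "I = (SIGMA \<tau>:{1..q}. {..<L - \<tau>})"
  define Y where "Y x Z = d (fst x) * (y (Z (snd x)) * y (Z (snd x + fst x)))" for x :: "nat \<times> nat" and Z :: "nat \<Rightarrow> nat \<Rightarrow> real"
  have h: "block_h y q L d Z = (\<Sum>x\<in>I. Y x Z)" for Z
    unfolding block_h_def I_def by (subst sum.Sigma) (auto simp: Y_def case_prod_unfold)
  have Y: "integrable (Pow_M L) (\<lambda>Z. Y x Z ^ 4)" "(\<integral>Z. Y x Z ^ 4 \<partial>Pow_M L) = d (fst x) ^ 4 * y4\<^sup>2" if "x \<in> I" for x
    using that unfolding Y_def I_def by (auto intro!: block_h_term_int)
  have card: "card I \<le> q * L"
  proof -
    have "card I = (\<Sum>\<tau>=1..q. L - \<tau>)" by (simp add: I_def)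
    also have "\<dots> \<le> (\<Sum>\<tau>=1..q. L)" by (intro sum_mono) simp
    finally show ?thesis by simp
  qed
  have "ustat_kernel.h4 (Pow_M L) (block_h y q L d) = (\<integral>Z. (\<Sum>x\<in>I. Y x Z) ^ 4 \<partial>Pow_M L)"
    unfolding ustat_kernel.h4_def[OF block_ustat] h ..
  also have "\<dots> \<le> (\<integral>Z. real (card I) ^ 3 * (\<Sum>x\<in>I. Y x Z ^ 4) \<partial>Pow_M L)"
    using Y(1) block_h_int[of L q d] unfolding h by (intro integral_mono sum_power4_le) auto
  also have "\<dots> = real (card I) ^ 3 * (\<Sum>x\<in>I. d (fst x) ^ 4 * y4\<^sup>2)"
    using Y by (simp add: Bochner_Integration.integral_sum)
  also have "\<dots> \<le> real (card I) ^ 3 * (\<Sum>x\<in>I. \<delta> ^ 4 * y4\<^sup>2)"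
  proof (intro mult_left_mono sum_mono mult_right_mono)
    fix x assume "x \<in> I"
    then have "\<bar>d (fst x)\<bar> ^ 4 \<le> \<delta> ^ 4" using d by (intro power_mono) (auto simp: I_def)
    then show "d (fst x) ^ 4 \<le> \<delta> ^ 4" by simp
  qed auto
  also have "\<dots> = real (card I) ^ 4 * (\<delta> ^ 4 * y4\<^sup>2)" by (simp add: power4_eq_xxxx power3_eq_cube)
  also have "\<dots> \<le> (real q * real L) ^ 4 * (\<delta> ^ 4 * y4\<^sup>2)"
    using card by (intro mult_right_mono power_mono) (auto simp flip: of_nat_mult)
  finally show ?thesis by (simp add: mult.assoc)
qed

lemma (in noise) dotp_measurable:
  assumes "a \<in> measurable N V" "b \<in> measurable N V"
  shows "(\<lambda>w. dotp p (a w) (b w)) \<in> borel_measurable N"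
  unfolding dotp_def
  by (intro borel_measurable_sum borel_measurable_times measurable_compose[OF assms(1) coord_meas] measurable_compose[OF assms(2) coord_meas]) auto

lemma (in noise) dotp_power4_int: "u \<in> space V \<Longrightarrow> integrable V (\<lambda>v. dotp p u v ^ 4)"
  unfolding dotp_def using coord_int coord_meas by (intro integrable_power4_sum) (auto simp: power_mult_distrib)

lemma (in noise) dotp_power4_int_pair: "integrable (V \<Otimes>\<^sub>M V) (\<lambda>w. dotp p (fst w) (snd w) ^ 4)"
  unfolding dotp_def
proof (rule integrable_power4_sum)
  fix i assume "i \<in> {..<p}"
  then have i: "i < p" by simp
  have m: "(\<lambda>w. fst w i) \<in> borel_measurable (V \<Otimes>\<^sub>M V)" "(\<lambda>w. snd w i) \<in> borel_measurable (V \<Otimes>\<^sub>M V)"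
    by (rule measurable_compose[OF measurable_fst coord_meas[OF i]], rule measurable_compose[OF measurable_snd coord_meas[OF i]])
  then show "(\<lambda>w. fst w i * snd w i) \<in> borel_measurable (V \<Otimes>\<^sub>M V)" by simp
  interpret P: pair_prob_space V V ..
  have "integrable (V \<Otimes>\<^sub>M V) (\<lambda>w. fst w i ^ 4 * snd w i ^ 4)"
  proof (rule P.Fubini_integrable)
    show "(\<lambda>w. fst w i ^ 4 * snd w i ^ 4) \<in> borel_measurable (V \<Otimes>\<^sub>M V)" using m by simp
    show "integrable V (\<lambda>u. \<integral>v. norm (fst (u, v) i ^ 4 * snd (u, v) i ^ 4) \<partial>V)" using coord_int[OF i] by simp
    show "AE u in V. integrable V (\<lambda>v. fst (u, v) i ^ 4 * snd (u, v) i ^ 4)" using coord_int[OF i] by simp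
  qed
  then show "integrable (V \<Otimes>\<^sub>M V) (\<lambda>w. (fst w i * snd w i) ^ 4)" by (simp add: power_mult_distrib)
qed simp

lemma (in noise) dot4_int: "integrable V (\<lambda>u. \<integral>v. dotp p u v ^ 4 \<partial>V)"
proof -
  interpret P: pair_prob_space V V ..
  show ?thesis using P.integrable_fst'[OF dotp_power4_int_pair] by simp
qed

text \<open>Power means over at most \<open>q * L^2\<close> products. For fixed \<open>Z\<close> the
  two inner products read different components of \<open>W\<close>, so their fourth moments factor;
  afterwards they factor once more in the two components of \<open>Z\<close>. This yields the square
  of \<open>dot4\<close>.\<close>

lemma (in noise) block_H4:
  assumes c: "\<And>\<tau>. \<tau> \<in> {1..q} \<Longrightarrow> \<bar>c \<tau>\<bar> \<le> \<delta>"
  shows "ustat_kernel.H4 (Pow_M L) (block_H p q L c) \<le> (real q * (real L)\<^sup>2) ^ 4 * \<delta> ^ 4 * dot4\<^sup>2"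
proof -
  interpret U: ustat_kernel "Pow_M L" "block_H p q L c" "block_h y q L c" by (rule block_ustat)
  define I where "I = (SIGMA \<tau>:{1..q}. {..<L - \<tau>} \<times> {..<L - \<tau>})"
  define Y where "Y = (\<lambda>(\<tau>, i, j) Z W. c \<tau> * (dotp p (Z i) (W j) * dotp p (Z (i + \<tau>)) (W (j + \<tau>))))"
  have H: "block_H p q L c Z W = (\<Sum>x\<in>I. Y x Z W)" for Z W
  proof -
    have "(\<Sum>x\<in>I. Y x Z W) = (\<Sum>\<tau>=1..q. \<Sum>x\<in>{..<L - \<tau>} \<times> {..<L - \<tau>}. Y (\<tau>, x) Z W)"
      unfolding I_def by (subst sum.Sigma) (auto simp: case_prod_unfold)
    also have "\<dots> = block_H p q L c Z W"
      by (simp add: block_H_def Y_def sum.cartesian_product case_prod_unfold)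
    finally show ?thesis by simp
  qed
  let ?k = "\<lambda>u. \<integral>v. dotp p u v ^ 4 \<partial>V"
  have Y1: "integrable (Pow_M L) (\<lambda>W. Y x Z W ^ 4)"
    "(\<integral>W. Y x Z W ^ 4 \<partial>Pow_M L) = c (fst x) ^ 4 * (?k (Z (fst (snd x))) * ?k (Z (fst (snd x) + fst x)))"
    if x: "x \<in> I" and Z: "Z \<in> space (Pow_M L)" for x Z
  proof -
    obtain \<tau> i j where [simp]: "x = (\<tau>, i, j)" by (metis surj_pair)
    have *: "\<tau> \<ge> 1" "i < L - \<tau>" "j < L - \<tau>" using x by (auto simp: I_def)
    have "Z i \<in> space V" "Z (i + \<tau>) \<in> space V" using * space_Pow[OF Z] by auto
    note PP = Pow_prod_two[OF _ _ _ dotp_power4_int[OF this(1)] dotp_power4_int[OF this(2)], of j L "j + \<tau>"]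
    show "integrable (Pow_M L) (\<lambda>W. Y x Z W ^ 4)" using * PP(1) by (simp add: Y_def power_mult_distrib)
    show "(\<integral>W. Y x Z W ^ 4 \<partial>Pow_M L) = c (fst x) ^ 4 * (?k (Z (fst (snd x))) * ?k (Z (fst (snd x) + fst x)))"
      using * PP(2) by (simp add: Y_def power_mult_distrib)
  qed
  have Y2: "integrable (Pow_M L) (\<lambda>Z. c (fst x) ^ 4 * (?k (Z (fst (snd x))) * ?k (Z (fst (snd x) + fst x))))"
    "(\<integral>Z. c (fst x) ^ 4 * (?k (Z (fst (snd x))) * ?k (Z (fst (snd x) + fst x))) \<partial>Pow_M L) = c (fst x) ^ 4 * dot4\<^sup>2" if x: "x \<in> I" for x
  proof -
    obtain \<tau> i j where [simp]: "x = (\<tau>, i, j)" by (metis surj_pair)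
    have *: "\<tau> \<ge> 1" "i < L - \<tau>" using x by (auto simp: I_def)
    note PP = Pow_prod_two[OF _ _ _ dot4_int dot4_int, of i L "i + \<tau>"]
    show "integrable (Pow_M L) (\<lambda>Z. c (fst x) ^ 4 * (?k (Z (fst (snd x))) * ?k (Z (fst (snd x) + fst x))))"
      using * PP(1) by simp
    show "(\<integral>Z. c (fst x) ^ 4 * (?k (Z (fst (snd x))) * ?k (Z (fst (snd x) + fst x))) \<partial>Pow_M L) = c (fst x) ^ 4 * dot4\<^sup>2"
      using * PP(2) by (simp add: dot4_def power2_eq_square)
  qed
  have card: "card I \<le> q * L\<^sup>2"
  proof -
    have "card I = (\<Sum>\<tau>=1..q. (L - \<tau>) * (L - \<tau>))" by (simp add: I_def)
    also have "\<dots> \<le> (\<Sum>\<tau>=1..q. L * L)" by (intro sum_mono mult_mono) auto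
    finally show ?thesis by (simp add: power2_eq_square)
  qed
  have "U.H4 \<le> (\<integral>Z. real (card I) ^ 3 * (\<Sum>x\<in>I. c (fst x) ^ 4 * (?k (Z (fst (snd x))) * ?k (Z (fst (snd x) + fst x)))) \<partial>Pow_M L)"
    unfolding U.H4_def
  proof (rule integral_mono[OF U.H4_int])
    show "integrable (Pow_M L) (\<lambda>Z. real (card I) ^ 3 * (\<Sum>x\<in>I. c (fst x) ^ 4 * (?k (Z (fst (snd x))) * ?k (Z (fst (snd x) + fst x)))))"
      by (intro integrable_mult_right Bochner_Integration.integrable_sum Y2)
    fix Z assume Z: "Z \<in> space (Pow_M L)"
    have "(\<integral>W. block_H p q L c Z W ^ 4 \<partial>Pow_M L) \<le> (\<integral>W. real (card I) ^ 3 * (\<Sum>x\<in>I. Y x Z W ^ 4) \<partial>Pow_M L)"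
    proof (rule integral_mono)
      show "integrable (Pow_M L) (\<lambda>W. block_H p q L c Z W ^ 4)" by (rule U.H_int[OF Z])
      show "integrable (Pow_M L) (\<lambda>W. real (card I) ^ 3 * (\<Sum>x\<in>I. Y x Z W ^ 4))"
        by (intro integrable_mult_right Bochner_Integration.integrable_sum Y1 Z)
    qed (simp only: H sum_power4_le)
    also have "\<dots> = real (card I) ^ 3 * (\<Sum>x\<in>I. \<integral>W. Y x Z W ^ 4 \<partial>Pow_M L)"
      using Y1(1)[OF _ Z] by (simp add: Bochner_Integration.integral_sum)
    finally show "(\<integral>W. block_H p q L c Z W ^ 4 \<partial>Pow_M L) \<le> real (card I) ^ 3 * (\<Sum>x\<in>I. c (fst x) ^ 4 * (?k (Z (fst (snd x))) * ?k (Z (fst (snd x) + fst x))))"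
      by (simp add: Y1(2)[OF _ Z])
  qed
  also have "\<dots> = real (card I) ^ 3 * (\<Sum>x\<in>I. c (fst x) ^ 4 * dot4\<^sup>2)"
  proof -
    have "(\<integral>Z. (\<Sum>x\<in>I. c (fst x) ^ 4 * (?k (Z (fst (snd x))) * ?k (Z (fst (snd x) + fst x)))) \<partial>Pow_M L)
      = (\<Sum>x\<in>I. \<integral>Z. c (fst x) ^ 4 * (?k (Z (fst (snd x))) * ?k (Z (fst (snd x) + fst x))) \<partial>Pow_M L)"
      by (intro Bochner_Integration.integral_sum Y2)
    also have "\<dots> = (\<Sum>x\<in>I. c (fst x) ^ 4 * dot4\<^sup>2)" by (intro sum.cong refl Y2)
    finally show ?thesis by (simp only: integral_mult_right_zero)
  qed
  also have "\<dots> \<le> real (card I) ^ 3 * (\<Sum>x\<in>I. \<delta> ^ 4 * dot4\<^sup>2)"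
  proof (intro mult_left_mono sum_mono mult_right_mono)
    fix x assume "x \<in> I"
    then have "\<bar>c (fst x)\<bar> ^ 4 \<le> \<delta> ^ 4" using c by (intro power_mono) (auto simp: I_def)
    then show "c (fst x) ^ 4 \<le> \<delta> ^ 4" by simp
  qed auto
  also have "\<dots> = real (card I) ^ 4 * (\<delta> ^ 4 * dot4\<^sup>2)" by (simp add: power4_eq_xxxx power3_eq_cube)
  also have "\<dots> \<le> (real q * (real L)\<^sup>2) ^ 4 * (\<delta> ^ 4 * dot4\<^sup>2)"
    using card by (intro mult_right_mono power_mono) (auto simp flip: of_nat_mult of_nat_power)
  finally show ?thesis by (simp add: mult.assoc)
qed

section \<open>Second moments of lagged sums over the whole sample\<close>

lemma (in prob_space) PiM_two_components:
  assumes I: "t \<in> I" "s \<in> I" "t \<noteq> s"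
  shows "distr (PiM I (\<lambda>_. M)) (M \<Otimes>\<^sub>M M) (\<lambda>x. (x t, x s)) = M \<Otimes>\<^sub>M M"
proof (rule pair_measure_eqI[symmetric])
  show "sigma_finite_measure M" "sigma_finite_measure M" by unfold_locales
  have m: "(\<lambda>x. (x t, x s)) \<in> measurable (PiM I (\<lambda>_. M)) (M \<Otimes>\<^sub>M M)"
    using I by (intro measurable_Pair measurable_component_singleton)
  interpret P: product_prob_space "\<lambda>_. M" I by unfold_locales
  fix A B assume AB: "A \<in> sets M" "B \<in> sets M"
  have "(\<lambda>x. (x t, x s)) -` (A \<times> B) \<inter> space (PiM I (\<lambda>_. M)) = {x \<in> space (PiM I (\<lambda>_. M)). \<forall>i\<in>{t, s}. x i \<in> (if i = t then A else B)}"
    using I by auto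
  then have "emeasure (distr (PiM I (\<lambda>_. M)) (M \<Otimes>\<^sub>M M) (\<lambda>x. (x t, x s))) (A \<times> B)
    = emeasure (PiM I (\<lambda>_. M)) {x \<in> space (PiM I (\<lambda>_. M)). \<forall>i\<in>{t, s}. x i \<in> (if i = t then A else B)}"
    using AB m by (subst emeasure_distr) auto
  also have "\<dots> = (\<Prod>i\<in>{t, s}. emeasure M (if i = t then A else B))"
    using I AB by (subst P.emeasure_PiM_Collect) auto
  finally show "emeasure M A * emeasure M B = emeasure (distr (PiM I (\<lambda>_. M)) (M \<Otimes>\<^sub>M M) (\<lambda>x. (x t, x s))) (A \<times> B)"
    using I by simp
qed simp

lemma (in prob_space) PiM_two_integral:
  fixes f :: "'a \<Rightarrow> 'a \<Rightarrow> real"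
  assumes I: "t \<in> I" "s \<in> I" "t \<noteq> s" and f: "integrable (M \<Otimes>\<^sub>M M) (\<lambda>w. f (fst w) (snd w))"
  shows "integrable (PiM I (\<lambda>_. M)) (\<lambda>x. f (x t) (x s))"
    "(\<integral>x. f (x t) (x s) \<partial>PiM I (\<lambda>_. M)) = (\<integral>u. (\<integral>v. f u v \<partial>M) \<partial>M)"
proof -
  have m: "(\<lambda>x. (x t, x s)) \<in> measurable (PiM I (\<lambda>_. M)) (M \<Otimes>\<^sub>M M)"
    using I by (intro measurable_Pair measurable_component_singleton)
  have d: "distr (PiM I (\<lambda>_. M)) (M \<Otimes>\<^sub>M M) (\<lambda>x. (x t, x s)) = M \<Otimes>\<^sub>M M" by (rule PiM_two_components[OF I])
  have fm: "(\<lambda>w. f (fst w) (snd w)) \<in> borel_measurable (M \<Otimes>\<^sub>M M)" using f by (rule borel_measurable_integrable)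
  show "integrable (PiM I (\<lambda>_. M)) (\<lambda>x. f (x t) (x s))"
    using integrable_distr_eq[OF m fm] f unfolding d by simp
  have "(\<integral>x. f (x t) (x s) \<partial>PiM I (\<lambda>_. M)) = (\<integral>w. f (fst w) (snd w) \<partial>(M \<Otimes>\<^sub>M M))"
    using integral_distr[OF m fm] unfolding d by simp
  also have "\<dots> = (\<integral>u. (\<integral>v. f u v \<partial>M) \<partial>M)"
  proof -
    interpret P: pair_prob_space M M ..
    show ?thesis using P.integral_fst'[OF f] by simp
  qed
  finally show "(\<integral>x. f (x t) (x s) \<partial>PiM I (\<lambda>_. M)) = (\<integral>u. (\<integral>v. f u v \<partial>M) \<partial>M)" .
qed

text \<open>All orthogonality relations over the sample are reduced to a single time index in which
  the integrand is linear.\<close>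

lemma (in prob_space) PiM_integral_zero:
  fixes F :: "('i \<Rightarrow> 'a) \<Rightarrow> real"
  assumes I: "finite I" "u \<in> I" and F: "integrable (PiM I (\<lambda>_. M)) F"
    and z: "\<And>x. x \<in> space (PiM (I - {u}) (\<lambda>_. M)) \<Longrightarrow> (\<integral>v. F (x(u := v)) \<partial>M) = 0"
  shows "(\<integral>x. F x \<partial>PiM I (\<lambda>_. M)) = 0"
proof -
  interpret P: product_prob_space "\<lambda>_. M" I by unfold_locales
  have ins: "insert u (I - {u}) = I" using I by auto
  have "(\<integral>x. F x \<partial>PiM I (\<lambda>_. M)) = (\<integral>x. (\<integral>v. F (x(u := v)) \<partial>M) \<partial>PiM (I - {u}) (\<lambda>_. M))"
    by (rule P.product_integral_insert[of "I - {u}" u F, unfolded ins, OF _ _ F]) (use I in auto)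
  also have "\<dots> = (\<integral>x. 0 \<partial>PiM (I - {u}) (\<lambda>_. M))" by (intro Bochner_Integration.integral_cong refl z)
  finally show ?thesis by simp
qed

text \<open>What the variance bounds need from the circular shift: a permutation of the times
  without cycles of length 1 or 2. The condition \<open>2 * \<tau> < n\<close> excludes cycles of
  length 2.\<close>

locale shift_map =
  fixes n :: nat and c :: "nat \<Rightarrow> nat"
  assumes c_range: "\<And>t. t \<in> {1..n} \<Longrightarrow> c t \<in> {1..n}"
    and c_inj: "\<And>t s. t \<in> {1..n} \<Longrightarrow> s \<in> {1..n} \<Longrightarrow> c t = c s \<Longrightarrow> t = s"
    and c_neq: "\<And>t. t \<in> {1..n} \<Longrightarrow> c t \<noteq> t"
    and cc_neq: "\<And>t. t \<in> {1..n} \<Longrightarrow> c (c t) \<noteq> t"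

lemma shift_map_circ:
  assumes "\<tau> \<ge> 1" "2 * \<tau> < n"
  shows "shift_map n (\<lambda>t. circ n (t + \<tau>))"
  by unfold_locales (use assms in \<open>auto simp: circ_def split: if_splits\<close>)

locale shifted_noise = noise V p S y + shift_map n c for V p S y n c

abbreviation (in shifted_noise) "Q \<equiv> PiM {1..n} (\<lambda>_. V)"

definition (in shifted_noise) B :: "nat \<times> nat \<Rightarrow> (nat \<Rightarrow> nat \<Rightarrow> real) \<Rightarrow> real" where
  "B ts x = dotp p (x (fst ts)) (x (snd ts)) * dotp p (x (c (fst ts))) (x (c (snd ts)))"

definition off_diag :: "nat \<Rightarrow> (nat \<times> nat) set" where
  "off_diag n = {(t, s). t \<in> {1..n} \<and> s \<in> {1..n} \<and> t \<noteq> s}"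

lemma (in shifted_noise) prob_space_Q: "prob_space Q"
  by (intro prob_space_PiM prob_space_axioms)

lemma (in shifted_noise) Q_component: "t \<in> {1..n} \<Longrightarrow> (\<lambda>x. x t) \<in> measurable Q V"
  by (rule measurable_component_singleton)

lemma (in shifted_noise) dotp_pair:
  assumes "t \<in> {1..n}" "s \<in> {1..n}" "t \<noteq> s"
  shows "integrable Q (\<lambda>x. dotp p (x t) (x s) ^ 4)" "(\<integral>x. dotp p (x t) (x s) ^ 4 \<partial>Q) = dot4"
  using PiM_two_integral[OF assms dotp_power4_int_pair] by (simp_all add: dot4_def)

lemma (in shifted_noise) dotp_Q_measurable:
  "t \<in> {1..n} \<Longrightarrow> s \<in> {1..n} \<Longrightarrow> (\<lambda>x. dotp p (x t) (x s)) \<in> borel_measurable Q"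
  by (intro dotp_measurable Q_component)

lemma off_diagD: "ts \<in> off_diag n \<Longrightarrow> fst ts \<in> {1..n} \<and> snd ts \<in> {1..n} \<and> fst ts \<noteq> snd ts"
  by (auto simp: off_diag_def)

lemma (in shifted_noise) B_measurable: "ts \<in> off_diag n \<Longrightarrow> B ts \<in> borel_measurable Q"
  unfolding B_def using off_diagD[of ts n] c_range by (intro borel_measurable_times dotp_Q_measurable) auto

text \<open>The pairs before and after the shift may share an index, so their factors need not be
  independent; the product is instead estimated by fourth powers of the two factors.\<close>

lemma (in shifted_noise) B_power2:
  assumes ts: "ts \<in> off_diag n"
  shows "integrable Q (\<lambda>x. (B ts x)\<^sup>2)" "(\<integral>x. (B ts x)\<^sup>2 \<partial>Q) \<le> dot4"
proof -
  let ?t = "fst ts" and ?s = "snd ts"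
  note * = off_diagD[OF ts]
  have c: "c ?t \<in> {1..n}" "c ?s \<in> {1..n}" "c ?t \<noteq> c ?s" using * c_range c_inj by blast+
  let ?a = "\<lambda>x. dotp p (x ?t) (x ?s)" and ?b = "\<lambda>x. dotp p (x (c ?t)) (x (c ?s))"
  have a: "integrable Q (\<lambda>x. ?a x ^ 4)" "(\<integral>x. ?a x ^ 4 \<partial>Q) = dot4" using * by (intro dotp_pair; blast)+
  have b: "integrable Q (\<lambda>x. ?b x ^ 4)" "(\<integral>x. ?b x ^ 4 \<partial>Q) = dot4" using c by (intro dotp_pair; blast)+
  have i: "integrable Q (\<lambda>x. (?a x ^ 4 + ?b x ^ 4) / 2)" using a(1) b(1) by simp
  have le: "(B ts x)\<^sup>2 \<le> (?a x ^ 4 + ?b x ^ 4) / 2" for x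
  proof -
    have "(B ts x)\<^sup>2 = (?a x)\<^sup>2 * (?b x)\<^sup>2" by (simp add: B_def power_mult_distrib)
    also have "\<dots> \<le> (((?a x)\<^sup>2)\<^sup>2 + ((?b x)\<^sup>2)\<^sup>2) / 2" using sum_squares_bound[of "(?a x)\<^sup>2" "(?b x)\<^sup>2"] by simp
    finally show ?thesis by simp
  qed
  show i2: "integrable Q (\<lambda>x. (B ts x)\<^sup>2)"
  proof (rule Bochner_Integration.integrable_bound[OF i])
    show "(\<lambda>x. (B ts x)\<^sup>2) \<in> borel_measurable Q" using B_measurable[OF ts] by simp
    show "AE x in Q. norm ((B ts x)\<^sup>2) \<le> norm ((?a x ^ 4 + ?b x ^ 4) / 2)" using le by (intro AE_I2) simp
  qed
  have "(\<integral>x. (B ts x)\<^sup>2 \<partial>Q) \<le> (\<integral>x. (?a x ^ 4 + ?b x ^ 4) / 2 \<partial>Q)" by (intro integral_mono i2 i le)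
  also have "\<dots> = dot4" using a b by simp
  finally show "(\<integral>x. (B ts x)\<^sup>2 \<partial>Q) \<le> dot4" .
qed

lemma (in shifted_noise) B_prod_int: "ts \<in> off_diag n \<Longrightarrow> uv \<in> off_diag n \<Longrightarrow> integrable Q (\<lambda>x. B ts x * B uv x)"
  by (intro integrable_mult_L2 B_measurable B_power2)

lemma (in shifted_noise) B_prod_le:
  assumes ts: "ts \<in> off_diag n" and uv: "uv \<in> off_diag n"
  shows "(\<integral>x. B ts x * B uv x \<partial>Q) \<le> dot4"
proof -
  have "(\<integral>x. B ts x * B uv x \<partial>Q) \<le> (\<integral>x. ((B ts x)\<^sup>2 + (B uv x)\<^sup>2) / 2 \<partial>Q)"
  proof (rule integral_mono[OF B_prod_int[OF ts uv]])
    show "integrable Q (\<lambda>x. ((B ts x)\<^sup>2 + (B uv x)\<^sup>2) / 2)" using B_power2(1)[OF ts] B_power2(1)[OF uv] by simp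
    show "B ts x * B uv x \<le> ((B ts x)\<^sup>2 + (B uv x)\<^sup>2) / 2" for x using sum_squares_bound[of "B ts x" "B uv x"] by simp
  qed
  also have "\<dots> \<le> dot4" using B_power2[OF ts] B_power2[OF uv] by simp
  finally show ?thesis .
qed

lemma (in noise) dotp_mean: "(\<integral>v. dotp p v w \<partial>V) = 0" "(\<integral>v. dotp p w v \<partial>V) = 0"
proof -
  have "(\<integral>v. (\<Sum>i<p. v i * w i) \<partial>V) = (\<Sum>i<p. \<integral>v. v i * w i \<partial>V)"
    using coord_int1 by (intro Bochner_Integration.integral_sum) auto
  then show "(\<integral>v. dotp p v w \<partial>V) = 0" using coord_mean by (simp add: dotp_def)
  then show "(\<integral>v. dotp p w v \<partial>V) = 0" by (simp add: dotp_def mult.commute)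
qed

text \<open>The index \<open>fst uv\<close> then occurs in just one of the inner products, in which
  the integrand is linear. The two coincidences missing from the list are excluded by
  \<open>off_diag\<close> and by the absence of fixed points.\<close>

lemma (in shifted_noise) B_singleton_fst:
  assumes ts: "ts \<in> off_diag n" and uv: "uv \<in> off_diag n"
    and u: "fst uv \<notin> {fst ts, snd ts, c (fst ts), c (snd ts), c (snd uv)}"
  shows "(\<integral>x. B ts x * B uv x \<partial>Q) = 0"
proof (rule PiM_integral_zero[OF _ _ B_prod_int[OF ts uv]])
  note * = off_diagD[OF ts] off_diagD[OF uv]
  show "fst uv \<in> {1..n}" using * by blast
  fix x :: "nat \<Rightarrow> nat \<Rightarrow> real"
  have ne: "snd uv \<noteq> fst uv" "c (fst uv) \<noteq> fst uv" using * c_neq by auto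
  have "B ts (x(fst uv := v)) * B uv (x(fst uv := v)) = (B ts x * dotp p (x (c (fst uv))) (x (c (snd uv)))) * dotp p v (x (snd uv))" for v
    using u ne by (auto simp: B_def)
  then show "(\<integral>v. B ts (x(fst uv := v)) * B uv (x(fst uv := v)) \<partial>V) = 0" by (simp add: dotp_mean)
qed simp

lemma (in shifted_noise) B_swap: "B (prod.swap ts) = B ts"
  by (auto simp: B_def dotp_def mult.commute)

text \<open>Neither index of \<open>uv\<close> may occur only once: each lies among the four indices
  \<open>F\<close> of \<open>ts\<close> or is the shift of the other. Both cannot be shifts of each
  other, as there is no cycle of length 2, so one lies in \<open>F\<close> and the other in
  \<open>F\<close> or its shift. The set \<open>E\<close> is the union of \<open>F\<close> and its
  shift.\<close>

lemma (in shifted_noise) B_prod_nonzero: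
  assumes ts: "ts \<in> off_diag n" and uv: "uv \<in> off_diag n" and nz: "(\<integral>x. B ts x * B uv x \<partial>Q) \<noteq> 0"
  defines "E \<equiv> {fst ts, snd ts, c (fst ts), c (snd ts), c (c (fst ts)), c (c (snd ts))}"
  shows "uv \<in> E \<times> E"
proof -
  note * = off_diagD[OF ts] off_diagD[OF uv]
  have 1: "fst uv \<in> {fst ts, snd ts, c (fst ts), c (snd ts), c (snd uv)}"
    using B_singleton_fst[OF ts uv] nz by blast
  have sw: "prod.swap uv \<in> off_diag n" using uv by (auto simp: off_diag_def)
  have 2: "snd uv \<in> {fst ts, snd ts, c (fst ts), c (snd ts), c (fst uv)}"
    using B_singleton_fst[OF ts sw] nz by (auto simp: B_swap)
  have ncc: "\<not> (fst uv = c (snd uv) \<and> snd uv = c (fst uv))" using cc_neq[of "fst uv"] * by auto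
  define F where "F = {fst ts, snd ts, c (fst ts), c (snd ts)}"
  have F: "u \<in> F \<Longrightarrow> u \<in> E" "u \<in> F \<Longrightarrow> c u \<in> E" for u by (auto simp: F_def E_def)
  have 3: "fst uv \<in> F \<or> fst uv = c (snd uv)" "snd uv \<in> F \<or> snd uv = c (fst uv)"
    using 1 2 unfolding F_def by blast+
  have "fst uv \<in> E"
  proof (cases "fst uv \<in> F")
    case False
    then have e: "fst uv = c (snd uv)" and "snd uv \<in> F" using 3 ncc by blast+
    then have "c (snd uv) \<in> E" using F by blast
    then show ?thesis by (simp only: e)
  qed (rule F)
  moreover have "snd uv \<in> E"
  proof (cases "snd uv \<in> F")
    case False
    then have e: "snd uv = c (fst uv)" and "fst uv \<in> F" using 3 ncc by blast+
    then have "c (fst uv) \<in> E" using F by blast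
    then show ?thesis by (simp only: e)
  qed (rule F)
  ultimately show ?thesis by (simp add: mem_Times_iff)
qed

text \<open>
  The covariance of \<open>B ts\<close> and \<open>B uv\<close> vanishes as soon as some time index occurs exactly once among the
  eight factors; this leaves at most 36 index pairs \<open>uv\<close> for each \<open>ts\<close>.
\<close>

lemma (in shifted_noise) B_sum_power2:
  assumes X: "X \<subseteq> off_diag n"
  shows "integrable Q (\<lambda>x. (\<Sum>ts\<in>X. B ts x)\<^sup>2)" "(\<integral>x. (\<Sum>ts\<in>X. B ts x)\<^sup>2 \<partial>Q) \<le> 36 * real (card X) * dot4"
proof -
  have "off_diag n \<subseteq> {1..n} \<times> {1..n}" by (auto simp: off_diag_def)
  then have "X \<subseteq> {1..n} \<times> {1..n}" using X by blast
  then have fX: "finite X" by (rule finite_subset) simp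
  have d0: "dot4 \<ge> 0" by (simp add: dot4_def)
  show "integrable Q (\<lambda>x. (\<Sum>ts\<in>X. B ts x)\<^sup>2)"
    using X by (intro integrable_power2_sum fX B_measurable B_power2) auto
  have "(\<integral>x. (\<Sum>ts\<in>X. B ts x)\<^sup>2 \<partial>Q) = (\<integral>x. (\<Sum>ts\<in>X. \<Sum>uv\<in>X. B ts x * B uv x) \<partial>Q)"
    by (simp add: power2_eq_square sum_product)
  also have "\<dots> = (\<Sum>ts\<in>X. \<integral>x. (\<Sum>uv\<in>X. B ts x * B uv x) \<partial>Q)"
    using X by (intro Bochner_Integration.integral_sum Bochner_Integration.integrable_sum B_prod_int) auto
  also have "\<dots> = (\<Sum>ts\<in>X. \<Sum>uv\<in>X. \<integral>x. B ts x * B uv x \<partial>Q)"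
    using X by (intro sum.cong refl Bochner_Integration.integral_sum B_prod_int) auto
  also have "\<dots> \<le> (\<Sum>ts\<in>X. 36 * dot4)"
  proof (rule sum_mono)
    fix ts assume ts: "ts \<in> X"
    define E where "E = {fst ts, snd ts, c (fst ts), c (snd ts), c (c (fst ts)), c (c (snd ts))}"
    have cE: "card E \<le> 6" and fE: "finite E"
      using card_length[of "[fst ts, snd ts, c (fst ts), c (snd ts), c (c (fst ts)), c (c (snd ts))]"] by (simp_all add: E_def)
    have "(\<Sum>uv\<in>X. \<integral>x. B ts x * B uv x \<partial>Q) = (\<Sum>uv\<in>X \<inter> (E \<times> E). \<integral>x. B ts x * B uv x \<partial>Q)"
      using X ts fX B_prod_nonzero[of ts] unfolding E_def by (intro sum.mono_neutral_right) blast+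
    also have "\<dots> \<le> (\<Sum>uv\<in>X \<inter> (E \<times> E). dot4)"
      using X ts by (intro sum_mono B_prod_le) auto
    also have "\<dots> = real (card (X \<inter> (E \<times> E))) * dot4" by simp
    also have "\<dots> \<le> 36 * dot4"
    proof (rule mult_right_mono[OF _ d0])
      have "card (X \<inter> (E \<times> E)) \<le> card (E \<times> E)" using fE by (intro card_mono) auto
      also have "\<dots> \<le> 6 * 6" unfolding card_cartesian_product using cE by (intro mult_mono) auto
      finally show "real (card (X \<inter> (E \<times> E))) \<le> 36" by simp
    qed
    finally show "(\<Sum>uv\<in>X. \<integral>x. B ts x * B uv x \<partial>Q) \<le> 36 * dot4" .
  qed
  also have "\<dots> = 36 * real (card X) * dot4" by simp
  finally show "(\<integral>x. (\<Sum>ts\<in>X. B ts x)\<^sup>2 \<partial>Q) \<le> 36 * real (card X) * dot4" .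
qed

lemma (in shifted_noise) y_Q_measurable: "t \<in> {1..n} \<Longrightarrow> (\<lambda>x. y (x t)) \<in> borel_measurable Q"
  by (rule measurable_compose[OF Q_component y_meas])

lemma (in noise) y_pair_int: "integrable (V \<Otimes>\<^sub>M V) (\<lambda>w. (y (fst w) * y (snd w))\<^sup>2)"
proof -
  have m: "(\<lambda>w. y (fst w)) \<in> borel_measurable (V \<Otimes>\<^sub>M V)" "(\<lambda>w. y (snd w)) \<in> borel_measurable (V \<Otimes>\<^sub>M V)"
    by (rule measurable_compose[OF measurable_fst y_meas], rule measurable_compose[OF measurable_snd y_meas])
  interpret P: pair_prob_space V V ..
  show ?thesis
  proof (rule P.Fubini_integrable)
    show "integrable V (\<lambda>u. \<integral>v. norm ((y (fst (u, v)) * y (snd (u, v)))\<^sup>2) \<partial>V)" using y_int2 by (simp add: power_mult_distrib)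
    show "AE u in V. integrable V (\<lambda>v. (y (fst (u, v)) * y (snd (u, v)))\<^sup>2)" using y_int2 by (simp add: power_mult_distrib)
  qed (use m in simp)
qed

lemma (in shifted_noise) yy_power2:
  assumes t: "t \<in> {1..n}"
  shows "integrable Q (\<lambda>x. (y (x t) * y (x (c t)))\<^sup>2)" "(\<integral>x. (y (x t) * y (x (c t)))\<^sup>2 \<partial>Q) = 1"
  using PiM_two_integral[OF t c_range[OF t] c_neq[OF t, symmetric] y_pair_int]
  by (simp_all add: power_mult_distrib y_var)

text \<open>The products are orthonormal. For different times \<open>t\<close> and \<open>s\<close>,
  either \<open>s\<close> or, when \<open>s\<close> is the shift of \<open>t\<close>, the shift of
  \<open>s\<close> occurs in only one factor; the second case uses the absence of cycles of length
  2.\<close>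

lemma (in shifted_noise) yy_sum_power2:
  assumes X: "X \<subseteq> {1..n}"
  shows "integrable Q (\<lambda>x. (\<Sum>t\<in>X. y (x t) * y (x (c t)))\<^sup>2)" "(\<integral>x. (\<Sum>t\<in>X. y (x t) * y (x (c t)))\<^sup>2 \<partial>Q) = card X"
proof -
  have fX: "finite X" using X finite_subset by blast
  let ?Y = "\<lambda>t x. y (x t) * y (x (c t))"
  have m: "?Y t \<in> borel_measurable Q" if "t \<in> X" for t
    using that X c_range by (intro borel_measurable_times y_Q_measurable) auto
  have i2: "integrable Q (\<lambda>x. (?Y t x)\<^sup>2)" if "t \<in> X" for t using that X by (intro yy_power2) auto
  have i: "integrable Q (\<lambda>x. ?Y t x * ?Y s x)" if "t \<in> X" "s \<in> X" for t s
    by (rule integrable_mult_L2[OF m[OF that(1)] m[OF that(2)] i2[OF that(1)] i2[OF that(2)]])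
  show "integrable Q (\<lambda>x. (\<Sum>t\<in>X. ?Y t x)\<^sup>2)" by (intro integrable_power2_sum fX m i2)
  have z: "(\<integral>x. ?Y t x * ?Y s x \<partial>Q) = 0" if t: "t \<in> X" and s: "s \<in> X" and ts: "t \<noteq> s" for t s
  proof -
    have r: "t \<in> {1..n}" "s \<in> {1..n}" using t s X by auto
    show ?thesis
    proof (cases "s = c t")
      case False
      show ?thesis
      proof (rule PiM_integral_zero[OF _ r(2) i[OF t s]])
        fix x :: "nat \<Rightarrow> nat \<Rightarrow> real"
        have "?Y t (x(s := v)) * ?Y s (x(s := v)) = (?Y t x * y (x (c s))) * y v" for v
          using False ts c_neq[OF r(2)] by auto
        then show "(\<integral>v. ?Y t (x(s := v)) * ?Y s (x(s := v)) \<partial>V) = 0" by (simp only: integral_mult_right_zero y_mean mult_zero_right)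
      qed simp
    next
      case True
      have ne: "c s \<noteq> t" "c s \<noteq> c t" "c s \<noteq> s" using True cc_neq[OF r(1)] c_neq[OF r(2)] by auto
      show ?thesis
      proof (rule PiM_integral_zero[OF _ c_range[OF r(2)] i[OF t s]])
        fix x :: "nat \<Rightarrow> nat \<Rightarrow> real"
        have "?Y t (x(c s := v)) * ?Y s (x(c s := v)) = (?Y t x * y (x s)) * y v" for v
          using ne by auto
        then show "(\<integral>v. ?Y t (x(c s := v)) * ?Y s (x(c s := v)) \<partial>V) = 0" by (simp only: integral_mult_right_zero y_mean mult_zero_right)
      qed simp
    qed
  qed
  have "(\<integral>x. (\<Sum>t\<in>X. ?Y t x)\<^sup>2 \<partial>Q) = (\<integral>x. (\<Sum>t\<in>X. \<Sum>s\<in>X. ?Y t x * ?Y s x) \<partial>Q)"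
    by (simp add: power2_eq_square sum_product)
  also have "\<dots> = (\<Sum>t\<in>X. \<integral>x. (\<Sum>s\<in>X. ?Y t x * ?Y s x) \<partial>Q)"
    by (intro Bochner_Integration.integral_sum Bochner_Integration.integrable_sum i)
  also have "\<dots> = (\<Sum>t\<in>X. \<Sum>s\<in>X. \<integral>x. ?Y t x * ?Y s x \<partial>Q)"
    by (intro sum.cong refl Bochner_Integration.integral_sum i)
  also have "\<dots> = (\<Sum>t\<in>X. \<Sum>s\<in>X. if s = t then 1 else 0)"
  proof (intro sum.cong refl)
    fix t s assume "t \<in> X" "s \<in> X"
    then show "(\<integral>x. ?Y t x * ?Y s x \<partial>Q) = (if s = t then 1 else 0)"
      using z[of t s] yy_power2(2)[of t] X by (auto simp: power2_eq_square)
  qed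
  also have "\<dots> = card X" using fX by simp
  finally show "(\<integral>x. (\<Sum>t\<in>X. ?Y t x)\<^sup>2 \<partial>Q) = card X" .
qed

lemma (in shifted_noise) y_sum_power2:
  shows "integrable Q (\<lambda>x. (\<Sum>t=1..n. y (x t))\<^sup>2)" "(\<integral>x. (\<Sum>t=1..n. y (x t))\<^sup>2 \<partial>Q) = n"
proof -
  have d: "distr Q V (\<lambda>x. x t) = V" if "t \<in> {1..n}" for t
    by (rule distr_PiM_component) (use that prob_space_axioms in auto)
  have i2: "integrable Q (\<lambda>x. (y (x t))\<^sup>2)" "(\<integral>x. (y (x t))\<^sup>2 \<partial>Q) = 1" if t: "t \<in> {1..n}" for t
    using integrable_distr_eq[OF Q_component[OF t], of "\<lambda>u. (y u)\<^sup>2"] integral_distr[OF Q_component[OF t], of "\<lambda>u. (y u)\<^sup>2"]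
      y_int2 y_var y_meas d[OF t] by simp_all
  show "integrable Q (\<lambda>x. (\<Sum>t=1..n. y (x t))\<^sup>2)" by (intro integrable_power2_sum i2 y_Q_measurable) auto
  have i: "integrable Q (\<lambda>x. y (x t) * y (x s))" if "t \<in> {1..n}" "s \<in> {1..n}" for t s
    by (rule integrable_mult_L2[OF y_Q_measurable[OF that(1)] y_Q_measurable[OF that(2)] i2(1)[OF that(1)] i2(1)[OF that(2)]])
  have z: "(\<integral>x. y (x t) * y (x s) \<partial>Q) = 0" if ts: "t \<in> {1..n}" "s \<in> {1..n}" "t \<noteq> s" for t s
  proof (rule PiM_integral_zero[OF _ ts(2) i[OF ts(1,2)]])
    fix x :: "nat \<Rightarrow> nat \<Rightarrow> real"
    show "(\<integral>v. y ((x(s := v)) t) * y ((x(s := v)) s) \<partial>V) = 0" using ts by (simp add: y_mean)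
  qed simp
  have "(\<integral>x. (\<Sum>t=1..n. y (x t))\<^sup>2 \<partial>Q) = (\<integral>x. (\<Sum>t=1..n. \<Sum>s=1..n. y (x t) * y (x s)) \<partial>Q)"
    by (simp add: power2_eq_square sum_product)
  also have "\<dots> = (\<Sum>t=1..n. \<integral>x. (\<Sum>s=1..n. y (x t) * y (x s)) \<partial>Q)"
    by (intro Bochner_Integration.integral_sum Bochner_Integration.integrable_sum i)
  also have "\<dots> = (\<Sum>t=1..n. \<Sum>s=1..n. \<integral>x. y (x t) * y (x s) \<partial>Q)"
    by (intro sum.cong refl Bochner_Integration.integral_sum i)
  also have "\<dots> = (\<Sum>t=1..n. \<Sum>s=1..n. if s = t then 1 else 0)"
  proof (intro sum.cong refl)
    fix t s assume "t \<in> {1..n}" "s \<in> {1..n}"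
    then show "(\<integral>x. y (x t) * y (x s) \<partial>Q) = (if s = t then 1 else 0)"
      using z[of t s] i2(2)[of t] by (auto simp: power2_eq_square)
  qed
  also have "\<dots> = n" by simp
  finally show "(\<integral>x. (\<Sum>t=1..n. y (x t))\<^sup>2 \<partial>Q) = n" .
qed

section \<open>Independence of the blocks\<close>

definition blocks :: "nat \<Rightarrow> nat \<Rightarrow> (nat \<Rightarrow> 'a) \<Rightarrow> nat \<Rightarrow> nat \<Rightarrow> 'a" where
  "blocks N L x = (\<lambda>b\<in>{..<N}. \<lambda>i\<in>{..<L}. x (b * L + i + 1))"

text \<open>Coordinates of a product measure are independent, and grouping them over disjoint
  intervals of times keeps independence; each group is a reindexed power. Times start at 1, blocks
  and positions at 0, which explains the offset; times after \<open>N * L\<close> are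
  ignored.\<close>

lemma (in prob_space) distr_blocks:
  assumes NL: "N * L \<le> n" and N: "N \<ge> 1" and L: "L \<ge> 1"
  shows "blocks N L \<in> measurable (PiM {1..n} (\<lambda>_. M)) (PiM {..<N} (\<lambda>_. PiM {..<L} (\<lambda>_. M)))"
    "distr (PiM {1..n} (\<lambda>_. M)) (PiM {..<N} (\<lambda>_. PiM {..<L} (\<lambda>_. M))) (blocks N L) = PiM {..<N} (\<lambda>_. PiM {..<L} (\<lambda>_. M))"
proof -
  let ?Q = "PiM {1..n} (\<lambda>_. M)" and ?B = "PiM {..<L} (\<lambda>_. M)"
  interpret Q: prob_space ?Q by (intro prob_space_PiM prob_space_axioms)
  have idx: "b * L + i + 1 \<in> {1..n}" if "b < N" "i < L" for b i
  proof -
    have "b * L + i + 1 \<le> (b + 1) * L" using that by simp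
    also have "\<dots> \<le> N * L" using that by (intro mult_right_mono) auto
    finally show ?thesis using NL by simp
  qed
  define Y where "Y b x = (\<lambda>i\<in>{..<L}. x (b * L + i + 1))" for b and x :: "nat \<Rightarrow> 'a"
  have Ym: "Y b \<in> measurable ?Q ?B" if "b < N" for b
    unfolding Y_def using idx[OF that] by (intro measurable_restrict measurable_component_singleton) auto
  have Yd: "distr ?Q ?B (Y b) = ?B" if "b < N" for b
    unfolding Y_def
    by (rule distr_PiM_reindex) (use that idx prob_space_axioms in \<open>auto simp: inj_on_def\<close>)
  have bl: "blocks N L = (\<lambda>x. \<lambda>b\<in>{..<N}. Y b x)" by (simp add: blocks_def Y_def fun_eq_iff)
  show "blocks N L \<in> measurable ?Q (PiM {..<N} (\<lambda>_. ?B))"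
    unfolding bl using Ym by (intro measurable_restrict) auto
  have "Q.indep_vars (\<lambda>_. M) (\<lambda>t x. x t) {1..n}"
  proof -
    have "N * L > 0" using N L by simp
    then have "n > 0" using NL by linarith
    then have n: "{1..n} \<noteq> {}" by simp
    have "distr ?Q ?Q (\<lambda>x. \<lambda>t\<in>{1..n}. x t) = distr ?Q ?Q (\<lambda>x. x)"
      by (rule distr_cong) (auto simp: space_PiM PiE_def extensional_restrict)
    also have "\<dots> = ?Q" by (rule distr_id)
    also have "\<dots> = PiM {1..n} (\<lambda>t. distr ?Q M (\<lambda>x. x t))"
      by (rule PiM_cong[OF refl]) (auto intro!: distr_PiM_component[symmetric] prob_space_axioms)
    finally show ?thesis
      using n by (subst Q.indep_vars_iff_distr_eq_PiM') auto
  qed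
  then have "Q.indep_vars (\<lambda>b. PiM {b * L + 1..b * L + L} (\<lambda>_. M)) (\<lambda>b x. restrict (\<lambda>t. x t) {b * L + 1..b * L + L}) {..<N}"
  proof (rule Q.indep_vars_restrict)
    fix b assume "b \<in> {..<N}"
    then have "b * L + L \<le> N * L" using mult_right_mono[of "b + 1" N L] by simp
    then show "{b * L + 1..b * L + L} \<subseteq> {1..n}" using NL by auto
  next
    show "disjoint_family_on (\<lambda>b. {b * L + 1..b * L + L}) {..<N}"
      unfolding disjoint_family_on_def
    proof (intro ballI impI)
      have "{a * L + 1..a * L + L} \<inter> {b * L + 1..b * L + L} = {}" if "a < b" for a b
      proof -
        have "a * L + L \<le> b * L" using mult_right_mono[of "a + 1" b L] that by simp
        then show ?thesis by auto
      qed
      moreover fix a b :: nat assume "a \<noteq> b"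
      ultimately show "{a * L + 1..a * L + L} \<inter> {b * L + 1..b * L + L} = {}"
        by (cases a b rule: linorder_cases) (auto simp: Int_commute)
    qed
  qed
  from Q.indep_vars_compose2[OF this, of "\<lambda>b w. \<lambda>i\<in>{..<L}. w (b * L + i + 1)" "\<lambda>_. ?B"]
  have "Q.indep_vars (\<lambda>_. ?B) (\<lambda>b x. \<lambda>i\<in>{..<L}. restrict (\<lambda>t. x t) {b * L + 1..b * L + L} (b * L + i + 1)) {..<N}"
    by (auto intro!: measurable_restrict measurable_component_singleton)
  moreover have "(\<lambda>b x. \<lambda>i\<in>{..<L}. restrict (\<lambda>t. x t) {b * L + 1..b * L + L} (b * L + i + 1)) = Y"
    by (auto simp: Y_def fun_eq_iff)
  ultimately have "Q.indep_vars (\<lambda>_. ?B) Y {..<N}" by simp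
  then have "distr ?Q (PiM {..<N} (\<lambda>_. ?B)) (\<lambda>x. \<lambda>b\<in>{..<N}. Y b x) = PiM {..<N} (\<lambda>b. distr ?Q ?B (Y b))"
    using N Ym by (subst (asm) Q.indep_vars_iff_distr_eq_PiM') (auto simp: lessThan_empty_iff)
  also have "\<dots> = PiM {..<N} (\<lambda>_. ?B)" by (rule PiM_cong[OF refl], rule Yd) simp
  finally show "distr ?Q (PiM {..<N} (\<lambda>_. ?B)) (blocks N L) = PiM {..<N} (\<lambda>_. ?B)" by (simp add: bl)
qed

section \<open>Approximation of the autocovariances by block statistics\<close>

lemma cis_diff_le: "cmod (cis a - cis b) \<le> \<bar>a - b\<bar>"
proof -
  have "cis a - cis b = cis b * (cis (a - b) - 1)" by (simp add: right_diff_distrib cis_mult)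
  then have "cmod (cis a - cis b) = cmod (iexp (a - b) - 1)" by (simp add: norm_mult cis_conv_exp)
  also have "\<dots> \<le> \<bar>a - b\<bar>" using iexp_approx1[of "a - b" 0] by simp
  finally show ?thesis .
qed

text \<open>\<open>cis\<close> is 1-Lipschitz, so an L1 estimate of the discarded summands is all
  that the characteristic function requires.\<close>

lemma (in prob_space) char_diff_le:
  assumes f: "f \<in> borel_measurable M" and g: "g \<in> borel_measurable M" and i: "integrable M (\<lambda>x. f x - g x)"
  shows "cmod ((\<integral>x. cis (f x) \<partial>M) - (\<integral>x. cis (g x) \<partial>M)) \<le> expectation (\<lambda>x. \<bar>f x - g x\<bar>)"
proof -
  have ci: "integrable M (\<lambda>x. cis (f x))" if "f \<in> borel_measurable M" for f :: "'a \<Rightarrow> real"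
  proof -
    have "(\<lambda>x. cis (f x)) \<in> borel_measurable M"
      by (rule measurable_compose[OF that]) (intro borel_measurable_continuous_onI continuous_intros)
    then show ?thesis by (intro integrable_const_bound[of _ 1]) auto
  qed
  have "cmod ((\<integral>x. cis (f x) \<partial>M) - (\<integral>x. cis (g x) \<partial>M)) = cmod (\<integral>x. cis (f x) - cis (g x) \<partial>M)"
    using ci[OF f] ci[OF g] by simp
  also have "\<dots> \<le> expectation (\<lambda>x. cmod (cis (f x) - cis (g x)))" by (rule integral_norm_bound)
  also have "\<dots> \<le> expectation (\<lambda>x. \<bar>f x - g x\<bar>)"
    using ci[OF f] ci[OF g] i cis_diff_le by (intro integral_mono integrable_norm integrable_abs) auto
  finally show ?thesis .
qed

section \<open>Times and pairs retained by the blocks\<close>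

definition block_pos :: "nat \<Rightarrow> nat \<Rightarrow> nat \<Rightarrow> nat" where
  "block_pos L b i = b * L + i + 1"

lemma block_pos_eq_iff:
  assumes "i < L" "j < L"
  shows "block_pos L b i = block_pos L b' j \<longleftrightarrow> b = b' \<and> i = j"
proof
  assume "block_pos L b i = block_pos L b' j"
  then have e: "b * L + i = b' * L + j" by (simp add: block_pos_def)
  have "b = (b * L + i) div L" "b' = (b' * L + j) div L" using assms by simp_all
  then have "b = b'" using e by simp
  then show "b = b' \<and> i = j" using e by simp
qed simp

lemma block_pos_range:
  assumes "b < N" "i < L" "N * L \<le> n"
  shows "block_pos L b i \<in> {1..n}"
proof -
  have "block_pos L b i \<le> (b + 1) * L" using assms by (simp add: block_pos_def)
  also have "\<dots> \<le> N * L" using assms by (intro mult_right_mono) auto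
  finally show ?thesis using assms by (simp add: block_pos_def)
qed

lemma blocks_eq: "b < N \<Longrightarrow> i < L \<Longrightarrow> blocks N L x b i = x (block_pos L b i)"
  by (simp add: blocks_def block_pos_def)

lemma circ_block_pos:
  assumes "b < N" "i + \<tau> < L" "N * L \<le> n"
  shows "circ n (block_pos L b i + \<tau>) = block_pos L b (i + \<tau>)"
  using block_pos_range[of b N "i + \<tau>" L n] assms by (simp add: circ_def block_pos_def)

definition good_times :: "nat \<Rightarrow> nat \<Rightarrow> nat \<Rightarrow> nat set" where
  "good_times N L \<tau> = (\<lambda>(b, i). block_pos L b i) ` ({..<N} \<times> {..<L - \<tau>})"

text \<open>Pairs inside a common block are excluded as well: only for different blocks is the
  summand a function of two independent arguments.\<close>

definition good_pairs :: "nat \<Rightarrow> nat \<Rightarrow> nat \<Rightarrow> (nat \<times> nat) set" where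
  "good_pairs N L \<tau> = (\<lambda>((b, b'), i, j). (block_pos L b i, block_pos L b' j)) `
     ({(b, b'). b < N \<and> b' < N \<and> b \<noteq> b'} \<times> ({..<L - \<tau>} \<times> {..<L - \<tau>}))"

lemma good_times_inj: "inj_on (\<lambda>(b, i). block_pos L b i) ({..<N} \<times> {..<L - \<tau>})"
  by (auto simp: inj_on_def block_pos_eq_iff)

lemma good_pairs_inj: "inj_on (\<lambda>((b, b'), i, j). (block_pos L b i, block_pos L b' j))
     ({(b, b'). b < N \<and> b' < N \<and> b \<noteq> b'} \<times> ({..<L - \<tau>} \<times> {..<L - \<tau>}))"
  by (auto simp: inj_on_def block_pos_eq_iff)

lemma good_times_subset: "N * L \<le> n \<Longrightarrow> good_times N L \<tau> \<subseteq> {1..n}"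
  using block_pos_range[of _ N _ L n] by (fastforce simp: good_times_def)

lemma good_pairs_subset: "N * L \<le> n \<Longrightarrow> good_pairs N L \<tau> \<subseteq> off_diag n"
  using block_pos_range[of _ N _ L n] by (fastforce simp: good_pairs_def off_diag_def block_pos_eq_iff)

lemma card_good_times: "card (good_times N L \<tau>) = N * (L - \<tau>)"
  unfolding good_times_def by (subst card_image[OF good_times_inj]) simp

lemma ne_pairs: "{(b, b'). b < N \<and> b' < N \<and> b \<noteq> b'} = (SIGMA b:{..<N::nat}. {..<N} - {b})"
  by auto

lemma card_good_pairs: "card (good_pairs N L \<tau>) = N * (N - 1) * (L - \<tau>)\<^sup>2"
  unfolding good_pairs_def
  by (subst card_image[OF good_pairs_inj]) (simp add: card_cartesian_product ne_pairs power2_eq_square)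

lemma sum_ne_pairs_symmetric:
  fixes f :: "nat \<Rightarrow> nat \<Rightarrow> real"
  assumes "\<And>b b'. f b b' = f b' b"
  shows "(\<Sum>(b, b') | b < N \<and> b' < N \<and> b \<noteq> b'. f b b') = 2 * (\<Sum>k<N. \<Sum>l<k. f l k)"
proof -
  have "(\<Sum>(b, b') | b < N \<and> b' < N \<and> b \<noteq> b'. f b b') = (\<Sum>b<N. \<Sum>b'\<in>{..<N} - {b}. f b b')"
    unfolding ne_pairs by (subst sum.Sigma) auto
  also have "\<dots> = (\<Sum>b<N. (\<Sum>b'<N. f b b') - f b b)"
    by (intro sum.cong refl) (simp add: sum_diff1)
  also have "\<dots> = (\<Sum>b<N. \<Sum>b'<N. f b b') - (\<Sum>b<N. f b b)" by (rule sum_subtractf)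
  also have "\<dots> = 2 * (\<Sum>k<N. \<Sum>l<k. f l k)"
    using sum_symmetric_square[of f N] assms by simp
  finally show ?thesis .
qed

definition lag_product :: "nat \<Rightarrow> nat \<Rightarrow> nat \<Rightarrow> (nat \<Rightarrow> nat \<Rightarrow> real) \<Rightarrow> nat \<times> nat \<Rightarrow> real" where
  "lag_product p n \<tau> x = (\<lambda>(t, s). dotp p (x t) (x s) * dotp p (x (circ n (t + \<tau>))) (x (circ n (s + \<tau>))))"

lemma sum_good_pairs:
  assumes NL: "N * L \<le> n"
  shows "(\<Sum>ts\<in>good_pairs N L \<tau>. lag_product p n \<tau> x ts) =
    2 * (\<Sum>k<N. \<Sum>l<k. \<Sum>i<L - \<tau>. \<Sum>j<L - \<tau>.
      dotp p (blocks N L x l i) (blocks N L x k j) * dotp p (blocks N L x l (i + \<tau>)) (blocks N L x k (j + \<tau>)))"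
proof -
  define F where "F b b' = (\<Sum>i<L - \<tau>. \<Sum>j<L - \<tau>. lag_product p n \<tau> x (block_pos L b i, block_pos L b' j))" for b b'
  have F_sym: "F b b' = F b' b" for b b'
    unfolding F_def by (subst sum.swap) (simp add: lag_product_def dotp_def mult.commute)
  have "(\<Sum>ts\<in>good_pairs N L \<tau>. lag_product p n \<tau> x ts) = (\<Sum>w\<in>{(b, b'). b < N \<and> b' < N \<and> b \<noteq> b'} \<times> ({..<L - \<tau>} \<times> {..<L - \<tau>}).
      lag_product p n \<tau> x ((\<lambda>((b, b'), i, j). (block_pos L b i, block_pos L b' j)) w))"
    unfolding good_pairs_def by (subst sum.reindex[OF good_pairs_inj]) (simp add: o_def)
  also have "\<dots> = (\<Sum>(b, b') | b < N \<and> b' < N \<and> b \<noteq> b'. F b b')"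
    unfolding F_def sum.cartesian_product' by (intro sum.cong refl) (auto split: prod.split)
  also have "\<dots> = 2 * (\<Sum>k<N. \<Sum>l<k. F l k)" by (rule sum_ne_pairs_symmetric[OF F_sym])
  also have "(\<Sum>k<N. \<Sum>l<k. F l k) = (\<Sum>k<N. \<Sum>l<k. \<Sum>i<L - \<tau>. \<Sum>j<L - \<tau>.
      dotp p (blocks N L x l i) (blocks N L x k j) * dotp p (blocks N L x l (i + \<tau>)) (blocks N L x k (j + \<tau>)))"
    unfolding F_def
    by (intro sum.cong refl) (auto simp: lag_product_def blocks_eq circ_block_pos[OF _ _ NL])
  finally show ?thesis .
qed

lemma sum_good_times:
  assumes NL: "N * L \<le> n"
  shows "(\<Sum>t\<in>good_times N L \<tau>. y (x t) * y (x (circ n (t + \<tau>)))) =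
    (\<Sum>k<N. \<Sum>i<L - \<tau>. y (blocks N L x k i) * y (blocks N L x k (i + \<tau>)) :: real)"
proof -
  have "(\<Sum>t\<in>good_times N L \<tau>. y (x t) * y (x (circ n (t + \<tau>)))) = (\<Sum>(b, i)\<in>{..<N} \<times> {..<L - \<tau>}.
      y (x (block_pos L b i)) * y (x (circ n (block_pos L b i + \<tau>))))"
    unfolding good_times_def by (subst sum.reindex[OF good_times_inj]) (simp add: o_def case_prod_unfold)
  also have "\<dots> = (\<Sum>k<N. \<Sum>i<L - \<tau>. y (x (block_pos L k i)) * y (x (circ n (block_pos L k i + \<tau>))))"
    by (simp add: sum.cartesian_product)
  also have "\<dots> = (\<Sum>k<N. \<Sum>i<L - \<tau>. y (blocks N L x k i) * y (blocks N L x k (i + \<tau>)))"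
    by (intro sum.cong refl) (auto simp: blocks_eq circ_block_pos[OF _ _ NL])
  finally show ?thesis .
qed

text \<open>The share of lost times is at most q/L for lags crossing a block boundary plus L/n for
  the incomplete last block. For pairs this share counts twice, and pairs inside one block cost
  another L/n; together they give \<open>\<delta>\<close>.\<close>

lemma block_count_bounds:
  assumes L: "q < L" "L \<le> n" and \<tau>: "\<tau> \<le> q" and N: "N = n div L"
  defines "\<delta> \<equiv> 2 * real q / real L + 3 * real L / real n"
  shows "N * L \<le> n" "N \<ge> 1" "real N * real (L - \<tau>) \<le> real n" "real n - real N * real (L - \<tau>) \<le> real n * \<delta>"
    "(real n)\<^sup>2 - real (N * (N - 1) * (L - \<tau>)\<^sup>2) \<le> (real n)\<^sup>2 * \<delta>"
    "real (N * (N - 1) * (L - \<tau>)\<^sup>2) \<le> (real n)\<^sup>2"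
proof -
  have L0: "real L > 0" and n0: "real n > 0" using L by auto
  show NL: "N * L \<le> n" using N by simp
  show N1: "N \<ge> 1" using N L by (simp add: div_greater_zero_iff Suc_le_eq)
  have NLr: "real N * real L \<le> real n" using NL by (simp flip: of_nat_mult)
  have "n < N * L + L" using N L dividend_less_div_times[of L n] by (simp add: add.commute)
  then have NLg: "real n - real L \<le> real N * real L" by (simp flip: of_nat_mult of_nat_add)
  define f where "f = real N * real (L - \<tau>)"
  have Lt: "real (L - \<tau>) = real L - real \<tau>" using L \<tau> by simp
  show f1: "real N * real (L - \<tau>) \<le> real n"
    using NLr mult_left_mono[of "real (L - \<tau>)" "real L" "real N"] by simp
  define e where "e = real q / real L + real L / real n"
  have fe: "real n - f \<le> real n * e"
  proof -
    have "real N * real \<tau> \<le> (real n / real L) * real q"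
      using NLr L0 \<tau> by (intro mult_mono) (auto simp: pos_le_divide_eq)
    then have "real n - f \<le> real L + real n / real L * real q"
      using NLg unfolding f_def Lt right_diff_distrib by linarith
    also have "\<dots> = real n * e" using n0 by (simp add: e_def field_simps)
    finally show ?thesis .
  qed
  have e\<delta>: "e \<le> \<delta>" unfolding e_def \<delta>_def using L0 n0 by (intro add_mono divide_right_mono) auto
  show "real n - real N * real (L - \<tau>) \<le> real n * \<delta>"
    using fe mult_left_mono[OF e\<delta>, of "real n"] unfolding f_def by simp
  have f0: "f \<ge> 0" "f \<le> real n" using f1 by (simp_all add: f_def)
  have eq: "real (N * (N - 1) * (L - \<tau>)\<^sup>2) = f\<^sup>2 - f * real (L - \<tau>)"
  proof -
    have "real (N - 1) = real N - 1" using N1 by simp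
    have "real (N * (N - 1) * (L - \<tau>)\<^sup>2) = real N * real (N - 1) * (real (L - \<tau>))\<^sup>2"
      by (simp only: of_nat_mult of_nat_power)
    also have "\<dots> = real N * (real N - 1) * (real (L - \<tau>))\<^sup>2" by (simp only: \<open>real (N - 1) = real N - 1\<close>)
    also have "\<dots> = f\<^sup>2 - f * real (L - \<tau>)"
    proof -
      have "a * (a - 1) * w\<^sup>2 = (a * w)\<^sup>2 - a * w * w" for a w :: real
        by (simp add: power2_eq_square algebra_simps)
      then show ?thesis unfolding f_def .
    qed
    finally show ?thesis .
  qed
  have "f * real (L - \<tau>) \<le> real n * real L" using f0 by (intro mult_mono) auto
  moreover have "(real n)\<^sup>2 - f\<^sup>2 \<le> 2 * real n * (real n * e)"
  proof -
    have "(real n)\<^sup>2 - f\<^sup>2 = (real n + f) * (real n - f)" by (simp add: power2_eq_square algebra_simps)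
    also have "\<dots> \<le> (2 * real n) * (real n * e)" using f0 fe by (intro mult_mono) auto
    finally show ?thesis by simp
  qed
  moreover have "2 * real n * (real n * e) + real n * real L = (real n)\<^sup>2 * \<delta>"
    using n0 by (simp add: e_def \<delta>_def power2_eq_square field_simps)
  ultimately show "(real n)\<^sup>2 - real (N * (N - 1) * (L - \<tau>)\<^sup>2) \<le> (real n)\<^sup>2 * \<delta>" unfolding eq by linarith
  have "f\<^sup>2 \<le> (real n)\<^sup>2" using f0 by (intro power_mono)
  moreover have "f * real (L - \<tau>) \<ge> 0" using f0 by simp
  ultimately show "real (N * (N - 1) * (L - \<tau>)\<^sup>2) \<le> (real n)\<^sup>2" unfolding eq by linarith
qed

section \<open>Normalised statistics and their block versions\<close>

definition (in noise) "\<rho> = (\<Sum>a<p. \<Sum>b<p. (S a b)\<^sup>2)"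

definition (in noise) stat1 :: "nat \<Rightarrow> nat \<Rightarrow> (nat \<Rightarrow> nat \<Rightarrow> real) \<Rightarrow> real" where
  "stat1 n \<tau> x = 1 / (sqrt 2 * n * \<rho>) * (\<Sum>ts\<in>off_diag n. lag_product p n \<tau> x ts)"

text \<open>This will be the centered second statistic in units of \<open>v / (p * sqrt n)\<close>,
  where \<open>v\<close> is the variance of the squared norm. The subtracted \<open>1 / n\<close> is
  the expectation of the squared mean and comes from \<open>mu2\<close>.\<close>

definition (in noise) stat2 :: "nat \<Rightarrow> nat \<Rightarrow> (nat \<Rightarrow> nat \<Rightarrow> real) \<Rightarrow> real" where
  "stat2 n \<tau> x = 1 / sqrt n * (\<Sum>t=1..n. y (x t) * y (x (circ n (t + \<tau>)))) - sqrt n * ((1 / n * (\<Sum>t=1..n. y (x t)))\<^sup>2 - 1 / n)"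

definition (in noise) block1 :: "nat \<Rightarrow> nat \<Rightarrow> nat \<Rightarrow> nat \<Rightarrow> (nat \<Rightarrow> nat \<Rightarrow> real) \<Rightarrow> real" where
  "block1 n N L \<tau> x = 1 / (sqrt 2 * n * \<rho>) * (\<Sum>ts\<in>good_pairs N L \<tau>. lag_product p n \<tau> x ts)"

definition (in noise) block2 :: "nat \<Rightarrow> nat \<Rightarrow> nat \<Rightarrow> nat \<Rightarrow> (nat \<Rightarrow> nat \<Rightarrow> real) \<Rightarrow> real" where
  "block2 n N L \<tau> x = 1 / sqrt n * (\<Sum>t\<in>good_times N L \<tau>. y (x t) * y (x (circ n (t + \<tau>))))"

lemma (in noise) shifted:
  assumes "\<tau> \<ge> 1" "2 * \<tau> < n"
  shows "shifted_noise V p S y n (\<lambda>t. circ n (t + \<tau>))"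
proof -
  interpret shift_map n "\<lambda>t. circ n (t + \<tau>)" by (rule shift_map_circ[OF assms])
  show ?thesis by unfold_locales
qed

lemma (in noise) lag_product_B:
  assumes "\<tau> \<ge> 1" "2 * \<tau> < n"
  shows "lag_product p n \<tau> x ts = shifted_noise.B p (\<lambda>t. circ n (t + \<tau>)) ts x"
  by (simp add: lag_product_def shifted_noise.B_def[OF shifted[OF assms]] case_prod_unfold)

lemma (in noise) lag_sum:
  assumes \<tau>: "\<tau> \<ge> 1" "2 * \<tau> < n" and X: "X \<subseteq> off_diag n" and \<rho>: "\<rho> > 0" and n: "n \<ge> 1"
  defines "f \<equiv> \<lambda>x. 1 / (sqrt 2 * n * \<rho>) * (\<Sum>ts\<in>X. lag_product p n \<tau> x ts)"
  shows "f \<in> borel_measurable (PiM {1..n} (\<lambda>_. V))" "integrable (PiM {1..n} (\<lambda>_. V)) f"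
    "(\<integral>x. \<bar>f x\<bar> \<partial>PiM {1..n} (\<lambda>_. V)) \<le> sqrt (18 * (dot4 / \<rho>\<^sup>2) * (card X / (real n)\<^sup>2))"
proof -
  interpret s: shifted_noise V p S y n "\<lambda>t. circ n (t + \<tau>)" by (rule shifted[OF \<tau>])
  interpret Q: prob_space "s.Q" by (rule s.prob_space_Q)
  let ?k = "1 / (sqrt 2 * n * \<rho>)"
  have f: "f = (\<lambda>x. ?k * (\<Sum>ts\<in>X. s.B ts x))" unfolding f_def lag_product_B[OF \<tau>] ..
  have m: "(\<lambda>x. \<Sum>ts\<in>X. s.B ts x) \<in> borel_measurable s.Q" using X by (intro borel_measurable_sum s.B_measurable) auto
  then show fm: "f \<in> borel_measurable s.Q" unfolding f by simp
  have i2: "integrable s.Q (\<lambda>x. (f x)\<^sup>2)" 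
    unfolding f power_mult_distrib using s.B_sum_power2(1)[OF X] by (rule integrable_mult_right)
  show "integrable s.Q f" by (rule Q.integrable_L2_L1[OF fm i2])
  have "(\<integral>x. \<bar>f x\<bar> \<partial>s.Q) \<le> sqrt (\<integral>x. (f x)\<^sup>2 \<partial>s.Q)" by (rule Q.expectation_abs_le_sqrt[OF fm i2])
  also have "(\<integral>x. (f x)\<^sup>2 \<partial>s.Q) = ?k\<^sup>2 * (\<integral>x. (\<Sum>ts\<in>X. s.B ts x)\<^sup>2 \<partial>s.Q)"
    unfolding f power_mult_distrib by (rule integral_mult_right_zero)
  also have "sqrt \<dots> \<le> sqrt (?k\<^sup>2 * (36 * real (card X) * dot4))"
    by (intro real_sqrt_le_mono mult_left_mono s.B_sum_power2(2)[OF X]) simp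
  \<comment> \<open>The 36 of \<open>B_sum_power2\<close> is halved by the squared factor
    \<open>1 / sqrt 2\<close>.\<close>
  also have "?k\<^sup>2 * (36 * real (card X) * dot4) = 18 * (dot4 / \<rho>\<^sup>2) * (card X / (real n)\<^sup>2)"
    by (simp add: power_divide power_mult_distrib mult_ac)
  finally show "(\<integral>x. \<bar>f x\<bar> \<partial>s.Q) \<le> sqrt (18 * (dot4 / \<rho>\<^sup>2) * (card X / (real n)\<^sup>2))" .
qed

lemma (in noise) y_lag_sum:
  assumes \<tau>: "\<tau> \<ge> 1" "2 * \<tau> < n" and X: "X \<subseteq> {1..n}" and n: "n \<ge> 1"
  defines "f \<equiv> \<lambda>x. 1 / sqrt n * (\<Sum>t\<in>X. y (x t) * y (x (circ n (t + \<tau>))))"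
  shows "f \<in> borel_measurable (PiM {1..n} (\<lambda>_. V))" "integrable (PiM {1..n} (\<lambda>_. V)) f"
    "(\<integral>x. \<bar>f x\<bar> \<partial>PiM {1..n} (\<lambda>_. V)) \<le> sqrt (card X / n)"
proof -
  interpret s: shifted_noise V p S y n "\<lambda>t. circ n (t + \<tau>)" by (rule shifted[OF \<tau>])
  interpret Q: prob_space "s.Q" by (rule s.prob_space_Q)
  have m: "(\<lambda>x. \<Sum>t\<in>X. y (x t) * y (x (circ n (t + \<tau>)))) \<in> borel_measurable s.Q"
    using X s.c_range by (intro borel_measurable_sum borel_measurable_times s.y_Q_measurable) blast+
  then show fm: "f \<in> borel_measurable s.Q" unfolding f_def by simp
  have i2: "integrable s.Q (\<lambda>x. (f x)\<^sup>2)"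
    unfolding f_def power_mult_distrib using s.yy_sum_power2(1)[OF X] by (rule integrable_mult_right)
  show "integrable s.Q f" by (rule Q.integrable_L2_L1[OF fm i2])
  have "(\<integral>x. \<bar>f x\<bar> \<partial>s.Q) \<le> sqrt (\<integral>x. (f x)\<^sup>2 \<partial>s.Q)" by (rule Q.expectation_abs_le_sqrt[OF fm i2])
  also have "(\<integral>x. (f x)\<^sup>2 \<partial>s.Q) = (1 / sqrt n)\<^sup>2 * card X"
    unfolding f_def power_mult_distrib integral_mult_right_zero s.yy_sum_power2(2)[OF X] ..
  also have "\<dots> = card X / n" by (simp add: power_divide)
  finally show "(\<integral>x. \<bar>f x\<bar> \<partial>s.Q) \<le> sqrt (card X / n)" .
qed

text \<open>The squared sample mean has expectation 1/n. Multiplied by \<open>sqrt n\<close>, it is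
  negligible together with its centring.\<close>

lemma (in noise) y_mean_square:
  fixes n :: nat
  assumes \<tau>: "2 < n"
  defines "f \<equiv> \<lambda>x. sqrt n * ((1 / n * (\<Sum>t=1..n. y (x t)))\<^sup>2 - 1 / n)"
  shows "f \<in> borel_measurable (PiM {1..n} (\<lambda>_. V))" "integrable (PiM {1..n} (\<lambda>_. V)) f"
    "(\<integral>x. \<bar>f x\<bar> \<partial>PiM {1..n} (\<lambda>_. V)) \<le> 2 / sqrt n"
proof -
  interpret s: shifted_noise V p S y n "\<lambda>t. circ n (t + 1)" by (rule shifted) (use \<tau> in auto)
  interpret Q: prob_space "s.Q" by (rule s.prob_space_Q)
  have n0: "real n > 0" using \<tau> by simp
  let ?s = "\<lambda>x. \<Sum>t=1..n. y (x t)"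
  have m: "?s \<in> borel_measurable s.Q" by (intro borel_measurable_sum s.y_Q_measurable)
  then show fm: "f \<in> borel_measurable s.Q" unfolding f_def by simp
  have i1: "integrable s.Q (\<lambda>x. (1 / n * ?s x)\<^sup>2)"
    unfolding power_mult_distrib using s.y_sum_power2(1) by (rule integrable_mult_right)
  show fi: "integrable s.Q f"
    unfolding f_def by (intro integrable_mult_right Bochner_Integration.integrable_diff i1 Q.integrable_const)
  have E: "(\<integral>x. (1 / n * ?s x)\<^sup>2 \<partial>s.Q) = 1 / n"
    unfolding power_mult_distrib integral_mult_right_zero s.y_sum_power2(2) using n0 by (simp add: power2_eq_square)
  have "(\<integral>x. \<bar>f x\<bar> \<partial>s.Q) \<le> (\<integral>x. sqrt n * ((1 / n * ?s x)\<^sup>2 + 1 / n) \<partial>s.Q)"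
  proof (rule integral_mono)
    show "integrable s.Q (\<lambda>x. \<bar>f x\<bar>)" using fi by simp
    show "integrable s.Q (\<lambda>x. sqrt n * ((1 / n * ?s x)\<^sup>2 + 1 / n))"
      by (intro integrable_mult_right Bochner_Integration.integrable_add i1 Q.integrable_const)
    fix x
    have "\<bar>u\<^sup>2 - 1 / n\<bar> \<le> u\<^sup>2 + 1 / n" for u :: real by (simp add: abs_le_iff)
    then show "\<bar>f x\<bar> \<le> sqrt n * ((1 / n * ?s x)\<^sup>2 + 1 / n)" unfolding f_def abs_mult by (intro mult_mono) auto
  qed
  also have "\<dots> = sqrt n * (\<integral>x. (1 / n * ?s x)\<^sup>2 + 1 / n \<partial>s.Q)" by (rule integral_mult_right_zero)
  also have "(\<integral>x. (1 / n * ?s x)\<^sup>2 + 1 / n \<partial>s.Q) = 1 / n + 1 / n"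
  proof -
    have "(\<integral>x. 1 / real n \<partial>s.Q) = 1 / n" by (simp only: lebesgue_integral_const Q.prob_space real_scaleR_def mult_1)
    then show ?thesis using Bochner_Integration.integral_add[OF i1 Q.integrable_const, of "1 / n"] E by (simp only:)
  qed
  also have "sqrt n * (1 / n + 1 / n) = 2 / sqrt n"
    using n0 by (simp add: field_simps)
  finally show "(\<integral>x. \<bar>f x\<bar> \<partial>s.Q) \<le> 2 / sqrt n" .
qed

lemma finite_off_diag: "finite (off_diag n)" and card_off_diag: "card (off_diag n) \<le> n\<^sup>2"
proof -
  have s: "off_diag n \<subseteq> {1..n} \<times> {1..n}" by (auto simp: off_diag_def)
  show "finite (off_diag n)" by (rule finite_subset[OF s]) simp
  have "card (off_diag n) \<le> card ({1..n} \<times> {1..n})" by (rule card_mono[OF _ s]) simp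
  then show "card (off_diag n) \<le> n\<^sup>2" by (simp add: card_cartesian_product power2_eq_square)
qed

definition block_error :: "nat \<Rightarrow> nat \<Rightarrow> nat \<Rightarrow> real" where
  "block_error q L n = 2 * real q / real L + 3 * real L / real n"

text \<open>The second-moment bound is proportional to the number of pairs and valid for any set of
  pairs. Applied to the complement of \<open>good_pairs\<close>, it turns the share of lost pairs
  into the L1 error, uniformly in p.\<close>

lemma (in noise) stat1_approx:
  assumes \<tau>: "\<tau> \<in> {1..q}" and L: "q < L" "L \<le> n" and n: "2 * q < n" and \<rho>: "\<rho> > 0" and N: "N = n div L"
  shows "stat1 n \<tau> \<in> borel_measurable (PiM {1..n} (\<lambda>_. V))" "block1 n N L \<tau> \<in> borel_measurable (PiM {1..n} (\<lambda>_. V))"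
    "integrable (PiM {1..n} (\<lambda>_. V)) (stat1 n \<tau>)" "integrable (PiM {1..n} (\<lambda>_. V)) (block1 n N L \<tau>)"
    "(\<integral>x. \<bar>stat1 n \<tau> x\<bar> \<partial>PiM {1..n} (\<lambda>_. V)) \<le> sqrt (18 * (dot4 / \<rho>\<^sup>2))"
    "(\<integral>x. \<bar>stat1 n \<tau> x - block1 n N L \<tau> x\<bar> \<partial>PiM {1..n} (\<lambda>_. V)) \<le> sqrt (18 * (dot4 / \<rho>\<^sup>2) * block_error q L n)"
proof -
  have t: "\<tau> \<ge> 1" "2 * \<tau> < n" "\<tau> \<le> q" and n1: "n \<ge> 1" using \<tau> n by auto
  note bc = block_count_bounds[OF L t(3) N, folded block_error_def]
  have gs: "good_pairs N L \<tau> \<subseteq> off_diag n" by (rule good_pairs_subset[OF bc(1)])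
  have n0: "real n > 0" using n1 by simp
  have d0: "dot4 / \<rho>\<^sup>2 \<ge> 0" by (simp add: dot4_def)
  note a = lag_sum[OF t(1,2) order_refl \<rho> n1] and b = lag_sum[OF t(1,2) gs \<rho> n1] and c = lag_sum[OF t(1,2) Diff_subset[of "off_diag n" "good_pairs N L \<tau>"] \<rho> n1]
  show "stat1 n \<tau> \<in> borel_measurable (PiM {1..n} (\<lambda>_. V))" "integrable (PiM {1..n} (\<lambda>_. V)) (stat1 n \<tau>)"
    unfolding stat1_def[abs_def] by (rule a)+
  show "block1 n N L \<tau> \<in> borel_measurable (PiM {1..n} (\<lambda>_. V))" "integrable (PiM {1..n} (\<lambda>_. V)) (block1 n N L \<tau>)"
    unfolding block1_def[abs_def] by (rule b)+
  have "card (off_diag n) / (real n)\<^sup>2 \<le> 1"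
    using card_off_diag[of n] n0 by (simp flip: of_nat_power)
  then have "18 * (dot4 / \<rho>\<^sup>2) * (card (off_diag n) / (real n)\<^sup>2) \<le> 18 * (dot4 / \<rho>\<^sup>2) * 1"
    using d0 by (intro mult_left_mono) auto
  then show "(\<integral>x. \<bar>stat1 n \<tau> x\<bar> \<partial>PiM {1..n} (\<lambda>_. V)) \<le> sqrt (18 * (dot4 / \<rho>\<^sup>2))"
    unfolding stat1_def using a(3) by (simp only: mult_1_right) (meson order_trans real_sqrt_le_mono)
  have e: "stat1 n \<tau> x - block1 n N L \<tau> x = 1 / (sqrt 2 * n * \<rho>) * (\<Sum>ts\<in>off_diag n - good_pairs N L \<tau>. lag_product p n \<tau> x ts)" for x
    unfolding stat1_def block1_def by (simp only: sum_diff[OF finite_off_diag gs] right_diff_distrib)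
  have "card (off_diag n - good_pairs N L \<tau>) / (real n)\<^sup>2 \<le> block_error q L n"
  proof -
    have "card (off_diag n - good_pairs N L \<tau>) = card (off_diag n) - card (good_pairs N L \<tau>)"
      by (rule card_Diff_subset[OF finite_subset[OF gs finite_off_diag] gs])
    moreover have "card (good_pairs N L \<tau>) \<le> card (off_diag n)" by (rule card_mono[OF finite_off_diag gs])
    ultimately have "real (card (off_diag n - good_pairs N L \<tau>)) = real (card (off_diag n)) - real (card (good_pairs N L \<tau>))"
      by simp
    also have "\<dots> \<le> real (n\<^sup>2) - real (card (good_pairs N L \<tau>))" using card_off_diag[of n] by (intro diff_right_mono of_nat_mono)
    also have "\<dots> = (real n)\<^sup>2 - real (N * (N - 1) * (L - \<tau>)\<^sup>2)" by (simp only: card_good_pairs of_nat_power)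
    also have "\<dots> \<le> (real n)\<^sup>2 * block_error q L n" by (rule bc(5))
    finally show ?thesis using n0 by (simp add: pos_divide_le_eq mult.commute)
  qed
  then have "18 * (dot4 / \<rho>\<^sup>2) * (card (off_diag n - good_pairs N L \<tau>) / (real n)\<^sup>2) \<le> 18 * (dot4 / \<rho>\<^sup>2) * block_error q L n"
    using d0 by (intro mult_left_mono) auto
  then show "(\<integral>x. \<bar>stat1 n \<tau> x - block1 n N L \<tau> x\<bar> \<partial>PiM {1..n} (\<lambda>_. V)) \<le> sqrt (18 * (dot4 / \<rho>\<^sup>2) * block_error q L n)"
    unfolding e using c(3) by (meson order_trans real_sqrt_le_mono)
qed

text \<open>The lost products are orthonormal, so their L2 size is the root of their share; the
  squared mean adds \<open>2 / sqrt n\<close>. The bound 3 is 1 for the normalised sum plus at most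
  2 for the squared mean.\<close>

lemma (in noise) stat2_approx:
  assumes \<tau>: "\<tau> \<in> {1..q}" and L: "q < L" "L \<le> n" and n: "2 * q < n" and N: "N = n div L"
  shows "stat2 n \<tau> \<in> borel_measurable (PiM {1..n} (\<lambda>_. V))" "block2 n N L \<tau> \<in> borel_measurable (PiM {1..n} (\<lambda>_. V))"
    "integrable (PiM {1..n} (\<lambda>_. V)) (stat2 n \<tau>)" "integrable (PiM {1..n} (\<lambda>_. V)) (block2 n N L \<tau>)"
    "(\<integral>x. \<bar>stat2 n \<tau> x\<bar> \<partial>PiM {1..n} (\<lambda>_. V)) \<le> 3"
    "(\<integral>x. \<bar>stat2 n \<tau> x - block2 n N L \<tau> x\<bar> \<partial>PiM {1..n} (\<lambda>_. V)) \<le> sqrt (block_error q L n) + 2 / sqrt n"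
proof -
  have t: "\<tau> \<ge> 1" "2 * \<tau> < n" "\<tau> \<le> q" and n1: "n \<ge> 1" and n2: "2 < n" using \<tau> n by auto
  note bc = block_count_bounds[OF L t(3) N, folded block_error_def]
  have gs: "good_times N L \<tau> \<subseteq> {1..n}" by (rule good_times_subset[OF bc(1)])
  have n0: "real n > 0" using n1 by simp
  note a = y_lag_sum[OF t(1,2) order_refl n1] and b = y_lag_sum[OF t(1,2) gs n1] and c = y_lag_sum[OF t(1,2) Diff_subset[of "{1..n}" "good_times N L \<tau>"] n1]
  note m = y_mean_square[OF n2]
  show "stat2 n \<tau> \<in> borel_measurable (PiM {1..n} (\<lambda>_. V))" "integrable (PiM {1..n} (\<lambda>_. V)) (stat2 n \<tau>)"
    unfolding stat2_def[abs_def] by (rule borel_measurable_diff[OF a(1) m(1)], rule Bochner_Integration.integrable_diff[OF a(2) m(2)])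
  show "block2 n N L \<tau> \<in> borel_measurable (PiM {1..n} (\<lambda>_. V))" "integrable (PiM {1..n} (\<lambda>_. V)) (block2 n N L \<tau>)"
    unfolding block2_def[abs_def] by (rule b)+
  have tri: "(\<integral>x. \<bar>f x - g x\<bar> \<partial>M) \<le> (\<integral>x. \<bar>f x\<bar> \<partial>M) + (\<integral>x. \<bar>g x\<bar> \<partial>M)"
    if i: "integrable M f" "integrable M g" for f g :: "'z \<Rightarrow> real" and M
  proof -
    have "(\<integral>x. \<bar>f x - g x\<bar> \<partial>M) \<le> (\<integral>x. \<bar>f x\<bar> + \<bar>g x\<bar> \<partial>M)"
      using i by (intro integral_mono) auto
    also have "\<dots> = (\<integral>x. \<bar>f x\<bar> \<partial>M) + (\<integral>x. \<bar>g x\<bar> \<partial>M)" using i by simp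
    finally show ?thesis .
  qed
  have sq: "sqrt n \<ge> 1" using n1 by simp
  have "(\<integral>x. \<bar>stat2 n \<tau> x\<bar> \<partial>PiM {1..n} (\<lambda>_. V)) \<le> sqrt (card {1..n} / n) + 2 / sqrt n"
    unfolding stat2_def by (rule order_trans[OF tri[OF a(2) m(2)] add_mono[OF a(3) m(3)]])
  also have "\<dots> \<le> 3"
  proof -
    have "2 / sqrt n \<le> 2" using sq by (simp add: divide_le_eq)
    then show ?thesis using n1 by simp
  qed
  finally show "(\<integral>x. \<bar>stat2 n \<tau> x\<bar> \<partial>PiM {1..n} (\<lambda>_. V)) \<le> 3" .
  have e: "stat2 n \<tau> x - block2 n N L \<tau> x = 1 / sqrt n * (\<Sum>t\<in>{1..n} - good_times N L \<tau>. y (x t) * y (x (circ n (t + \<tau>))))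
      - sqrt n * ((1 / n * (\<Sum>t=1..n. y (x t)))\<^sup>2 - 1 / n)" for x
    unfolding stat2_def block2_def by (simp only: sum_diff[OF finite_atLeastAtMost gs] right_diff_distrib)
  have "card ({1..n} - good_times N L \<tau>) / real n \<le> block_error q L n"
  proof -
    have "card ({1..n} - good_times N L \<tau>) = card {1..n} - card (good_times N L \<tau>)"
      by (rule card_Diff_subset[OF finite_subset[OF gs finite_atLeastAtMost] gs])
    then have "real (card ({1..n} - good_times N L \<tau>)) = real n - real (N * (L - \<tau>))"
      using card_mono[OF finite_atLeastAtMost gs] by (simp add: card_good_times of_nat_diff del: of_nat_mult)
    also have "\<dots> \<le> real n * block_error q L n" using bc(4) by simp
    finally show ?thesis using n0 by (simp add: pos_divide_le_eq mult.commute)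
  qed
  then have le: "sqrt (card ({1..n} - good_times N L \<tau>) / real n) \<le> sqrt (block_error q L n)" by (rule real_sqrt_le_mono)
  have "(\<integral>x. \<bar>stat2 n \<tau> x - block2 n N L \<tau> x\<bar> \<partial>PiM {1..n} (\<lambda>_. V)) \<le> sqrt (card ({1..n} - good_times N L \<tau>) / real n) + 2 / sqrt n"
    unfolding e by (rule order_trans[OF tri[OF c(2) m(2)] add_mono[OF c(3) m(3)]])
  then show "(\<integral>x. \<bar>stat2 n \<tau> x - block2 n N L \<tau> x\<bar> \<partial>PiM {1..n} (\<lambda>_. V)) \<le> sqrt (block_error q L n) + 2 / sqrt n"
    using le by linarith
qed

section \<open>Characteristic function of the block statistics\<close>

lemma (in ustat_kernel) ustat_sum_measurable:
  "(\<lambda>x. \<Sum>k<N. h (x k) + (\<Sum>l<k. H (x l) (x k))) \<in> borel_measurable (Pow_M N)"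
  by (intro borel_measurable_sum borel_measurable_add measurable_compose[OF Pow_comp_measurable h_meas] H_comp Pow_comp_measurable) auto

text \<open>The order of summation is changed from lags to blocks, so that all statistics share a
  single martingale. Every unordered pair of blocks occurs twice, which turns the normalisation
  \<open>1 / sqrt 2\<close> into the factor \<open>sqrt 2\<close> of the kernel.\<close>

lemma (in noise) block_combination:
  assumes NL: "N * L \<le> n"
  shows "(\<Sum>\<tau>=1..q. \<alpha> \<tau> * block1 n N L \<tau> x + \<alpha> (q + \<tau>) * block2 n N L \<tau> x) =
    (\<Sum>k<N. block_h y q L (\<lambda>\<tau>. \<alpha> (q + \<tau>) / sqrt n) (blocks N L x k)
      + (\<Sum>l<k. block_H p q L (\<lambda>\<tau>. \<alpha> \<tau> * (sqrt 2 / (n * \<rho>))) (blocks N L x l) (blocks N L x k)))"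
proof -
  let ?d = "\<lambda>\<tau>. \<alpha> (q + \<tau>) / sqrt n" and ?c = "\<lambda>\<tau>. \<alpha> \<tau> * (sqrt 2 / (n * \<rho>))"
  let ?Z = "blocks N L x"
  have c2: "1 / (sqrt 2 * n * \<rho>) * (2 * s) = sqrt 2 / (n * \<rho>) * s" for s :: real
  proof -
    have "sqrt 2 / (n * \<rho>) = sqrt 2 * sqrt 2 / (sqrt 2 * n * \<rho>)" by (subst mult.assoc, subst mult_divide_mult_cancel_left) auto
    also have "\<dots> = 2 / (sqrt 2 * n * \<rho>)" by simp
    finally show ?thesis by simp
  qed
  have 1: "\<alpha> \<tau> * block1 n N L \<tau> x = (\<Sum>k<N. \<Sum>l<k. \<Sum>i<L - \<tau>. \<Sum>j<L - \<tau>.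
      ?c \<tau> * (dotp p (?Z l i) (?Z k j) * dotp p (?Z l (i + \<tau>)) (?Z k (j + \<tau>))))" for \<tau>
    unfolding block1_def sum_good_pairs[OF NL] c2 by (simp only: sum_distrib_left mult.assoc)
  have 2: "\<alpha> (q + \<tau>) * block2 n N L \<tau> x = (\<Sum>k<N. \<Sum>i<L - \<tau>. ?d \<tau> * (y (?Z k i) * y (?Z k (i + \<tau>))))" for \<tau>
    unfolding block2_def sum_good_times[OF NL] by (simp add: sum_distrib_left mult.assoc sum_divide_distrib)
  have "(\<Sum>\<tau>=1..q. \<alpha> \<tau> * block1 n N L \<tau> x + \<alpha> (q + \<tau>) * block2 n N L \<tau> x)
    = (\<Sum>\<tau>=1..q. \<Sum>k<N. (\<Sum>i<L - \<tau>. ?d \<tau> * (y (?Z k i) * y (?Z k (i + \<tau>))))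
        + (\<Sum>l<k. \<Sum>i<L - \<tau>. \<Sum>j<L - \<tau>. ?c \<tau> * (dotp p (?Z l i) (?Z k j) * dotp p (?Z l (i + \<tau>)) (?Z k (j + \<tau>)))))"
    unfolding 1 2 sum.distrib by simp
  also have "\<dots> = (\<Sum>k<N. \<Sum>\<tau>=1..q. (\<Sum>i<L - \<tau>. ?d \<tau> * (y (?Z k i) * y (?Z k (i + \<tau>))))
        + (\<Sum>l<k. \<Sum>i<L - \<tau>. \<Sum>j<L - \<tau>. ?c \<tau> * (dotp p (?Z l i) (?Z k j) * dotp p (?Z l (i + \<tau>)) (?Z k (j + \<tau>)))))"
    by (rule sum.swap)
  also have "\<dots> = (\<Sum>k<N. block_h y q L ?d (?Z k) + (\<Sum>l<k. block_H p q L ?c (?Z l) (?Z k)))"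
  proof (intro sum.cong refl)
    fix k
    have "(\<Sum>\<tau>=1..q. \<Sum>l<k. \<Sum>i<L - \<tau>. \<Sum>j<L - \<tau>. ?c \<tau> * (dotp p (?Z l i) (?Z k j) * dotp p (?Z l (i + \<tau>)) (?Z k (j + \<tau>))))
      = (\<Sum>l<k. block_H p q L ?c (?Z l) (?Z k))"
      unfolding block_H_def by (rule sum.swap)
    then show "(\<Sum>\<tau>=1..q. (\<Sum>i<L - \<tau>. ?d \<tau> * (y (?Z k i) * y (?Z k (i + \<tau>))))
        + (\<Sum>l<k. \<Sum>i<L - \<tau>. \<Sum>j<L - \<tau>. ?c \<tau> * (dotp p (?Z l i) (?Z k j) * dotp p (?Z l (i + \<tau>)) (?Z k (j + \<tau>)))))
      = block_h y q L ?d (?Z k) + (\<Sum>l<k. block_H p q L ?c (?Z l) (?Z k))"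
      unfolding sum.distrib by (simp only: block_h_def)
  qed
  finally show ?thesis .
qed

definition clt_error :: "real \<Rightarrow> real \<Rightarrow> nat \<Rightarrow> real" where
  "clt_error K \<epsilon> n = 17 / 6 * K / sqrt n + sqrt K / (2 * sqrt n) + K\<^sup>2 / (2 * real n) + sqrt (K * sqrt \<epsilon>) + sqrt \<epsilon>"

text \<open>A single constant for four bounds: the first summand serves \<open>h2\<close> and
  \<open>H2\<close>, the second \<open>h4\<close>, the third \<open>H4\<close>. The inner 4 is the
  fourth power of \<open>sqrt 2\<close>.\<close>

definition block_const :: "nat \<Rightarrow> nat \<Rightarrow> real \<Rightarrow> real \<Rightarrow> real \<Rightarrow> real" where
  "block_const q L A C4 Cy = 2 * real q * A\<^sup>2 * (real L)\<^sup>2 + (real q * real L) ^ 4 * A ^ 4 * Cy\<^sup>2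
     + (real q * (real L)\<^sup>2) ^ 4 * (4 * A ^ 4) * C4\<^sup>2"

lemma abs_le_power4:
  fixes x y :: real
  assumes "\<bar>x\<bar> \<le> y"
  shows "x ^ 4 \<le> y ^ 4"
proof -
  have "\<bar>x\<bar> ^ 4 \<le> y ^ 4" using assms by (intro power_mono) auto
  then show ?thesis by simp
qed

text \<open>The second argument of \<open>clt_error\<close> bounds \<open>n^4\<close> times
  \<open>Gsq\<close>: the fourth power of the coefficient \<open>A * sqrt 2 / (n * \<rho>)\<close>
  times \<open>L\<close> meets the square of \<open>C2 * \<rho>\<close>, and a decay like the
  inverse square of \<open>\<rho>\<close> remains. The final summand compares the variance of the
  block sum with the limiting one.\<close>

lemma (in noise) block_char_bound:
  assumes L: "q < L" "L \<le> n" and \<rho>: "\<rho> > 0" and N: "N = n div L"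
    and C4: "dot4 \<le> C4 * \<rho>\<^sup>2" "C4 \<ge> 0" and Cy: "y4 \<le> Cy" and C2: "(\<Sum>a<p. \<Sum>b<p. (\<Sum>k<p. S a k * S k b)\<^sup>2) \<le> C2 * \<rho>"
    and A: "\<And>k. k \<in> {1..2 * q} \<Longrightarrow> \<bar>\<alpha> k\<bar> \<le> A" "A \<ge> 0"
  shows "cmod ((\<integral>x. cis (\<Sum>\<tau>=1..q. \<alpha> \<tau> * block1 n N L \<tau> x + \<alpha> (q + \<tau>) * block2 n N L \<tau> x) \<partial>PiM {1..n} (\<lambda>_. V))
      - complex_of_real (exp (- (\<Sum>k\<in>{1..2 * q}. (\<alpha> k)\<^sup>2) / 2)))
    \<le> clt_error (block_const q L A C4 Cy) (4 * real q * A ^ 4 * real L ^ 4 * C2\<^sup>2 / \<rho>\<^sup>2) n + q * A\<^sup>2 * block_error q L n"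
proof -
  let ?d = "\<lambda>\<tau>. \<alpha> (q + \<tau>) / sqrt n" and ?c = "\<lambda>\<tau>. \<alpha> \<tau> * (sqrt 2 / (n * \<rho>))"
  let ?K = "block_const q L A C4 Cy" and ?e = "4 * real q * A ^ 4 * real L ^ 4 * C2\<^sup>2 / \<rho>\<^sup>2"
  let ?T2 = "\<Sum>a<p. \<Sum>b<p. (\<Sum>k<p. S a k * S k b)\<^sup>2"
  interpret U: ustat_kernel "Pow_M L" "block_H p q L ?c" "block_h y q L ?d" by (rule block_ustat)
  note bc = block_count_bounds[OF L _ N, folded block_error_def]
  have n1: "n \<ge> 1" and L1: "L \<ge> 1" using L by auto
  have n0: "real n > 0" and L0: "real L \<ge> 1" using n1 L1 by auto
  have A2: "(\<alpha> k)\<^sup>2 \<le> A\<^sup>2" if "k \<in> {1..2 * q}" for k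
    using A(1)[OF that] A(2) by (metis abs_le_square_iff abs_of_nonneg)
  have y40: "y4 \<ge> 0" "dot4 \<ge> 0" by (simp_all add: y4_def dot4_def)
  have T0: "?T2 \<ge> 0" by (intro sum_nonneg) simp
  have Kparts: "2 * real q * A\<^sup>2 * (real L)\<^sup>2 \<ge> 0" "(real q * real L) ^ 4 * A ^ 4 * Cy\<^sup>2 \<ge> 0" "(real q * (real L)\<^sup>2) ^ 4 * (4 * A ^ 4) * C4\<^sup>2 \<ge> 0"
    using A(2) by simp_all
  have K0: "?K \<ge> 0" using Kparts unfolding block_const_def by linarith
  have h2: "U.h2 = (\<Sum>\<tau>=1..q. (\<alpha> (q + \<tau>))\<^sup>2 * real (L - \<tau>)) / n"
    unfolding block_h2 using n0 by (simp add: power_divide sum_divide_distrib)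
  have H2: "U.H2 = (\<Sum>\<tau>=1..q. 2 * (\<alpha> \<tau>)\<^sup>2 * (real (L - \<tau>))\<^sup>2) / (real n)\<^sup>2"
    unfolding block_H2 sum_divide_distrib \<rho>_def[symmetric]
    using \<rho> n0 by (intro sum.cong refl) (simp add: power_mult_distrib power_divide)
  have b1: "U.h2 \<le> ?K / n"
  proof -
    have "(\<Sum>\<tau>=1..q. (\<alpha> (q + \<tau>))\<^sup>2 * real (L - \<tau>)) \<le> (\<Sum>\<tau>=1..q. A\<^sup>2 * real L)"
      by (intro sum_mono mult_mono A2) auto
    also have "\<dots> = q * A\<^sup>2 * real L * 1" by simp
    also have "\<dots> \<le> q * A\<^sup>2 * real L * (2 * real L)" using L0 by (intro mult_left_mono) auto
    also have "\<dots> = 2 * real q * A\<^sup>2 * (real L)\<^sup>2" by (simp add: power2_eq_square)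
    also have "\<dots> \<le> ?K" using Kparts unfolding block_const_def by linarith
    finally show ?thesis unfolding h2 using n0 by (simp add: divide_right_mono)
  qed
  have b2: "U.H2 \<le> ?K / (real n)\<^sup>2"
  proof -
    have "(\<Sum>\<tau>=1..q. 2 * (\<alpha> \<tau>)\<^sup>2 * (real (L - \<tau>))\<^sup>2) \<le> (\<Sum>\<tau>=1..q. 2 * A\<^sup>2 * (real L)\<^sup>2)"
      by (intro sum_mono mult_mono mult_left_mono A2 power_mono) auto
    also have "\<dots> = 2 * real q * A\<^sup>2 * (real L)\<^sup>2" by simp
    also have "\<dots> \<le> ?K" using Kparts unfolding block_const_def by linarith
    finally show ?thesis unfolding H2 by (simp add: divide_right_mono)
  qed
  have b3: "U.h4 \<le> ?K / (real n)\<^sup>2"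
  proof -
    have "\<bar>?d \<tau>\<bar> \<le> A / sqrt n" if "\<tau> \<in> {1..q}" for \<tau>
      using A(1)[of "q + \<tau>"] that by (simp add: abs_divide divide_right_mono)
    then have "U.h4 \<le> (real q * real L) ^ 4 * (A / sqrt n) ^ 4 * y4\<^sup>2" by (rule block_h4)
    also have "(A / sqrt n) ^ 4 = A ^ 4 / (real n)\<^sup>2"
    proof -
      have "sqrt n ^ 4 = (real n)\<^sup>2" using n0 by (simp add: power4_eq_xxxx power2_eq_square)
      then show ?thesis by (simp add: power_divide)
    qed
    also have "(real q * real L) ^ 4 * (A ^ 4 / (real n)\<^sup>2) * y4\<^sup>2 \<le> (real q * real L) ^ 4 * (A ^ 4 / (real n)\<^sup>2) * Cy\<^sup>2"
      using Cy y40 A(2) by (intro mult_left_mono power_mono) auto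
    also have "\<dots> = (real q * real L) ^ 4 * A ^ 4 * Cy\<^sup>2 / (real n)\<^sup>2" by simp
    also have "\<dots> \<le> ?K / (real n)\<^sup>2" using Kparts unfolding block_const_def by (intro divide_right_mono) (linarith, simp)
    finally show ?thesis .
  qed
  have c4: "(A * (sqrt 2 / (n * \<rho>))) ^ 4 = 4 * A ^ 4 / (real n ^ 4 * \<rho> ^ 4)"
  proof -
    have "sqrt 2 ^ 4 = (4::real)" by (simp add: power4_eq_xxxx)
    then show ?thesis by (simp add: power_mult_distrib power_divide)
  qed
  have b4: "U.H4 \<le> ?K / real n ^ 4"
  proof -
    have "\<bar>?c \<tau>\<bar> \<le> A * (sqrt 2 / (n * \<rho>))" if "\<tau> \<in> {1..q}" for \<tau>
      using A(1)[of \<tau>] that \<rho> unfolding abs_mult by (intro mult_mono) auto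
    then have "U.H4 \<le> (real q * (real L)\<^sup>2) ^ 4 * (A * (sqrt 2 / (n * \<rho>))) ^ 4 * dot4\<^sup>2" by (rule block_H4[of q ?c _ L])
    also have "\<dots> \<le> (real q * (real L)\<^sup>2) ^ 4 * (A * (sqrt 2 / (n * \<rho>))) ^ 4 * (C4 * \<rho>\<^sup>2)\<^sup>2"
      using C4 y40 A(2) \<rho> by (intro mult_left_mono power_mono) auto
    also have "\<dots> = (real q * (real L)\<^sup>2) ^ 4 * (4 * A ^ 4) * C4\<^sup>2 / real n ^ 4"
      unfolding c4 using \<rho> by (simp add: power_mult_distrib)
    also have "\<dots> \<le> ?K / real n ^ 4" using Kparts unfolding block_const_def by (intro divide_right_mono) (linarith, simp)
    finally show ?thesis .
  qed
  have b5: "U.Gsq \<le> ?e / real n ^ 4"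
  proof -
    have "U.Gsq = (\<Sum>\<tau>=1..q. (?c \<tau> * real (L - \<tau>)) ^ 4 * ?T2\<^sup>2)" by (rule block_Gsq)
    also have "\<dots> \<le> (\<Sum>\<tau>=1..q. (A * (sqrt 2 / (n * \<rho>)) * real L) ^ 4 * (C2 * \<rho>)\<^sup>2)"
    proof (intro sum_mono mult_mono)
      fix \<tau> assume t: "\<tau> \<in> {1..q}"
      have "\<bar>?c \<tau> * real (L - \<tau>)\<bar> \<le> A * (sqrt 2 / (n * \<rho>)) * real L"
        using A(1)[of \<tau>] A(2) t \<rho> unfolding abs_mult by (intro mult_mono) auto
      then show "(?c \<tau> * real (L - \<tau>)) ^ 4 \<le> (A * (sqrt 2 / (n * \<rho>)) * real L) ^ 4" by (rule abs_le_power4)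
      show "?T2\<^sup>2 \<le> (C2 * \<rho>)\<^sup>2" using C2 T0 by (intro power_mono)
    qed auto
    also have "\<dots> = q * (4 * A ^ 4 / (real n ^ 4 * \<rho> ^ 4) * real L ^ 4 * (C2 * \<rho>)\<^sup>2)"
      unfolding power_mult_distrib[of "A * (sqrt 2 / (n * \<rho>))" "real L"] c4 by simp
    also have "\<dots> = ?e / real n ^ 4"
      using \<rho> n0 by (simp add: power_mult_distrib power4_eq_xxxx power2_eq_square field_simps)
    finally show ?thesis .
  qed
  have "0 \<le> ?e" using A(2) by simp
  from U.char_bound_normalized[OF n1 _ K0 this b1 b2 b3 b4 b5, of N]
  have 1: "cmod ((\<integral>Z. cis (\<Sum>k<N. block_h y q L ?d (Z k) + (\<Sum>l<k. block_H p q L ?c (Z l) (Z k))) \<partial>PiM {..<N} (\<lambda>_. Pow_M L))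
      - complex_of_real (exp (- (\<Sum>k<N. U.h2 + real k * U.H2) / 2))) \<le> clt_error ?K ?e n"
    using N by (simp add: clt_error_def)
  have dm: "blocks N L \<in> measurable (PiM {1..n} (\<lambda>_. V)) (PiM {..<N} (\<lambda>_. Pow_M L))"
    and dd: "distr (PiM {1..n} (\<lambda>_. V)) (PiM {..<N} (\<lambda>_. Pow_M L)) (blocks N L) = PiM {..<N} (\<lambda>_. Pow_M L)"
    using distr_blocks[OF bc(1,2)[of 0] L1] by simp_all
  have cm: "(\<lambda>Z. cis (\<Sum>k<N. block_h y q L ?d (Z k) + (\<Sum>l<k. block_H p q L ?c (Z l) (Z k)))) \<in> borel_measurable (PiM {..<N} (\<lambda>_. Pow_M L))"
    by (rule measurable_compose[OF U.ustat_sum_measurable]) (intro borel_measurable_continuous_onI continuous_intros)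
  have 2: "(\<integral>x. cis (\<Sum>\<tau>=1..q. \<alpha> \<tau> * block1 n N L \<tau> x + \<alpha> (q + \<tau>) * block2 n N L \<tau> x) \<partial>PiM {1..n} (\<lambda>_. V))
    = (\<integral>Z. cis (\<Sum>k<N. block_h y q L ?d (Z k) + (\<Sum>l<k. block_H p q L ?c (Z l) (Z k))) \<partial>PiM {..<N} (\<lambda>_. Pow_M L))"
    unfolding block_combination[OF bc(1)[of 0, OF le0]] using integral_distr[OF dm cm] unfolding dd by (rule sym)
  define s where "s = (\<Sum>k<N. U.h2 + real k * U.H2)"
  define a where "a = (\<Sum>k\<in>{1..2 * q}. (\<alpha> k)\<^sup>2)"
  have a_split: "a = (\<Sum>\<tau>=1..q. (\<alpha> \<tau>)\<^sup>2 + (\<alpha> (q + \<tau>))\<^sup>2)"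
  proof -
    have "{1..2 * q} = {1..q} \<union> (\<lambda>\<tau>. q + \<tau>) ` {1..q}"
      by (auto simp: image_iff Bex_def)
    then have "a = (\<Sum>k\<in>{1..q}. (\<alpha> k)\<^sup>2) + (\<Sum>k\<in>(\<lambda>\<tau>. q + \<tau>) ` {1..q}. (\<alpha> k)\<^sup>2)"
      unfolding a_def by (simp only:) (rule sum.union_disjoint, auto)
    also have "(\<Sum>k\<in>(\<lambda>\<tau>. q + \<tau>) ` {1..q}. (\<alpha> k)\<^sup>2) = (\<Sum>\<tau>=1..q. (\<alpha> (q + \<tau>))\<^sup>2)"
      by (subst sum.reindex) (auto simp: inj_on_def)
    finally show ?thesis by (simp add: sum.distrib)
  qed
  \<comment> \<open>The conditional variances grow linearly in k; their sum reproduces exactly the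
    number of retained pairs divided by \<open>n^2\<close>.\<close>
  have gauss: "2 * (\<Sum>k<N. real k) = real (N * (N - 1))"
    by (induction N) (auto simp: algebra_simps of_nat_diff)
  have s_eq: "s = (\<Sum>\<tau>=1..q. (\<alpha> (q + \<tau>))\<^sup>2 * (real N * real (L - \<tau>) / n) + (\<alpha> \<tau>)\<^sup>2 * (real (N * (N - 1) * (L - \<tau>)\<^sup>2) / (real n)\<^sup>2))"
  proof -
    have "s = N * U.h2 + (\<Sum>k<N. real k) * U.H2" by (simp add: s_def sum.distrib sum_distrib_right)
    also have "\<dots> = N * U.h2 + real (N * (N - 1)) * (U.H2 / 2)" using gauss by simp
    also have "N * U.h2 = (\<Sum>\<tau>=1..q. (\<alpha> (q + \<tau>))\<^sup>2 * (real N * real (L - \<tau>) / n))"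
      unfolding h2 by (simp add: sum_divide_distrib sum_distrib_left mult_ac)
    also have "real (N * (N - 1)) * (U.H2 / 2) = (\<Sum>\<tau>=1..q. (\<alpha> \<tau>)\<^sup>2 * (real (N * (N - 1) * (L - \<tau>)\<^sup>2) / (real n)\<^sup>2))"
      unfolding H2 sum_divide_distrib sum_distrib_left by (intro sum.cong refl) (simp add: mult_ac)
    finally show ?thesis by (simp add: sum.distrib)
  qed
  have sa: "\<bar>s - a\<bar> \<le> 2 * q * A\<^sup>2 * block_error q L n" and s0: "s \<ge> 0"
  proof -
    have "\<bar>s - a\<bar> \<le> (\<Sum>\<tau>=1..q. 2 * A\<^sup>2 * block_error q L n)"
      unfolding s_eq a_split sum_subtractf[symmetric]
    proof (rule order_trans[OF sum_abs], rule sum_mono)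
      fix \<tau> assume t: "\<tau> \<in> {1..q}"
      then have tq: "\<tau> \<le> q" by simp
      define u where "u = real N * real (L - \<tau>) / n"
      define w where "w = real (N * (N - 1) * (L - \<tau>)\<^sup>2) / (real n)\<^sup>2"
      have u: "u \<le> 1" "1 - u \<le> block_error q L n"
        using bc(3,4)[OF tq] n0 by (simp_all add: u_def field_simps)
      have w: "w \<le> 1" "1 - w \<le> block_error q L n"
      proof -
        have n2: "(real n)\<^sup>2 > 0" using n0 by simp
        show "w \<le> 1" unfolding w_def using bc(6)[OF tq] n2 by (simp only: divide_le_eq_1 if_True) simp
        have "1 - w = ((real n)\<^sup>2 - real (N * (N - 1) * (L - \<tau>)\<^sup>2)) / (real n)\<^sup>2"
          unfolding w_def diff_divide_distrib using n2 by simp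
        also have "\<dots> \<le> block_error q L n" using bc(5)[OF tq] n2 by (simp only: pos_divide_le_eq mult.commute)
        finally show "1 - w \<le> block_error q L n" .
      qed
      have "(\<alpha> (q + \<tau>))\<^sup>2 * u + (\<alpha> \<tau>)\<^sup>2 * w - ((\<alpha> \<tau>)\<^sup>2 + (\<alpha> (q + \<tau>))\<^sup>2) = - ((\<alpha> (q + \<tau>))\<^sup>2 * (1 - u) + (\<alpha> \<tau>)\<^sup>2 * (1 - w))"
        by (simp add: algebra_simps)
      moreover have "0 \<le> (\<alpha> (q + \<tau>))\<^sup>2 * (1 - u)" "0 \<le> (\<alpha> \<tau>)\<^sup>2 * (1 - w)" using u w by simp_all
      moreover have "(\<alpha> (q + \<tau>))\<^sup>2 * (1 - u) \<le> A\<^sup>2 * block_error q L n" "(\<alpha> \<tau>)\<^sup>2 * (1 - w) \<le> A\<^sup>2 * block_error q L n"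
        using t u w by (intro mult_mono A2; simp)+
      ultimately show "\<bar>(\<alpha> (q + \<tau>))\<^sup>2 * (real N * real (L - \<tau>) / n) + (\<alpha> \<tau>)\<^sup>2 * (real (N * (N - 1) * (L - \<tau>)\<^sup>2) / (real n)\<^sup>2)
          - ((\<alpha> \<tau>)\<^sup>2 + (\<alpha> (q + \<tau>))\<^sup>2)\<bar> \<le> 2 * A\<^sup>2 * block_error q L n"
        unfolding u_def[symmetric] w_def[symmetric] by linarith
    qed
    then show "\<bar>s - a\<bar> \<le> 2 * q * A\<^sup>2 * block_error q L n" by simp
    show "s \<ge> 0" unfolding s_eq by (intro sum_nonneg add_nonneg_nonneg mult_nonneg_nonneg divide_nonneg_nonneg) auto
  qed
  have a0: "a \<ge> 0" unfolding a_def by (intro sum_nonneg) simp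
  \<comment> \<open>\<open>exp\<close> is 1-Lipschitz on the negative axis, so half of the variance
    error survives, which cancels the factor 2 in \<open>sa\<close>.\<close>
  have exp_lip: "\<bar>exp (- s / 2) - exp (- a / 2)\<bar> \<le> \<bar>s - a\<bar> / 2"
  proof -
    have *: "\<bar>exp (- u) - exp (- v)\<bar> \<le> \<bar>u - v\<bar>" if "u \<ge> 0" "u \<le> v" for u v :: real
    proof -
      have "exp (- u) - exp (- v) = exp (- u) * (1 - exp (- (v - u)))" by (simp add: right_diff_distrib flip: exp_add)
      also have "\<dots> \<le> 1 * (v - u)"
      proof (rule mult_mono)
        have "1 + (u - v) \<le> exp (u - v)" by (rule exp_ge_add_one_self)
        then show "1 - exp (- (v - u)) \<le> v - u" unfolding minus_diff_eq by linarith
      qed (use that in auto)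
      finally show ?thesis using that by (simp add: abs_le_iff)
    qed
    have "\<bar>exp (- (s / 2)) - exp (- (a / 2))\<bar> \<le> \<bar>s / 2 - a / 2\<bar>"
    proof (cases "s \<le> a")
      case True
      then show ?thesis using *[of "s / 2" "a / 2"] s0 by simp
    next
      case False
      then show ?thesis using *[of "a / 2" "s / 2"] a0 by (simp add: abs_minus_commute)
    qed
    then show ?thesis by (simp add: abs_divide flip: diff_divide_distrib)
  qed
  let ?I = "\<integral>Z. cis (\<Sum>k<N. block_h y q L ?d (Z k) + (\<Sum>l<k. block_H p q L ?c (Z l) (Z k))) \<partial>PiM {..<N} (\<lambda>_. Pow_M L)"
  have "cmod (?I - complex_of_real (exp (- a / 2))) \<le> cmod (?I - complex_of_real (exp (- s / 2))) + cmod (complex_of_real (exp (- s / 2) - exp (- a / 2)))"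
    using norm_triangle_ineq[of "?I - complex_of_real (exp (- s / 2))" "complex_of_real (exp (- s / 2) - exp (- a / 2))"] by simp
  also have "\<dots> \<le> clt_error ?K ?e n + q * A\<^sup>2 * block_error q L n"
    using 1[folded s_def] exp_lip sa unfolding norm_of_real by simp
  finally show ?thesis unfolding 2 a_def .
qed

section \<open>Convergence of the autocovariances\<close>

text \<open>Three replacements are combined: full sums by block sums, the factor
  \<open>1 / \<kappa>\<close> by 1, and the block sums by a Gaussian. The second costs
  \<open>3 * \<bar>1 / \<kappa> - 1\<bar>\<close> because \<open>stat2\<close> has L1 norm at most
  3.\<close>

lemma (in noise) stat_char_bound:
  assumes L: "q < L" "L \<le> n" and n: "2 * q < n" and \<rho>: "\<rho> > 0" and \<kappa>: "\<kappa> > 0"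
    and C4: "dot4 \<le> C4 * \<rho>\<^sup>2" "C4 \<ge> 0" and Cy: "y4 \<le> Cy" and C2: "(\<Sum>a<p. \<Sum>b<p. (\<Sum>k<p. S a k * S k b)\<^sup>2) \<le> C2 * \<rho>"
    and A: "\<And>k. k \<in> {1..2 * q} \<Longrightarrow> \<bar>\<alpha> k\<bar> \<le> A" "A \<ge> 0"
  shows "cmod ((\<integral>x. cis (\<Sum>\<tau>=1..q. \<alpha> \<tau> * stat1 n \<tau> x + \<alpha> (q + \<tau>) * (stat2 n \<tau> x / \<kappa>)) \<partial>PiM {1..n} (\<lambda>_. V))
      - complex_of_real (exp (- (\<Sum>k\<in>{1..2 * q}. (\<alpha> k)\<^sup>2) / 2)))
    \<le> q * A * (sqrt (18 * C4 * block_error q L n) + (sqrt (block_error q L n) + 2 / sqrt n + 3 * \<bar>1 / \<kappa> - 1\<bar>))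
      + (clt_error (block_const q L A C4 Cy) (4 * real q * A ^ 4 * real L ^ 4 * C2\<^sup>2 / \<rho>\<^sup>2) n + q * A\<^sup>2 * block_error q L n)"
proof -
  define N where "N = n div L"
  let ?Q = "PiM {1..n} (\<lambda>_. V)" and ?be = "block_error q L n"
  interpret Q: prob_space ?Q by (intro prob_space_PiM prob_space_axioms)
  let ?f = "\<lambda>x. \<Sum>\<tau>=1..q. \<alpha> \<tau> * stat1 n \<tau> x + \<alpha> (q + \<tau>) * (stat2 n \<tau> x / \<kappa>)"
  let ?g = "\<lambda>x. \<Sum>\<tau>=1..q. \<alpha> \<tau> * block1 n N L \<tau> x + \<alpha> (q + \<tau>) * block2 n N L \<tau> x"
  note s1 = stat1_approx[OF _ L n \<rho> N_def] and s2 = stat2_approx[OF _ L n N_def]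
  have be0: "?be \<ge> 0" by (simp add: block_error_def)
  have fm: "?f \<in> borel_measurable ?Q" and gm: "?g \<in> borel_measurable ?Q"
    by (intro borel_measurable_sum borel_measurable_add borel_measurable_times borel_measurable_const borel_measurable_divide s1 s2; simp)+
  have i1: "integrable ?Q (\<lambda>x. \<bar>stat1 n \<tau> x - block1 n N L \<tau> x\<bar>)" "integrable ?Q (\<lambda>x. \<bar>stat2 n \<tau> x - block2 n N L \<tau> x\<bar>)"
    "integrable ?Q (\<lambda>x. \<bar>stat2 n \<tau> x\<bar>)" if "\<tau> \<in> {1..q}" for \<tau>
    by (intro integrable_abs Bochner_Integration.integrable_diff s1 s2 that)+
  let ?e = "\<lambda>\<tau> x. A * \<bar>stat1 n \<tau> x - block1 n N L \<tau> x\<bar> + A * (\<bar>stat2 n \<tau> x - block2 n N L \<tau> x\<bar> + \<bar>1 / \<kappa> - 1\<bar> * \<bar>stat2 n \<tau> x\<bar>)"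
  have ei: "integrable ?Q (\<lambda>x. \<Sum>\<tau>=1..q. ?e \<tau> x)"
    by (intro Bochner_Integration.integrable_sum Bochner_Integration.integrable_add integrable_mult_right i1)
  have pt: "\<bar>?f x - ?g x\<bar> \<le> (\<Sum>\<tau>=1..q. ?e \<tau> x)" for x
    unfolding sum_subtractf[symmetric]
  proof (rule order_trans[OF sum_abs], rule sum_mono)
    fix \<tau> assume t: "\<tau> \<in> {1..q}"
    have eq: "\<alpha> \<tau> * stat1 n \<tau> x + \<alpha> (q + \<tau>) * (stat2 n \<tau> x / \<kappa>) - (\<alpha> \<tau> * block1 n N L \<tau> x + \<alpha> (q + \<tau>) * block2 n N L \<tau> x)
      = \<alpha> \<tau> * (stat1 n \<tau> x - block1 n N L \<tau> x) + \<alpha> (q + \<tau>) * ((stat2 n \<tau> x - block2 n N L \<tau> x) + (1 / \<kappa> - 1) * stat2 n \<tau> x)"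
      by (simp add: algebra_simps)
    have "\<bar>\<alpha> \<tau> * (stat1 n \<tau> x - block1 n N L \<tau> x) + \<alpha> (q + \<tau>) * ((stat2 n \<tau> x - block2 n N L \<tau> x) + (1 / \<kappa> - 1) * stat2 n \<tau> x)\<bar> \<le> \<bar>\<alpha> \<tau> * (stat1 n \<tau> x - block1 n N L \<tau> x)\<bar> + \<bar>\<alpha> (q + \<tau>) * ((stat2 n \<tau> x - block2 n N L \<tau> x) + (1 / \<kappa> - 1) * stat2 n \<tau> x)\<bar>"
      by (rule abs_triangle_ineq)
    also have "\<dots> \<le> ?e \<tau> x"
    proof (rule add_mono)
      show "\<bar>\<alpha> \<tau> * (stat1 n \<tau> x - block1 n N L \<tau> x)\<bar> \<le> A * \<bar>stat1 n \<tau> x - block1 n N L \<tau> x\<bar>"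
        unfolding abs_mult using A(1)[of \<tau>] t by (intro mult_right_mono) auto
      have "\<bar>(stat2 n \<tau> x - block2 n N L \<tau> x) + (1 / \<kappa> - 1) * stat2 n \<tau> x\<bar> \<le> \<bar>stat2 n \<tau> x - block2 n N L \<tau> x\<bar> + \<bar>1 / \<kappa> - 1\<bar> * \<bar>stat2 n \<tau> x\<bar>"
        using abs_triangle_ineq[of "stat2 n \<tau> x - block2 n N L \<tau> x" "(1 / \<kappa> - 1) * stat2 n \<tau> x"] by (simp only: abs_mult)
      then show "\<bar>\<alpha> (q + \<tau>) * ((stat2 n \<tau> x - block2 n N L \<tau> x) + (1 / \<kappa> - 1) * stat2 n \<tau> x)\<bar> \<le> A * (\<bar>stat2 n \<tau> x - block2 n N L \<tau> x\<bar> + \<bar>1 / \<kappa> - 1\<bar> * \<bar>stat2 n \<tau> x\<bar>)"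
        unfolding abs_mult[of "\<alpha> (q + \<tau>)"] using A(1)[of "q + \<tau>"] A(2) t by (intro mult_mono) auto
    qed
    finally show "\<bar>\<alpha> \<tau> * stat1 n \<tau> x + \<alpha> (q + \<tau>) * (stat2 n \<tau> x / \<kappa>) - (\<alpha> \<tau> * block1 n N L \<tau> x + \<alpha> (q + \<tau>) * block2 n N L \<tau> x)\<bar> \<le> ?e \<tau> x" unfolding eq .
  qed
  have fgi: "integrable ?Q (\<lambda>x. ?f x - ?g x)"
  proof (rule Bochner_Integration.integrable_bound[OF ei])
    show "(\<lambda>x. ?f x - ?g x) \<in> borel_measurable ?Q" using fm gm by (rule borel_measurable_diff)
    show "AE x in ?Q. norm (?f x - ?g x) \<le> norm (\<Sum>\<tau>=1..q. ?e \<tau> x)"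
    proof (intro AE_I2)
      fix x
      show "norm (?f x - ?g x) \<le> norm (\<Sum>\<tau>=1..q. ?e \<tau> x)" unfolding real_norm_def by (rule order_trans[OF pt abs_ge_self])
    qed
  qed
  have "cmod ((\<integral>x. cis (?f x) \<partial>?Q) - (\<integral>x. cis (?g x) \<partial>?Q)) \<le> (\<integral>x. \<bar>?f x - ?g x\<bar> \<partial>?Q)"
    by (rule Q.char_diff_le[OF fm gm fgi])
  also have "\<dots> \<le> (\<integral>x. (\<Sum>\<tau>=1..q. ?e \<tau> x) \<partial>?Q)"
    by (rule integral_mono[OF integrable_abs[OF fgi] ei pt])
  also have "\<dots> = (\<Sum>\<tau>=1..q. \<integral>x. ?e \<tau> x \<partial>?Q)"
    by (intro Bochner_Integration.integral_sum Bochner_Integration.integrable_add integrable_mult_right i1)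
  also have "\<dots> \<le> (\<Sum>\<tau>=1..q. A * sqrt (18 * C4 * ?be) + A * ((sqrt ?be + 2 / sqrt n) + \<bar>1 / \<kappa> - 1\<bar> * 3))"
  proof (rule sum_mono)
    fix \<tau> assume t: "\<tau> \<in> {1..q}"
    have "(\<integral>x. ?e \<tau> x \<partial>?Q) = A * (\<integral>x. \<bar>stat1 n \<tau> x - block1 n N L \<tau> x\<bar> \<partial>?Q) + A * ((\<integral>x. \<bar>stat2 n \<tau> x - block2 n N L \<tau> x\<bar> \<partial>?Q)
        + \<bar>1 / \<kappa> - 1\<bar> * (\<integral>x. \<bar>stat2 n \<tau> x\<bar> \<partial>?Q))"
      using i1[OF t] by (simp only: Bochner_Integration.integral_add integral_mult_right_zero Bochner_Integration.integrable_add integrable_mult_right)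
    also have "\<dots> \<le> A * sqrt (18 * C4 * ?be) + A * ((sqrt ?be + 2 / sqrt n) + \<bar>1 / \<kappa> - 1\<bar> * 3)"
    proof (intro add_mono mult_left_mono)
      have "dot4 / \<rho>\<^sup>2 \<le> C4" using C4(1) \<rho> by (simp add: pos_divide_le_eq)
      then have "sqrt (18 * (dot4 / \<rho>\<^sup>2) * ?be) \<le> sqrt (18 * C4 * ?be)"
        using be0 by (intro real_sqrt_le_mono mult_right_mono mult_left_mono) auto
      then show "(\<integral>x. \<bar>stat1 n \<tau> x - block1 n N L \<tau> x\<bar> \<partial>?Q) \<le> sqrt (18 * C4 * ?be)"
        by (rule order_trans[OF s1(6)[OF t]])
      show "(\<integral>x. \<bar>stat2 n \<tau> x - block2 n N L \<tau> x\<bar> \<partial>?Q) \<le> sqrt ?be + 2 / sqrt n" by (rule s2(6)[OF t])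
      show "(\<integral>x. \<bar>stat2 n \<tau> x\<bar> \<partial>?Q) \<le> 3" by (rule s2(5)[OF t])
    qed (use A(2) in auto)
    finally show "(\<integral>x. ?e \<tau> x \<partial>?Q) \<le> A * sqrt (18 * C4 * ?be) + A * ((sqrt ?be + 2 / sqrt n) + \<bar>1 / \<kappa> - 1\<bar> * 3)" .
  qed
  also have "\<dots> = q * A * (sqrt (18 * C4 * ?be) + (sqrt ?be + 2 / sqrt n + 3 * \<bar>1 / \<kappa> - 1\<bar>))"
    by (simp add: algebra_simps)
  finally have 1: "cmod ((\<integral>x. cis (?f x) \<partial>?Q) - (\<integral>x. cis (?g x) \<partial>?Q)) \<le> q * A * (sqrt (18 * C4 * ?be) + (sqrt ?be + 2 / sqrt n + 3 * \<bar>1 / \<kappa> - 1\<bar>))" .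
  have 2: "cmod ((\<integral>x. cis (?g x) \<partial>?Q) - complex_of_real (exp (- (\<Sum>k\<in>{1..2 * q}. (\<alpha> k)\<^sup>2) / 2)))
    \<le> clt_error (block_const q L A C4 Cy) (4 * real q * A ^ 4 * real L ^ 4 * C2\<^sup>2 / \<rho>\<^sup>2) n + q * A\<^sup>2 * block_error q L n"
    by (rule block_char_bound[OF L \<rho> N_def C4 Cy C2 A])
  show ?thesis
    using norm_triangle_ineq[of "(\<integral>x. cis (?f x) \<partial>?Q) - (\<integral>x. cis (?g x) \<partial>?Q)" "(\<integral>x. cis (?g x) \<partial>?Q) - complex_of_real (exp (- (\<Sum>k\<in>{1..2 * q}. (\<alpha> k)\<^sup>2) / 2))"] 1 2
    by simp
qed

section \<open>Limit of the error bound\<close>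

definition total_error :: "nat \<Rightarrow> real \<Rightarrow> real \<Rightarrow> real \<Rightarrow> real \<Rightarrow> nat \<Rightarrow> nat \<Rightarrow> real \<Rightarrow> real \<Rightarrow> real" where
  "total_error q A C4 Cy C2 L n r \<kappa> =
     q * A * (sqrt (18 * C4 * block_error q L n) + (sqrt (block_error q L n) + 2 / sqrt n + 3 * \<bar>1 / \<kappa> - 1\<bar>))
      + (clt_error (block_const q L A C4 Cy) (4 * real q * A ^ 4 * real L ^ 4 * C2\<^sup>2 / r\<^sup>2) n + q * A\<^sup>2 * block_error q L n)"

text \<open>For fixed \<open>L\<close> the Gaussian approximation error vanishes as \<open>n\<close>
  and \<open>r\<close> grow. Only the share 2q/L of products lost at block boundaries survives, and
  it is removed afterwards by the choice of \<open>L\<close>.\<close>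

lemma total_error_tendsto:
  assumes n: "filterlim n at_top F" and r: "filterlim r at_top F" and \<kappa>: "(\<kappa> \<longlongrightarrow> 1) F"
  shows "((\<lambda>i. total_error q A C4 Cy C2 L (n i) (r i) (\<kappa> i)) \<longlongrightarrow>
    q * A * (sqrt (18 * C4 * (2 * real q / real L)) + sqrt (2 * real q / real L)) + q * A\<^sup>2 * (2 * real q / real L)) F"
proof -
  have rn: "filterlim (\<lambda>i. real (n i)) at_top F" by (rule filterlim_compose[OF filterlim_real_sequentially n])
  have sn: "filterlim (\<lambda>i. sqrt (real (n i))) at_top F" by (rule filterlim_compose[OF sqrt_at_top rn])
  have c: "((\<lambda>i. c / real (n i)) \<longlongrightarrow> 0) F" "((\<lambda>i. c / sqrt (real (n i))) \<longlongrightarrow> 0) F" for c :: real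
    by (rule real_tendsto_divide_at_top[OF tendsto_const rn], rule real_tendsto_divide_at_top[OF tendsto_const sn])
  have be: "((\<lambda>i. block_error q L (n i)) \<longlongrightarrow> 2 * real q / real L + 0) F"
    unfolding block_error_def by (intro tendsto_add tendsto_const c)
  have r2: "filterlim (\<lambda>i. (r i)\<^sup>2) at_top F" using filterlim_pow_at_top[OF _ r, of 2] by simp
  have ee: "((\<lambda>i. c / (r i)\<^sup>2) \<longlongrightarrow> 0) F" for c :: real
    by (rule real_tendsto_divide_at_top[OF tendsto_const r2])
  have cl: "((\<lambda>i. clt_error K (c / (r i)\<^sup>2) (n i)) \<longlongrightarrow> 0 + 0 + 0 + sqrt (K * sqrt 0) + sqrt 0) F" for K c :: real
  proof -
    have a: "(\<lambda>i. sqrt K / (2 * sqrt (real (n i)))) = (\<lambda>i. (sqrt K / 2) / sqrt (real (n i)))"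
      and b: "(\<lambda>i. K\<^sup>2 / (2 * real (n i))) = (\<lambda>i. (K\<^sup>2 / 2) / real (n i))" by (simp_all add: fun_eq_iff)
    have "((\<lambda>i. sqrt K / (2 * sqrt (real (n i)))) \<longlongrightarrow> 0) F" "((\<lambda>i. K\<^sup>2 / (2 * real (n i))) \<longlongrightarrow> 0) F"
      unfolding a b by (rule c)+
    then show ?thesis unfolding clt_error_def
      by (intro tendsto_add tendsto_real_sqrt tendsto_mult tendsto_const c ee)
  qed
  have k: "((\<lambda>i. 3 * \<bar>1 / \<kappa> i - 1\<bar>) \<longlongrightarrow> 3 * \<bar>1 / 1 - 1\<bar>) F"
    by (intro tendsto_intros \<kappa>) simp
  have "((\<lambda>i. total_error q A C4 Cy C2 L (n i) (r i) (\<kappa> i)) \<longlongrightarrow>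
    q * A * (sqrt (18 * C4 * (2 * real q / real L + 0)) + (sqrt (2 * real q / real L + 0) + 0 + 3 * \<bar>1 / 1 - 1\<bar>))
     + ((0 + 0 + 0 + sqrt (block_const q L A C4 Cy * sqrt 0) + sqrt 0) + q * A\<^sup>2 * (2 * real q / real L + 0))) F"
    unfolding total_error_def
    by (intro tendsto_add tendsto_mult tendsto_const tendsto_real_sqrt be cl k c)
  then show ?thesis by simp
qed

lemma total_error_limit_small:
  assumes "e > 0"
  shows "\<exists>L>q. q * A * (sqrt (18 * C4 * (2 * real q / real L)) + sqrt (2 * real q / real L)) + q * A\<^sup>2 * (2 * real q / real L) < e"
proof -
  have c: "(\<lambda>L. 2 * real q / real L) \<longlonglongrightarrow> 0"
    by (rule real_tendsto_divide_at_top[OF tendsto_const filterlim_real_sequentially])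
  have "(\<lambda>L. q * A * (sqrt (18 * C4 * (2 * real q / real L)) + sqrt (2 * real q / real L)) + q * A\<^sup>2 * (2 * real q / real L))
    \<longlonglongrightarrow> q * A * (sqrt (18 * C4 * 0) + sqrt 0) + q * A\<^sup>2 * 0"
    by (intro tendsto_add tendsto_mult tendsto_const tendsto_real_sqrt c)
  then have "eventually (\<lambda>L. q * A * (sqrt (18 * C4 * (2 * real q / real L)) + sqrt (2 * real q / real L)) + q * A\<^sup>2 * (2 * real q / real L) < e) sequentially"
    using assms by (intro order_tendstoD(2)[where a = e]) auto
  then have "eventually (\<lambda>L. L > q \<and> q * A * (sqrt (18 * C4 * (2 * real q / real L)) + sqrt (2 * real q / real L)) + q * A\<^sup>2 * (2 * real q / real L) < e) sequentially"
    using eventually_gt_at_top[of q] by eventually_elim simp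
  then show ?thesis by (rule eventually_happens'[OF sequentially_bot])
qed

section \<open>The law of the sample\<close>

definition noise_law :: "'a measure \<Rightarrow> nat \<Rightarrow> (int \<Rightarrow> 'a \<Rightarrow> nat \<Rightarrow> real) \<Rightarrow> (nat \<Rightarrow> real) measure" where
  "noise_law M p z = distr M (\<Pi>\<^sub>M i\<in>{..<p}. borel) (\<lambda>\<omega>. restrict (z 1 \<omega>) {..<p})"

definition sample :: "nat \<Rightarrow> (int \<Rightarrow> 'a \<Rightarrow> nat \<Rightarrow> real) \<Rightarrow> nat \<Rightarrow> 'a \<Rightarrow> nat \<Rightarrow> nat \<Rightarrow> real" where
  "sample p z n \<omega> = (\<lambda>t\<in>{1..n}. restrict (z (int t) \<omega>) {..<p})"

text \<open>Independence gives the product law over integer times; the observations are indexed by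
  natural numbers, so the law is carried over along the injection \<open>int\<close>. Afterwards
  only product measures occur.\<close>

lemma sample_distr:
  assumes M: "prob_space M" and iid: "iid_vectors M p z" and n: "n \<ge> 1"
  shows "sample p z n \<in> measurable M (PiM {1..n} (\<lambda>_. noise_law M p z))"
    "distr M (PiM {1..n} (\<lambda>_. noise_law M p z)) (sample p z n) = PiM {1..n} (\<lambda>_. noise_law M p z)"
proof -
  interpret prob_space M by fact
  let ?B = "\<Pi>\<^sub>M i\<in>{..<p}. (borel :: real measure)" and ?J = "int ` {1..n}"
  have ind: "indep_vars (\<lambda>_. ?B) (\<lambda>t \<omega>. restrict (z t \<omega>) {..<p}) UNIV"
    and same: "distr M ?B (\<lambda>\<omega>. restrict (z s \<omega>) {..<p}) = distr M ?B (\<lambda>\<omega>. restrict (z t \<omega>) {..<p})" for s t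
    using iid unfolding iid_vectors_def by blast+
  have sets: "sets (PiM {1..n} (\<lambda>_. noise_law M p z)) = sets (PiM {1..n} (\<lambda>_. ?B))"
    by (rule sets_PiM_cong[OF refl]) (simp add: noise_law_def)
  have rv: "(\<lambda>\<omega>. restrict (z t \<omega>) {..<p}) \<in> measurable M ?B" for t
    using ind by (simp add: indep_vars_def)
  have "(\<lambda>\<omega>. \<lambda>t\<in>{1..n}. restrict (z (int t) \<omega>) {..<p}) \<in> measurable M (PiM {1..n} (\<lambda>_. ?B))"
    by (rule measurable_restrict, rule rv)
  then show m: "sample p z n \<in> measurable M (PiM {1..n} (\<lambda>_. noise_law M p z))"
    unfolding measurable_cong_sets[OF refl sets] sample_def[abs_def] .
  have "distr M (PiM {1..n} (\<lambda>_. noise_law M p z)) (sample p z n) = distr M (PiM {1..n} (\<lambda>_. ?B)) (\<lambda>\<omega>. \<lambda>t\<in>{1..n}. restrict (z (int t) \<omega>) {..<p})"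
    by (rule distr_cong[OF refl sets]) (simp add: sample_def)
  \<comment> \<open>The family is factored through the integer times 1 to n, where independence is
    formulated.\<close>
  also have "\<dots> = distr (distr M (PiM ?J (\<lambda>_. ?B)) (\<lambda>\<omega>. \<lambda>j\<in>?J. restrict (z j \<omega>) {..<p})) (PiM {1..n} (\<lambda>_. ?B)) (\<lambda>w. \<lambda>t\<in>{1..n}. w (int t))"
    by (subst distr_distr) (auto simp: o_def fun_eq_iff intro!: measurable_restrict rv measurable_component_singleton distr_cong)
  also have "distr M (PiM ?J (\<lambda>_. ?B)) (\<lambda>\<omega>. \<lambda>j\<in>?J. restrict (z j \<omega>) {..<p}) = PiM ?J (\<lambda>j. distr M ?B (\<lambda>\<omega>. restrict (z j \<omega>) {..<p}))"
    by (rule indep_vars_iff_distr_eq_PiM'[THEN iffD1]) (use n rv indep_vars_subset[OF ind] in auto)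
  also have "\<dots> = PiM ?J (\<lambda>_. noise_law M p z)"
    unfolding noise_law_def by (rule PiM_cong[OF refl], rule same)
  also have "distr (PiM ?J (\<lambda>_. noise_law M p z)) (PiM {1..n} (\<lambda>_. ?B)) (\<lambda>w. \<lambda>t\<in>{1..n}. w (int t)) =
      distr (PiM ?J (\<lambda>_. noise_law M p z)) (PiM {1..n} (\<lambda>_. noise_law M p z)) (\<lambda>w. \<lambda>t\<in>{1..n}. w (int t))"
    by (rule distr_cong[OF refl sets[symmetric]]) simp
  also have "\<dots> = PiM {1..n} (\<lambda>_. noise_law M p z)"
    by (rule distr_PiM_reindex) (auto simp: noise_law_def intro!: prob_space_distr rv)
  finally show "distr M (PiM {1..n} (\<lambda>_. noise_law M p z)) (sample p z n) = PiM {1..n} (\<lambda>_. noise_law M p z)" .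
qed

lemma dotp_restrict: "dotp p (restrict u {..<p}) (restrict v {..<p}) = dotp p u v"
  by (simp add: dotp_def)

lemma L2_set_restrict: "L2_set (restrict u {..<p}) {..<p} = L2_set u {..<p}"
  by (simp add: L2_set_def)

definition centered_norm :: "nat \<Rightarrow> real \<Rightarrow> (nat \<Rightarrow> real) \<Rightarrow> real" where
  "centered_norm p m u = (L2_set u {..<p})\<^sup>2 - m"

lemma L2_set_power2: "(L2_set u {..<p})\<^sup>2 = (\<Sum>i<p. (u i)\<^sup>2)"
  unfolding L2_set_def by (simp add: sum_nonneg)

text \<open>The eighth power is the fourth power of the double sum of products; the fourth power of
  each product is a product of two square integrable functions.\<close>

lemma integrable_power8_sum:
  fixes b :: "'i \<Rightarrow> 'a \<Rightarrow> real"
  assumes I: "finite I" and m: "\<And>i. i \<in> I \<Longrightarrow> b i \<in> borel_measurable M" and int: "\<And>i. i \<in> I \<Longrightarrow> integrable M (\<lambda>x. b i x ^ 8)"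
  shows "integrable M (\<lambda>x. (\<Sum>i\<in>I. b i x) ^ 8)"
proof -
  have "integrable M (\<lambda>x. (\<Sum>w\<in>I \<times> I. b (fst w) x * b (snd w) x) ^ 4)"
  proof (rule integrable_power4_sum)
    fix w assume w: "w \<in> I \<times> I"
    then show "(\<lambda>x. b (fst w) x * b (snd w) x) \<in> borel_measurable M" using m by auto
    have "integrable M (\<lambda>x. b (fst w) x ^ 4 * b (snd w) x ^ 4)"
      using w m int by (intro integrable_mult_L2) (auto simp flip: power_mult)
    then show "integrable M (\<lambda>x. (b (fst w) x * b (snd w) x) ^ 4)" by (simp add: power_mult_distrib)
  qed (use I in simp)
  moreover have "(\<Sum>w\<in>I \<times> I. b (fst w) x * b (snd w) x) ^ 4 = (\<Sum>i\<in>I. b i x) ^ 8" for x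
  proof -
    have "(\<Sum>w\<in>I \<times> I. b (fst w) x * b (snd w) x) = (\<Sum>i\<in>I. b i x)\<^sup>2"
      by (simp add: power2_eq_square sum_product sum.cartesian_product case_prod_unfold)
    then show ?thesis by (simp flip: power_mult)
  qed
  ultimately show ?thesis by simp
qed

lemma noise_law_integral:
  fixes f :: "(nat \<Rightarrow> real) \<Rightarrow> real"
  assumes M: "prob_space M" and iid: "iid_vectors M p z" and f: "f \<in> borel_measurable (\<Pi>\<^sub>M i\<in>{..<p}. borel)"
  shows "integrable (noise_law M p z) f \<longleftrightarrow> integrable M (\<lambda>\<omega>. f (restrict (z t \<omega>) {..<p}))"
    "(\<integral>u. f u \<partial>noise_law M p z) = (\<integral>\<omega>. f (restrict (z t \<omega>) {..<p}) \<partial>M)"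
proof -
  let ?B = "\<Pi>\<^sub>M i\<in>{..<p}. (borel :: real measure)"
  have d: "noise_law M p z = distr M ?B (\<lambda>\<omega>. restrict (z t \<omega>) {..<p})"
    using iid unfolding iid_vectors_def noise_law_def by blast
  have rv: "(\<lambda>\<omega>. restrict (z t \<omega>) {..<p}) \<in> measurable M ?B"
    using iid M unfolding iid_vectors_def by (simp add: prob_space.indep_vars_def)
  show "integrable (noise_law M p z) f \<longleftrightarrow> integrable M (\<lambda>\<omega>. f (restrict (z t \<omega>) {..<p}))"
    unfolding d by (rule integrable_distr_eq[OF rv f])
  show "(\<integral>u. f u \<partial>noise_law M p z) = (\<integral>\<omega>. f (restrict (z t \<omega>) {..<p}) \<partial>M)"
    unfolding d by (rule integral_distr[OF rv f])
qed

lemma coordinate_measurable: "i < p \<Longrightarrow> (\<lambda>u. u i) \<in> borel_measurable (\<Pi>\<^sub>M i\<in>{..<p}. (borel :: real measure))"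
  by (rule measurable_component_singleton) simp

lemma centered_norm_measurable: "centered_norm p m \<in> borel_measurable (\<Pi>\<^sub>M i\<in>{..<p}. (borel :: real measure))"
  unfolding centered_norm_def[abs_def] L2_set_power2
  by (intro borel_measurable_diff borel_measurable_sum borel_measurable_power coordinate_measurable borel_measurable_const) auto

section \<open>Covariance and norm moments of one observation\<close>

lemma norm_moment_noise_law:
  assumes M: "prob_space M" and iid: "iid_vectors M p z"
  shows "norm_moment M p S (z t) k = (\<integral>u. centered_norm p (mat_trace S) u ^ k \<partial>noise_law M p z)"
  using noise_law_integral(2)[OF M iid borel_measurable_power[OF centered_norm_measurable], of "mat_trace S" k t]
  by (simp add: norm_moment_def centered_norm_def L2_set_restrict)

lemma noise_covariance:
  assumes wn: "mean_zero_white_noise M p z S"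
  shows "S \<in> carrier_mat p p" "\<And>i j. i < p \<Longrightarrow> j < p \<Longrightarrow> S $$ (i, j) = (\<integral>\<omega>. z 1 \<omega> i * z 1 \<omega> j \<partial>M)"
proof -
  have S: "S = cross_cov M p (z 1) (z 1)" and z: "\<And>i. i < p \<Longrightarrow> (\<integral>\<omega>. z 1 \<omega> i \<partial>M) = 0"
    using wn unfolding mean_zero_white_noise_def by auto
  show "S \<in> carrier_mat p p" unfolding S cross_cov_def by simp
  show "S $$ (i, j) = (\<integral>\<omega>. z 1 \<omega> i * z 1 \<omega> j \<partial>M)" if "i < p" "j < p" for i j
    unfolding S cross_cov_def using that z by simp
qed

text \<open>The quadratic form of a covariance matrix is the second moment of a linear combination
  of the coordinates.\<close>

lemma covariance_psd:
  assumes wn: "mean_zero_white_noise M p z S"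
  shows "dotp p x (apply_mat p (\<lambda>i j. S $$ (i, j)) x) \<ge> 0"
proof -
  have m: "(\<lambda>\<omega>. z 1 \<omega> i) \<in> borel_measurable M" "integrable M (\<lambda>\<omega>. (z 1 \<omega> i)\<^sup>2)" if "i < p" for i
    using wn that unfolding mean_zero_white_noise_def by auto
  have ij: "integrable M (\<lambda>\<omega>. z 1 \<omega> i * z 1 \<omega> j)" if "i < p" "j < p" for i j
    by (rule integrable_mult_L2[OF m(1)[OF that(1)] m(1)[OF that(2)] m(2)[OF that(1)] m(2)[OF that(2)]])
  have "dotp p x (apply_mat p (\<lambda>i j. S $$ (i, j)) x) = (\<Sum>i<p. \<Sum>j<p. x i * x j * (\<integral>\<omega>. z 1 \<omega> i * z 1 \<omega> j \<partial>M))"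
    unfolding dotp_def apply_mat_def sum_distrib_left
    by (intro sum.cong refl) (simp add: noise_covariance(2)[OF wn] mult_ac)
  also have "\<dots> = (\<Sum>i<p. \<integral>\<omega>. (\<Sum>j<p. x i * x j * (z 1 \<omega> i * z 1 \<omega> j)) \<partial>M)"
  proof (intro sum.cong refl)
    fix i assume "i \<in> {..<p}"
    then have "(\<integral>\<omega>. (\<Sum>j<p. x i * x j * (z 1 \<omega> i * z 1 \<omega> j)) \<partial>M) = (\<Sum>j<p. \<integral>\<omega>. x i * x j * (z 1 \<omega> i * z 1 \<omega> j) \<partial>M)"
      by (intro Bochner_Integration.integral_sum integrable_mult_right ij) auto
    then show "(\<Sum>j<p. x i * x j * (\<integral>\<omega>. z 1 \<omega> i * z 1 \<omega> j \<partial>M)) = (\<integral>\<omega>. (\<Sum>j<p. x i * x j * (z 1 \<omega> i * z 1 \<omega> j)) \<partial>M)"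
      by (simp only: integral_mult_right_zero)
  qed
  also have "\<dots> = (\<integral>\<omega>. (\<Sum>i<p. \<Sum>j<p. x i * x j * (z 1 \<omega> i * z 1 \<omega> j)) \<partial>M)"
    by (intro Bochner_Integration.integral_sum[symmetric] Bochner_Integration.integrable_sum integrable_mult_right ij) auto
  also have "\<dots> = (\<integral>\<omega>. (\<Sum>i<p. x i * z 1 \<omega> i)\<^sup>2 \<partial>M)"
    by (simp add: power2_eq_square sum_product mult_ac)
  also have "\<dots> \<ge> 0" by simp
  finally show ?thesis .
qed

lemma mat_trace_square:
  assumes S: "S \<in> carrier_mat p p" and sym: "\<And>i j. i < p \<Longrightarrow> j < p \<Longrightarrow> S $$ (i, j) = S $$ (j, i)"
  shows "mat_trace (S ^\<^sub>m 2) = (\<Sum>i<p. \<Sum>j<p. (S $$ (i, j))\<^sup>2)"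
proof -
  have "S ^\<^sub>m 2 = S * S" using S by (simp add: numeral_2_eq_2)
  then have "mat_trace (S ^\<^sub>m 2) = (\<Sum>i<p. \<Sum>j<p. S $$ (i, j) * S $$ (j, i))"
    using S by (auto simp: mat_trace_def scalar_prod_def lessThan_atLeast0 intro!: sum.cong)
  also have "\<dots> = (\<Sum>i<p. \<Sum>j<p. (S $$ (i, j))\<^sup>2)"
    by (intro sum.cong refl) (simp add: sym power2_eq_square)
  finally show ?thesis .
qed

text \<open>Sixteenth moments of the coordinates make the eighth power of the centered squared norm
  integrable, so \<open>norm_moment\<close> up to order 8 is a true moment and not the default value
  0 of a divergent integral. The first two conclusions serve to exclude variance 0 and to bound the
  standardised fourth moment.\<close>

lemma noise_instance:
  fixes z :: "int \<Rightarrow> 'a \<Rightarrow> nat \<Rightarrow> real"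
  assumes M: "prob_space M" and wn: "mean_zero_white_noise M p z S" and iid: "iid_vectors M p z"
    and m4: "\<And>i. i < p \<Longrightarrow> integrable M (\<lambda>\<omega>. (z 1 \<omega> i) ^ 4)"
    and m16: "\<And>i. i < p \<Longrightarrow> integrable M (\<lambda>\<omega>. (z 1 \<omega> i) ^ 16)"
  defines "v \<equiv> norm_moment M p S (z 1) 2"
  defines "y \<equiv> \<lambda>u. centered_norm p (mat_trace S) u / sqrt v"
  shows "v = 0 \<Longrightarrow> norm_moment M p S (z 1) 4 = 0" "(norm_moment M p S (z 1) 4)\<^sup>2 \<le> norm_moment M p S (z 1) 8"
    "v \<ge> 0" "v > 0 \<Longrightarrow> noise (noise_law M p z) p (\<lambda>i j. S $$ (i, j)) y"
    "v > 0 \<Longrightarrow> noise.y4 (noise_law M p z) y = norm_moment M p S (z 1) 4 / v\<^sup>2"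
proof -
  let ?B = "\<Pi>\<^sub>M i\<in>{..<p}. (borel :: real measure)" and ?V = "noise_law M p z" and ?c = "centered_norm p (mat_trace S)"
  have sets: "sets ?V = sets ?B" by (simp add: noise_law_def)
  have rv: "(\<lambda>\<omega>. restrict (z 1 \<omega>) {..<p}) \<in> measurable M ?B"
    using iid M unfolding iid_vectors_def by (simp add: prob_space.indep_vars_def)
  interpret V: prob_space ?V
    unfolding noise_law_def by (rule prob_space.prob_space_distr[OF M rv])
  note I = noise_law_integral[OF M iid]
  have mV: "f \<in> borel_measurable ?V" if "f \<in> borel_measurable ?B" for f :: "_ \<Rightarrow> real"
    using that unfolding measurable_cong_sets[OF sets refl] .
  have cm: "(\<lambda>u. u i) \<in> borel_measurable ?V" if "i < p" for i by (rule mV[OF coordinate_measurable[OF that]])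
  have c4: "integrable ?V (\<lambda>u. u i ^ 4)" and c16: "integrable ?V (\<lambda>u. u i ^ 16)" if "i < p" for i
    using I(1)[OF borel_measurable_power[OF coordinate_measurable[OF that]], of _ 1] m4[OF that] m16[OF that] that by simp_all
  have c2: "integrable ?V (\<lambda>u. (u i)\<^sup>2)" if "i < p" for i by (rule V.integrable_L4_L2[OF cm[OF that] c4[OF that]])
  have cc: "?c \<in> borel_measurable ?V" by (rule mV[OF centered_norm_measurable])
  \<comment> \<open>The constant is counted as one more summand, with index \<open>p\<close>, which
    brings the centered norm into the form required by \<open>integrable_power8_sum\<close>.\<close>
  have ceq: "?c u = (\<Sum>i\<in>{..p}. if i < p then (u i)\<^sup>2 else - mat_trace S)" for u
  proof -
    have "{..p} = insert p {..<p}" by auto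
    then show ?thesis by (simp add: centered_norm_def L2_set_power2)
  qed
  have n8: "integrable ?V (\<lambda>u. ?c u ^ 8)"
    unfolding ceq
  proof (rule integrable_power8_sum)
    fix i assume "i \<in> {..p}"
    show "(\<lambda>u. if i < p then (u i)\<^sup>2 else - mat_trace S) \<in> borel_measurable ?V" using cm[of i] by (cases "i < p") auto
    show "integrable ?V (\<lambda>u. (if i < p then (u i)\<^sup>2 else - mat_trace S) ^ 8)" using c16[of i] by (cases "i < p") (auto simp flip: power_mult)
  qed simp
  have n4: "integrable ?V (\<lambda>u. ?c u ^ 4)"
    by (rule V.integrable_L2_L1) (use cc n8 in \<open>auto simp flip: power_mult\<close>)
  have n2: "integrable ?V (\<lambda>u. (?c u)\<^sup>2)" by (rule V.integrable_L4_L2[OF cc n4])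
  note nm = norm_moment_noise_law[OF M iid, of S 1]
  have v: "v = (\<integral>u. (?c u)\<^sup>2 \<partial>?V)" unfolding v_def nm ..
  show "v \<ge> 0" unfolding v by simp
  show "norm_moment M p S (z 1) 4 = 0" if "v = 0"
  proof -
    have "AE u in ?V. (?c u)\<^sup>2 = 0" using that integral_nonneg_eq_0_iff_AE[OF n2] unfolding v by simp
    then have "AE u in ?V. ?c u ^ 4 = 0" by eventually_elim simp
    then show ?thesis unfolding nm by (rule integral_eq_zero_AE)
  qed
  show "(norm_moment M p S (z 1) 4)\<^sup>2 \<le> norm_moment M p S (z 1) 8"
    unfolding nm using V.expectation_power2_le[of "\<lambda>u. ?c u ^ 4"] cc n8 by (simp flip: power_mult)
  have SI: "S $$ (i, j) = (\<integral>u. u i * u j \<partial>?V)" if "i < p" "j < p" for i j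
    using I(2)[OF borel_measurable_times[OF coordinate_measurable[OF that(1)] coordinate_measurable[OF that(2)]], of 1]
      noise_covariance(2)[OF wn that] that by simp
  have tr: "mat_trace S = (\<Sum>i<p. \<integral>u. (u i)\<^sup>2 \<partial>?V)"
    using noise_covariance(1)[OF wn] SI by (simp add: mat_trace_def power2_eq_square)
  have cmean: "(\<integral>u. ?c u \<partial>?V) = 0"
  proof -
    have "(\<integral>u. ?c u \<partial>?V) = (\<integral>u. (\<Sum>i<p. (u i)\<^sup>2) \<partial>?V) - mat_trace S"
      unfolding centered_norm_def L2_set_power2
      by (subst Bochner_Integration.integral_diff) (auto simp: V.prob_space intro!: Bochner_Integration.integrable_sum c2)
    also have "(\<integral>u. (\<Sum>i<p. (u i)\<^sup>2) \<partial>?V) = mat_trace S"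
      unfolding tr using c2 by (intro Bochner_Integration.integral_sum) auto
    finally show ?thesis by simp
  qed
  assume v0: "v > 0"
  have sv: "sqrt v ^ 4 = v\<^sup>2" "(sqrt v)\<^sup>2 = v" using v0 by (simp_all add: power4_eq_xxxx power2_eq_square)
  show N: "noise ?V p (\<lambda>i j. S $$ (i, j)) y"
  proof
    show "(\<integral>u. u i \<partial>?V) = 0" if "i < p" for i
      using I(2)[OF coordinate_measurable[OF that], of 1] wn that unfolding mean_zero_white_noise_def by simp
    show "(\<integral>u. u i * u j \<partial>?V) = S $$ (i, j)" if "i < p" "j < p" for i j using SI[OF that] by simp
    show "y \<in> borel_measurable ?V" unfolding y_def using cc by simp
    show "integrable ?V (\<lambda>u. y u ^ 4)" unfolding y_def power_divide using n4 by simp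
    show "(\<integral>u. y u \<partial>?V) = 0" unfolding y_def using cmean by simp
    show "(\<integral>u. (y u)\<^sup>2 \<partial>?V) = 1" unfolding y_def power_divide sv using v v0 by simp
  qed (use cm c4 in auto)
  show "noise.y4 ?V y = norm_moment M p S (z 1) 4 / v\<^sup>2"
    unfolding noise.y4_def[OF N] nm unfolding y_def power_divide sv by simp
qed

lemma (in noise) dot4_sample:
  assumes M: "prob_space M" and iid: "iid_vectors M p z" and V: "V = noise_law M p z"
  shows "dot4 = (\<integral>\<omega>. dotp p (z 1 \<omega>) (z 2 \<omega>) ^ 4 \<partial>M)"
proof -
  let ?Q = "PiM {1..2::nat} (\<lambda>_. V)"
  have sd: "sample p z 2 \<in> measurable M ?Q" "distr M ?Q (sample p z 2) = ?Q"
    using sample_distr[OF M iid, of 2] unfolding V by simp_all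
  have m: "(\<lambda>x. dotp p (x 1) (x 2) ^ 4) \<in> borel_measurable ?Q"
    by (intro borel_measurable_power dotp_measurable measurable_component_singleton) auto
  have "dot4 = (\<integral>x. dotp p (x 1) (x 2) ^ 4 \<partial>?Q)"
    using PiM_two_integral(2)[of 1 "{1..2::nat}" 2, OF _ _ _ dotp_power4_int_pair] by (simp add: dot4_def)
  also have "\<dots> = (\<integral>\<omega>. dotp p (sample p z 2 \<omega> 1) (sample p z 2 \<omega> 2) ^ 4 \<partial>M)"
    using integral_distr[OF sd(1) m] unfolding sd(2) .
  finally show ?thesis by (simp add: sample_def dotp_restrict)
qed

section \<open>The statistics as functions of the sample\<close>

lemma circ_range: "t \<in> {1..n} \<Longrightarrow> \<tau> < n \<Longrightarrow> circ n (t + \<tau>) \<in> {1..n}"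
  by (auto simp: circ_def)

lemma G1_eq_lag: "G1 p n \<tau> x = 1 / (real n * real p) * (\<Sum>ts\<in>off_diag n. lag_product p n \<tau> x ts)"
  unfolding G1_def off_diag_def lag_product_def ..

lemma lag_product_sample:
  assumes "ts \<in> off_diag n" "\<tau> < n"
  shows "lag_product p n \<tau> (sample p z n \<omega>) ts = lag_product p n \<tau> (\<lambda>t. z (int t) \<omega>) ts"
proof -
  obtain t s where [simp]: "ts = (t, s)" by force
  have "t \<in> {1..n}" "s \<in> {1..n}" using assms by (auto simp: off_diag_def)
  with circ_range[OF _ assms(2)] show ?thesis by (simp add: lag_product_def sample_def dotp_restrict)
qed

lemma (in noise) G1_stat1:
  assumes \<tau>: "\<tau> < n" and p: "p \<ge> 1" and \<rho>: "\<rho> > 0" and tr: "mat_trace (T ^\<^sub>m 2) = \<rho>"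
  shows "G1 p n \<tau> (\<lambda>t. z (int t) \<omega>) / sigma_n1 p T = stat1 n \<tau> (sample p z n \<omega>)"
proof -
  have "sigma_n1 p T = sqrt 2 * \<rho> / p"
    unfolding sigma_n1_def tr using \<rho> p by (simp add: real_sqrt_mult real_sqrt_divide)
  moreover have "(\<Sum>ts\<in>off_diag n. lag_product p n \<tau> (\<lambda>t. z (int t) \<omega>) ts) = (\<Sum>ts\<in>off_diag n. lag_product p n \<tau> (sample p z n \<omega>) ts)"
    by (intro sum.cong refl lag_product_sample[OF _ \<tau>, symmetric])
  ultimately show ?thesis
    unfolding G1_eq_lag stat1_def using p by (simp add: field_simps)
qed

text \<open>Substituting \<open>f\<close> = \<open>sqrt v * g + m\<close> creates terms linear in
  \<open>g\<close>. As the shift preserves the sum of \<open>g\<close>, the linear terms of the two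
  parts cancel exactly, and so do the squares of \<open>m\<close>. The subtracted mean supplies the
  summand 1/n.\<close>

lemma autocovariance_centered:
  fixes f g :: "nat \<Rightarrow> real" and n :: nat
  assumes v: "v > 0" and n: "n \<ge> 1" and p: "p > 0" and g: "\<And>t. g t = (f t - m) / sqrt v"
    and c: "(\<Sum>t=1..n. g (c t)) = (\<Sum>t=1..n. g t)"
  shows "1 / (real n * p) * (\<Sum>t=1..n. f t * f (c t)) - 1 / p * (1 / real n * (\<Sum>t=1..n. f t))\<^sup>2 - (- (1 / (p * real n)) * v)
    = v / (p * sqrt n) * (1 / sqrt n * (\<Sum>t=1..n. g t * g (c t)) - sqrt n * ((1 / real n * (\<Sum>t=1..n. g t))\<^sup>2 - 1 / real n))"
proof -
  define w where "w = sqrt v"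
  define r where "r = sqrt (real n)"
  have w: "w > 0" "w * w = v" using v by (simp_all add: w_def)
  have r: "r > 0" "r * r = real n" using n by (simp_all add: r_def)
  have n0: "real n > 0" using n by simp
  define P where "P = (\<Sum>t=1..n. g t * g (c t))"
  define s where "s = (\<Sum>t=1..n. g t)"
  have f: "f t = w * g t + m" for t using w g[of t] by (simp add: w_def)
  have 1: "(\<Sum>t=1..n. f t) = w * s + n * m" by (simp add: f s_def sum.distrib sum_distrib_left)
  have "(\<Sum>t=1..n. f t * f (c t)) = (\<Sum>t=1..n. w * w * (g t * g (c t)) + w * m * g t + w * m * g (c t) + m * m)"
    by (intro sum.cong refl) (simp add: f algebra_simps)
  also have "\<dots> = w * w * P + w * m * s + w * m * s + n * (m * m)"
    by (simp only: P_def s_def sum.distrib sum_distrib_left[symmetric] c) simp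
  finally have 2: "(\<Sum>t=1..n. f t * f (c t)) = w * w * P + w * m * s + w * m * s + n * (m * m)" .
  have "1 / (real n * p) * (w * w * P + w * m * s + w * m * s + n * (m * m)) - 1 / p * (1 / real n * (w * s + n * m))\<^sup>2 - (- (1 / (p * real n)) * (w * w))
    = w * w / p * (P / n - s * s / (real n * real n) + 1 / n)"
    using n0 p by (simp add: field_simps power2_eq_square)
  moreover have "w * w / (p * r) * (1 / r * P - r * ((1 / real n * s)\<^sup>2 - 1 / real n)) = w * w / p * (P / n - s * s / (real n * real n) + 1 / n)"
  proof -
    have "w * w / (p * r) * (1 / r * P - r * ((1 / real n * s)\<^sup>2 - 1 / real n)) = w * w / p * (P / (r * r) - (1 / real n * s)\<^sup>2 + 1 / real n)"
      using r(1) p by (simp add: field_simps)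
    then show ?thesis unfolding r(2) by (simp add: power2_eq_square)
  qed
  ultimately show ?thesis unfolding 1 2 P_def[symmetric] s_def[symmetric] r_def[symmetric] w(2)[symmetric] by simp
qed

text \<open>The leading standard deviation is factored out. The standardised fourth moment
  \<open>k4\<close> enters with weight \<open>1 / n^2\<close> only, so a bound on it is enough for
  the remaining root to tend to 1.\<close>

lemma sigma_n2_factor:
  assumes v: "norm_moment M p S X 2 = v" "v > 0" and y4: "norm_moment M p S X 4 / v\<^sup>2 = k4" and n: "n \<ge> 1" and p: "p \<ge> 1"
  shows "sigma_n2 M p n S X = v / (real p * sqrt n) * sqrt (k4 / (real n)\<^sup>2 + (1 - 2 / real n - 3 / (real n)\<^sup>2))"
proof -
  have n0: "real n > 0" and p0: "real p > 0" using n p by auto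
  have k: "norm_moment M p S X 4 = k4 * v\<^sup>2" using y4 v by auto
  have "1 / ((real p)\<^sup>2 * real n ^ 3) * norm_moment M p S X 4 + (real n - 2 - 3 / real n) * (mu2 M p n S X)\<^sup>2
    = (v\<^sup>2 / ((real p)\<^sup>2 * real n)) * (k4 / (real n)\<^sup>2 + (1 - 2 / real n - 3 / (real n)\<^sup>2))"
    unfolding mu2_def k v using n0 p0 by (simp add: field_simps power2_eq_square power3_eq_cube)
  also have "v\<^sup>2 / ((real p)\<^sup>2 * real n) = (v / (real p * sqrt n))\<^sup>2"
    by (simp add: power_divide power_mult_distrib)
  finally show ?thesis unfolding sigma_n2_def using v p0 n0 by (simp add: real_sqrt_mult)
qed

lemma (in noise) G2_stat2:
  assumes y: "y = (\<lambda>u. centered_norm p m u / sqrt v)" and v: "v > 0" "norm_moment M p T X 2 = v"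
    and \<tau>: "\<tau> \<ge> 1" "2 * \<tau> < n" and p: "p \<ge> 1"
    and \<sigma>: "sigma_n2 M p n T X = v / (real p * sqrt n) * \<kappa>" and \<kappa>: "\<kappa> > 0"
  shows "(G2 p n \<tau> (\<lambda>t. z (int t) \<omega>) - mu2 M p n T X) / sigma_n2 M p n T X = stat2 n \<tau> (sample p z n \<omega>) / \<kappa>"
proof -
  interpret s: shift_map n "\<lambda>t. circ n (t + \<tau>)" by (rule shift_map_circ[OF \<tau>])
  have n1: "n \<ge> 1" and n0: "real n > 0" and p0: "real p > 0" using \<tau> p by auto
  define f where "f t = (L2_set (z (int t) \<omega>) {..<p})\<^sup>2" for t :: nat
  define g where "g t = (f t - m) / sqrt v" for t
  have gy: "y (sample p z n \<omega> t) = g t" if "t \<in> {1..n}" for t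
    using that by (simp add: y centered_norm_def sample_def L2_set_restrict g_def f_def)
  have "bij_betw (\<lambda>t. circ n (t + \<tau>)) {1..n} {1..n}"
    unfolding bij_betw_def
  proof
    show inj: "inj_on (\<lambda>t. circ n (t + \<tau>)) {1..n}" using s.c_inj by (auto simp: inj_on_def)
    show "(\<lambda>t. circ n (t + \<tau>)) ` {1..n} = {1..n}"
      by (rule endo_inj_surj[OF _ _ inj]) (use s.c_range in auto)
  qed
  from sum.reindex_bij_betw[OF this, of g]
  have c: "(\<Sum>t=1..n. g (circ n (t + \<tau>))) = (\<Sum>t=1..n. g t)" .
  have "G2 p n \<tau> (\<lambda>t. z (int t) \<omega>) - mu2 M p n T X =
    1 / (real n * real p) * (\<Sum>t=1..n. f t * f (circ n (t + \<tau>))) - 1 / real p * (1 / real n * (\<Sum>t=1..n. f t))\<^sup>2 - (- (1 / (real p * real n)) * v)"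
    unfolding G2_def mu2_def v f_def ..
  also have "\<dots> = v / (p * sqrt n) * (1 / sqrt n * (\<Sum>t=1..n. g t * g (circ n (t + \<tau>))) - sqrt n * ((1 / real n * (\<Sum>t=1..n. g t))\<^sup>2 - 1 / real n))"
    by (rule autocovariance_centered[OF v(1) n1 p0 g_def c])
  also have "\<dots> = v / (p * sqrt n) * stat2 n \<tau> (sample p z n \<omega>)"
  proof -
    have "(\<Sum>t=1..n. g t * g (circ n (t + \<tau>))) = (\<Sum>t=1..n. y (sample p z n \<omega> t) * y (sample p z n \<omega> (circ n (t + \<tau>))))"
      using gy s.c_range by (intro sum.cong refl) simp
    moreover have "(\<Sum>t=1..n. g t) = (\<Sum>t=1..n. y (sample p z n \<omega> t))" using gy by (intro sum.cong refl) simp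
    ultimately show ?thesis unfolding stat2_def by (simp only:)
  qed
  finally have e: "G2 p n \<tau> (\<lambda>t. z (int t) \<omega>) - mu2 M p n T X = v / (p * sqrt n) * stat2 n \<tau> (sample p z n \<omega>)" .
  have "v / (real p * sqrt n) \<noteq> 0" using v p0 n0 by simp
  then show ?thesis unfolding e \<sigma> by (rule mult_divide_mult_cancel_left)
qed

lemma min_at_top_filterlim:
  "filterlim fst at_top min_at_top" "filterlim snd at_top min_at_top"
proof -
  have m: "filterlim (\<lambda>(p, n). min p n) at_top min_at_top"
    unfolding min_at_top_def by (rule filterlim_filtercomap)
  show "filterlim fst at_top min_at_top" by (rule filterlim_at_top_mono[OF m]) (auto intro!: always_eventually)
  show "filterlim snd at_top min_at_top" by (rule filterlim_at_top_mono[OF m]) (auto intro!: always_eventually)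
qed

section \<open>The vector of all statistics\<close>

definition (in noise) statistics :: "nat \<Rightarrow> nat \<Rightarrow> real \<Rightarrow> (nat \<Rightarrow> nat \<Rightarrow> real) \<Rightarrow> nat \<Rightarrow> real" where
  "statistics q n \<kappa> x = (\<lambda>k\<in>{1..2 * q}. if k \<le> q then stat1 n k x else stat2 n (k - q) x / \<kappa>)"

lemma (in noise) statistics_props:
  fixes q n :: nat
  assumes n: "2 * q < n" and \<rho>: "\<rho> > 0" and \<kappa>: "\<kappa> > 0"
  defines "B \<equiv> PiM {1..2 * q} (\<lambda>_. borel :: real measure)" and "P \<equiv> PiM {1..n} (\<lambda>_. V)"
  shows "statistics q n \<kappa> \<in> measurable P B"
    "prob_space (distr P B (statistics q n \<kappa>))"
    "\<And>k. k \<in> {1..2 * q} \<Longrightarrow> integrable (distr P B (statistics q n \<kappa>)) (\<lambda>x. x k)"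
    "\<And>k. k \<in> {1..2 * q} \<Longrightarrow> (\<integral>x. \<bar>x k\<bar> \<partial>distr P B (statistics q n \<kappa>)) \<le> sqrt (18 * (dot4 / \<rho>\<^sup>2)) + 3 / \<kappa>"
    "\<And>a. (\<integral>x. cis (\<Sum>k\<in>{1..2 * q}. a k * x k) \<partial>distr P B (statistics q n \<kappa>)) =
      (\<integral>x. cis (\<Sum>\<tau>=1..q. a \<tau> * stat1 n \<tau> x + a (q + \<tau>) * (stat2 n \<tau> x / \<kappa>)) \<partial>P)"
proof -
  \<comment> \<open>Measurability and L1 norms of the statistics do not involve blocks; the shortest
    admissible block length gives access to the lemmas in which they are recorded.\<close>
  have L: "q < q + 1" "q + 1 \<le> n" using n by auto
  note s1 = stat1_approx[OF _ L n \<rho> refl, folded P_def] and s2 = stat2_approx[OF _ L n refl, folded P_def]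
  interpret P: prob_space P unfolding P_def by (intro prob_space_PiM prob_space_axioms)
  have d0: "sqrt (18 * (dot4 / \<rho>\<^sup>2)) \<ge> 0" "3 / \<kappa> \<ge> 0" using \<kappa> by (simp_all add: dot4_def)
  have kq: "k \<in> {1..q}" if "k \<in> {1..2 * q}" "k \<le> q" for k using that by simp
  have kq2: "k - q \<in> {1..q}" if "k \<in> {1..2 * q}" "\<not> k \<le> q" for k using that by auto
  have cm: "(\<lambda>x. if k \<le> q then stat1 n k x else stat2 n (k - q) x / \<kappa>) \<in> borel_measurable P" if "k \<in> {1..2 * q}" for k
    using s1(1)[OF kq[OF that]] borel_measurable_divide[OF s2(1)[OF kq2[OF that]] borel_measurable_const[of \<kappa>]] by (cases "k \<le> q") simp_all
  have ci: "integrable P (\<lambda>x. if k \<le> q then stat1 n k x else stat2 n (k - q) x / \<kappa>)" if "k \<in> {1..2 * q}" for k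
    using s1(3)[OF kq[OF that]] s2(3)[OF kq2[OF that]] by (cases "k \<le> q") simp_all
  have cb: "(\<integral>x. \<bar>if k \<le> q then stat1 n k x else stat2 n (k - q) x / \<kappa>\<bar> \<partial>P) \<le> sqrt (18 * (dot4 / \<rho>\<^sup>2)) + 3 / \<kappa>" if "k \<in> {1..2 * q}" for k
  proof (cases "k \<le> q")
    case True
    then show ?thesis using order_trans[OF s1(5)[OF kq[OF that True]] add_increasing2[OF d0(2) order_refl]] by (simp only: if_True)
  next
    case False
    have "(\<integral>x. \<bar>stat2 n (k - q) x / \<kappa>\<bar> \<partial>P) = (\<integral>x. \<bar>stat2 n (k - q) x\<bar> \<partial>P) / \<kappa>"
      using \<kappa> by (simp add: abs_divide)
    also have "\<dots> \<le> 3 / \<kappa>" using s2(5)[OF kq2[OF that False]] \<kappa> by (intro divide_right_mono) auto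
    also have "\<dots> \<le> sqrt (18 * (dot4 / \<rho>\<^sup>2)) + 3 / \<kappa>" by (rule add_increasing[OF d0(1) order_refl])
    finally show ?thesis using False by (simp only: if_False)
  qed
  show m: "statistics q n \<kappa> \<in> measurable P B"
    unfolding B_def statistics_def[abs_def] by (rule measurable_restrict, rule cm)
  show "prob_space (distr P B (statistics q n \<kappa>))" by (rule P.prob_space_distr[OF m])
  have ev: "statistics q n \<kappa> x k = (if k \<le> q then stat1 n k x else stat2 n (k - q) x / \<kappa>)" if "k \<in> {1..2 * q}" for k x
    unfolding statistics_def using that by (rule restrict_apply')
  have pm: "(\<lambda>x. x k) \<in> borel_measurable B" if "k \<in> {1..2 * q}" for k
    unfolding B_def using that by (rule measurable_component_singleton)
  show "integrable (distr P B (statistics q n \<kappa>)) (\<lambda>x. x k)" if "k \<in> {1..2 * q}" for k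
    unfolding integrable_distr_eq[OF m pm[OF that]] ev[OF that] by (rule ci[OF that])
  show "(\<integral>x. \<bar>x k\<bar> \<partial>distr P B (statistics q n \<kappa>)) \<le> sqrt (18 * (dot4 / \<rho>\<^sup>2)) + 3 / \<kappa>" if "k \<in> {1..2 * q}" for k
    unfolding integral_distr[OF m borel_measurable_abs[OF pm[OF that]]] ev[OF that] by (rule cb[OF that])
  show "(\<integral>x. cis (\<Sum>k\<in>{1..2 * q}. a k * x k) \<partial>distr P B (statistics q n \<kappa>)) =
      (\<integral>x. cis (\<Sum>\<tau>=1..q. a \<tau> * stat1 n \<tau> x + a (q + \<tau>) * (stat2 n \<tau> x / \<kappa>)) \<partial>P)" for a
  proof -
    have "(\<lambda>x. \<Sum>k\<in>{1..2 * q}. a k * x k) \<in> borel_measurable B"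
      by (intro borel_measurable_sum borel_measurable_times borel_measurable_const pm)
    then have cism: "(\<lambda>x. cis (\<Sum>k\<in>{1..2 * q}. a k * x k)) \<in> borel_measurable B"
      by (rule measurable_compose) (intro borel_measurable_continuous_onI continuous_on_cis continuous_on_id)
    have eq: "(\<Sum>k\<in>{1..2 * q}. a k * statistics q n \<kappa> x k) = (\<Sum>\<tau>=1..q. a \<tau> * stat1 n \<tau> x + a (q + \<tau>) * (stat2 n \<tau> x / \<kappa>))" for x
    proof -
      let ?g = "\<lambda>k. a k * statistics q n \<kappa> x k"
      have u: "{1..2 * q} = {1..q} \<union> (\<lambda>\<tau>. q + \<tau>) ` {1..q}" by (auto simp: image_iff intro!: bexI[of _ "_ - q"])
      have "sum ?g {1..2 * q} = sum ?g {1..q} + sum ?g ((\<lambda>\<tau>. q + \<tau>) ` {1..q})"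
        unfolding u by (rule sum.union_disjoint) auto
      also have "sum ?g ((\<lambda>\<tau>. q + \<tau>) ` {1..q}) = (\<Sum>\<tau>=1..q. ?g (q + \<tau>))"
        by (subst sum.reindex) auto
      also have "sum ?g {1..q} + (\<Sum>\<tau>=1..q. ?g (q + \<tau>)) = (\<Sum>\<tau>=1..q. ?g \<tau> + ?g (q + \<tau>))"
        by (rule sum.distrib[symmetric])
      also have "\<dots> = (\<Sum>\<tau>=1..q. a \<tau> * stat1 n \<tau> x + a (q + \<tau>) * (stat2 n \<tau> x / \<kappa>))"
        by (intro sum.cong refl) (auto simp: ev)
      finally show ?thesis .
    qed
    show ?thesis unfolding integral_distr[OF m cism] eq ..
  qed
qed

lemma at_top_of_ratio:
  assumes "(\<lambda>p. f p / real p) \<longlonglongrightarrow> L" "L > 0"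
  shows "filterlim f at_top sequentially"
proof -
  have "filterlim (\<lambda>p. f p / real p * real p) at_top sequentially"
    by (rule filterlim_tendsto_pos_mult_at_top[OF assms filterlim_real_sequentially])
  moreover have "eventually (\<lambda>p. f p / real p * real p = f p) sequentially"
    using eventually_gt_at_top[of 0] by eventually_elim simp
  ultimately show ?thesis by (rule filterlim_cong[OF refl refl, THEN iffD1, rotated])
qed

text \<open>\<open>k\<close> may depend on p and need not converge, so it is squeezed between 0 and
  \<open>C\<close>.\<close>

lemma variance_factor_tendsto:
  fixes k :: "'i \<Rightarrow> real"
  assumes n: "filterlim n at_top F" and k: "eventually (\<lambda>i. 0 \<le> k i \<and> k i \<le> C) F"
  shows "((\<lambda>i. sqrt (k i / (real (n i))\<^sup>2 + (1 - 2 / real (n i) - 3 / (real (n i))\<^sup>2))) \<longlongrightarrow> 1) F"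
proof -
  have rn: "filterlim (\<lambda>i. real (n i)) at_top F" by (rule filterlim_compose[OF filterlim_real_sequentially n])
  have rn2: "filterlim (\<lambda>i. (real (n i))\<^sup>2) at_top F" using filterlim_pow_at_top[OF _ rn, of 2] by simp
  have c: "((\<lambda>i. c / real (n i)) \<longlongrightarrow> 0) F" "((\<lambda>i. c / (real (n i))\<^sup>2) \<longlongrightarrow> 0) F" for c :: real
    by (rule real_tendsto_divide_at_top[OF tendsto_const rn], rule real_tendsto_divide_at_top[OF tendsto_const rn2])
  have "((\<lambda>i. k i / (real (n i))\<^sup>2) \<longlongrightarrow> 0) F"
  proof (rule tendsto_sandwich[OF _ _ tendsto_const c(2)[of C]])
    show "eventually (\<lambda>i. 0 \<le> k i / (real (n i))\<^sup>2) F" using k by eventually_elim simp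
    show "eventually (\<lambda>i. k i / (real (n i))\<^sup>2 \<le> C / (real (n i))\<^sup>2) F"
      using k by eventually_elim (simp add: divide_right_mono)
  qed
  then have "((\<lambda>i. sqrt (k i / (real (n i))\<^sup>2 + (1 - 2 / real (n i) - 3 / (real (n i))\<^sup>2))) \<longlongrightarrow> sqrt (0 + (1 - 0 - 0))) F"
    by (intro tendsto_real_sqrt tendsto_add tendsto_diff tendsto_const c)
  then show ?thesis by simp
qed

text \<open>The statistics read the noise only through the sample, whose law is a product measure.
  This moves the problem from the original probability spaces, which change with p, to powers of
  \<open>V\<close>.\<close>

lemma (in noise) statistics_distr:
  assumes M: "prob_space M" and iid: "iid_vectors M p z" and V: "V = noise_law M p z"
    and y: "y = (\<lambda>u. centered_norm p m u / sqrt v)" and v: "v > 0" "norm_moment M p T (z 1) 2 = v"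
    and n: "2 * q < n" and p: "p \<ge> 1" and \<rho>: "\<rho> > 0" and tr: "mat_trace (T ^\<^sub>m 2) = \<rho>"
    and \<sigma>: "sigma_n2 M p n T (z 1) = v / (real p * sqrt n) * \<kappa>" and \<kappa>: "\<kappa> > 0"
  shows "distr M (PiM {1..2 * q} (\<lambda>_. borel)) (\<lambda>\<omega>. restrict (\<lambda>k. if k \<le> q then G1 p n k (\<lambda>t. z (int t) \<omega>) / sigma_n1 p T
      else (G2 p n (k - q) (\<lambda>t. z (int t) \<omega>) - mu2 M p n T (z 1)) / sigma_n2 M p n T (z 1)) {1..2 * q})
    = distr (PiM {1..n} (\<lambda>_. V)) (PiM {1..2 * q} (\<lambda>_. borel)) (statistics q n \<kappa>)" (is "distr M ?B (\<lambda>\<omega>. restrict (?X \<omega>) _) = _")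
proof -
  have n1: "n \<ge> 1" using n by simp
  note sd = sample_distr[OF M iid n1, folded V]
  have X: "restrict (?X \<omega>) {1..2 * q} = statistics q n \<kappa> (sample p z n \<omega>)" for \<omega>
    unfolding statistics_def
  proof (rule restrict_ext)
    fix k assume k: "k \<in> {1..2 * q}"
    show "?X \<omega> k = (if k \<le> q then stat1 n k (sample p z n \<omega>) else stat2 n (k - q) (sample p z n \<omega>) / \<kappa>)"
    proof (cases "k \<le> q")
      case True
      then have "k < n" using n by simp
      from G1_stat1[OF this p \<rho> tr] show ?thesis using True by simp
    next
      case False
      then have "k - q \<ge> 1" "2 * (k - q) < n" using k n by auto
      from G2_stat2[OF y v this p \<sigma> \<kappa>] show ?thesis using False by simp
    qed
  qed
  have "distr M ?B (\<lambda>\<omega>. restrict (?X \<omega>) {1..2 * q}) = distr M ?B (statistics q n \<kappa> \<circ> sample p z n)"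
    unfolding X by (simp add: o_def)
  also have "\<dots> = distr (distr M (PiM {1..n} (\<lambda>_. V)) (sample p z n)) ?B (statistics q n \<kappa>)"
    by (rule distr_distr[OF statistics_props(1)[OF n \<rho> \<kappa>] sd(1), symmetric])
  finally show ?thesis unfolding sd(2) .
qed

theorem proposition1:
  fixes M :: "nat \<Rightarrow> 'a measure"
    and z :: "nat \<Rightarrow> int \<Rightarrow> 'a \<Rightarrow> nat \<Rightarrow> real"
    and S :: "nat \<Rightarrow> real mat"
    and q :: nat and C1 C2 :: real
  assumes q: "q \<ge> 1"
    and prob: "\<And>p. p \<ge> 1 \<Longrightarrow> prob_space (M p)"
    and white_noise: "\<And>p. p \<ge> 1 \<Longrightarrow> mean_zero_white_noise (M p) p (z p) (S p)"
    and iid: "\<And>p. p \<ge> 1 \<Longrightarrow> iid_vectors (M p) p (z p)"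
    and moment_prod: "\<And>s t. s \<noteq> t \<Longrightarrow>
      (\<lambda>p. \<integral>\<omega>. (dotp p (z p t \<omega>) (z p s \<omega>)) ^ 4 \<partial>M p) \<in> O(\<lambda>p. (real p)\<^sup>2)"
    and C1: "C1 > 0"
    and moment4: "\<And>p t i. p \<ge> 1 \<Longrightarrow> i < p \<Longrightarrow>
      integrable (M p) (\<lambda>\<omega>. (z p t \<omega> i) ^ 4) \<and> (\<integral>\<omega>. (z p t \<omega> i) ^ 4 \<partial>M p) \<le> C1"
    and eigenvalue_bound: "\<exists>C. \<forall>p\<ge>1. Max (spectrum (S p)) \<le> C"
    and trace_limit: "\<And>l. l \<in> {1, 2} \<Longrightarrow>
      \<exists>L>0. (\<lambda>p. mat_trace (S p ^\<^sub>m l) / real p) \<longlonglongrightarrow> L"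
    and C2: "C2 > 0"
    and moment16: "\<And>p t i. p \<ge> 1 \<Longrightarrow> i < p \<Longrightarrow>
      integrable (M p) (\<lambda>\<omega>. (z p t \<omega> i) ^ 16) \<and> (\<integral>\<omega>. (z p t \<omega> i) ^ 16 \<partial>M p) \<le> C2"
    and norm_moment8: "\<And>t.
      (\<lambda>p. norm_moment (M p) p (S p) (z p t) 8) \<in> O(\<lambda>p. (norm_moment (M p) p (S p) (z p t) 2) ^ 4)"
    and third_moment: "\<And>t.
      (\<lambda>p. (L2_set (\<lambda>i. \<integral>\<omega>. z p t \<omega> i * (L2_set (z p t \<omega>) {..<p})\<^sup>2 \<partial>M p) {..<p})\<^sup>2)
        \<in> O(\<lambda>p. norm_moment (M p) p (S p) (z p t) 2)"
    and sigma_n2_nonzero: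
      "eventually (\<lambda>(p, n). sigma_n2 (M p) p n (S p) (z p 1) \<noteq> 0) min_at_top"
  shows "conv_in_distr {1..2 * q} (\<lambda>(p, n). M p)
    (\<lambda>(p, n) \<omega> k.
       if k \<le> q
       then G1 p n k (\<lambda>t. z p (int t) \<omega>) / sigma_n1 p (S p)
       else (G2 p n (k - q) (\<lambda>t. z p (int t) \<omega>) - mu2 (M p) p n (S p) (z p 1))
              / sigma_n2 (M p) p n (S p) (z p 1))
    (std_normal_vec {1..2 * q}) min_at_top"
proof -
  define v where "v p = norm_moment (M p) p (S p) (z p 1) 2" for p
  define k4 where "k4 p = norm_moment (M p) p (S p) (z p 1) 4 / (v p)\<^sup>2" for p
  define \<rho> where "\<rho> p = (\<Sum>i<p. \<Sum>j<p. (S p $$ (i, j))\<^sup>2)" for p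
  define V where "V p = noise_law (M p) p (z p)" for p
  define T where "T p = (\<lambda>i j. S p $$ (i, j))" for p
  define y where "y p = (\<lambda>u. centered_norm p (mat_trace (S p)) u / sqrt (v p))" for p
  define \<kappa> where "\<kappa> pn = sqrt (k4 (fst pn) / (real (snd pn))\<^sup>2 + (1 - 2 / real (snd pn) - 3 / (real (snd pn))\<^sup>2))" for pn :: "nat \<times> nat"
  note fst_ev = eventually_compose_filterlim[OF _ min_at_top_filterlim(1)]
  note snd_ev = eventually_compose_filterlim[OF _ min_at_top_filterlim(2)]
  have sym: "S p $$ (i, j) = S p $$ (j, i)" if "p \<ge> 1" "i < p" "j < p" for p i j
    using noise_covariance(2)[OF white_noise[OF that(1)]] that by (simp add: mult.commute)
  have tr: "mat_trace (S p ^\<^sub>m 2) = \<rho> p" if "p \<ge> 1" for p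
    unfolding \<rho>_def by (rule mat_trace_square[OF noise_covariance(1)[OF white_noise[OF that]] sym[OF that]])
  have inst: "v p = 0 \<Longrightarrow> norm_moment (M p) p (S p) (z p 1) 4 = 0"
    "(norm_moment (M p) p (S p) (z p 1) 4)\<^sup>2 \<le> norm_moment (M p) p (S p) (z p 1) 8"
    "v p \<ge> 0" "v p > 0 \<Longrightarrow> noise (V p) p (T p) (y p)" "v p > 0 \<Longrightarrow> noise.y4 (V p) (y p) = k4 p" if "p \<ge> 1" for p
    unfolding v_def V_def T_def y_def k4_def
    by (rule noise_instance[OF prob[OF that] white_noise[OF that] iid[OF that] conjunct1[OF moment4[OF that]] conjunct1[OF moment16[OF that]]]; assumption)+
  obtain C where C: "C > 0" "\<And>p. p \<ge> 1 \<Longrightarrow> Max (spectrum (S p)) \<le> C"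
  proof -
    obtain C' where "\<forall>p\<ge>1. Max (spectrum (S p)) \<le> C'" using eigenvalue_bound by blast
    then show ?thesis using that[of "max C' 1"] by (simp add: le_max_iff_disj)
  qed
  have S4: "(\<Sum>a<p. \<Sum>b<p. (\<Sum>k<p. T p a k * T p k b)\<^sup>2) \<le> C\<^sup>2 * \<rho> p" if "p \<ge> 1" for p
    unfolding \<rho>_def T_def
    by (rule eigenvalue_bound_square[OF noise_covariance(1)[OF white_noise[OF that]] that sym[OF that] covariance_psd[OF white_noise[OF that]] C(2)[OF that] C(1)])
  obtain l where l: "l > 0" "(\<lambda>p. mat_trace (S p ^\<^sub>m 2) / real p) \<longlonglongrightarrow> l" using trace_limit[of 2] by auto
  have ratio: "(\<lambda>p. \<rho> p / real p) \<longlonglongrightarrow> l"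
  proof (rule Lim_transform_eventually[OF l(2)])
    show "eventually (\<lambda>p. mat_trace (S p ^\<^sub>m 2) / real p = \<rho> p / real p) sequentially"
      using eventually_ge_at_top[of 1] by eventually_elim (simp only: tr)
  qed
  have \<rho>_top: "filterlim \<rho> at_top sequentially" by (rule at_top_of_ratio[OF ratio l(1)])
  obtain c4 where c4: "c4 > 0" "eventually (\<lambda>p. norm (\<integral>\<omega>. dotp p (z p 1 \<omega>) (z p 2 \<omega>) ^ 4 \<partial>M p) \<le> c4 * norm ((real p)\<^sup>2)) sequentially"
    using moment_prod[of 2 1] by (auto elim: landau_o.bigE)
  obtain c8 where c8: "c8 > 0" "eventually (\<lambda>p. norm (norm_moment (M p) p (S p) (z p 1) 8) \<le> c8 * norm (v p ^ 4)) sequentially"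
    using norm_moment8[of 1] unfolding v_def by (auto elim: landau_o.bigE)
  \<comment> \<open>As tr(S^2)/p tends to \<open>l\<close>, eventually \<open>p\<close> is at most
    \<open>2 / l * \<rho> p\<close>, and a bound by \<open>c4 * p^2\<close> becomes one by
    \<open>C4 * (\<rho> p)^2\<close>.\<close>
  define C4 where "C4 = c4 * (2 / l)\<^sup>2"
  \<comment> \<open>The squared fourth moment is at most the eighth, which is at most
    \<open>c8 * v p ^ 4\<close>; hence \<open>k4\<close> squared is at most
    \<open>c8\<close>.\<close>
  define Cy where "Cy = sqrt c8"
  have C40: "C4 \<ge> 0" using c4 by (simp add: C4_def)
  have ev_dot: "eventually (\<lambda>p. (\<integral>\<omega>. dotp p (z p 1 \<omega>) (z p 2 \<omega>) ^ 4 \<partial>M p) \<le> C4 * (\<rho> p)\<^sup>2) sequentially"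
  proof -
    have "eventually (\<lambda>p. \<rho> p / real p > l / 2) sequentially" using l by (intro order_tendstoD(1)[OF ratio]) simp
    then show ?thesis using c4(2) eventually_ge_at_top[of 1]
    proof eventually_elim
      case (elim p)
      then have "real p \<le> 2 / l * \<rho> p" using l by (simp add: field_simps)
      then have "(real p)\<^sup>2 \<le> (2 / l * \<rho> p)\<^sup>2" by (intro power_mono) auto
      then have "c4 * (real p)\<^sup>2 \<le> c4 * (2 / l * \<rho> p)\<^sup>2" using c4(1) by (intro mult_left_mono) auto
      then have "c4 * (real p)\<^sup>2 \<le> C4 * (\<rho> p)\<^sup>2" by (simp only: C4_def power_mult_distrib mult.assoc)
      moreover have "(\<integral>\<omega>. dotp p (z p 1 \<omega>) (z p 2 \<omega>) ^ 4 \<partial>M p) \<le> c4 * (real p)\<^sup>2" using elim(2) by simp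
      ultimately show ?case by (rule order_trans[rotated])
    qed
  qed
  \<comment> \<open>Variance 0 of the squared norm would make its fourth centered moment and
    \<open>mu2\<close> vanish, so \<open>sigma_n2\<close> would be 0, contrary to
    \<open>sigma_n2_nonzero\<close>.\<close>
  have ev_v: "eventually (\<lambda>pn. v (fst pn) > 0) min_at_top"
    using sigma_n2_nonzero fst_ev[OF eventually_ge_at_top[of 1]]
  proof eventually_elim
    case (elim pn)
    obtain p n where [simp]: "pn = (p, n)" by force
    have p: "p \<ge> 1" using elim by simp
    have "v p \<noteq> 0"
    proof
      assume v0: "v p = 0"
      have "norm_moment (M p) p (S p) (z p 1) 4 = 0" by (rule inst(1)[OF p v0])
      moreover have "mu2 (M p) p n (S p) (z p 1) = 0" using v0 by (simp add: mu2_def v_def)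
      ultimately show False using elim(1) by (simp add: sigma_n2_def)
    qed
    moreover have "v p \<ge> 0" by (rule inst(3)[OF p])
    ultimately show ?case by simp
  qed
  have ev_k4: "eventually (\<lambda>pn. 0 \<le> k4 (fst pn) \<and> k4 (fst pn) \<le> Cy) min_at_top"
    using ev_v fst_ev[OF eventually_ge_at_top[of 1]] fst_ev[OF c8(2)]
  proof eventually_elim
    case (elim pn)
    obtain p n where [simp]: "pn = (p, n)" by force
    have p: "p \<ge> 1" and v0: "v p > 0" using elim by simp_all
    have "norm_moment (M p) p (S p) (z p 1) 4 \<ge> 0" by (simp add: norm_moment_def)
    moreover have "(k4 p)\<^sup>2 \<le> c8"
    proof -
      have "(norm_moment (M p) p (S p) (z p 1) 4)\<^sup>2 \<le> norm_moment (M p) p (S p) (z p 1) 8" by (rule inst(2)[OF p])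
      also have "\<dots> \<le> c8 * v p ^ 4" using elim(3) by simp
      finally show ?thesis using v0 by (simp add: k4_def power_divide pos_divide_le_eq flip: power_mult)
    qed
    ultimately show ?case by (simp add: k4_def Cy_def real_le_rsqrt)
  qed
  have \<kappa>_lim: "(\<kappa> \<longlongrightarrow> 1) min_at_top"
    unfolding \<kappa>_def[abs_def] by (rule variance_factor_tendsto[OF min_at_top_filterlim(2) ev_k4])
  \<comment> \<open>The conditions under which the non-asymptotic bounds apply to a given pair.
    Asking for \<open>\<kappa>\<close> above 1/2 keeps the first moments of the rescaled statistics
    bounded.\<close>
  define good where "good pn \<longleftrightarrow> fst pn \<ge> 1 \<and> 2 * q < snd pn \<and> v (fst pn) > 0 \<and> \<rho> (fst pn) > 0 \<and> k4 (fst pn) \<le> Cy \<and> \<kappa> pn > 1 / 2 \<and>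
    (\<integral>\<omega>. dotp (fst pn) (z (fst pn) 1 \<omega>) (z (fst pn) 2 \<omega>) ^ 4 \<partial>M (fst pn)) \<le> C4 * (\<rho> (fst pn))\<^sup>2" for pn :: "nat \<times> nat"
  have ev_good: "eventually good min_at_top"
  proof -
    have rp: "eventually (\<lambda>p. \<rho> p > 0) sequentially" using \<rho>_top by (simp add: filterlim_at_top_dense)
    have kap: "eventually (\<lambda>pn. \<kappa> pn > 1 / 2) min_at_top" by (rule order_tendstoD(1)[OF \<kappa>_lim]) simp
    from fst_ev[OF eventually_ge_at_top[of 1]] snd_ev[OF eventually_gt_at_top[of "2 * q"]] ev_v fst_ev[OF rp]
      ev_k4 kap fst_ev[OF ev_dot]
    show ?thesis by eventually_elim (simp add: good_def)
  qed
  define K where "K = {1..2 * q}"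
  let ?B = "PiM K (\<lambda>_. borel :: real measure)"
  let ?X = "\<lambda>(p, n) \<omega> k. if k \<le> q then G1 p n k (\<lambda>t. z p (int t) \<omega>) / sigma_n1 p (S p)
       else (G2 p n (k - q) (\<lambda>t. z p (int t) \<omega>) - mu2 (M p) p n (S p) (z p 1)) / sigma_n2 (M p) p n (S p) (z p 1)"
  define \<mu> where "\<mu> = (\<lambda>pn. distr ((\<lambda>(p, n). M p) pn) ?B (\<lambda>\<omega>. restrict (?X pn \<omega>) K))"
  have noise: "noise (V p) p (T p) (y p)" "noise.\<rho> p (T p) = \<rho> p" "noise.y4 (V p) (y p) = k4 p"
    "noise.dot4 (V p) p = (\<integral>\<omega>. dotp p (z p 1 \<omega>) (z p 2 \<omega>) ^ 4 \<partial>M p)"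
    "\<mu> (p, n) = distr (PiM {1..n} (\<lambda>_. V p)) ?B (noise.statistics p (T p) (y p) q n (\<kappa> (p, n)))"
    if g: "good (p, n)" for p n
  proof -
    have p: "p \<ge> 1" and n: "2 * q < n" and v0: "v p > 0" and \<rho>0: "\<rho> p > 0" and \<kappa>0: "\<kappa> (p, n) > 0" using g by (auto simp: good_def)
    show N: "noise (V p) p (T p) (y p)" by (rule inst(4)[OF p v0])
    show r: "noise.\<rho> p (T p) = \<rho> p" unfolding noise.\<rho>_def[OF N] unfolding \<rho>_def T_def ..
    show "noise.y4 (V p) (y p) = k4 p" by (rule inst(5)[OF p v0])
    show "noise.dot4 (V p) p = (\<integral>\<omega>. dotp p (z p 1 \<omega>) (z p 2 \<omega>) ^ 4 \<partial>M p)"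
      by (rule noise.dot4_sample[OF N prob[OF p] iid[OF p] V_def])
    have r0: "noise.\<rho> p (T p) > 0" "mat_trace (S p ^\<^sub>m 2) = noise.\<rho> p (T p)" using r \<rho>0 tr[OF p] by simp_all
    have n1: "n \<ge> 1" using n by simp
    have s2: "sigma_n2 (M p) p n (S p) (z p 1) = v p / (real p * sqrt n) * \<kappa> (p, n)"
      unfolding \<kappa>_def fst_conv snd_conv by (rule sigma_n2_factor[OF v_def[symmetric] v0 k4_def[symmetric] n1 p])
    show "\<mu> (p, n) = distr (PiM {1..n} (\<lambda>_. V p)) ?B (noise.statistics p (T p) (y p) q n (\<kappa> (p, n)))"
      unfolding \<mu>_def K_def prod.case
      by (rule noise.statistics_distr[OF N prob[OF p] iid[OF p] V_def y_def v0 v_def[symmetric] n p r0 s2 \<kappa>0])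
  qed
  \<comment> \<open>The 6 bounds \<open>3 / \<kappa>\<close> for \<open>\<kappa>\<close> above 1/2;
    the root bounds the L1 norm of \<open>stat1\<close>.\<close>
  define D where "D = sqrt (18 * C4) + 6"
  have fin: "finite K" by (simp add: K_def)
  note sn = std_normal_vec_props[OF fin]
  have "weak_conv_on (product_topology (\<lambda>_. euclideanreal) K) \<mu> (std_normal_vec K) min_at_top"
  proof (rule weak_conv_on_char[OF fin, where D = D])
    show "eventually (\<lambda>i. prob_space (\<mu> i) \<and> sets (\<mu> i) = sets ?B \<and>
        (\<forall>k\<in>K. integrable (\<mu> i) (\<lambda>x. x k) \<and> (\<integral>x. \<bar>x k\<bar> \<partial>\<mu> i) \<le> D)) min_at_top"
      using ev_good
    proof eventually_elim
      case (elim pn)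
      obtain p n where [simp]: "pn = (p, n)" by force
      from elim have g: "good (p, n)" by simp
      have n: "2 * q < n" and r0: "noise.\<rho> p (T p) > 0" and k0: "\<kappa> (p, n) > 0" and k2: "\<kappa> (p, n) > 1 / 2"
        and d: "noise.dot4 (V p) p \<le> C4 * (noise.\<rho> p (T p))\<^sup>2"
        using g noise(2,4)[OF g] by (auto simp: good_def)
      note sp = noise.statistics_props[OF noise(1)[OF g] n r0 k0, folded K_def, folded noise(5)[OF g]]
      have "sqrt (18 * (noise.dot4 (V p) p / (noise.\<rho> p (T p))\<^sup>2)) \<le> sqrt (18 * C4)"
        using d r0 by (simp add: pos_divide_le_eq)
      moreover have "3 / \<kappa> (p, n) \<le> 6" using k0 k2 by (simp add: pos_divide_le_eq)
      ultimately have "sqrt (18 * (noise.dot4 (V p) p / (noise.\<rho> p (T p))\<^sup>2)) + 3 / \<kappa> (p, n) \<le> D" unfolding D_def by (rule add_mono)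
      then show ?case using sp(2,3) order_trans[OF sp(4)] unfolding \<open>pn = (p, n)\<close> by (simp add: \<mu>_def)
    qed
    show "prob_space (std_normal_vec K)" "sets (std_normal_vec K) = sets ?B" by (rule sn)+
    show "integrable (std_normal_vec K) (\<lambda>x. x k)" if "k \<in> K" for k by (rule sn(3)[OF that])
    show "(\<integral>x. \<bar>x k\<bar> \<partial>std_normal_vec K) \<le> D" if "k \<in> K" for k
    proof (rule order_trans[OF sn(4)[OF that]])
      have "sqrt (18 * C4) \<ge> 0" using C40 by simp
      then show "1 \<le> D" unfolding D_def by simp
    qed
    show "((\<lambda>i. \<integral>x. cis (\<Sum>k\<in>K. a k * x k) \<partial>\<mu> i) \<longlongrightarrow> (\<integral>x. cis (\<Sum>k\<in>K. a k * x k) \<partial>std_normal_vec K)) min_at_top" for a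
    proof (rule tendstoI)
      fix e :: real assume e: "e > 0"
      define A where "A = (\<Sum>k\<in>K. \<bar>a k\<bar>)"
      have A0: "A \<ge> 0" by (simp add: A_def sum_nonneg)
      have A: "\<bar>a k\<bar> \<le> A" if "k \<in> {1..2 * q}" for k
        unfolding A_def using that fin by (intro member_le_sum) (auto simp: K_def)
      \<comment> \<open>The block length is fixed before the limit in p and n is taken, so that the
        limit of \<open>total_error\<close> for this \<open>L\<close> is already below
        \<open>e\<close>.\<close>
      obtain L where L: "L > q" "q * A * (sqrt (18 * C4 * (2 * real q / real L)) + sqrt (2 * real q / real L)) + q * A\<^sup>2 * (2 * real q / real L) < e"
        using total_error_limit_small[OF e] by blast
      have "((\<lambda>i. total_error q A C4 Cy (C\<^sup>2) L (snd i) (\<rho> (fst i)) (\<kappa> i)) \<longlongrightarrow>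
        q * A * (sqrt (18 * C4 * (2 * real q / real L)) + sqrt (2 * real q / real L)) + q * A\<^sup>2 * (2 * real q / real L)) min_at_top"
        by (rule total_error_tendsto[OF min_at_top_filterlim(2) filterlim_compose[OF \<rho>_top min_at_top_filterlim(1)] \<kappa>_lim])
      from order_tendstoD(2)[OF this L(2)] ev_good snd_ev[OF eventually_ge_at_top[of L]]
      show "eventually (\<lambda>i. dist (\<integral>x. cis (\<Sum>k\<in>K. a k * x k) \<partial>\<mu> i) (\<integral>x. cis (\<Sum>k\<in>K. a k * x k) \<partial>std_normal_vec K) < e) min_at_top"
      proof eventually_elim
        case (elim pn)
        obtain p n where [simp]: "pn = (p, n)" by force
        from elim have g: "good (p, n)" and Ln: "L \<le> n" and te: "total_error q A C4 Cy (C\<^sup>2) L n (\<rho> p) (\<kappa> (p, n)) < e" by simp_all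
          have p: "p \<ge> 1" and n: "2 * q < n" and r0: "noise.\<rho> p (T p) > 0" and k0: "\<kappa> (p, n) > 0"
          and d: "noise.dot4 (V p) p \<le> C4 * (noise.\<rho> p (T p))\<^sup>2" and yb: "noise.y4 (V p) (y p) \<le> Cy"
          using g noise(2,3,4)[OF g] by (auto simp: good_def)
        note sp = noise.statistics_props[OF noise(1)[OF g] n r0 k0, folded K_def, folded noise(5)[OF g]]
        have "cmod ((\<integral>x. cis (\<Sum>k\<in>K. a k * x k) \<partial>\<mu> (p, n)) - complex_of_real (exp (- (\<Sum>k\<in>K. (a k)\<^sup>2) / 2)))
            \<le> total_error q A C4 Cy (C\<^sup>2) L n (noise.\<rho> p (T p)) (\<kappa> (p, n))"
          unfolding sp(5) total_error_def
          unfolding K_def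
          by (rule noise.stat_char_bound[OF noise(1)[OF g] L(1) Ln n r0 k0 d C40 yb S4[OF p, folded noise(2)[OF g]] A A0])
        then show ?case using te unfolding sn(5) noise(2)[OF g] by (simp add: dist_norm)
      qed
    qed
  qed
  then show ?thesis unfolding conv_in_distr_def K_def \<mu>_def .
qed

end
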